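(* Let $(\mathcal S,\mathcal D,E,B)$ satisfy assumptions (i)–(iv) of the context, let $\Lambda=E(\mathcal S)$, and let $\mathrm W_\Lambda$ be the geodesic restriction of $\mathrm W$ to $\Lambda$. For $\theta_0,\theta_1\in\mathcal S$ let $d_\Lambda(\theta_0,\theta_1):=\mathrm W_\Lambda(\lambda_{\theta_0},\lambda_{\theta_1})$. Then $$d_\Lambda(\theta_0,\theta_1)=\inf\big\{\mathrm{energy}_{\mathcal S}(\gamma)^{1/2}:\gamma\in\mathrm{Lip}([0,1];(\mathcal S,d_{\mathcal S})),\ \gamma(0)=\theta_0,\ \gamma(1)=\theta_1\big\},$$ where $\mathrm{energy}_{\mathcal S}(\gamma)=\int_0^1\|B_{\gamma(t)}\dot\gamma(t)\|^2_{L^2(E(\gamma(t)))}dt$. Moreover, $d_{\mathcal S}$ and $d_\Lambda$ are equivalent metrics on $\mathcal S$, and $\mathrm W$ and $\mathrm W_\Lambda$ are equivalent metrics on $\Lambda$.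
   Context: Two metrics $d,d'$ on a set are equivalent if there is a constant $c\in(0,\infty)$ with $c^{-1}d\le d'\le c\,d$. $\Omega\subset\mathbb R^d$ is compact and convex, $\mathcal P(\Omega)$ is the set of probability measures on $\Omega$, $\mathrm W$ is the Wasserstein-2 distance, $\mathrm W(\mu,\nu)^2=\inf_{\pi}\int|x-y|^2\,d\pi$ over couplings $\pi$ of $\mu,\nu$. $L^2(\mu)$ means $L^2(\mu;\mathbb R^d)$. $\|\cdot\|_{C^1(\mathbb R^d)}$ is the supremum norm of the function and its first derivatives. $\#$ denotes push-forward. $\mathrm{Lip}(X;Y)$ is the set of Lipschitz maps. Assumptions. (i) $\mathcal S$ is a compact, connected, finite-dimensional smooth Riemannian manifold with tangent norms $\|\eta\|_\theta$ ($\eta\in T_\theta\mathcal S$) and induced distance $d_{\mathcal S}$. $\mathcal D\subset T\mathcal S$ is a subset on which the Riemannian exponential map is well defined, such that $(\theta,\eta)\in\mathcal D$ implies $(\theta,t\eta)\in\mathcal D$ for $t\in[0,1]$; for every $(\theta,\eta)\in\mathcal D$ the curve $\gamma(t)=\exp_\theta(t\eta)$, $t\in[0,1]$, is a constant speed geodesic from $\theta$ to $\exp_\theta(\eta)$ with $\|\dot\gamma(t)\|_{\gamma(t)}=\|\eta\|_\theta=d_{\mathcal S}(\theta,\exp_\theta(\eta))$ for $t\in[0,1]$; and, with $\mathcal D_\theta=\{\eta:(\theta,\eta)\in\mathcal D\}$, for any $\theta_0,\theta_1\in\mathcal S$ there is $\eta\in\mathcal D_{\theta_0}$ with $\theta_1=\exp_{\theta_0}(\eta)$.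 ($\mathcal S$ may have a boundary as long as it is a geodesically convex subset of a larger, not necessarily compact, such manifold and the construction of geodesics via $\mathcal D$ remains valid.) (ii) $E:\mathcal S\to\mathcal P(\Omega)$ is a bi-Lipschitz bijection from $(\mathcal S,d_{\mathcal S})$ onto $\Lambda:=E(\mathcal S)$ with metric $\mathrm W$; write $\lambda_\theta=E(\theta)$. All $\lambda\in\Lambda$ are absolutely continuous with respect to Lebesgue measure. (iii) For each $\theta\in\mathcal S$, $B_\theta:T_\theta\mathcal S\to C^1(\mathbb R^d;\mathbb R^d)$ is linear with values in gradient vector fields, and there is $C_0\in(0,\infty)$ such that for all $(\theta,\eta)\in\mathcal D$, $x\in\mathbb R^d$, $t\in[0,1]$, with $\gamma(t)=\exp_\theta(t\eta)$: $C_0^{-1}\|\eta\|_\theta\le\|B_\theta\eta\|_{L^2(\lambda_\theta)}\le C_0\|\eta\|_\theta$; $\|B_\theta\eta\|_{C^1(\mathbb R^d)}\le C_0\|\eta\|_\theta$; $|\partial_t[B_{\gamma(t)}\dot\gamma(t)](x)|\le C_0\|\eta\|_\theta^2$. (iv) For every Lipschitz curve $\gamma:[0,1]\to\mathcal S$, let $v(t,\cdot)=B_{\gamma(t)}\dot\gamma(t)$ (defined for a.e. $t$) and let $\varphi:[0,1]\times\Omega\to\mathbb R^d$ be the solution of $\varphi(0,\cdot)=\mathrm{id}$, $\partial_t\varphi(t,\cdot)=v(t,\varphi(t,\cdot))$ for a.e. $t$; then $\lambda_{\gamma(t)}=\varphi(t,\cdot)_\#\lambda_{\gamma(0)}$ for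 all $t\in[0,1]$. Energy and geodesic restriction. For a Lipschitz curve $\rho:[0,1]\to(\mathcal P(\Omega),\mathrm W)$, $\mathrm{CE}(\rho)$ is the set of measurable $v$ with $v(t)\in L^2(\rho(t))$ such that for all $\phi\in C^1([0,1]\times\Omega)$: $\int_0^1\int_\Omega\partial_t\phi(t,\cdot)\,d\rho(t)\,dt+\int_0^1\int_\Omega\langle\nabla\phi(t,\cdot),v(t)\rangle\,d\rho(t)\,dt=\int_\Omega\phi(1,\cdot)\,d\rho(1)-\int_\Omega\phi(0,\cdot)\,d\rho(0)$. Set $\mathrm{energy}(\rho)=\inf\{\int_0^1\|v(t)\|_{L^2(\rho(t))}^2dt: v\in\mathrm{CE}(\rho)\}$. For $\mu,\nu\in\Lambda$, $\mathrm W_\Lambda(\mu,\nu)=\inf\{\mathrm{energy}(\rho)^{1/2}:\rho\in\mathrm{Lip}([0,1];(\Lambda,\mathrm W)),\rho(0)=\mu,\rho(1)=\nu\}$. *)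

theory Defs
  imports "HOL-Probability.Probability"
begin

section \<open>Smooth manifolds and tangent vectors\<close>

primrec Ck_on :: "nat \<Rightarrow> 'a::euclidean_space set \<Rightarrow> ('a \<Rightarrow> 'b::euclidean_space) \<Rightarrow> bool" where
  "Ck_on 0 U f \<longleftrightarrow> continuous_on U f"
| "Ck_on (Suc k) U f \<longleftrightarrow> f differentiable_on U \<and> (\<forall>h. Ck_on k U (\<lambda>x. frechet_derivative f (at x) h))"

definition smooth_on :: "'a::euclidean_space set \<Rightarrow> ('a \<Rightarrow> 'b::euclidean_space) \<Rightarrow> bool" where
  "smooth_on U f \<longleftrightarrow> (\<forall>k. Ck_on k U f)"

type_synonym ('m, 'e) chart = "'m set \<times> ('m \<Rightarrow> 'e)"

definition transition :: "('m, 'e) chart \<Rightarrow> ('m, 'e) chart \<Rightarrow> 'e \<Rightarrow> 'e" where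
  "transition c c' = snd c' \<circ> inv_into (fst c) (snd c)"

definition carrier :: "('m, 'e) chart set \<Rightarrow> 'm set" where
  "carrier A = (\<Union>c\<in>A. fst c)"

definition smooth_atlas :: "('m::topological_space, 'e::euclidean_space) chart set \<Rightarrow> bool" where
  "smooth_atlas A \<longleftrightarrow>
     (\<forall>c\<in>A. open (fst c) \<and> open (snd c ` fst c) \<and> (\<exists>\<psi>. homeomorphism (fst c) (snd c ` fst c) (snd c) \<psi>)) \<and>
     (\<forall>c\<in>A. \<forall>c'\<in>A. smooth_on (snd c ` (fst c \<inter> fst c')) (transition c c'))"

text \<open>A tangent vector at \<open>p\<close> is the family of its coordinate vectors in all charts around \<open>p\<close>
  (and 0 at all other charts); the coordinate vectors are related by the derivatives of the chart
  transitions. Linear operations are taken chart by chart.\<close>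

type_synonym ('m, 'e) tangent = "('m, 'e) chart \<Rightarrow> 'e"

definition coord_vector ::
    "('m, 'e::euclidean_space) chart set \<Rightarrow> ('m, 'e) chart \<Rightarrow> 'm \<Rightarrow> 'e \<Rightarrow> ('m, 'e) tangent" where
  "coord_vector A c p u =
     (\<lambda>c'. if c' \<in> A \<and> p \<in> fst c' then frechet_derivative (transition c c') (at (snd c p)) u else 0)"

definition tangent_space :: "('m, 'e::euclidean_space) chart set \<Rightarrow> 'm \<Rightarrow> ('m, 'e) tangent set" where
  "tangent_space A p =
     {v. (\<forall>c. c \<notin> A \<or> p \<notin> fst c \<longrightarrow> v c = 0) \<and>
         (\<forall>c\<in>A. p \<in> fst c \<longrightarrow> v = coord_vector A c p (v c))}"

text \<open>All curves are parametrised by \<open>[0,1]\<close>; derivatives at the end points are one-sided.\<close>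

definition velocity :: "('m, 'e::euclidean_space) chart set \<Rightarrow> (real \<Rightarrow> 'm) \<Rightarrow> real \<Rightarrow> ('m, 'e) tangent" where
  "velocity A \<gamma> t =
     (\<lambda>c. if c \<in> A \<and> \<gamma> t \<in> fst c then vector_derivative (snd c \<circ> \<gamma>) (at t within {0..1}) else 0)"


section \<open>Riemannian manifolds, distance, geodesics, exponential map\<close>

definition metric_coords ::
    "('m, 'e::euclidean_space) chart set \<Rightarrow> ('m \<Rightarrow> ('m, 'e) tangent \<Rightarrow> ('m, 'e) tangent \<Rightarrow> real) \<Rightarrow>
     ('m, 'e) chart \<Rightarrow> 'e \<Rightarrow> 'e \<Rightarrow> 'e \<Rightarrow> real" where
  "metric_coords A g c x u w =
     (let p = inv_into (fst c) (snd c) x in g p (coord_vector A c p u) (coord_vector A c p w))"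

locale riemannian_manifold =
  fixes A :: "('m::{t2_space, second_countable_topology}, 'e::euclidean_space) chart set"
    and g :: "'m \<Rightarrow> ('m, 'e) tangent \<Rightarrow> ('m, 'e) tangent \<Rightarrow> real"
  assumes smooth_atlas: "smooth_atlas A"
    and metric_linear: "\<And>p u v w a b. p \<in> carrier A \<Longrightarrow> u \<in> tangent_space A p \<Longrightarrow> v \<in> tangent_space A p \<Longrightarrow>
          w \<in> tangent_space A p \<Longrightarrow> g p (\<lambda>c. a *\<^sub>R u c + b *\<^sub>R v c) w = a * g p u w + b * g p v w"
    and metric_sym: "\<And>p u v. p \<in> carrier A \<Longrightarrow> u \<in> tangent_space A p \<Longrightarrow> v \<in> tangent_space A p \<Longrightarrow>
          g p u v = g p v u"
    and metric_pos: "\<And>p u. p \<in> carrier A \<Longrightarrow> u \<in> tangent_space A p \<Longrightarrow> u \<noteq> (\<lambda>c. 0) \<Longrightarrow> g p u u > 0"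
    and metric_smooth: "\<And>c u w. c \<in> A \<Longrightarrow> smooth_on (snd c ` fst c) (\<lambda>x. metric_coords A g c x u w)"

definition tangent_norm ::
    "('m \<Rightarrow> ('m, 'e) tangent \<Rightarrow> ('m, 'e) tangent \<Rightarrow> real) \<Rightarrow> 'm \<Rightarrow> ('m, 'e) tangent \<Rightarrow> real" where
  "tangent_norm g p v = sqrt (g p v v)"

definition C1_curve_on ::
    "('m::topological_space, 'e::euclidean_space) chart set \<Rightarrow> real \<Rightarrow> real \<Rightarrow> (real \<Rightarrow> 'm) \<Rightarrow> bool" where
  "C1_curve_on A a b \<gamma> \<longleftrightarrow>
     continuous_on {a..b} \<gamma> \<and> \<gamma> ` {a..b} \<subseteq> carrier A \<and>
     (\<forall>c\<in>A. \<exists>x'. continuous_on {t\<in>{a..b}. \<gamma> t \<in> fst c} x' \<and>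
        (\<forall>t\<in>{a..b}. \<gamma> t \<in> fst c \<longrightarrow> ((snd c \<circ> \<gamma>) has_vector_derivative x' t) (at t within {a..b})))"

definition piecewise_C1_curve ::
    "('m::topological_space, 'e::euclidean_space) chart set \<Rightarrow> (real \<Rightarrow> 'm) \<Rightarrow> bool" where
  "piecewise_C1_curve A \<gamma> \<longleftrightarrow>
     (\<exists>F. finite F \<and> {0, 1} \<subseteq> F \<and> F \<subseteq> {0..1} \<and>
        (\<forall>a\<in>F. \<forall>b\<in>F. a < b \<and> {a<..<b} \<inter> F = {} \<longrightarrow> C1_curve_on A a b \<gamma>))"

definition curve_length ::
    "('m, 'e::euclidean_space) chart set \<Rightarrow> ('m \<Rightarrow> ('m, 'e) tangent \<Rightarrow> ('m, 'e) tangent \<Rightarrow> real) \<Rightarrow>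
     (real \<Rightarrow> 'm) \<Rightarrow> ennreal" where
  "curve_length A g \<gamma> = (\<integral>\<^sup>+t\<in>{0..1}. ennreal (tangent_norm g (\<gamma> t) (velocity A \<gamma> t)) \<partial>lborel)"

text \<open>The distance induced on a subset \<open>X\<close> of the manifold by curves inside \<open>X\<close>; for
  \<open>X = carrier A\<close> this is the usual Riemannian distance.\<close>

definition riem_dist ::
    "('m::topological_space, 'e::euclidean_space) chart set \<Rightarrow>
     ('m \<Rightarrow> ('m, 'e) tangent \<Rightarrow> ('m, 'e) tangent \<Rightarrow> real) \<Rightarrow> 'm set \<Rightarrow> 'm \<Rightarrow> 'm \<Rightarrow> real" where
  "riem_dist A g X p q =
     enn2real (INF \<gamma>\<in>{\<gamma>. piecewise_C1_curve A \<gamma> \<and> \<gamma> ` {0..1} \<subseteq> X \<and> \<gamma> 0 = p \<and> \<gamma> 1 = q}. curve_length A g \<gamma>)"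

text \<open>In a chart with metric \<open>G\<close>, \<open>christoffel A g c x u v\<close> is the vector \<open>\<Gamma>(x)(u,v)\<close> of the
  Levi-Civita connection, determined by the Koszul formula
  \<open>2 G(x)(\<Gamma>(x)(u,v), w) = \<partial>\<^sub>u G(v,w) + \<partial>\<^sub>v G(u,w) - \<partial>\<^sub>w G(u,v)\<close>.\<close>

definition christoffel ::
    "('m, 'e::euclidean_space) chart set \<Rightarrow> ('m \<Rightarrow> ('m, 'e) tangent \<Rightarrow> ('m, 'e) tangent \<Rightarrow> real) \<Rightarrow>
     ('m, 'e) chart \<Rightarrow> 'e \<Rightarrow> 'e \<Rightarrow> 'e \<Rightarrow> 'e" where
  "christoffel A g c x u v =
     (THE z. \<forall>w. 2 * metric_coords A g c x z w =
          frechet_derivative (\<lambda>y. metric_coords A g c y v w) (at x) u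
        + frechet_derivative (\<lambda>y. metric_coords A g c y u w) (at x) v
        - frechet_derivative (\<lambda>y. metric_coords A g c y u v) (at x) w)"

definition geodesic ::
    "('m::topological_space, 'e::euclidean_space) chart set \<Rightarrow>
     ('m \<Rightarrow> ('m, 'e) tangent \<Rightarrow> ('m, 'e) tangent \<Rightarrow> real) \<Rightarrow> (real \<Rightarrow> 'm) \<Rightarrow> bool" where
  "geodesic A g \<gamma> \<longleftrightarrow>
     continuous_on {0..1} \<gamma> \<and> \<gamma> ` {0..1} \<subseteq> carrier A \<and>
     (\<forall>c\<in>A. \<exists>x'. \<forall>t\<in>{0..1}. \<gamma> t \<in> fst c \<longrightarrow>
        ((snd c \<circ> \<gamma>) has_vector_derivative x' t) (at t within {0..1}) \<and>
        (x' has_vector_derivative - christoffel A g c (snd c (\<gamma> t)) (x' t) (x' t)) (at t within {0..1}))"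

definition exp_defined ::
    "('m::topological_space, 'e::euclidean_space) chart set \<Rightarrow>
     ('m \<Rightarrow> ('m, 'e) tangent \<Rightarrow> ('m, 'e) tangent \<Rightarrow> real) \<Rightarrow> 'm \<Rightarrow> ('m, 'e) tangent \<Rightarrow> bool" where
  "exp_defined A g p v \<longleftrightarrow> (\<exists>\<gamma>. geodesic A g \<gamma> \<and> \<gamma> 0 = p \<and> velocity A \<gamma> 0 = v)"

definition riem_exp ::
    "('m::topological_space, 'e::euclidean_space) chart set \<Rightarrow>
     ('m \<Rightarrow> ('m, 'e) tangent \<Rightarrow> ('m, 'e) tangent \<Rightarrow> real) \<Rightarrow> 'm \<Rightarrow> ('m, 'e) tangent \<Rightarrow> 'm" where
  "riem_exp A g p v = (THE q. \<exists>\<gamma>. geodesic A g \<gamma> \<and> \<gamma> 0 = p \<and> velocity A \<gamma> 0 = v \<and> \<gamma> 1 = q)"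

definition exp_curve ::
    "('m::topological_space, 'e::euclidean_space) chart set \<Rightarrow>
     ('m \<Rightarrow> ('m, 'e) tangent \<Rightarrow> ('m, 'e) tangent \<Rightarrow> real) \<Rightarrow> 'm \<Rightarrow> ('m, 'e) tangent \<Rightarrow> real \<Rightarrow> 'm" where
  "exp_curve A g p v t = riem_exp A g p (\<lambda>c. t *\<^sub>R v c)"

definition geodesically_convex ::
    "('m::topological_space, 'e::euclidean_space) chart set \<Rightarrow>
     ('m \<Rightarrow> ('m, 'e) tangent \<Rightarrow> ('m, 'e) tangent \<Rightarrow> real) \<Rightarrow> 'm set \<Rightarrow> bool" where
  "geodesically_convex A g X \<longleftrightarrow>
     (\<forall>p\<in>X. \<forall>q\<in>X. \<exists>\<gamma>. geodesic A g \<gamma> \<and> \<gamma> 0 = p \<and> \<gamma> 1 = q \<and> \<gamma> ` {0..1} \<subseteq> X \<and>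
        curve_length A g \<gamma> = ennreal (riem_dist A g (carrier A) p q))"

text \<open>The parameter space \<open>S\<close> is either the whole (compact) manifold, or a compact geodesically convex
  subset of the not necessarily compact manifold, which is how a boundary is allowed. Its metric is
  \<open>riem_dist A g S\<close>, and \<open>D\<close> selects the minimising geodesics inside \<open>S\<close>.\<close>

locale parameter_space = riemannian_manifold A g
  for A :: "('m::{t2_space, second_countable_topology}, 'e::euclidean_space) chart set"
    and g :: "'m \<Rightarrow> ('m, 'e) tangent \<Rightarrow> ('m, 'e) tangent \<Rightarrow> real" +
  fixes S :: "'m set" and D :: "('m \<times> ('m, 'e) tangent) set"
  assumes connected_carrier: "connected (carrier A)"
    and S_subset: "S \<subseteq> carrier A"
    and S_compact: "compact S"
    and S_connected: "connected S"
    and S_whole_or_convex: "S = carrier A \<or> geodesically_convex A g S"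
    and D_tangent: "\<And>\<theta> \<eta>. (\<theta>, \<eta>) \<in> D \<Longrightarrow> \<theta> \<in> S \<and> \<eta> \<in> tangent_space A \<theta>"
    and D_exp_defined: "\<And>\<theta> \<eta>. (\<theta>, \<eta>) \<in> D \<Longrightarrow> exp_defined A g \<theta> \<eta>"
    and D_star_shaped: "\<And>\<theta> \<eta> t. (\<theta>, \<eta>) \<in> D \<Longrightarrow> t \<in> {0..1} \<Longrightarrow> (\<theta>, \<lambda>c. t *\<^sub>R \<eta> c) \<in> D"
    and D_geodesic: "\<And>\<theta> \<eta>. (\<theta>, \<eta>) \<in> D \<Longrightarrow>
          geodesic A g (exp_curve A g \<theta> \<eta>) \<and> exp_curve A g \<theta> \<eta> ` {0..1} \<subseteq> S \<and> exp_curve A g \<theta> \<eta> 0 = \<theta>"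
    and D_speed: "\<And>\<theta> \<eta> t. (\<theta>, \<eta>) \<in> D \<Longrightarrow> t \<in> {0..1} \<Longrightarrow>
          tangent_norm g (exp_curve A g \<theta> \<eta> t) (velocity A (exp_curve A g \<theta> \<eta>) t) = tangent_norm g \<theta> \<eta> \<and>
          tangent_norm g \<theta> \<eta> = riem_dist A g S \<theta> (riem_exp A g \<theta> \<eta>)"
    and D_reaches: "\<And>\<theta>\<^sub>0 \<theta>\<^sub>1. \<theta>\<^sub>0 \<in> S \<Longrightarrow> \<theta>\<^sub>1 \<in> S \<Longrightarrow> \<exists>\<eta>. (\<theta>\<^sub>0, \<eta>) \<in> D \<and> \<theta>\<^sub>1 = riem_exp A g \<theta>\<^sub>0 \<eta>"


section \<open>Wasserstein distance, energy, geodesic restriction\<close>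

definition ennsqrt :: "ennreal \<Rightarrow> ennreal" where
  "ennsqrt x = (if x = \<infinity> then \<infinity> else ennreal (sqrt (enn2real x)))"

definition lip_curve :: "('p \<Rightarrow> 'p \<Rightarrow> real) \<Rightarrow> 'p set \<Rightarrow> (real \<Rightarrow> 'p) \<Rightarrow> bool" where
  "lip_curve d X \<gamma> \<longleftrightarrow>
     \<gamma> ` {0..1} \<subseteq> X \<and> (\<exists>L. \<forall>s\<in>{0..1}. \<forall>t\<in>{0..1}. d (\<gamma> s) (\<gamma> t) \<le> L * \<bar>s - t\<bar>)"

definition equivalent_metrics :: "'p set \<Rightarrow> ('p \<Rightarrow> 'p \<Rightarrow> real) \<Rightarrow> ('p \<Rightarrow> 'p \<Rightarrow> real) \<Rightarrow> bool" where
  "equivalent_metrics X d d' \<longleftrightarrow>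
     Metric_space X d \<and> Metric_space X d' \<and>
     (\<exists>c>0. \<forall>x\<in>X. \<forall>y\<in>X. inverse c * d x y \<le> d' x y \<and> d' x y \<le> c * d x y)"

text \<open>Probability measures on \<open>\<Omega>\<close> are Borel measures on the ambient space concentrated on \<open>\<Omega>\<close>.\<close>

definition prob_measures_on :: "'x::euclidean_space set \<Rightarrow> 'x measure set" where
  "prob_measures_on \<Omega> = {\<mu>. prob_space \<mu> \<and> sets \<mu> = sets borel \<and> emeasure \<mu> \<Omega> = 1}"

definition couplings :: "'x::euclidean_space measure \<Rightarrow> 'x measure \<Rightarrow> ('x \<times> 'x) measure set" where
  "couplings \<mu> \<nu> = {\<pi>. sets \<pi> = sets borel \<and> distr \<pi> borel fst = \<mu> \<and> distr \<pi> borel snd = \<nu>}"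

definition wasserstein2 :: "'x::euclidean_space measure \<Rightarrow> 'x measure \<Rightarrow> real" where
  "wasserstein2 \<mu> \<nu> =
     sqrt (enn2real (INF \<pi>\<in>couplings \<mu> \<nu>. \<integral>\<^sup>+z. ennreal ((norm (fst z - snd z))\<^sup>2) \<partial>\<pi>))"

definition L2_enorm :: "'x::euclidean_space measure \<Rightarrow> ('x \<Rightarrow> 'x) \<Rightarrow> ennreal" where
  "L2_enorm \<mu> f = ennsqrt (\<integral>\<^sup>+x. ennreal ((norm (f x))\<^sup>2) \<partial>\<mu>)"

definition C1_enorm :: "('x::euclidean_space \<Rightarrow> 'x) \<Rightarrow> ennreal" where
  "C1_enorm f =
     max (SUP x. ennreal (norm (f x))) (SUP x. ennreal (onorm (frechet_derivative f (at x))))"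

text \<open>\<open>\<phi> \<in> C\<^sup>1([0,1] \<times> \<Omega>)\<close> with time derivative \<open>\<phi>t\<close> and spatial gradient \<open>\<phi>x\<close>, continuous up to the
  boundary.\<close>

definition C1_test ::
    "'x::euclidean_space set \<Rightarrow> (real \<times> 'x \<Rightarrow> real) \<Rightarrow> (real \<times> 'x \<Rightarrow> real) \<Rightarrow> (real \<times> 'x \<Rightarrow> 'x) \<Rightarrow> bool" where
  "C1_test \<Omega> \<phi> \<phi>t \<phi>x \<longleftrightarrow>
     continuous_on ({0..1} \<times> \<Omega>) \<phi>t \<and> continuous_on ({0..1} \<times> \<Omega>) \<phi>x \<and>
     (\<forall>z\<in>{0..1} \<times> \<Omega>. (\<phi> has_derivative (\<lambda>(s, h). s * \<phi>t z + \<phi>x z \<bullet> h)) (at z within {0..1} \<times> \<Omega>))"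

text \<open>The integrability clause says that the space-time integral against \<open>v\<close> is meaningful (the Bochner
  integral of a non-integrable function is 0 by convention).\<close>

definition CE :: "'x::euclidean_space set \<Rightarrow> (real \<Rightarrow> 'x measure) \<Rightarrow> (real \<Rightarrow> 'x \<Rightarrow> 'x) set" where
  "CE \<Omega> \<rho> =
     {v. (\<lambda>(t, x). v t x) \<in> borel_measurable (restrict_space borel ({0..1} \<times> \<Omega>)) \<and>
         (\<forall>t\<in>{0..1}. L2_enorm (\<rho> t) (v t) < \<infinity>) \<and>
         (\<forall>\<phi> \<phi>t \<phi>x. C1_test \<Omega> \<phi> \<phi>t \<phi>x \<longrightarrow>
            set_integrable lborel {0..1} (\<lambda>t. LINT x:\<Omega>|\<rho> t. \<phi>x (t, x) \<bullet> v t x) \<and>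
            (LINT t:{0..1}|lborel. (LINT x:\<Omega>|\<rho> t. \<phi>t (t, x)))
              + (LINT t:{0..1}|lborel. (LINT x:\<Omega>|\<rho> t. \<phi>x (t, x) \<bullet> v t x))
            = (LINT x:\<Omega>|\<rho> 1. \<phi> (1, x)) - (LINT x:\<Omega>|\<rho> 0. \<phi> (0, x)))}"

definition energy :: "'x::euclidean_space set \<Rightarrow> (real \<Rightarrow> 'x measure) \<Rightarrow> ennreal" where
  "energy \<Omega> \<rho> = (INF v\<in>CE \<Omega> \<rho>. \<integral>\<^sup>+t\<in>{0..1}. (L2_enorm (\<rho> t) (v t))\<^sup>2 \<partial>lborel)"

definition geodesic_restriction ::
    "'x::euclidean_space set \<Rightarrow> 'x measure set \<Rightarrow> 'x measure \<Rightarrow> 'x measure \<Rightarrow> ennreal" where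
  "geodesic_restriction \<Omega> \<Lambda> \<mu> \<nu> =
     (INF \<rho>\<in>{\<rho>. lip_curve wasserstein2 \<Lambda> \<rho> \<and> \<rho> 0 = \<mu> \<and> \<rho> 1 = \<nu>}. ennsqrt (energy \<Omega> \<rho>))"


section \<open>The velocity model\<close>

definition gradient_field :: "('x::euclidean_space \<Rightarrow> 'x) \<Rightarrow> bool" where
  "gradient_field f \<longleftrightarrow> (\<exists>\<psi>::'x \<Rightarrow> real. \<forall>x. (\<psi> has_derivative (\<lambda>h. f x \<bullet> h)) (at x))"

text \<open>\<open>\<phi>\<close> is the flow of \<open>v\<close> in the Caratheodory sense: absolutely continuous in time (Lipschitz,
  as the velocity fields considered here are bounded), with the differential equation holding for
  almost every \<open>t\<close>.\<close>

definition flow_of :: "'x::euclidean_space set \<Rightarrow> (real \<Rightarrow> 'x \<Rightarrow> 'x) \<Rightarrow> (real \<Rightarrow> 'x \<Rightarrow> 'x) \<Rightarrow> bool" where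
  "flow_of \<Omega> v \<phi> \<longleftrightarrow>
     (\<forall>x\<in>\<Omega>. \<phi> 0 x = x) \<and>
     (\<forall>x\<in>\<Omega>. \<exists>L. L-lipschitz_on {0..1} (\<lambda>t. \<phi> t x)) \<and>
     (AE t in lborel. t \<in> {0..1} \<longrightarrow>
        (\<forall>x\<in>\<Omega>. ((\<lambda>s. \<phi> s x) has_vector_derivative v t (\<phi> t x)) (at t within {0..1})))"

definition curve_energy ::
    "('m, 'e::euclidean_space) chart set \<Rightarrow> ('m \<Rightarrow> 'x::euclidean_space measure) \<Rightarrow>
     ('m \<Rightarrow> ('m, 'e) tangent \<Rightarrow> 'x \<Rightarrow> 'x) \<Rightarrow> (real \<Rightarrow> 'm) \<Rightarrow> ennreal" where
  "curve_energy A E B \<gamma> =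
     (\<integral>\<^sup>+t\<in>{0..1}. (L2_enorm (E (\<gamma> t)) (B (\<gamma> t) (velocity A \<gamma> t)))\<^sup>2 \<partial>lborel)"

locale embedded_family = parameter_space A g S D
  for A :: "('m::{t2_space, second_countable_topology}, 'e::euclidean_space) chart set"
    and g :: "'m \<Rightarrow> ('m, 'e) tangent \<Rightarrow> ('m, 'e) tangent \<Rightarrow> real"
    and S :: "'m set" and D :: "('m \<times> ('m, 'e) tangent) set" +
  fixes \<Omega> :: "'x::euclidean_space set"
    and E :: "'m \<Rightarrow> 'x measure"
    and B :: "'m \<Rightarrow> ('m, 'e) tangent \<Rightarrow> 'x \<Rightarrow> 'x"
  assumes \<Omega>_compact: "compact \<Omega>" and \<Omega>_convex: "convex \<Omega>"
    and E_prob: "\<And>\<theta>. \<theta> \<in> S \<Longrightarrow> E \<theta> \<in> prob_measures_on \<Omega>"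
    and E_inj: "inj_on E S"
    and E_bilipschitz: "\<exists>L>0. \<forall>\<theta>\<^sub>0\<in>S. \<forall>\<theta>\<^sub>1\<in>S.
          inverse L * riem_dist A g S \<theta>\<^sub>0 \<theta>\<^sub>1 \<le> wasserstein2 (E \<theta>\<^sub>0) (E \<theta>\<^sub>1) \<and>
          wasserstein2 (E \<theta>\<^sub>0) (E \<theta>\<^sub>1) \<le> L * riem_dist A g S \<theta>\<^sub>0 \<theta>\<^sub>1"
    and E_abs_continuous: "\<And>\<theta>. \<theta> \<in> S \<Longrightarrow> absolutely_continuous lborel (E \<theta>)"
    and B_linear: "\<And>\<theta> \<eta> \<zeta> a b. \<theta> \<in> S \<Longrightarrow> \<eta> \<in> tangent_space A \<theta> \<Longrightarrow> \<zeta> \<in> tangent_space A \<theta> \<Longrightarrow>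
          B \<theta> (\<lambda>c. a *\<^sub>R \<eta> c + b *\<^sub>R \<zeta> c) = (\<lambda>x. a *\<^sub>R B \<theta> \<eta> x + b *\<^sub>R B \<theta> \<zeta> x)"
    and B_C1: "\<And>\<theta> \<eta>. \<theta> \<in> S \<Longrightarrow> \<eta> \<in> tangent_space A \<theta> \<Longrightarrow> Ck_on 1 UNIV (B \<theta> \<eta>)"
    and B_gradient: "\<And>\<theta> \<eta>. \<theta> \<in> S \<Longrightarrow> \<eta> \<in> tangent_space A \<theta> \<Longrightarrow> gradient_field (B \<theta> \<eta>)"
    and B_bounds: "\<exists>C\<^sub>0>0. \<forall>(\<theta>, \<eta>)\<in>D.
          ennreal (inverse C\<^sub>0 * tangent_norm g \<theta> \<eta>) \<le> L2_enorm (E \<theta>) (B \<theta> \<eta>) \<and>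
          L2_enorm (E \<theta>) (B \<theta> \<eta>) \<le> ennreal (C\<^sub>0 * tangent_norm g \<theta> \<eta>) \<and>
          C1_enorm (B \<theta> \<eta>) \<le> ennreal (C\<^sub>0 * tangent_norm g \<theta> \<eta>) \<and>
          (\<forall>x. \<forall>t\<in>{0..1}. \<exists>w.
             ((\<lambda>s. B (exp_curve A g \<theta> \<eta> s) (velocity A (exp_curve A g \<theta> \<eta>) s) x) has_vector_derivative w)
               (at t within {0..1}) \<and>
             norm w \<le> C\<^sub>0 * (tangent_norm g \<theta> \<eta>)\<^sup>2)"
    and B_flow: "\<And>\<gamma>. lip_curve (riem_dist A g S) S \<gamma> \<Longrightarrow>
          \<exists>\<phi>. flow_of \<Omega> (\<lambda>t. B (\<gamma> t) (velocity A \<gamma> t)) \<phi> \<and>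
              (\<forall>t\<in>{0..1}. E (\<gamma> t) = distr (restrict_space (E (\<gamma> 0)) \<Omega>) borel (\<phi> t))"

end

theory Submission
  imports Defs
begin

text \<open>For a Lipschitz curve \<open>\<gamma>\<close> in \<open>S\<close> the field \<open>B \<dot>\<gamma>\<close> is bounded and Lipschitz in space and
  transports \<open>E \<circ> \<gamma>\<close>, so it solves the continuity equation. Being a gradient field it is orthogonal in
  \<open>L\<^sup>2\<close> to the difference of any two solutions, hence it has minimal energy and \<open>energy \<Omega> (E \<circ> \<gamma>)\<close>
  equals \<open>curve_energy A E B \<gamma>\<close>. Since \<open>E\<close> is bi-Lipschitz, Lipschitz curves in \<open>S\<close> and in \<open>E ` S\<close>
  correspond to each other, which gives the formula. Minimising geodesics of \<open>D\<close> bound the restricted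
  distance by a multiple of \<open>dist_S\<close>; conversely, moving mass along the flow is an admissible coupling,
  so the Wasserstein distance, and thereby \<open>dist_S\<close>, is bounded by the restricted distance.\<close>

text \<open>Three features of the assumptions shape the proof. The flow solves its equation only at
  almost every time, and nothing is known about how \<open>B\<close> varies in time along a general
  curve: hence a calculus of Lipschitz functions with almost everywhere derivatives, and the
  replacement of the velocity field by a jointly Borel one that agrees with it on trajectories. The
  potential of a velocity field varies in time without any regularity, so it is no admissible test
  function; a function of time multiplied by one fixed potential is, and countably many fixed
  potentials suffice because all fields share one Lipschitz constant. Finally,
  \<open>riem_exp\<close> is a definite description, so uniqueness of geodesics has to be proved
  before a curve issued from \<open>D\<close> is known to have the prescribed initial velocity. Only
  then can vectors of \<open>D\<close> be compared in charts with the increments of a Lipschitz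
  curve, which is what carries the bounds on \<open>B\<close> over to its velocity.\<close>

subsection \<open>Lipschitz functions of one real variable\<close>

text \<open>Real induction: the points where G is at least G a form a compact set, whose largest
  element can only be b. A single y to the right is enough in \<open>step\<close>, which is why the
  lemma also serves Dini derivatives.\<close>

lemma continuous_le_if_locally_le_right:
  fixes G :: "real \<Rightarrow> real"
  assumes ab: "a \<le> b" and cont: "continuous_on {a..b} G"
    and step: "\<And>x. a \<le> x \<Longrightarrow> x < b \<Longrightarrow> \<exists>y. x < y \<and> y \<le> b \<and> G x \<le> G y"
  shows "G a \<le> G b"
proof -
  define T where "T = {a..b} \<inter> G -` {G a..}"
  have "closed T"
    unfolding T_def by (rule continuous_closed_preimage[OF cont]) auto
  moreover have "bounded T"
    by (rule bounded_subset[of "{a..b}"]) (auto simp: T_def)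
  ultimately have "compact T"
    by (simp add: compact_eq_bounded_closed)
  moreover have "a \<in> T"
    using ab by (auto simp: T_def)
  ultimately obtain s where s: "s \<in> T" "\<And>t. t \<in> T \<Longrightarrow> t \<le> s"
    using compact_attains_sup[of T] by blast
  have "s = b"
  proof (rule ccontr)
    assume "s \<noteq> b"
    then have "a \<le> s" "s < b"
      using s(1) by (auto simp: T_def)
    from step[OF this] obtain y where y: "s < y" "y \<le> b" "G s \<le> G y"
      by blast
    then have "y \<in> T"
      using s(1) by (auto simp: T_def)
    with s(2)[of y] y show False by simp
  qed
  then show ?thesis
    using s(1) by (auto simp: T_def)
qed

text \<open>A 1-Lipschitz primitive of the indicator of K. Comparison functions use it to charge an
  exceptional set for the increments that it may cause.\<close>

definition content_upto :: "real set \<Rightarrow> real \<Rightarrow> real \<Rightarrow> real" where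
  "content_upto K a x = measure lborel (K \<inter> {a..x})"

lemma fmeasurable_Int_Icc [intro]: "K \<in> sets borel \<Longrightarrow> K \<inter> {a..b::real} \<in> fmeasurable lborel"
  by (rule fmeasurableI2[of "{a..b}"]) (auto intro!: fmeasurableI emeasure_bounded_finite)

lemma fmeasurable_Int_Ioc [intro]: "K \<in> sets borel \<Longrightarrow> K \<inter> {a<..b::real} \<in> fmeasurable lborel"
  by (rule fmeasurableI2[of "{a<..b}"]) (auto intro!: fmeasurableI emeasure_bounded_finite simp: bounded_Ioc)

lemma content_upto_diff:
  assumes "K \<in> sets borel" "a \<le> x" "x \<le> y"
  shows "content_upto K a y = content_upto K a x + measure lborel (K \<inter> {x<..y})"
proof -
  have "K \<inter> {a..y} = (K \<inter> {a..x}) \<union> (K \<inter> {x<..y})"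
    using assms by auto
  then show ?thesis
    unfolding content_upto_def
    by (simp only:) (intro measure_Un2 [THEN trans] arg_cong2[of _ _ _ _ "(+)"] refl
        fmeasurable_Int_Icc fmeasurable_Int_Ioc assms(1) arg_cong[of _ _ "measure lborel"] | auto)+
qed

lemma measure_Int_Ioc_le:
  assumes "K \<in> sets borel" "x \<le> y"
  shows "measure lborel (K \<inter> {x<..y}) \<le> y - x"
proof -
  have "measure lborel (K \<inter> {x<..y}) \<le> measure lborel {x<..y}"
    by (rule measure_mono_fmeasurable) (use assms in \<open>auto simp: fmeasurable_def\<close>)
  then show ?thesis using assms by simp
qed

lemma content_upto_refl: "content_upto K a a = 0"
proof -
  have "measure lborel (K \<inter> {a..a}) = 0"
    by (cases "a \<in> K") (auto simp: )
  then show ?thesis by (simp add: content_upto_def)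
qed

lemma continuous_on_content_upto:
  assumes "K \<in> sets borel"
  shows "continuous_on {a..b} (content_upto K a)"
proof -
  have "1-lipschitz_on {a..b} (content_upto K a)"
  proof (rule lipschitz_onI)
    fix x y assume xy: "x \<in> {a..b}" "y \<in> {a..b}"
    show "dist (content_upto K a x) (content_upto K a y) \<le> 1 * dist x y"
    proof (cases "x \<le> y")
      case True
      then show ?thesis
        using content_upto_diff[OF assms, of a x y] measure_Int_Ioc_le[OF assms True] xy
        by (simp add: dist_real_def)
    next
      case False
      then show ?thesis
        using content_upto_diff[OF assms, of a y x] measure_Int_Ioc_le[OF assms, of y x] xy
        by (simp add: dist_real_def)
    qed
  qed simp
  then show ?thesis
    by (rule lipschitz_on_continuous_on)
qed

lemma content_upto_open_near:
  assumes "open U" "x \<in> U" "a \<le> x"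
  shows "\<exists>d>0. \<forall>y. x \<le> y \<and> y < x + d \<longrightarrow> content_upto U a y = content_upto U a x + (y - x)"
proof -
  obtain d where d: "d > 0" "ball x d \<subseteq> U"
    using assms by (meson openE)
  show ?thesis
  proof (intro exI[of _ d] conjI allI impI)
    fix y assume y: "x \<le> y \<and> y < x + d"
    then have "U \<inter> {x<..y} = {x<..y}"
      using d by (force simp: dist_real_def)
    then show "content_upto U a y = content_upto U a x + (y - x)"
      using content_upto_diff[of U a x y] assms y by simp
  qed fact
qed

lemma content_upto_closed_near:
  assumes "closed K" "x \<notin> K" "a \<le> x"
  shows "\<exists>d>0. \<forall>y. x \<le> y \<and> y < x + d \<longrightarrow> content_upto K a y = content_upto K a x"
proof -
  have "open (- K)" "x \<in> - K" using assms by auto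
  then obtain d where d: "d > 0" "ball x d \<subseteq> - K"
    by (meson openE)
  show ?thesis
  proof (intro exI[of _ d] conjI allI impI)
    fix y assume y: "x \<le> y \<and> y < x + d"
    have "ball x d \<inter> K = {}" using d by auto
    moreover have "{x<..y} \<subseteq> ball x d" using y by (auto simp: dist_real_def)
    ultimately have "K \<inter> {x<..y} = {}" by auto
    then show "content_upto K a y = content_upto K a x"
      using content_upto_diff[of K a x y] assms y by simp
  qed fact
qed

lemma ae_null_borel:
  assumes "AE x in lborel. P (x::'a::euclidean_space)"
  obtains N where "N \<in> null_sets lborel" "\<And>x. x \<notin> N \<Longrightarrow> P x"
proof (rule AE_E[OF assms])
  fix N assume "{x \<in> space lborel. \<not> P x} \<subseteq> N" "emeasure lborel N = 0" "N \<in> sets lborel"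
  then show thesis by (intro that[of N]) auto
qed

text \<open>Proved without integrating the derivative. The null set N of bad times lies in an open U
  of small measure; the comparison function \<open>G\<close> contains L times the content of U,
  which at a bad time grows as fast as f possibly can, while the term with \<epsilon> covers the
  good times.\<close>

lemma lipschitz_nonincreasing_if_ae_deriv_le:
  fixes f :: "real \<Rightarrow> real"
  assumes ab: "a \<le> b" and lip: "L-lipschitz_on {a..b} f"
    and ae: "AE t in lborel. t \<in> {a..b} \<longrightarrow>
       (\<exists>f'\<le>0. (f has_real_derivative f') (at t within {a..b}))"
  shows "f b \<le> f a"
proof (rule field_le_epsilon)
  fix e :: real assume e: "e > 0"
  have L: "0 \<le> L" using lip by (rule lipschitz_on_nonneg)
  obtain N where N: "N \<in> null_sets lborel"
    "\<And>t. t \<notin> N \<Longrightarrow> t \<in> {a..b} \<longrightarrow> (\<exists>f'\<le>0. (f has_real_derivative f') (at t within {a..b}))"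
    using ae_null_borel[OF ae] by blast
  \<comment> \<open>The total error is \<epsilon> times (L + (b - a)), hence at most e; the added 1
    keeps the denominator positive.\<close>
  define \<epsilon> where "\<epsilon> = e / (L + (b - a) + 1)"
  have \<epsilon>: "\<epsilon> > 0" using e L ab by (auto simp: \<epsilon>_def)
  obtain U where U: "open U" "N \<subseteq> U" "emeasure lborel (U - N) < ennreal \<epsilon>"
    using outer_regular_lborel[of N \<epsilon>] N(1) \<epsilon> by (auto simp: null_sets_def)
  have UN: "emeasure lborel U < ennreal \<epsilon>"
  proof -
    have "emeasure lborel (U - N) = emeasure lborel U"
      using N(1) U(1) by (intro emeasure_Diff_null_set) auto
    then show ?thesis using U(3) by simp
  qed
  have cU: "content_upto U a b \<le> \<epsilon>"
  proof -
    have "measure lborel (U \<inter> {a..b}) \<le> measure lborel U"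
      using U(1) UN by (intro measure_mono_fmeasurable) (auto simp: fmeasurable_def intro: less_trans[OF _ ennreal_less_top])
    also have "\<dots> \<le> \<epsilon>"
      using UN \<epsilon> by (simp add: measure_def enn2real_leI less_imp_le)
    finally show ?thesis by (simp add: content_upto_def)
  qed
  define G where "G = (\<lambda>t. \<epsilon> * (t - a) + L * content_upto U a t - f t)"
  have "G a \<le> G b"
  proof (rule continuous_le_if_locally_le_right[OF ab])
    show "continuous_on {a..b} G"
      unfolding G_def
      by (intro continuous_intros continuous_on_content_upto lipschitz_on_continuous_on[OF lip])
        (use U in auto)
  next
    fix x assume x: "a \<le> x" "x < b"
    show "\<exists>y>x. y \<le> b \<and> G x \<le> G y"
    proof (cases "x \<in> N")
      case True
      then obtain d where d: "d > 0"
        "\<And>y. x \<le> y \<Longrightarrow> y < x + d \<Longrightarrow> content_upto U a y = content_upto U a x + (y - x)"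
        using content_upto_open_near[OF U(1), of x a] U(2) x by blast
      define y where "y = min b (x + d/2)"
      have y: "x < y" "y \<le> b" "y < x + d" using x d(1) by (auto simp: y_def)
      have "\<bar>f y - f x\<bar> \<le> L * (y - x)"
        using lipschitz_onD[OF lip, of y x] x y by (auto simp: dist_real_def)
      moreover have "L * content_upto U a y = L * content_upto U a x + L * (y - x)"
        using d(2)[of y] y by (simp only: distrib_left)
      moreover have "\<epsilon> * (x - a) \<le> \<epsilon> * (y - a)" using y \<epsilon> by simp
      ultimately have "G x \<le> G y"
        by (simp add: G_def)
      then show ?thesis using y by blast
    next
      case False
      then obtain f' where f': "f' \<le> 0" "(f has_real_derivative f') (at x within {a..b})"
        using N(2)[of x] x by auto
      have "((\<lambda>y. (f y - f x) / (y - x)) \<longlongrightarrow> f') (at x within {a..b})"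
        using f'(2) by (simp add: has_field_derivative_iff)
      then have "\<forall>\<^sub>F y in at x within {a..b}. (f y - f x) / (y - x) < \<epsilon>"
        by (rule order_tendstoD) (use f' \<epsilon> in auto)
      then obtain d where d: "d > 0"
        "\<And>y. y \<in> {a..b} \<Longrightarrow> y \<noteq> x \<Longrightarrow> dist y x < d \<Longrightarrow> (f y - f x) / (y - x) < \<epsilon>"
        by (auto simp: eventually_at)
      define y where "y = min b (x + d/2)"
      have y: "x < y" "y \<le> b" "y < x + d" using x d(1) by (auto simp: y_def)
      have "f y - f x < \<epsilon> * (y - x)"
        using d(2)[of y] y x by (simp add: dist_real_def divide_simps)
      moreover have "L * content_upto U a x \<le> L * content_upto U a y"
        using content_upto_diff[of U a x y] U(1) x y L by (simp add: mult_left_mono)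
      ultimately have "G x \<le> G y"
        by (simp add: G_def algebra_simps)
      then show ?thesis using y by blast
    qed
  qed
  then have "f b \<le> f a + \<epsilon> * (b - a) + L * content_upto U a b"
    by (simp add: G_def content_upto_refl)
  also have "\<dots> \<le> f a + \<epsilon> * (b - a) + L * \<epsilon>"
    using cU L by (simp add: mult_left_mono)
  also have "\<dots> = f a + \<epsilon> * (L + (b - a))" by (simp add: algebra_simps)
  also have "\<epsilon> * (L + (b - a)) \<le> \<epsilon> * (L + (b - a) + 1)" using \<epsilon> by simp
  also have "\<dots> = e" using L ab by (simp add: \<epsilon>_def)
  finally show "f b \<le> f a + e" by simp
qed

text \<open>At a point of K only some arbitrarily short steps are controlled, as by a lower Dini
  derivative, and \<open>continuous_le_if_locally_le_right\<close> needs no more. The part of such a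
  step that misses K is charged with slope L, which \<open>p \<le> L\<close> permits.\<close>

lemma increment_le_content_right:
  fixes f :: "real \<Rightarrow> real"
  assumes lip: "L-lipschitz_on UNIV f" and K: "closed K" and ab: "a \<le> b" and pL: "p \<le> L"
    and up: "\<And>x d. x \<in> K \<Longrightarrow> d > 0 \<Longrightarrow> \<exists>h. 0 < h \<and> h < d \<and> f (x + h) - f x \<le> p * h"
  shows "f b - f a \<le> p * content_upto K a b + L * ((b - a) - content_upto K a b)"
proof -
  have L: "0 \<le> L" using lip by (rule lipschitz_on_nonneg)
  have Kb: "K \<in> sets borel" using K by auto
  define G where "G = (\<lambda>t. p * content_upto K a t + L * ((t - a) - content_upto K a t) - f t)"
  have "G a \<le> G b"
  proof (rule continuous_le_if_locally_le_right[OF ab])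
    show "continuous_on {a..b} G"
      unfolding G_def
      by (intro continuous_intros continuous_on_content_upto Kb
          lipschitz_on_continuous_on[OF lipschitz_on_subset[OF lip]]) auto
  next
    fix x assume x: "a \<le> x" "x < b"
    show "\<exists>y>x. y \<le> b \<and> G x \<le> G y"
    proof (cases "x \<in> K")
      case True
      then obtain h where h: "0 < h" "h < b - x" "f (x + h) - f x \<le> p * h"
        using up[of x "b - x"] x by auto
      have 1: "content_upto K a (x + h) = content_upto K a x + measure lborel (K \<inter> {x<..x+h})"
        using content_upto_diff[OF Kb, of a x "x + h"] x h by simp
      have 2: "measure lborel (K \<inter> {x<..x+h}) \<le> h"
        using measure_Int_Ioc_le[OF Kb, of x "x+h"] h by simp
      have "p * h \<le> p * measure lborel (K \<inter> {x<..x+h}) + L * (h - measure lborel (K \<inter> {x<..x+h}))"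
        using mult_right_mono[OF pL, of "h - measure lborel (K \<inter> {x<..x+h})"] 2
        by (simp add: algebra_simps)
      then have "G x \<le> G (x + h)"
        unfolding G_def 1 using h(3) by (simp add: algebra_simps)
      then show ?thesis using h by (intro exI[of _ "x + h"]) auto
    next
      case False
      then obtain d where d: "d > 0"
        "\<And>y. x \<le> y \<Longrightarrow> y < x + d \<Longrightarrow> content_upto K a y = content_upto K a x"
        using content_upto_closed_near[OF K, of x a] x by blast
      define y where "y = min b (x + d/2)"
      have y: "x < y" "y \<le> b" "y < x + d" using x d(1) by (auto simp: y_def)
      have "\<bar>f y - f x\<bar> \<le> L * (y - x)"
        using lipschitz_onD[OF lip, of y x] x y by (auto simp: dist_real_def)
      then have "G x \<le> G y"
        using d(2)[of y] y by (simp add: G_def algebra_simps)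
      then show ?thesis using y by blast
    qed
  qed
  then show ?thesis by (simp add: G_def content_upto_refl)
qed

lemma measure_reflect:
  assumes "K \<in> sets borel"
  shows "measure lborel (uminus ` K) = measure lborel (K :: real set)"
proof -
  have "measure lborel K = measure (distr lborel borel uminus) K"
    by (simp add: lborel_distr_uminus)
  also have "\<dots> = measure lborel (uminus -` K)"
    using assms by (subst measure_distr) auto
  also have "uminus -` K = uminus ` K"
    by force
  finally show ?thesis by simp
qed

text \<open>Passing from f to the function with value - f (- x) at x turns left steps into right
  steps and keeps the increment over the interval.\<close>

lemma increment_le_content_left:
  fixes f :: "real \<Rightarrow> real"
  assumes lip: "L-lipschitz_on UNIV f" and K: "closed K" and ab: "a \<le> b" and pL: "p \<le> L"
    and up: "\<And>x d. x \<in> K \<Longrightarrow> d > 0 \<Longrightarrow> \<exists>h. 0 < h \<and> h < d \<and> f x - f (x - h) \<le> p * h"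
  shows "f b - f a \<le> p * content_upto K a b + L * ((b - a) - content_upto K a b)"
proof -
  define g where "g = (\<lambda>x. - f (- x))"
  have lipg: "L-lipschitz_on UNIV g"
  proof (rule lipschitz_onI)
    show "dist (g x) (g y) \<le> L * dist x y" for x y
      using lipschitz_onD[OF lip, of "-x" "-y"] by (simp add: g_def dist_minus)
  qed (rule lipschitz_on_nonneg[OF lip])
  have Kb: "K \<in> sets borel" using K by auto
  have c: "content_upto (uminus ` K) (-b) (-a) = content_upto K a b"
  proof -
    have "uminus ` K \<inter> {-b..-a} = uminus ` (K \<inter> {a..b})" by force
    then show ?thesis
      using measure_reflect[of "K \<inter> {a..b}"] Kb by (simp add: content_upto_def)
  qed
  have "g (-a) - g (-b) \<le> p * content_upto (uminus ` K) (-b) (-a) + L * ((-a - -b) - content_upto (uminus ` K) (-b) (-a))"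
  proof (rule increment_le_content_right[OF lipg _ _ pL])
    show "closed (uminus ` K)" using K by (rule closed_negations)
    fix x d :: real assume "x \<in> uminus ` K" "d > 0"
    then obtain h where "0 < h" "h < d" "f (-x) - f (-x - h) \<le> p * h"
      using up[of "-x" d] by auto
    then show "\<exists>h>0. h < d \<and> g (x + h) - g x \<le> p * h"
      by (intro exI[of _ h]) (auto simp: g_def)
  qed (use ab in auto)
  then show ?thesis by (simp add: c g_def)
qed

text \<open>The hypothesis keeps the fraction of any interval occupied by K away from one, so K has
  no density point. In place of the density theorem, an open U around K with U - K small is compared
  with K over short intervals inside U; together they give c |K| \<le> C |U - K|.\<close>

lemma null_if_content_le:
  fixes K :: "real set"
  assumes K: "compact K" and c: "c > 0" and C: "C \<ge> 0"
    and le: "\<And>a b. a \<le> b \<Longrightarrow> c * content_upto K a b \<le> C * ((b - a) - content_upto K a b)"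
  shows "emeasure lborel K = 0"
proof -
  have Kb: "K \<in> sets borel" and Kc: "closed K"
    using K by (auto intro: compact_imp_closed borel_closed)
  have Kfm: "K \<in> fmeasurable lborel"
    using K by (rule fmeasurable_compact)
  have "measure lborel K \<le> 0"
  proof (rule field_le_epsilon)
    fix e :: real assume e: "e > 0"
    define \<epsilon> where "\<epsilon> = e * c / (C + 1)"
    have \<epsilon>: "\<epsilon> > 0" using e c C by (auto simp: \<epsilon>_def)
    obtain U where U: "open U" "K \<subseteq> U" "emeasure lborel (U - K) < ennreal \<epsilon>"
      using outer_regular_lborel[of K \<epsilon>] Kb \<epsilon> by auto
    obtain a b where ab: "a \<le> b" "K \<subseteq> {a..b}"
    proof -
      obtain r where "r > 0" "K \<subseteq> cball 0 r"
        using bounded_subset_ballD[OF compact_imp_bounded[OF K], of 0] ball_subset_cball by blast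
      then show ?thesis by (intro that[of "-r" r]) (auto simp: dist_real_def abs_le_iff subset_iff)
    qed
    have UKb: "U - K \<in> sets borel" using U(1) Kb by auto
    have mUK: "measure lborel (U - K) \<le> \<epsilon>"
      using U(3) \<epsilon> by (simp add: measure_def enn2real_leI less_imp_le)
    define G where "G = (\<lambda>t. C * content_upto (U - K) a t - c * content_upto K a t)"
    have "G a \<le> G b"
    proof (rule continuous_le_if_locally_le_right[OF ab(1)])
      show "continuous_on {a..b} G"
        unfolding G_def by (intro continuous_intros continuous_on_content_upto Kb UKb)
    next
      fix x assume x: "a \<le> x" "x < b"
      show "\<exists>y>x. y \<le> b \<and> G x \<le> G y"
      proof (cases "x \<in> K")
        case True
        then obtain d where d: "d > 0" "ball x d \<subseteq> U"
          using U by (meson openE subsetD)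
        define y where "y = min b (x + d/2)"
        have y: "x < y" "y \<le> b" "y < x + d" using x d(1) by (auto simp: y_def)
        have sub: "{x..y} \<subseteq> U" using d(2) y by (force simp: dist_real_def)
        \<comment> \<open>Inside U the complement of K is U - K, so the hypothesis for this interval
          compares the growth of the two contents.\<close>
        then have "(U - K) \<inter> {x<..y} = {x<..y} - (K \<inter> {x<..y})" by auto
        then have mU: "measure lborel ((U - K) \<inter> {x<..y}) = (y - x) - measure lborel (K \<inter> {x<..y})"
          using Kb y measure_Diff[of lborel "{x<..y}" "K \<inter> {x<..y}"] by simp
        have "content_upto K x y = measure lborel (K \<inter> {x<..y})"
          using content_upto_diff[OF Kb, of x x y] y by (simp add: content_upto_refl)
        then have "c * measure lborel (K \<inter> {x<..y}) \<le> C * ((y - x) - measure lborel (K \<inter> {x<..y}))"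
          using le[of x y] y by simp
        moreover have "content_upto (U - K) a y = content_upto (U - K) a x + ((y - x) - measure lborel (K \<inter> {x<..y}))"
          using content_upto_diff[OF UKb, of a x y] x y mU by simp
        then have "C * content_upto (U - K) a y = C * content_upto (U - K) a x + C * ((y - x) - measure lborel (K \<inter> {x<..y}))"
          by (simp only: distrib_left)
        moreover have "c * content_upto K a y = c * content_upto K a x + c * measure lborel (K \<inter> {x<..y})"
          using content_upto_diff[OF Kb, of a x y] x y by (simp only: distrib_left)
        ultimately have "G x \<le> G y"
          unfolding G_def by linarith
        then show ?thesis using y by blast
      next
        case False
        then obtain d where d: "d > 0"
          "\<And>y. x \<le> y \<Longrightarrow> y < x + d \<Longrightarrow> content_upto K a y = content_upto K a x"
          using content_upto_closed_near[OF Kc, of x a] x by blast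
        define y where "y = min b (x + d/2)"
        have y: "x < y" "y \<le> b" "y < x + d" using x d(1) by (auto simp: y_def)
        have "G x \<le> G y"
          unfolding G_def using d(2)[of y] y x C content_upto_diff[OF UKb, of a x y]
          by (simp add: mult_left_mono)
        then show ?thesis using y by blast
      qed
    qed
    then have "c * measure lborel K \<le> C * content_upto (U - K) a b"
      using ab(2) unfolding G_def content_upto_refl by (simp add: content_upto_def Int_absorb2)
    also have "\<dots> \<le> C * \<epsilon>"
    proof -
      have "content_upto (U - K) a b \<le> measure lborel (U - K)"
        unfolding content_upto_def using UKb U(3)
        by (intro measure_mono_fmeasurable) (auto simp: fmeasurable_def intro: less_trans[OF _ ennreal_less_top])
      then show ?thesis using mUK C by (intro mult_left_mono) auto
    qed
    also have "\<dots> \<le> c * e"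
      using e c C by (simp add: \<epsilon>_def field_simps)
    finally show "measure lborel K \<le> 0 + e" using c by simp
  qed
  then have "measure lborel K = 0" by (simp add: measure_le_0_iff)
  then show ?thesis
    using Kfm by (metis emeasure_eq_measure2 ennreal_0)
qed


lemma null_if_compact_subsets_null:
  fixes N :: "real set"
  assumes N: "N \<in> sets borel" and null: "\<And>K. compact K \<Longrightarrow> K \<subseteq> N \<Longrightarrow> emeasure lborel K = 0"
  shows "N \<in> null_sets lborel"
proof -
  have "N \<inter> cball 0 (real k) \<in> null_sets lborel" for k :: nat
  proof -
    let ?S = "N \<inter> cball 0 (real k)"
    have S: "?S \<in> sets lebesgue" using N by auto
    have "emeasure lebesgue ?S \<le> 0"
    proof (rule ennreal_le_epsilon)
      fix e :: real assume e: "e > 0"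
      from sets_lebesgue_inner_closed[OF S e] obtain T where
        T: "closed T" "T \<subseteq> ?S" "?S - T \<in> lmeasurable" "emeasure lebesgue (?S - T) < ennreal e"
        by blast
      have "compact T"
        using T by (meson bounded_cball bounded_subset compact_eq_bounded_closed le_inf_iff)
      then have "emeasure lborel T = 0" using null T by blast
      then have "emeasure lebesgue T = 0" using T(1) by simp
      moreover have "emeasure lebesgue ?S \<le> emeasure lebesgue T + emeasure lebesgue (?S - T)"
        using T(1,2,3) S by (intro order_trans[OF emeasure_mono emeasure_subadditive])
          (auto simp: fmeasurable_def)
      ultimately show "emeasure lebesgue ?S \<le> 0 + ennreal e"
        using T(4) by simp
    qed
    then show ?thesis using N by (auto simp: null_sets_def)
  qed
  then have "(\<Union>k. N \<inter> cball 0 (real k)) \<in> null_sets lborel"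
    by (rule null_sets_UN)
  also have "(\<Union>k. N \<inter> cball 0 (real k)) = N"
    using real_arch_simple by (auto simp: dist_real_def)
  finally show ?thesis .
qed

text \<open>On a compact set \<open>K\<close> where one Dini derivative is at most \<open>p\<close> and another at least \<open>q > p\<close>, the
  increments of \<open>f\<close> grow with both slopes per unit of content of \<open>K\<close>, up to the content of the
  complement. So \<open>K\<close> has no density points. Left and right derivatives are encoded by the signs.\<close>

lemma lipschitz_dini_gap_null:
  fixes f :: "real \<Rightarrow> real"
  assumes lip: "L-lipschitz_on UNIV f" and pq: "p < q" and sgn: "\<sigma> \<in> {1,-1}" "\<tau> \<in> {1,-1}"
  shows "{x. (\<forall>n::nat. \<exists>h. 0 < h \<and> h < 1 / Suc n \<and> \<sigma> * (f (x + \<sigma> * h) - f x) < p * h) \<and>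
             (\<forall>n::nat. \<exists>h. 0 < h \<and> h < 1 / Suc n \<and> \<tau> * (f (x + \<tau> * h) - f x) > q * h)} \<in> null_sets lborel"
    (is "?N \<in> _")
proof (rule null_if_compact_subsets_null)
  have cont: "continuous_on UNIV (\<lambda>x. \<sigma> * (f (x + \<sigma> * h) - f x))" for \<sigma> h :: real
  proof -
    have "continuous_on UNIV (\<lambda>x. f (x + \<sigma> * h))"
      by (rule continuous_on_compose2[OF lipschitz_on_continuous_on[OF lip]])
        (auto intro!: continuous_intros)
    then show ?thesis
      by (intro continuous_on_mult_left continuous_on_diff lipschitz_on_continuous_on[OF lip])
  qed
  have "open (\<Union>h\<in>{0<..<1 / Suc n}. {x. \<sigma> * (f (x + \<sigma> * h) - f x) < p * h})" for n :: nat
    by (intro open_UN ballI open_Collect_less cont continuous_intros)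
  moreover have "open (\<Union>h\<in>{0<..<1 / Suc n}. {x. q * h < \<tau> * (f (x + \<tau> * h) - f x)})" for n :: nat
    by (intro open_UN ballI open_Collect_less cont continuous_intros)
  ultimately have "(\<Inter>n. (\<Union>h\<in>{0<..<1 / Suc n}. {x. \<sigma> * (f (x + \<sigma> * h) - f x) < p * h})) \<inter>
     (\<Inter>n. (\<Union>h\<in>{0<..<1 / Suc n}. {x. q * h < \<tau> * (f (x + \<tau> * h) - f x)})) \<in> sets borel"
    by (intro sets.Int sets.countable_INT'') auto
  also have "(\<Inter>n. (\<Union>h\<in>{0<..<1 / Suc n}. {x. \<sigma> * (f (x + \<sigma> * h) - f x) < p * h})) \<inter>
     (\<Inter>n. (\<Union>h\<in>{0<..<1 / Suc n}. {x. q * h < \<tau> * (f (x + \<tau> * h) - f x)})) = ?N"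
    by (simp add: set_eq_iff Bex_def)
  finally show "?N \<in> sets borel" .
next
  fix K assume K: "compact K" "K \<subseteq> ?N"
  \<comment> \<open>A common Lipschitz constant of f and - f that also dominates p and - q, the
    slopes used on K for the two functions.\<close>
  define M where "M = max L (max \<bar>p\<bar> \<bar>q\<bar>)"
  have M: "p \<le> M" "-q \<le> M" "M \<ge> 0" by (auto simp: M_def)
  have lipM: "M-lipschitz_on UNIV f" "M-lipschitz_on UNIV (\<lambda>x. - f x)"
    using lipschitz_on_mono[OF lip, of UNIV M] by (simp_all add: M_def)
  have small: "\<exists>n::nat. 1 / Suc n < d" if "d > 0" for d :: real
    using reals_Archimedean[OF that] by (auto simp: inverse_eq_divide)
  show "emeasure lborel K = 0"
  proof (rule null_if_content_le[OF K(1)])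
    show "q - p > 0" "2 * M \<ge> 0" using pq M by auto
    fix a b :: real assume ab: "a \<le> b"
    have low: "\<exists>h>0. h < d \<and> \<sigma> * (f (x + \<sigma> * h) - f x) \<le> p * h" if x: "x \<in> K" and "d > 0" for x d
    proof -
      obtain n :: nat where "1 / Suc n < d" using small \<open>d > 0\<close> by blast
      moreover obtain h where "0 < h" "h < 1 / Suc n" "\<sigma> * (f (x + \<sigma> * h) - f x) < p * h"
        using x K(2) by blast
      ultimately show ?thesis by (intro exI[of _ h]) auto
    qed
    have up: "\<exists>h>0. h < d \<and> \<tau> * (f (x + \<tau> * h) - f x) \<ge> q * h" if x: "x \<in> K" and "d > 0" for x d
    proof -
      obtain n :: nat where "1 / Suc n < d" using small \<open>d > 0\<close> by blast
      moreover obtain h where "0 < h" "h < 1 / Suc n" "\<tau> * (f (x + \<tau> * h) - f x) > q * h"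
        using x K(2) by blast
      ultimately show ?thesis by (intro exI[of _ h]) auto
    qed
    have 1: "f b - f a \<le> p * content_upto K a b + M * ((b - a) - content_upto K a b)"
    proof (cases "\<sigma> = 1")
      case True
      then show ?thesis
        using low by (intro increment_le_content_right[OF lipM(1) compact_imp_closed[OF K(1)] ab M(1)]) auto
    next
      case False
      then have "\<sigma> = -1" using sgn by auto
      then show ?thesis
        using low by (intro increment_le_content_left[OF lipM(1) compact_imp_closed[OF K(1)] ab M(1)]) auto
    qed
    have 2: "- f b - - f a \<le> -q * content_upto K a b + M * ((b - a) - content_upto K a b)"
    proof (cases "\<tau> = 1")
      case True
      then show ?thesis
        using up by (intro increment_le_content_right[OF lipM(2) compact_imp_closed[OF K(1)] ab M(2)]) (auto simp: algebra_simps)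
    next
      case False
      then have "\<tau> = -1" using sgn by auto
      then show ?thesis
        using up by (intro increment_le_content_left[OF lipM(2) compact_imp_closed[OF K(1)] ab M(2)]) (auto simp: algebra_simps)
    qed
    \<comment> \<open>The increments of f and - f cancel in the sum of the two estimates.\<close>
    show "(q - p) * content_upto K a b \<le> 2 * M * ((b - a) - content_upto K a b)"
      using 1 2 by (simp add: algebra_simps)
  qed
qed

text \<open>The limit is the infimum \<open>s\<close> of the eventual upper bounds, that is, the
  upper limit of Q. Values frequently at most some a < s would leave room for two rationals between
  a and s that form a forbidden gap.\<close>

lemma bounded_tendsto_if_no_gap:
  fixes Q :: "'a \<Rightarrow> real"
  assumes F: "F \<noteq> bot" and bd: "\<And>h. \<bar>Q h\<bar> \<le> L"
    and gap: "\<And>p q. p \<in> \<rat> \<Longrightarrow> q \<in> \<rat> \<Longrightarrow> p < q \<Longrightarrow> \<not> ((\<exists>\<^sub>F h in F. Q h < p) \<and> (\<exists>\<^sub>F h in F. Q h > q))"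
  shows "\<exists>l. (Q \<longlongrightarrow> l) F"
proof -
  define A where "A = {q. \<forall>\<^sub>F h in F. Q h \<le> q}"
  have LA: "L \<in> A" using bd by (auto simp: A_def abs_le_iff)
  have bb: "- L \<le> q" if "q \<in> A" for q
  proof -
    have "\<forall>\<^sub>F h in F. -L \<le> q"
      using that unfolding A_def mem_Collect_eq
    proof eventually_elim
      case (elim h)
      then show ?case using bd[of h] by linarith
    qed
    then show ?thesis using F by (simp add: eventually_const)
  qed
  then have bdd: "bdd_below A" by (meson bdd_belowI)
  define s where "s = Inf A"
  have "(Q \<longlongrightarrow> s) F"
  proof (rule order_tendstoI)
    fix a assume "s < a"
    then obtain q where q: "q \<in> A" "q < a"
      using LA bdd cInf_less_iff[of A a] unfolding s_def by blast
    then show "\<forall>\<^sub>F h in F. Q h < a"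
      unfolding A_def mem_Collect_eq by (auto elim: eventually_mono)
  next
    fix a assume a: "a < s"
    obtain p where p: "p \<in> \<rat>" "a < p" "p < s" using Rats_dense_in_real[OF a] by blast
    obtain q where q: "q \<in> \<rat>" "p < q" "q < s" using Rats_dense_in_real[OF p(3)] by blast
    have "q \<notin> A" using q(3) bdd unfolding s_def by (meson cInf_lower not_le)
    then have "\<exists>\<^sub>F h in F. Q h > q"
      by (simp add: A_def frequently_def not_less)
    then have "\<not> (\<exists>\<^sub>F h in F. Q h < p)"
      using gap[OF p(1) q(1,2)] by blast
    then have "\<forall>\<^sub>F h in F. Q h \<ge> p"
      by (simp add: frequently_def not_less)
    then show "\<forall>\<^sub>F h in F. Q h > a"
      by eventually_elim (use p in auto)
  qed
  then show ?thesis by blast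
qed

lemma frequently_at_0_sided:
  fixes P :: "real \<Rightarrow> bool"
  assumes "\<exists>\<^sub>F h in at 0. P h"
  shows "\<exists>\<sigma>\<in>{1,-1}. \<forall>n::nat. \<exists>h>0. h < 1 / Suc n \<and> P (\<sigma> * h)"
proof -
  have *: "\<exists>h>0. h < e \<and> P (\<sigma> * h)" if "\<exists>\<^sub>F h in (if \<sigma> = 1 then at_right 0 else at_left 0). P h" "\<sigma> \<in> {1,-1}" "e > 0"
    for \<sigma> e :: real
  proof (rule ccontr)
    assume neg: "\<not> ?thesis"
    have "\<forall>\<^sub>F h in (if \<sigma> = 1 then at_right 0 else at_left 0). \<not> P h"
    proof (cases "\<sigma> = 1")
      case True
      then show ?thesis using neg \<open>e > 0\<close>
        by (auto simp: eventually_at_right_field intro!: exI[of _ e])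
    next
      case False
      then have "\<sigma> = -1" using that by auto
      have "\<not> P y" if "-e < y" "y < 0" for y
        using neg \<open>\<sigma> = -1\<close> that by (auto dest!: spec[of _ "-y"])
      then show ?thesis using \<open>\<sigma> = -1\<close> \<open>e > 0\<close>
        by (auto simp: eventually_at_left_field intro!: exI[of _ "-e"])
    qed
    with that(1) show False by (simp add: frequently_def)
  qed
  from assms have "(\<exists>\<^sub>F h in at_right 0. P h) \<or> (\<exists>\<^sub>F h in at_left 0. P h)"
    by (simp add: frequently_def eventually_at_split) blast
  then show ?thesis
    using *[of 1] *[of "-1"] by (auto simp: )
qed

text \<open>A bounded difference quotient without limit is frequently below p and frequently above q
  for some rationals p < q, each time from one of the two sides. Two signs and two rationals make
  countably many exceptional sets, all null by \<open>lipschitz_dini_gap_null\<close>.\<close>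

lemma lipschitz_ae_differentiable_real:
  fixes f :: "real \<Rightarrow> real"
  assumes lip: "L-lipschitz_on UNIV f"
  shows "AE x in lborel. f differentiable (at x)"
proof -
  define N where "N = (\<lambda>\<sigma> \<tau> p q. {x. (\<forall>n::nat. \<exists>h. 0 < h \<and> h < 1 / Suc n \<and> \<sigma> * (f (x + \<sigma> * h) - f x) < p * h) \<and>
             (\<forall>n::nat. \<exists>h. 0 < h \<and> h < 1 / Suc n \<and> \<tau> * (f (x + \<tau> * h) - f x) > q * h)})"
  define I where "I = (SIGMA \<sigma>:{1,-1::real}. SIGMA \<tau>:{1,-1::real}. {(p,q). p \<in> \<rat> \<and> q \<in> \<rat> \<and> p < (q::real)})"
  have "countable {(p,q). p \<in> \<rat> \<and> q \<in> \<rat> \<and> p < (q::real)}"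
    by (rule countable_subset[of _ "\<rat> \<times> \<rat>"]) (auto intro: countable_rat)
  then have cI: "countable I" unfolding I_def by (intro countable_SIGMA) auto
  have "(\<Union>(\<sigma>,\<tau>,p,q)\<in>I. N \<sigma> \<tau> p q) \<in> null_sets lborel"
  proof (rule null_sets_UN'[OF cI])
    fix i assume "i \<in> I"
    then obtain \<sigma> \<tau> p q where i: "i = (\<sigma>, \<tau>, p, q)" "\<sigma> \<in> {1,-1}" "\<tau> \<in> {1,-1}" "p < q"
      unfolding I_def by blast
    then show "(case i of (\<sigma>, \<tau>, p, q) \<Rightarrow> N \<sigma> \<tau> p q) \<in> null_sets lborel"
      unfolding i(1) prod.case N_def by (intro lipschitz_dini_gap_null[OF lip])
  qed
  then have "AE x in lborel. x \<notin> (\<Union>(\<sigma>,\<tau>,p,q)\<in>I. N \<sigma> \<tau> p q)"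
    by (rule AE_not_in)
  then show ?thesis
  proof (rule AE_mp, intro AE_I2 impI)
    fix x assume x: "x \<notin> (\<Union>(\<sigma>,\<tau>,p,q)\<in>I. N \<sigma> \<tau> p q)"
    define Q where "Q = (\<lambda>h. (f (x + h) - f x) / h)"
    have bd: "\<bar>Q h\<bar> \<le> L" for h
      using lipschitz_onD[OF lip, of "x + h" x] lipschitz_on_nonneg[OF lip]
      by (cases "h = 0") (auto simp: Q_def dist_real_def divide_simps)
    have "\<exists>l. (Q \<longlongrightarrow> l) (at 0)"
    proof (rule bounded_tendsto_if_no_gap[OF _ bd])
      fix p q :: real assume pq: "p \<in> \<rat>" "q \<in> \<rat>" "p < q"
      show "\<not> ((\<exists>\<^sub>F h in at 0. Q h < p) \<and> (\<exists>\<^sub>F h in at 0. Q h > q))"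
      proof
        assume "(\<exists>\<^sub>F h in at 0. Q h < p) \<and> (\<exists>\<^sub>F h in at 0. Q h > q)"
        then obtain \<sigma> \<tau> where s: "\<sigma> \<in> {1,-1}" "\<tau> \<in> {1,-1}"
          "\<forall>n::nat. \<exists>h>0. h < 1 / Suc n \<and> Q (\<sigma> * h) < p" "\<forall>n::nat. \<exists>h>0. h < 1 / Suc n \<and> Q (\<tau> * h) > q"
          using frequently_at_0_sided[of "\<lambda>h. Q h < p"] frequently_at_0_sided[of "\<lambda>h. Q h > q"] by blast
        have e1: "Q (\<sigma> * h) < p \<longleftrightarrow> \<sigma> * (f (x + \<sigma> * h) - f x) < p * h" if "h > 0" for h
          using s(1) that by (auto simp: Q_def field_simps)
        have e2: "Q (\<tau> * h) > q \<longleftrightarrow> \<tau> * (f (x + \<tau> * h) - f x) > q * h" if "h > 0" for h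
          using s(2) that by (auto simp: Q_def field_simps)
        have "x \<in> N \<sigma> \<tau> p q"
          using s(3,4) e1 e2 unfolding N_def by blast
        then show False using x s(1,2) pq by (force simp: I_def)
      qed
    qed simp
    then obtain l where "(Q \<longlongrightarrow> l) (at 0)" by blast
    then have "(f has_real_derivative l) (at x)"
      by (simp add: DERIV_def Q_def)
    then show "f differentiable (at x)"
      by (auto simp: real_differentiable_def)
  qed
qed


lemma lipschitz_ae_differentiable:
  fixes f :: "real \<Rightarrow> 'a::euclidean_space"
  assumes lip: "L-lipschitz_on {a..b} f"
  shows "AE x in lborel. x \<in> {a<..<b} \<longrightarrow> f differentiable (at x)"
proof (cases "a \<le> b")
  case True
  \<comment> \<open>Clamping the argument extends f to the whole line with the same Lipschitz
    constant and changes nothing near an interior point.\<close>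
  define F where "F = (\<lambda>i x. f (max a (min b x)) \<bullet> i)"
  have "L-lipschitz_on UNIV (F i)" if i: "i \<in> Basis" for i
  proof (rule lipschitz_onI)
    fix x y :: real
    have "dist (F i x) (F i y) \<le> dist (f (max a (min b x))) (f (max a (min b y)))"
      using i by (simp add: F_def dist_norm inner_diff_left[symmetric] Basis_le_norm)
    also have "\<dots> \<le> L * dist (max a (min b x)) (max a (min b y))"
      using True by (intro lipschitz_onD[OF lip]) auto
    also have "\<dots> \<le> L * dist x y"
      using lipschitz_on_nonneg[OF lip] by (intro mult_left_mono) (auto simp: dist_real_def)
    finally show "dist (F i x) (F i y) \<le> L * dist x y" .
  qed (use lipschitz_on_nonneg[OF lip] in auto)
  then have "\<forall>i\<in>Basis. AE x in lborel. F i differentiable (at x)"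
    by (intro ballI lipschitz_ae_differentiable_real[of L])
  then have "AE x in lborel. \<forall>i\<in>Basis. F i differentiable (at x)"
    unfolding AE_ball_countable[OF countable_finite[OF finite_Basis]] .
  then show ?thesis
  proof (rule eventually_mono, intro impI)
    fix x assume x: "\<forall>i\<in>Basis. F i differentiable (at x)" "x \<in> {a<..<b}"
    have "(\<lambda>y. f y \<bullet> i) differentiable (at x)" if i: "i \<in> Basis" for i
    proof -
      obtain F' where F': "(F i has_derivative F') (at x)"
        using bspec[OF x(1) i] unfolding differentiable_def by (rule exE)
      have "((\<lambda>y. f y \<bullet> i) has_derivative F') (at x)"
        by (rule has_derivative_transform_within_open[OF F', of "{a<..<b}"]) (use x(2) in \<open>simp_all add: F_def\<close>)
      then show ?thesis by (rule differentiableI)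
    qed
    then show "f differentiable (at x)"
      unfolding differentiable_componentwise_within[of f] by blast
  qed
next case False then show ?thesis by simp qed

section \<open>Mean value estimate, Gronwall inequality and fundamental theorem with almost
  everywhere derivatives\<close>

lemma lipschitz_increment_le_ae:
  fixes f :: "real \<Rightarrow> 'a::euclidean_space"
  assumes ab: "a \<le> b" and lip: "L-lipschitz_on {a..b} f"
    and ae: "AE t in lborel. t \<in> {a..b} \<longrightarrow>
       (\<exists>v. (f has_vector_derivative v) (at t within {a..b}) \<and> norm v \<le> C)"
  shows "norm (f b - f a) \<le> C * (b - a)"
proof -
  define u where "u = f b - f a"
  \<comment> \<open>Projecting on the direction of the increment reduces the claim to the
    monotonicity of one real function.\<close>
  define h where "h = (\<lambda>t. f t \<bullet> u - C * norm u * t)"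
  have "h b \<le> h a"
  proof (rule lipschitz_nonincreasing_if_ae_deriv_le[OF ab])
    show "(L * norm u + \<bar>C * norm u\<bar>)-lipschitz_on {a..b} h"
    proof (rule lipschitz_onI)
      fix x y assume xy: "x \<in> {a..b}" "y \<in> {a..b}"
      have "h x - h y = (f x - f y) \<bullet> u - C * norm u * (x - y)"
        by (simp add: h_def algebra_simps)
      then have "\<bar>h x - h y\<bar> \<le> \<bar>(f x - f y) \<bullet> u\<bar> + \<bar>C * norm u * (x - y)\<bar>"
        by linarith
      also have "\<dots> \<le> norm (f x - f y) * norm u + \<bar>C * norm u\<bar> * \<bar>x - y\<bar>"
        using Cauchy_Schwarz_ineq2[of "f x - f y" u] by (simp add: abs_mult)
      also have "norm (f x - f y) \<le> L * \<bar>x - y\<bar>"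
        using lipschitz_onD[OF lip xy] by (simp add: dist_norm dist_real_def)
      finally show "dist (h x) (h y) \<le> (L * norm u + \<bar>C * norm u\<bar>) * dist x y"
        by (simp add: dist_real_def algebra_simps mult_right_mono)
    qed (use lipschitz_on_nonneg[OF lip] in auto)
    show "AE t in lborel. t \<in> {a..b} \<longrightarrow>
       (\<exists>h'\<le>0. (h has_real_derivative h') (at t within {a..b}))"
      using ae
    proof (rule eventually_mono, intro impI)
      fix t assume "t \<in> {a..b} \<longrightarrow> (\<exists>v. (f has_vector_derivative v) (at t within {a..b}) \<and> norm v \<le> C)"
        and "t \<in> {a..b}"
      then obtain v where v: "(f has_vector_derivative v) (at t within {a..b})" "norm v \<le> C" by blast
      have "(h has_real_derivative (v \<bullet> u - C * norm u)) (at t within {a..b})"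
        unfolding h_def has_real_derivative_iff_has_vector_derivative
        by (auto intro!: derivative_eq_intros bounded_linear.has_vector_derivative[OF bounded_linear_inner_left v(1)])
      moreover have "v \<bullet> u \<le> C * norm u"
        using norm_cauchy_schwarz[of v u] mult_right_mono[OF v(2), of "norm u"] by simp
      ultimately show "\<exists>h'\<le>0. (h has_real_derivative h') (at t within {a..b})"
        by (intro exI[of _ "v \<bullet> u - C * norm u"]) auto
    qed
  qed
  then have "norm u * norm u \<le> norm u * (C * (b - a))"
  proof -
    have "u \<bullet> u = f b \<bullet> u - f a \<bullet> u" by (simp add: u_def inner_diff_left)
    then have "u \<bullet> u = norm u * norm u" "u \<bullet> u = f b \<bullet> u - f a \<bullet> u"
      by (simp_all add: dot_square_norm power2_eq_square)
    with \<open>h b \<le> h a\<close> show ?thesis by (simp add: h_def algebra_simps)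
  qed
  \<comment> \<open>For u = 0 the claim is a statement on the sign of C: a negative C would
    contradict the hypothesis at almost every time of a nondegenerate interval.\<close>
  moreover have "0 \<le> C * (b - a)" if "u = 0"
  proof (cases "a = b")
    case False
    have "0 \<le> C"
    proof (rule ccontr)
      assume neg: "\<not> 0 \<le> C"
      have "AE t in lborel. t \<notin> {a..b}"
      proof (rule eventually_mono[OF ae], rule notI)
        fix t assume "t \<in> {a..b} \<longrightarrow> (\<exists>v. (f has_vector_derivative v) (at t within {a..b}) \<and> norm v \<le> C)"
          and "t \<in> {a..b}"
        then obtain v :: 'a where "norm v \<le> C" by blast
        then show False using neg norm_ge_zero[of v] by linarith
      qed
      then have "{a..b} \<in> null_sets lborel"
        by (simp add: AE_iff_null_sets)
      then show False using False ab by (simp add: null_sets_def)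
    qed
    then show ?thesis using ab by simp
  qed simp
  ultimately show ?thesis
    unfolding u_def[symmetric] by (cases "u = 0") (auto simp: mult_le_cancel_left)
qed

lemma lipschitz_on_mult_bounded:
  fixes f g :: "'a::metric_space \<Rightarrow> real"
  assumes f: "L-lipschitz_on X f" and g: "M-lipschitz_on X g"
    and bd: "\<And>x. x \<in> X \<Longrightarrow> \<bar>f x\<bar> \<le> A" "\<And>x. x \<in> X \<Longrightarrow> \<bar>g x\<bar> \<le> B" and "A \<ge> 0" "B \<ge> 0"
  shows "(A * M + B * L)-lipschitz_on X (\<lambda>x. f x * g x)"
proof (rule lipschitz_onI)
  fix x y assume xy: "x \<in> X" "y \<in> X"
  have "f x * g x - f y * g y = f x * (g x - g y) + g y * (f x - f y)"
    by (simp add: algebra_simps)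
  then have "\<bar>f x * g x - f y * g y\<bar> \<le> \<bar>f x\<bar> * \<bar>g x - g y\<bar> + \<bar>g y\<bar> * \<bar>f x - f y\<bar>"
    by (metis abs_mult abs_triangle_ineq)
  also have "\<dots> \<le> A * (M * dist x y) + B * (L * dist x y)"
    using lipschitz_onD[OF f xy] lipschitz_onD[OF g xy] bd xy assms(5,6)
    by (intro add_mono mult_mono) (auto simp: dist_real_def)
  finally show "dist (f x * g x) (f y * g y) \<le> (A * M + B * L) * dist x y"
    by (simp add: dist_real_def algebra_simps)
qed (use assms lipschitz_on_nonneg[OF f] lipschitz_on_nonneg[OF g] in auto)

text \<open>The usual integrating factor. C may have either sign, and
  \<open>flow_bilipschitz\<close> uses both.\<close>

lemma gronwall_ae:
  fixes Z :: "real \<Rightarrow> real"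
  assumes ab: "a \<le> b" and lip: "L-lipschitz_on {a..b} Z"
    and ae: "AE t in lborel. t \<in> {a..b} \<longrightarrow>
       (\<exists>z. (Z has_real_derivative z) (at t within {a..b}) \<and> z \<le> C * Z t)"
  shows "Z b \<le> exp (C * (b - a)) * Z a"
proof -
  define h where "h = (\<lambda>t. exp (- C * (t - a)) * Z t)"
  have "compact (Z ` {a..b})"
    by (intro compact_continuous_image lipschitz_on_continuous_on[OF lip]) auto
  then obtain B where B: "B \<ge> 0" "\<And>x. x \<in> {a..b} \<Longrightarrow> \<bar>Z x\<bar> \<le> B"
    using compact_imp_bounded bounded_pos by (metis imageI less_imp_le real_norm_def)
  define A where "A = exp (\<bar>C\<bar> * (b - a))"
  have A: "\<bar>exp (- C * (t - a))\<bar> \<le> A" if "t \<in> {a..b}" for t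
  proof -
    have "- C * (t - a) \<le> \<bar>C\<bar> * (b - a)"
      using that ab by (intro mult_mono) auto
    then show ?thesis by (simp add: A_def)
  qed
  have e: "(A * \<bar>C\<bar>)-lipschitz_on {a..b} (\<lambda>t. exp (- C * (t - a)))"
  proof (rule bounded_derivative_imp_lipschitz)
    fix t assume t: "t \<in> {a..b}"
    show "((\<lambda>t. exp (- C * (t - a))) has_derivative (\<lambda>h. h * (exp (- C * (t - a)) * (- C)))) (at t within {a..b})"
      by (auto intro!: derivative_eq_intros simp: algebra_simps)
    show "onorm (\<lambda>h. h * (exp (- C * (t - a)) * (- C))) \<le> A * \<bar>C\<bar>"
    proof (rule onorm_le)
      fix x
      have "\<bar>x\<bar> * (\<bar>exp (- C * (t - a))\<bar> * \<bar>C\<bar>) \<le> \<bar>x\<bar> * (A * \<bar>C\<bar>)"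
        using A[OF t] by (intro mult_left_mono mult_right_mono) auto
      then show "norm (x * (exp (- C * (t - a)) * (- C))) \<le> A * \<bar>C\<bar> * norm x"
        by (simp add: abs_mult algebra_simps)
    qed
  qed (auto simp: A_def)
  have "h b \<le> h a"
  proof (rule lipschitz_nonincreasing_if_ae_deriv_le[OF ab])
    show "(A * L + B * (A * \<bar>C\<bar>))-lipschitz_on {a..b} h"
      unfolding h_def using A B by (intro lipschitz_on_mult_bounded e lip) (auto simp: A_def)
    show "AE t in lborel. t \<in> {a..b} \<longrightarrow>
       (\<exists>h'\<le>0. (h has_real_derivative h') (at t within {a..b}))"
      using ae
    proof (rule eventually_mono, intro impI)
      fix t assume "t \<in> {a..b} \<longrightarrow> (\<exists>z. (Z has_real_derivative z) (at t within {a..b}) \<and> z \<le> C * Z t)"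
        and "t \<in> {a..b}"
      then obtain z where z: "(Z has_real_derivative z) (at t within {a..b})" "z \<le> C * Z t" by blast
      have "(h has_real_derivative (exp (- C * (t - a)) * (z - C * Z t))) (at t within {a..b})"
        unfolding h_def by (rule derivative_eq_intros z(1) refl)+ (simp add: algebra_simps)
      moreover have "exp (- C * (t - a)) * (z - C * Z t) \<le> 0"
        using z(2) by (intro mult_nonneg_nonpos) auto
      ultimately show "\<exists>h'\<le>0. (h has_real_derivative h') (at t within {a..b})" by blast
    qed
  qed
  then have "exp (- C * (b - a)) * Z b \<le> Z a" by (simp add: h_def)
  then have "exp (C * (b - a)) * (exp (- C * (b - a)) * Z b) \<le> exp (C * (b - a)) * Z a"
    by (intro mult_left_mono) auto
  then show ?thesis by (simp add: mult.assoc[symmetric] exp_add[symmetric])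
qed

text \<open>The difference quotients of f are bounded by L and converge almost everywhere to f', so
  dominated convergence applies. Their integrals are known exactly through an antiderivative
  \<open>P\<close> of f: they are difference quotients of \<open>P\<close> at b and at a, which
  converge to f b and f a.\<close>

lemma lipschitz_FTC:
  fixes f :: "real \<Rightarrow> real"
  assumes ab: "a \<le> b" and lip: "L-lipschitz_on {a..b} f"
    and meas: "f' \<in> borel_measurable borel"
    and ae: "AE t in lborel. t \<in> {a..b} \<longrightarrow> (f has_real_derivative f' t) (at t within {a..b})"
  shows "set_integrable lborel {a..b} f'" "(LINT t:{a..b}|lborel. f' t) = f b - f a"
proof -
  define F where "F = (\<lambda>t. f (max a (min b t)))"
  have lipF: "L-lipschitz_on UNIV F"
  proof (rule lipschitz_onI)
    fix x y :: real
    have "dist (F x) (F y) \<le> L * dist (max a (min b x)) (max a (min b y))"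
      unfolding F_def using ab by (intro lipschitz_onD[OF lip]) auto
    also have "\<dots> \<le> L * dist x y"
      using lipschitz_on_nonneg[OF lip] by (intro mult_left_mono) (auto simp: dist_real_def)
    finally show "dist (F x) (F y) \<le> L * dist x y" .
  qed (rule lipschitz_on_nonneg[OF lip])
  have cF: "continuous_on A F" for A
    by (rule continuous_on_subset[OF lipschitz_on_continuous_on[OF lipF]]) auto
  \<comment> \<open>The margin leaves room for shifts of size at most 1 and makes \<open>P\<close>
    differentiable on both sides at a and b.\<close>
  obtain P where P: "\<And>x. x \<in> {a-1..b+2} \<Longrightarrow> (P has_vector_derivative F x) (at x within {a-1..b+2})"
    using antiderivative_continuous[OF cF] by blast
  have P': "(P has_vector_derivative F x) (at x)" if "a - 1 < x" "x < b + 2" for x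
  proof -
    have "at x within {a-1..b+2} = at x"
      using that by (intro at_within_interior) auto
    then show ?thesis using P[of x] that by simp
  qed
  define h where "h = (\<lambda>n::nat. 1 / real (Suc n))"
  have h: "h n > 0" "h n \<le> 1" for n by (auto simp: h_def)
  have hlim: "filterlim h (at 0) sequentially"
    unfolding filterlim_at
  proof
    show "(h \<longlongrightarrow> 0) sequentially"
      unfolding h_def using LIMSEQ_inverse_real_of_nat by (simp add: inverse_eq_divide)
  qed (use h in \<open>auto simp: less_imp_neq[symmetric]\<close>)
  define q where "q = (\<lambda>n t. indicator {a..b} t *\<^sub>R ((F (t + h n) - F t) / h n))"
  have cq: "continuous_on A (\<lambda>t. (F (t + h n) - F t) / h n)" for n A
  proof -
    have "continuous_on A (\<lambda>t. F (t + h n))"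
      by (rule continuous_on_compose2[OF cF[of UNIV]]) (auto intro!: continuous_intros)
    then show ?thesis using cF[of A] h(1)[of n]
      by (intro continuous_on_divide continuous_on_diff continuous_on_const) auto
  qed
  have qint: "(LINT t|lborel. q n t) = (P (b + h n) - P b) / h n - (P (a + h n) - P a) / h n" for n
  proof -
    have "(LINT t|lborel. indicator {a..b} t *\<^sub>R ((F (t + h n) - F t) / h n))
       = (\<lambda>t. (P (t + h n) - P t) / h n) b - (\<lambda>t. (P (t + h n) - P t) / h n) a"
    proof (rule integral_FTC_atLeastAtMost[OF ab])
      fix x assume x: "a \<le> x" "x \<le> b"
      have 1: "(P has_real_derivative F (x + h n)) (at (x + h n))" "(P has_real_derivative F x) (at x)"
        using P'[of "x + h n"] P'[of x] x h[of n]
        by (auto simp: has_real_derivative_iff_has_vector_derivative)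
      have "((\<lambda>t. P (t + h n)) has_real_derivative F (x + h n)) (at x)"
        using 1(1) by (simp add: DERIV_shift)
      then have "((\<lambda>t. (P (t + h n) - P t) / h n) has_real_derivative ((F (x + h n) - F x) / h n)) (at x)"
        using 1(2) by (intro DERIV_cdivide DERIV_diff)
      then show "((\<lambda>t. (P (t + h n) - P t) / h n) has_vector_derivative ((F (x + h n) - F x) / h n)) (at x within {a..b})"
        unfolding has_real_derivative_iff_has_vector_derivative by (rule has_vector_derivative_at_within)
    qed (rule cq)
    then show ?thesis by (simp add: q_def diff_divide_distrib)
  qed
  have dP: "(\<lambda>n. (P (x + h n) - P x) / h n) \<longlonglongrightarrow> F x" if "a \<le> x" "x \<le> b" for x
  proof -
    have "(P has_real_derivative F x) (at x)"
      using P'[of x] that by (simp add: has_real_derivative_iff_has_vector_derivative)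
    then have "((\<lambda>h. (P (x + h) - P x) / h) \<longlongrightarrow> F x) (at 0)"
      by (simp add: DERIV_def)
    from filterlim_compose[OF this hlim] show ?thesis .
  qed
  have lim1: "(\<lambda>n. LINT t|lborel. q n t) \<longlonglongrightarrow> F b - F a"
    unfolding qint using ab by (intro tendsto_diff dP) auto
  have measq: "q n \<in> borel_measurable lborel" for n
    unfolding q_def using borel_measurable_continuous_onI[OF cq[of UNIV n]] by measurable
  have measf: "(\<lambda>t. indicator {a..b} t *\<^sub>R f' t) \<in> borel_measurable lborel"
    using meas by measurable
  have intw: "integrable lborel (\<lambda>t. indicator {a..b} t *\<^sub>R L)"
    using integrable_real_indicator[of "{a..b}" lborel] by (simp add: emeasure_lborel_Icc_eq)
  have conv: "AE t in lborel. (\<lambda>n. q n t) \<longlonglongrightarrow> indicator {a..b} t *\<^sub>R f' t"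
  proof -
    have "AE t in lborel. t \<noteq> a \<and> t \<noteq> b"
      using AE_lborel_singleton[of a] AE_lborel_singleton[of b] by (rule eventually_conj)
    from eventually_conj[OF ae this] show ?thesis
    proof (rule eventually_mono)
      fix t assume t: "(t \<in> {a..b} \<longrightarrow> (f has_real_derivative f' t) (at t within {a..b})) \<and> t \<noteq> a \<and> t \<noteq> b"
      show "(\<lambda>n. q n t) \<longlonglongrightarrow> indicator {a..b} t *\<^sub>R f' t"
      proof (cases "t \<in> {a..b}")
        case True
        have "at t within {a..b} = at t"
          using True t by (intro at_within_interior) auto
        then have "(f has_real_derivative f' t) (at t)" using t True by simp
        then have "(F has_real_derivative f' t) (at t)"
          by (rule has_field_derivative_transform_within_open[of _ _ _ "{a<..<b}"])
            (use True t in \<open>auto simp: F_def\<close>)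
        then have "((\<lambda>h. (F (t + h) - F t) / h) \<longlongrightarrow> f' t) (at 0)"
          by (simp add: DERIV_def)
        from filterlim_compose[OF this hlim] show ?thesis
          using True by (simp add: q_def)
      qed (simp add: q_def)
    qed
  qed
  have bound: "AE t in lborel. norm (q n t) \<le> indicator {a..b} t *\<^sub>R L" for n
  proof (rule AE_I2)
    fix t
    have "\<bar>F (t + h n) - F t\<bar> \<le> L * h n"
      using lipschitz_onD[OF lipF, of "t + h n" t] h(1)[of n] by (simp add: dist_real_def)
    then show "norm (q n t) \<le> indicator {a..b} t *\<^sub>R L"
      using h(1)[of n] by (auto simp: q_def indicator_def divide_simps)
  qed
  note dc = integrable_dominated_convergence[OF measf measq intw conv bound]
    integral_dominated_convergence[OF measf measq intw conv bound]
  show "set_integrable lborel {a..b} f'"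
    using dc(1) by (simp add: set_integrable_def)
  have "(LINT t|lborel. indicator {a..b} t *\<^sub>R f' t) = F b - F a"
    by (rule LIMSEQ_unique[OF dc(2) lim1])
  then show "(LINT t:{a..b}|lborel. f' t) = f b - f a"
    using ab by (simp add: set_lebesgue_integral_def F_def)
qed

subsection \<open>The triangle inequality for the Wasserstein distance\<close>

definition transport_cost :: "('x::euclidean_space \<times> 'x) measure \<Rightarrow> ennreal" where
  "transport_cost \<pi> = (\<integral>\<^sup>+z. ennreal ((norm (fst z - snd z))\<^sup>2) \<partial>\<pi>)"

lemma wasserstein2_alt: "wasserstein2 \<mu> \<nu> = sqrt (enn2real (INF \<pi>\<in>couplings \<mu> \<nu>. transport_cost \<pi>))"
  by (simp add: wasserstein2_def transport_cost_def)

lemma wasserstein2_nonneg: "0 \<le> wasserstein2 \<mu> \<nu>"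
  by (simp add: wasserstein2_alt)

lemma sets_borel_pair:
  "sets (borel \<Otimes>\<^sub>M borel) = sets (borel :: ('a::euclidean_space \<times> 'b::euclidean_space) measure)"
  by (rule arg_cong[OF borel_prod])

lemma couplings_swap:
  fixes \<mu> \<nu> :: "'x::euclidean_space measure"
  assumes "\<pi> \<in> couplings \<mu> \<nu>"
  shows "distr \<pi> borel prod.swap \<in> couplings \<nu> \<mu>"
    and "transport_cost (distr \<pi> borel prod.swap) = transport_cost \<pi>"
proof -
  have s: "sets \<pi> = sets borel" and m: "distr \<pi> borel fst = \<mu>" "distr \<pi> borel snd = \<nu>"
    using assms by (auto simp: couplings_def)
  have [measurable_cong]: "sets \<pi> = sets (borel \<Otimes>\<^sub>M borel)" by (simp only: s sets_borel_pair)
  have [measurable]: "prod.swap \<in> \<pi> \<rightarrow>\<^sub>M (borel :: ('x \<times> 'x) measure)"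
    unfolding borel_prod[symmetric] prod.swap_def by measurable
  have [measurable]: "fst \<in> (borel :: ('x \<times> 'x) measure) \<rightarrow>\<^sub>M borel" "snd \<in> (borel :: ('x \<times> 'x) measure) \<rightarrow>\<^sub>M borel"
    unfolding borel_prod[symmetric] by measurable
  have "distr (distr \<pi> borel prod.swap) borel fst = \<nu>" "distr (distr \<pi> borel prod.swap) borel snd = \<mu>"
    using m by (auto simp: distr_distr comp_def)
  then show "distr \<pi> borel prod.swap \<in> couplings \<nu> \<mu>" by (simp add: couplings_def)
  show "transport_cost (distr \<pi> borel prod.swap) = transport_cost \<pi>"
    unfolding transport_cost_def
    by (subst nn_integral_distr) (simp_all add: norm_minus_commute)
qed

lemma wasserstein2_commute: "wasserstein2 \<mu> \<nu> = wasserstein2 \<nu> \<mu>"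
proof -
  have "(INF \<pi>\<in>couplings \<nu> \<mu>. transport_cost \<pi>) \<le> (INF \<pi>\<in>couplings \<mu> \<nu>. transport_cost \<pi>)" for \<mu> \<nu> :: "'a measure"
    by (rule INF_greatest) (metis couplings_swap INF_lower)
  then show ?thesis unfolding wasserstein2_alt by (metis antisym)
qed

lemma wasserstein2_le:
  assumes "\<pi> \<in> couplings \<mu> \<nu>" "transport_cost \<pi> \<le> ennreal (c\<^sup>2)" "c \<ge> 0"
  shows "wasserstein2 \<mu> \<nu> \<le> c"
proof -
  have "enn2real (INF \<pi>\<in>couplings \<mu> \<nu>. transport_cost \<pi>) \<le> c\<^sup>2"
    using assms by (intro enn2real_leI INF_lower2[OF assms(1)]) auto
  then show ?thesis
    unfolding wasserstein2_alt using assms(3) by (metis real_le_lsqrt)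
qed

lemma couplings_measure:
  assumes "\<pi> \<in> couplings \<mu> \<nu>" "A \<in> sets borel"
  shows "emeasure \<pi> (fst -` A) = emeasure \<mu> A" "emeasure \<pi> (snd -` A) = emeasure \<nu> A"
proof -
  have s: "sets \<pi> = sets borel" and m: "distr \<pi> borel fst = \<mu>" "distr \<pi> borel snd = \<nu>"
    using assms by (auto simp: couplings_def)
  have [measurable_cong]: "sets \<pi> = sets (borel \<Otimes>\<^sub>M borel)" by (simp only: s sets_borel_pair)
  have sp: "space \<pi> = UNIV" using sets_eq_imp_space_eq[OF s] by simp
  show "emeasure \<pi> (fst -` A) = emeasure \<mu> A" unfolding m(1)[symmetric]
    using assms(2) sp by (subst emeasure_distr) auto
  show "emeasure \<pi> (snd -` A) = emeasure \<nu> A" unfolding m(2)[symmetric]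
    using assms(2) sp by (subst emeasure_distr) auto
qed

lemma prob_measures_onD:
  assumes "\<mu> \<in> prob_measures_on \<Omega>"
  shows "prob_space \<mu>" "sets \<mu> = sets borel" "space \<mu> = UNIV" "emeasure \<mu> \<Omega> = 1"
  using assms sets_eq_imp_space_eq[of \<mu> borel] by (auto simp: prob_measures_on_def)

lemma couplings_nonempty:
  fixes \<mu> \<nu> :: "'x::euclidean_space measure"
  assumes "\<mu> \<in> prob_measures_on \<Omega>" "\<nu> \<in> prob_measures_on \<Omega>"
  shows "\<mu> \<Otimes>\<^sub>M \<nu> \<in> couplings \<mu> \<nu>"
proof -
  note M = prob_measures_onD[OF assms(1)] and N = prob_measures_onD[OF assms(2)]
  interpret M: prob_space \<mu> by (rule M(1))
  interpret N: prob_space \<nu> by (rule N(1))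
  interpret P: pair_prob_space \<mu> \<nu> ..
  have s: "sets (\<mu> \<Otimes>\<^sub>M \<nu>) = sets borel"
    using sets_pair_measure_cong[OF M(2) N(2)] by (simp only: sets_borel_pair)
  have [measurable_cong]: "sets \<mu> = sets borel" "sets \<nu> = sets borel" by fact+
  have "distr (\<mu> \<Otimes>\<^sub>M \<nu>) borel fst = \<mu>"
  proof (rule measure_eqI)
    fix A assume "A \<in> sets (distr (\<mu> \<Otimes>\<^sub>M \<nu>) borel fst)"
    then have A: "A \<in> sets borel" by simp
    have "fst -` A \<inter> space (\<mu> \<Otimes>\<^sub>M \<nu>) = A \<times> UNIV" using M(3) N(3) by (auto simp: space_pair_measure)
    then show "emeasure (distr (\<mu> \<Otimes>\<^sub>M \<nu>) borel fst) A = emeasure \<mu> A"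
      using A M(2) N(2,3) N.emeasure_space_1 N.emeasure_pair_measure_Times[of A \<mu> UNIV]
      by (subst emeasure_distr) auto
  qed (simp add: M)
  moreover have "distr (\<mu> \<Otimes>\<^sub>M \<nu>) borel snd = \<nu>"
  proof (rule measure_eqI)
    fix A assume "A \<in> sets (distr (\<mu> \<Otimes>\<^sub>M \<nu>) borel snd)"
    then have A: "A \<in> sets borel" by simp
    have "snd -` A \<inter> space (\<mu> \<Otimes>\<^sub>M \<nu>) = UNIV \<times> A" using M(3) N(3) by (auto simp: space_pair_measure)
    then show "emeasure (distr (\<mu> \<Otimes>\<^sub>M \<nu>) borel snd) A = emeasure \<nu> A"
      using A M(2,3) N(2) M.emeasure_space_1 N.emeasure_pair_measure_Times[of UNIV \<mu> A]
      by (subst emeasure_distr) auto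
  qed (simp add: N)
  ultimately show ?thesis using s by (simp add: couplings_def)
qed

lemma prob_measures_on_AE:
  assumes "\<mu> \<in> prob_measures_on \<Omega>" "\<Omega> \<in> sets borel"
  shows "AE x in \<mu>. x \<in> \<Omega>"
proof -
  note M = prob_measures_onD[OF assms(1)]
  have "{x \<in> space \<mu>. x \<in> \<Omega>} = \<Omega>" using M(3) by auto
  then show ?thesis
    using prob_space.AE_iff_emeasure_eq_1[OF M(1), of "\<lambda>x. x \<in> \<Omega>"] M(2,4) assms(2)
    by (simp add: pred_def)
qed

lemma transport_cost_finite:
  fixes \<mu> \<nu> :: "'x::euclidean_space measure"
  assumes "\<mu> \<in> prob_measures_on \<Omega>" "\<nu> \<in> prob_measures_on \<Omega>" "compact \<Omega>" "\<pi> \<in> couplings \<mu> \<nu>"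
  shows "transport_cost \<pi> < \<infinity>"
proof -
  note M = prob_measures_onD[OF assms(1)]
  have s: "sets \<pi> = sets borel" and d: "distr \<pi> borel fst = \<mu>" "distr \<pi> borel snd = \<nu>"
    using assms(4) by (auto simp: couplings_def)
  have [measurable_cong]: "sets \<pi> = sets (borel \<Otimes>\<^sub>M borel)" by (simp only: s sets_borel_pair)
  have sp: "space \<pi> = UNIV" using sets_eq_imp_space_eq[OF s] by simp
  have \<Omega>: "\<Omega> \<in> sets borel" using assms(3) by (simp add: borel_compact)
  have p1: "emeasure \<pi> UNIV = 1"
    using couplings_measure(1)[OF assms(4), of UNIV] M(3) prob_space.emeasure_space_1[OF M(1)] by simp
  have "AE z in \<pi>. fst z \<in> \<Omega>"
    using prob_measures_on_AE[OF assms(1) \<Omega>] unfolding d(1)[symmetric] by (rule AE_distrD[rotated]) measurable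
  moreover have "AE z in \<pi>. snd z \<in> \<Omega>"
    using prob_measures_on_AE[OF assms(2) \<Omega>] unfolding d(2)[symmetric] by (rule AE_distrD[rotated]) measurable
  ultimately have ae: "AE z in \<pi>. fst z \<in> \<Omega> \<and> snd z \<in> \<Omega>" by eventually_elim auto
  obtain d where d: "\<And>x y. x \<in> \<Omega> \<Longrightarrow> y \<in> \<Omega> \<Longrightarrow> dist x y \<le> d"
    using compact_imp_bounded[OF assms(3)] bounded_two_points[of \<Omega>] by blast
  have "AE z in \<pi>. ennreal ((norm (fst z - snd z))\<^sup>2) \<le> ennreal (d\<^sup>2)"
    using ae by eventually_elim (use d in \<open>auto intro!: ennreal_leI power_mono simp: dist_norm\<close>)
  then have "transport_cost \<pi> \<le> (\<integral>\<^sup>+z. ennreal (d\<^sup>2) \<partial>\<pi>)"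
    unfolding transport_cost_def by (rule nn_integral_mono_AE)
  also have "\<dots> < \<infinity>" using p1 sp by (simp add: ennreal_mult_less_top)
  finally show ?thesis .
qed

text \<open>The infimum of the costs has to be finite first, because \<open>enn2real\<close> turns
  an infinite infimum into 0. The product coupling and the boundedness of \<Omega> provide
  this.\<close>

lemma coupling_cost_less:
  fixes \<mu> \<nu> :: "'x::euclidean_space measure"
  assumes "\<mu> \<in> prob_measures_on \<Omega>" "\<nu> \<in> prob_measures_on \<Omega>" "compact \<Omega>" "wasserstein2 \<mu> \<nu> < a"
  obtains \<pi> where "\<pi> \<in> couplings \<mu> \<nu>" "transport_cost \<pi> < ennreal (a\<^sup>2)"
proof -
  let ?I = "INF \<pi>\<in>couplings \<mu> \<nu>. transport_cost \<pi>"
  have "?I \<le> transport_cost (\<mu> \<Otimes>\<^sub>M \<nu>)"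
    using couplings_nonempty[OF assms(1,2)] by (rule INF_lower)
  also have "\<dots> < \<infinity>"
    using assms couplings_nonempty[OF assms(1,2)] by (intro transport_cost_finite)
  finally have fin: "?I < top" by simp
  have "sqrt (enn2real ?I) < a" using assms(4) by (simp add: wasserstein2_alt)
  then have "(sqrt (enn2real ?I))\<^sup>2 < a\<^sup>2"
    by (intro power_strict_mono) auto
  then have "enn2real ?I < a\<^sup>2" by simp
  then have "ennreal (enn2real ?I) < ennreal (a\<^sup>2)"
    by (simp add: ennreal_less_iff)
  then have "?I < ennreal (a\<^sup>2)" using fin by simp
  then show ?thesis using that by (auto simp: INF_less_iff)
qed

text \<open>A point goes to the cell of the first member of a dense sequence at distance less than
  \<delta>/2; the cell index is then measurable.\<close>

lemma measurable_partition_exists: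
  fixes \<delta> :: real
  assumes "\<delta> > 0"
  obtains k :: "'x::euclidean_space \<Rightarrow> nat" where
    "k \<in> borel \<rightarrow>\<^sub>M count_space UNIV" "\<And>x y. k x = k y \<Longrightarrow> norm (x - y) \<le> \<delta>"
proof -
  obtain D :: "'x set" where D: "countable D" "\<And>X. open X \<Longrightarrow> X \<noteq> {} \<Longrightarrow> \<exists>d\<in>D. d \<in> X"
    using countable_dense_exists by blast
  have "D \<noteq> {}" using D(2)[of UNIV] by auto
  define k where "k = (\<lambda>y. LEAST n. dist y (from_nat_into D n) < \<delta>/2)"
  have ex: "\<exists>n. dist y (from_nat_into D n) < \<delta>/2" for y
  proof -
    obtain d where "d \<in> D" "d \<in> ball y (\<delta>/2)" using D(2)[of "ball y (\<delta>/2)"] assms by auto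
    then show ?thesis using from_nat_into_surj[OF D(1)] by (metis mem_ball)
  qed
  have near: "dist y (from_nat_into D (k y)) < \<delta>/2" for y
    unfolding k_def by (rule LeastI_ex[OF ex])
  show thesis
  proof (rule that[of k])
    show "k \<in> borel \<rightarrow>\<^sub>M count_space UNIV"
      unfolding k_def by measurable
    fix x y assume "k x = k y"
    then have "dist x y < \<delta>"
      using near[of x] near[of y] dist_triangle_half_l[of x "from_nat_into D (k x)" \<delta> y]
      by (simp add: dist_commute)
    then show "norm (x - y) \<le> \<delta>" by (simp add: dist_norm)
  qed
qed

text \<open>Without disintegration, the two couplings are glued along a countable partition into small
  cells: conditionally on the cell of the middle variable they are made independent. The two copies
  \<open>y\<close>, \<open>y'\<close> of the middle variable then differ by at most the cell size.\<close>

lemma couplings_glue: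
  fixes \<mu> \<nu> \<xi> :: "'x::euclidean_space measure"
  assumes pi: "\<pi> \<in> couplings \<mu> \<nu>" and sg: "\<sigma> \<in> couplings \<nu> \<xi>" and nu: "prob_space \<nu>" "sets \<nu> = sets borel"
    and abc: "a > 0" "b > 0" "c > 0"
    and cost: "transport_cost \<pi> \<le> ennreal (a\<^sup>2)" "transport_cost \<sigma> \<le> ennreal (b\<^sup>2)"
  obtains \<tau> where "\<tau> \<in> couplings \<mu> \<xi>" "transport_cost \<tau> \<le> ennreal ((a + b + c)\<^sup>2)"
proof -
  have sp: "sets \<pi> = sets borel" and mp: "distr \<pi> borel fst = \<mu>" "distr \<pi> borel snd = \<nu>"
    using pi by (auto simp: couplings_def)
  have ss: "sets \<sigma> = sets borel" and ms: "distr \<sigma> borel fst = \<nu>" "distr \<sigma> borel snd = \<xi>"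
    using sg by (auto simp: couplings_def)
  have [measurable_cong]: "sets \<pi> = sets (borel \<Otimes>\<^sub>M borel)" "sets \<sigma> = sets (borel \<Otimes>\<^sub>M borel)"
    "sets \<nu> = sets borel" by (simp_all only: sp ss nu sets_borel_pair)
  have space: "space \<pi> = UNIV" "space \<sigma> = UNIV" "space \<nu> = UNIV"
    using sets_eq_imp_space_eq[OF sp] sets_eq_imp_space_eq[OF ss] sets_eq_imp_space_eq[OF nu(2)] by auto
  have tot: "emeasure \<nu> UNIV = 1"
    using prob_space.emeasure_space_1[OF nu(1)] space by simp
  have "emeasure \<pi> (space \<pi>) = 1" "emeasure \<sigma> (space \<sigma>) = 1"
    using couplings_measure(2)[OF pi, of UNIV] couplings_measure(1)[OF sg, of UNIV] tot space by auto
  then interpret P: prob_space \<pi> + S: prob_space \<sigma>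
    by (auto intro: prob_spaceI)
  interpret PS: pair_prob_space \<pi> \<sigma> ..
  obtain k :: "'x \<Rightarrow> nat" where k[measurable]: "k \<in> borel \<rightarrow>\<^sub>M count_space UNIV"
    and kc: "\<And>x y. k x = k y \<Longrightarrow> norm (x - y) \<le> c"
    using measurable_partition_exists[OF abc(3)] by blast
  define m where "m = (\<lambda>n. emeasure \<nu> (k -` {n}))"
  have kset: "k -` {n} \<in> sets borel" for n
    using measurable_sets[OF k, of "{n}"] by simp
  note kset[measurable]
  have m1: "m n \<le> 1" for n
    unfolding m_def using emeasure_mono[of "k -` {n}" UNIV \<nu>] tot nu by simp
  \<comment> \<open>Density of the glued law: both copies of the middle variable lie in the same
    cell, and given the cell the two couplings are independent. The inverse mass normalises each
    cell.\<close>
  define h where "h = (\<lambda>p::('x \<times> 'x) \<times> ('x \<times> 'x).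
     if k (snd (fst p)) = k (fst (snd p)) then inverse (m (k (snd (fst p)))) else 0)"
  have h[measurable]: "h \<in> borel_measurable (\<pi> \<Otimes>\<^sub>M \<sigma>)"
  proof -
    have k1[measurable]: "(\<lambda>p. k (snd (fst p))) \<in> \<pi> \<Otimes>\<^sub>M \<sigma> \<rightarrow>\<^sub>M count_space UNIV" by measurable
    have k2[measurable]: "(\<lambda>p. k (fst (snd p))) \<in> \<pi> \<Otimes>\<^sub>M \<sigma> \<rightarrow>\<^sub>M count_space UNIV" by measurable
    have inv: "(\<lambda>p. inverse (m (k (snd (fst p))))) \<in> borel_measurable (\<pi> \<Otimes>\<^sub>M \<sigma>)"
      by (rule measurable_compose[OF k1, of "\<lambda>n. inverse (m n)"]) simp
    have E: "(\<lambda>p. \<exists>n. k (snd (fst p)) = n \<and> k (fst (snd p)) = n) = (\<lambda>p. k (snd (fst p)) = k (fst (snd p)))"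
      by (auto simp: fun_eq_iff)
    have "Measurable.pred (\<pi> \<Otimes>\<^sub>M \<sigma>) (\<lambda>p. \<exists>n. k (snd (fst p)) = n \<and> k (fst (snd p)) = n)"
      by measurable
    then have "Measurable.pred (\<pi> \<Otimes>\<^sub>M \<sigma>) (\<lambda>p. k (snd (fst p)) = k (fst (snd p)))"
      unfolding E .
    with inv show ?thesis unfolding h_def pred_def
      by (intro measurable_If borel_measurable_const)
  qed
  define T where "T = density (\<pi> \<Otimes>\<^sub>M \<sigma>) h"
  have [measurable_cong]: "sets T = sets (\<pi> \<Otimes>\<^sub>M \<sigma>)" by (simp add: T_def)
  \<comment> \<open>\<open>inverse 0\<close> is infinite in \<open>ennreal\<close>, so cells of mass
    zero have to be discarded before the mass can be cancelled.\<close>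
  have pos: "AE y in \<nu>. m (k y) \<noteq> 0"
  proof -
    have "(\<Union>n\<in>{n. m n = 0}. k -` {n}) \<in> null_sets \<nu>"
      using kset nu by (intro null_sets_UN') (auto simp: m_def null_sets_def)
    then have "AE y in \<nu>. y \<notin> (\<Union>n\<in>{n. m n = 0}. k -` {n})" by (rule AE_not_in)
    then show ?thesis by eventually_elim auto
  qed
  have pospi: "AE p in \<pi>. m (k (snd p)) \<noteq> 0"
    using pos unfolding mp(2)[symmetric] by (subst (asm) AE_distr_iff) auto
  have possg: "AE p in \<sigma>. m (k (fst p)) \<noteq> 0"
    using pos unfolding ms(1)[symmetric] by (subst (asm) AE_distr_iff) auto
  have int1: "(\<integral>\<^sup>+p. f (fst p) \<partial>T) = (\<integral>\<^sup>+p. f p \<partial>\<pi>)" if f[measurable]: "f \<in> borel_measurable \<pi>" for f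
  proof -
    have "(\<integral>\<^sup>+p. f (fst p) \<partial>T) = (\<integral>\<^sup>+p. h p * f (fst p) \<partial>(\<pi> \<Otimes>\<^sub>M \<sigma>))"
      unfolding T_def by (rule nn_integral_density) auto
    also have "\<dots> = (\<integral>\<^sup>+p. (\<integral>\<^sup>+q. h (p, q) * f p \<partial>\<sigma>) \<partial>\<pi>)"
      by (subst S.nn_integral_fst[symmetric]) auto
    also have "\<dots> = (\<integral>\<^sup>+p. f p \<partial>\<pi>)"
    proof (rule nn_integral_cong_AE, use pospi in eventually_elim)
      fix p :: "'x \<times> 'x" assume p: "m (k (snd p)) \<noteq> 0"
      have "(\<integral>\<^sup>+q. h (p, q) * f p \<partial>\<sigma>) = (\<integral>\<^sup>+q. (inverse (m (k (snd p))) * f p) * indicator (fst -` (k -` {k (snd p)})) q \<partial>\<sigma>)"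
        by (intro nn_integral_cong) (auto simp: h_def indicator_def)
      also have "\<dots> = (inverse (m (k (snd p))) * f p) * emeasure \<sigma> (fst -` (k -` {k (snd p)}))"
      proof (rule nn_integral_cmult_indicator)
        have "fst -` (k -` {k (snd p)}) \<inter> space \<sigma> \<in> sets \<sigma>" by measurable
        then show "fst -` (k -` {k (snd p)}) \<in> sets \<sigma>" using space by simp
      qed
      also have "emeasure \<sigma> (fst -` (k -` {k (snd p)})) = m (k (snd p))"
        using couplings_measure(1)[OF sg kset] by (simp add: m_def)
      also have "inverse (m (k (snd p))) * f p * m (k (snd p)) = (m (k (snd p)) * inverse (m (k (snd p)))) * f p"
        by (simp add: ac_simps)
      also have "m (k (snd p)) * inverse (m (k (snd p))) = 1"
        using p ennreal_divide_self[of "m (k (snd p))"] le_less_trans[OF m1[of "k (snd p)"], of top]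
        by (simp add: divide_ennreal_def)
      finally show "(\<integral>\<^sup>+q. h (p, q) * f p \<partial>\<sigma>) = f p" by simp
    qed
    finally show ?thesis .
  qed
  have int2: "(\<integral>\<^sup>+p. f (snd p) \<partial>T) = (\<integral>\<^sup>+p. f p \<partial>\<sigma>)" if f[measurable]: "f \<in> borel_measurable \<sigma>" for f
  proof -
    have "(\<integral>\<^sup>+p. f (snd p) \<partial>T) = (\<integral>\<^sup>+p. h p * f (snd p) \<partial>(\<pi> \<Otimes>\<^sub>M \<sigma>))"
      unfolding T_def by (rule nn_integral_density) auto
    also have "\<dots> = (\<integral>\<^sup>+q. (\<integral>\<^sup>+p. h (p, q) * f q \<partial>\<pi>) \<partial>\<sigma>)"
      by (subst PS.nn_integral_snd[symmetric]) auto
    also have "\<dots> = (\<integral>\<^sup>+q. f q \<partial>\<sigma>)"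
    proof (rule nn_integral_cong_AE, use possg in eventually_elim)
      fix q :: "'x \<times> 'x" assume q: "m (k (fst q)) \<noteq> 0"
      have "(\<integral>\<^sup>+p. h (p, q) * f q \<partial>\<pi>) = (\<integral>\<^sup>+p. (inverse (m (k (fst q))) * f q) * indicator (snd -` (k -` {k (fst q)})) p \<partial>\<pi>)"
        by (intro nn_integral_cong) (auto simp: h_def indicator_def)
      also have "\<dots> = (inverse (m (k (fst q))) * f q) * emeasure \<pi> (snd -` (k -` {k (fst q)}))"
      proof (rule nn_integral_cmult_indicator)
        have "snd -` (k -` {k (fst q)}) \<inter> space \<pi> \<in> sets \<pi>" by measurable
        then show "snd -` (k -` {k (fst q)}) \<in> sets \<pi>" using space by simp
      qed
      also have "emeasure \<pi> (snd -` (k -` {k (fst q)})) = m (k (fst q))"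
        using couplings_measure(2)[OF pi kset] by (simp add: m_def)
      also have "inverse (m (k (fst q))) * f q * m (k (fst q)) = (m (k (fst q)) * inverse (m (k (fst q)))) * f q"
        by (simp add: ac_simps)
      also have "m (k (fst q)) * inverse (m (k (fst q))) = 1"
        using q ennreal_divide_self[of "m (k (fst q))"] le_less_trans[OF m1[of "k (fst q)"], of top]
        by (simp add: divide_ennreal_def)
      finally show "(\<integral>\<^sup>+p. h (p, q) * f q \<partial>\<pi>) = f q" by simp
    qed
    finally show ?thesis .
  qed
  define \<tau> where "\<tau> = distr T borel (\<lambda>p. (fst (fst p), snd (snd p)))"
  have tm[measurable]: "(\<lambda>p. (fst (fst p), snd (snd p))) \<in> T \<rightarrow>\<^sub>M borel"
    unfolding borel_prod[symmetric] by measurable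
  have [measurable]: "fst \<in> (borel :: ('x \<times> 'x) measure) \<rightarrow>\<^sub>M borel" "snd \<in> (borel :: ('x \<times> 'x) measure) \<rightarrow>\<^sub>M borel"
    unfolding borel_prod[symmetric] by measurable
  have "distr \<tau> borel fst = distr T borel (\<lambda>p. fst (fst p))"
    unfolding \<tau>_def by (subst distr_distr) (auto simp: comp_def)
  also have "\<dots> = \<mu>"
  proof (rule measure_eqI)
    fix A assume "A \<in> sets (distr T borel (\<lambda>p. fst (fst p)))"
    then have A[measurable]: "A \<in> sets borel" by simp
    have "emeasure (distr T borel (\<lambda>p. fst (fst p))) A = (\<integral>\<^sup>+p. indicator A (fst (fst p)) \<partial>T)"
      by (subst nn_integral_indicator[symmetric], simp, subst nn_integral_distr) auto
    also have "\<dots> = (\<integral>\<^sup>+p. indicator A (fst p) \<partial>\<pi>)"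
      by (rule int1[of "\<lambda>p. indicator A (fst p)"]) measurable
    also have "\<dots> = emeasure \<mu> A"
      unfolding mp(1)[symmetric]
      by (subst nn_integral_indicator[symmetric], simp, subst nn_integral_distr) auto
    finally show "emeasure (distr T borel (\<lambda>p. fst (fst p))) A = emeasure \<mu> A" .
  qed (simp flip: mp(1))
  finally have t1: "distr \<tau> borel fst = \<mu>" .
  have "distr \<tau> borel snd = distr T borel (\<lambda>p. snd (snd p))"
    unfolding \<tau>_def by (subst distr_distr) (auto simp: comp_def)
  also have "\<dots> = \<xi>"
  proof (rule measure_eqI)
    fix A assume "A \<in> sets (distr T borel (\<lambda>p. snd (snd p)))"
    then have A[measurable]: "A \<in> sets borel" by simp
    have "emeasure (distr T borel (\<lambda>p. snd (snd p))) A = (\<integral>\<^sup>+p. indicator A (snd (snd p)) \<partial>T)"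
      by (subst nn_integral_indicator[symmetric], simp, subst nn_integral_distr) auto
    also have "\<dots> = (\<integral>\<^sup>+p. indicator A (snd p) \<partial>\<sigma>)"
      by (rule int2[of "\<lambda>p. indicator A (snd p)"]) measurable
    also have "\<dots> = emeasure \<xi> A"
      unfolding ms(2)[symmetric]
      by (subst nn_integral_indicator[symmetric], simp, subst nn_integral_distr) auto
    finally show "emeasure (distr T borel (\<lambda>p. snd (snd p))) A = emeasure \<xi> A" .
  qed (simp flip: ms(2))
  finally have t2: "distr \<tau> borel snd = \<xi>" .
  have tau: "\<tau> \<in> couplings \<mu> \<xi>"
    using t1 t2 by (simp add: couplings_def \<tau>_def)
  define s where "s = a + b + c"
  have s: "s > 0" using abc by (simp add: s_def)
  have T1: "(\<integral>\<^sup>+p. 1 \<partial>T) = 1"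
    using int1[of "\<lambda>_. 1"] P.emeasure_space_1 by simp
  \<comment> \<open>Convexity of the square with weights a/s, c/s and b/s. Since it is linear in the
    two squared distances it can be integrated, and costs at most a^2 and b^2 give exactly s^2, so
    no Minkowski inequality is required.\<close>
  have weighted: "(norm (x - z))\<^sup>2 \<le> s / a * (norm (x - y))\<^sup>2 + (s / b * (norm (y' - z))\<^sup>2 + s * c)"
    if "norm (y - y') \<le> c" for x y y' z :: 'x
  proof -
    define u v where "u = norm (x - y)" and "v = norm (y' - z)"
    have "norm (x - z) \<le> u + c + v"
      using that norm_triangle_ineq[of "x - y" "y - z"] norm_triangle_ineq[of "y - y'" "y' - z"]
      by (simp add: u_def v_def)
    then have "(norm (x - z))\<^sup>2 \<le> (u + c + v)\<^sup>2" by (intro power_mono) auto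
    also have "\<dots> \<le> s / a * u\<^sup>2 + (s / b * v\<^sup>2 + s * c)"
    proof -
      have "s / a * u\<^sup>2 + (s / b * v\<^sup>2 + s * c) - (u + c + v)\<^sup>2
         = (b * u - a * v)\<^sup>2 / (a * b) + c * (u - a)\<^sup>2 / a + c * (v - b)\<^sup>2 / b"
        using abc by (simp add: s_def field_simps power2_eq_square)
      also have "\<dots> \<ge> 0" using abc by (intro add_nonneg_nonneg) auto
      finally show ?thesis by simp
    qed
    finally show ?thesis by (simp add: u_def v_def)
  qed
  have "transport_cost \<tau> = (\<integral>\<^sup>+p. ennreal ((norm (fst (fst p) - snd (snd p)))\<^sup>2) \<partial>T)"
    unfolding transport_cost_def \<tau>_def by (subst nn_integral_distr) auto
  also have "\<dots> \<le> (\<integral>\<^sup>+p. (ennreal (s / a) * ennreal ((norm (fst (fst p) - snd (fst p)))\<^sup>2) +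
      (ennreal (s / b) * ennreal ((norm (fst (snd p) - snd (snd p)))\<^sup>2) + ennreal (s * c) * 1)) \<partial>T)"
  proof (rule nn_integral_mono_AE)
    have "AE p in T. h p \<noteq> 0"
      unfolding T_def by (subst AE_density) auto
    then show "AE p in T. ennreal ((norm (fst (fst p) - snd (snd p)))\<^sup>2) \<le>
      ennreal (s / a) * ennreal ((norm (fst (fst p) - snd (fst p)))\<^sup>2) +
      (ennreal (s / b) * ennreal ((norm (fst (snd p) - snd (snd p)))\<^sup>2) + ennreal (s * c) * 1)"
    proof eventually_elim
      case (elim p)
      then have "k (snd (fst p)) = k (fst (snd p))" by (auto simp: h_def split: if_splits)
      from weighted[OF kc[OF this], of "fst (fst p)" "snd (snd p)"]
      show ?case
        using s abc by (simp add: ennreal_mult[symmetric] ennreal_plus[symmetric] ennreal_leI del: ennreal_plus)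
    qed
  qed
  also have "\<dots> = ennreal (s / a) * transport_cost \<pi> + (ennreal (s / b) * transport_cost \<sigma> + ennreal (s * c) * 1)"
    using int1[of "\<lambda>p. ennreal ((norm (fst p - snd p))\<^sup>2)"] int2[of "\<lambda>p. ennreal ((norm (fst p - snd p))\<^sup>2)"] T1
    unfolding transport_cost_def
    by (simp add: nn_integral_add nn_integral_cmult)
  also have "\<dots> \<le> ennreal (s / a) * ennreal (a\<^sup>2) + (ennreal (s / b) * ennreal (b\<^sup>2) + ennreal (s * c) * 1)"
    using cost by (intro add_mono mult_left_mono) auto
  also have "\<dots> = ennreal (s / a * a\<^sup>2 + (s / b * b\<^sup>2 + s * c))"
    using s abc by (simp add: ennreal_mult[symmetric] ennreal_plus[symmetric] del: ennreal_plus)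
  also have "s / a * a\<^sup>2 + (s / b * b\<^sup>2 + s * c) = s * (a + b + c)"
    using abc by (simp add: power2_eq_square distrib_left)
  also have "\<dots> = s\<^sup>2" by (simp add: s_def power2_eq_square)
  finally show ?thesis using that tau by (simp add: s_def)
qed

lemma wasserstein2_triangle:
  fixes \<mu> \<nu> \<xi> :: "'x::euclidean_space measure"
  assumes "\<mu> \<in> prob_measures_on \<Omega>" "\<nu> \<in> prob_measures_on \<Omega>" "\<xi> \<in> prob_measures_on \<Omega>" "compact \<Omega>"
  shows "wasserstein2 \<mu> \<xi> \<le> wasserstein2 \<mu> \<nu> + wasserstein2 \<nu> \<xi>"
proof (rule field_le_epsilon)
  fix e :: real assume e: "e > 0"
  \<comment> \<open>The summands e/3 make both radii positive even for vanishing distances; the last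
    third of e is the size of the cells.\<close>
  define a b where "a = wasserstein2 \<mu> \<nu> + e/3" and "b = wasserstein2 \<nu> \<xi> + e/3"
  have ab: "a > 0" "b > 0" using e wasserstein2_nonneg[of \<mu> \<nu>] wasserstein2_nonneg[of \<nu> \<xi>] by (auto simp: a_def b_def)
  obtain \<pi> where pi: "\<pi> \<in> couplings \<mu> \<nu>" "transport_cost \<pi> < ennreal (a\<^sup>2)"
    using coupling_cost_less[OF assms(1,2,4), of a] e by (auto simp: a_def)
  obtain \<sigma> where sg: "\<sigma> \<in> couplings \<nu> \<xi>" "transport_cost \<sigma> < ennreal (b\<^sup>2)"
    using coupling_cost_less[OF assms(2,3,4), of b] e by (auto simp: b_def)
  obtain \<tau> where "\<tau> \<in> couplings \<mu> \<xi>" "transport_cost \<tau> \<le> ennreal ((a + b + e/3)\<^sup>2)"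
    using couplings_glue[OF pi(1) sg(1) prob_measures_onD(1,2)[OF assms(2)] ab, of "e/3"] pi(2) sg(2) e
    by (auto simp: less_imp_le)
  then have "wasserstein2 \<mu> \<xi> \<le> a + b + e/3"
    using ab e by (intro wasserstein2_le) auto
  then show "wasserstein2 \<mu> \<xi> \<le> wasserstein2 \<mu> \<nu> + wasserstein2 \<nu> \<xi> + e"
    by (simp add: a_def b_def)
qed

subsection \<open>Transport along a flow\<close>

lemma measurable_compose_pair:
  fixes F :: "'a::euclidean_space \<Rightarrow> 'b::euclidean_space \<Rightarrow> 'c::euclidean_space"
  assumes "(\<lambda>z. F (fst z) (snd z)) \<in> borel_measurable borel"
    and "f \<in> borel_measurable M" "g \<in> borel_measurable M"
  shows "(\<lambda>z. F (f z) (g z)) \<in> borel_measurable M"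
  using measurable_compose[OF borel_measurable_Pair[OF assms(2,3)] assms(1)] by simp

lemma has_vector_derivative_tendsto:
  assumes "(f has_vector_derivative D) (at x within S)"
  shows "((\<lambda>y. (1 / (y - x)) *\<^sub>R (f y - f x)) \<longlongrightarrow> D) (at x within S)"
proof -
  have "((\<lambda>y. (1 / norm (y - x)) *\<^sub>R (f y - (f x + (y - x) *\<^sub>R D))) \<longlongrightarrow> 0) (at x within S)"
    using assms by (simp add: has_vector_derivative_def has_derivative_within)
  then have "((\<lambda>y. norm ((1 / norm (y - x)) *\<^sub>R (f y - (f x + (y - x) *\<^sub>R D)))) \<longlongrightarrow> 0) (at x within S)"
    by (rule tendsto_norm_zero)
  moreover have "\<forall>\<^sub>F y in at x within S. norm ((1 / norm (y - x)) *\<^sub>R (f y - (f x + (y - x) *\<^sub>R D)))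
      = norm ((1 / (y - x)) *\<^sub>R (f y - f x) - D)"
    unfolding eventually_at
  proof (intro exI[of _ 1] conjI ballI impI)
    fix y assume "y \<noteq> x \<and> dist y x < 1"
    then have "(1 / (y - x)) *\<^sub>R ((y - x) *\<^sub>R D) = D" by simp
    then have "(1 / (y - x)) *\<^sub>R (f y - f x) - D = (1 / (y - x)) *\<^sub>R (f y - (f x + (y - x) *\<^sub>R D))"
      by (simp only: diff_diff_eq[symmetric] scaleR_diff_right)
    then show "norm ((1 / norm (y - x)) *\<^sub>R (f y - (f x + (y - x) *\<^sub>R D)))
      = norm ((1 / (y - x)) *\<^sub>R (f y - f x) - D)" by simp
  qed simp
  ultimately have "((\<lambda>y. norm ((1 / (y - x)) *\<^sub>R (f y - f x) - D)) \<longlongrightarrow> 0) (at x within S)"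
    by (rule Lim_transform_eventually)
  then show ?thesis by (rule LIM_zero_cancel[OF tendsto_norm_zero_cancel])
qed

lemma ennsqrt_power2: "(ennsqrt x)\<^sup>2 = x"
  by (cases x) (auto simp: ennsqrt_def ennreal_power)

lemma L2_enorm_power2: "(L2_enorm \<mu> f)\<^sup>2 = (\<integral>\<^sup>+x. ennreal ((norm (f x))\<^sup>2) \<partial>\<mu>)"
  by (simp add: L2_enorm_def ennsqrt_power2)

section \<open>Measures carried along a field that is bounded and Lipschitz in space at almost every
  time\<close>

locale transported_family =
  fixes \<Omega> :: "'x::euclidean_space set" and w :: "real \<Rightarrow> 'x \<Rightarrow> 'x" and \<phi> :: "real \<Rightarrow> 'x \<Rightarrow> 'x"
    and C :: real and \<rho> :: "real \<Rightarrow> 'x measure"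
  assumes compact_\<Omega>: "compact \<Omega>" and convex_\<Omega>: "convex \<Omega>"
    and flow: "flow_of \<Omega> w \<phi>" and C_nonneg: "0 \<le> C"
    and bounds: "AE t in lborel. t \<in> {0..1} \<longrightarrow> (\<forall>x. norm (w t x) \<le> C) \<and> (\<forall>x y. norm (w t x - w t y) \<le> C * norm (x - y))"
    and prob: "\<And>t. t \<in> {0..1} \<Longrightarrow> \<rho> t \<in> prob_measures_on \<Omega>"
    and push: "\<And>t. t \<in> {0..1} \<Longrightarrow> \<rho> t = distr (restrict_space (\<rho> 0) \<Omega>) borel (\<phi> t)"
begin

text \<open>One choice of a Borel set of full measure, so that all later statements share their
  exceptional times. The time 1 is left out so that a forward difference quotient exists at every
  good time.\<close>

definition good :: "real set" where
  "good = (SOME T. T \<in> sets borel \<and> T \<subseteq> {0..<1} \<and> (AE t in lborel. t \<in> {0..1} \<longrightarrow> t \<in> T) \<and>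
     (\<forall>t\<in>T. (\<forall>x. norm (w t x) \<le> C) \<and> (\<forall>x y. norm (w t x - w t y) \<le> C * norm (x - y)) \<and>
        (\<forall>x\<in>\<Omega>. ((\<lambda>s. \<phi> s x) has_vector_derivative w t (\<phi> t x)) (at t within {0..1}))))"

lemma good_spec:
  "good \<in> sets borel \<and> good \<subseteq> {0..<1} \<and> (AE t in lborel. t \<in> {0..1} \<longrightarrow> t \<in> good) \<and>
     (\<forall>t\<in>good. (\<forall>x. norm (w t x) \<le> C) \<and> (\<forall>x y. norm (w t x - w t y) \<le> C * norm (x - y)) \<and>
        (\<forall>x\<in>\<Omega>. ((\<lambda>s. \<phi> s x) has_vector_derivative w t (\<phi> t x)) (at t within {0..1})))"
  unfolding good_def
proof (rule someI_ex)
  have d: "AE t in lborel. t \<in> {0..1} \<longrightarrow>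
        (\<forall>x\<in>\<Omega>. ((\<lambda>s. \<phi> s x) has_vector_derivative w t (\<phi> t x)) (at t within {0..1}))"
    using flow by (simp add: flow_of_def)
  obtain N where N: "N \<in> null_sets lborel"
    "\<And>t. t \<notin> N \<Longrightarrow> (t \<in> {0..1} \<longrightarrow> (\<forall>x. norm (w t x) \<le> C) \<and> (\<forall>x y. norm (w t x - w t y) \<le> C * norm (x - y))) \<and>
      (t \<in> {0..1} \<longrightarrow> (\<forall>x\<in>\<Omega>. ((\<lambda>s. \<phi> s x) has_vector_derivative w t (\<phi> t x)) (at t within {0..1})))"
    using ae_null_borel[OF eventually_conj[OF bounds d]] by blast
  have ae: "AE t in lborel. t \<noteq> 1 \<and> t \<notin> N"
    using AE_lborel_singleton[of 1] AE_not_in[OF N(1)] by (rule eventually_conj)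
  show "\<exists>T. T \<in> sets borel \<and> T \<subseteq> {0..<1} \<and> (AE t in lborel. t \<in> {0..1} \<longrightarrow> t \<in> T) \<and>
     (\<forall>t\<in>T. (\<forall>x. norm (w t x) \<le> C) \<and> (\<forall>x y. norm (w t x - w t y) \<le> C * norm (x - y)) \<and>
        (\<forall>x\<in>\<Omega>. ((\<lambda>s. \<phi> s x) has_vector_derivative w t (\<phi> t x)) (at t within {0..1})))"
  proof (intro exI[of _ "{0..<1} - N"] conjI)
    show "{0..<1} - N \<in> sets borel" using N(1) by (auto simp: null_sets_def)
    show "AE t in lborel. t \<in> {0..1} \<longrightarrow> t \<in> {0..<1} - N"
      using ae by eventually_elim auto
    show "\<forall>t\<in>{0..<1} - N. (\<forall>x. norm (w t x) \<le> C) \<and> (\<forall>x y. norm (w t x - w t y) \<le> C * norm (x - y)) \<and>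
        (\<forall>x\<in>\<Omega>. ((\<lambda>s. \<phi> s x) has_vector_derivative w t (\<phi> t x)) (at t within {0..1}))"
    proof
      fix t assume "t \<in> {0..<1} - N"
      then have "t \<notin> N" "t \<in> {0..1}" by auto
      with N(2)[of t] show "(\<forall>x. norm (w t x) \<le> C) \<and> (\<forall>x y. norm (w t x - w t y) \<le> C * norm (x - y)) \<and>
        (\<forall>x\<in>\<Omega>. ((\<lambda>s. \<phi> s x) has_vector_derivative w t (\<phi> t x)) (at t within {0..1}))" by blast
    qed
  qed auto
qed

lemma good_sets[measurable]: "good \<in> sets borel"
  and good_subset: "good \<subseteq> {0..<1}"
  and good_AE: "AE t in lborel. t \<in> {0..1} \<longrightarrow> t \<in> good"
  and good_bound: "\<And>t x. t \<in> good \<Longrightarrow> norm (w t x) \<le> C"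
  and good_lipschitz: "\<And>t x y. t \<in> good \<Longrightarrow> norm (w t x - w t y) \<le> C * norm (x - y)"
  and good_derivative: "\<And>t x. t \<in> good \<Longrightarrow> x \<in> \<Omega> \<Longrightarrow>
      ((\<lambda>s. \<phi> s x) has_vector_derivative w t (\<phi> t x)) (at t within {0..1})"
  using good_spec by blast+

lemma good_interval: "t \<in> good \<Longrightarrow> t \<in> {0..1}"
  using good_subset by auto

lemma flow_0: "x \<in> \<Omega> \<Longrightarrow> \<phi> 0 x = x"
  using flow by (simp add: flow_of_def)

text \<open>\<open>flow_of\<close> grants each trajectory a Lipschitz constant of its own; the
  differential equation replaces it by the uniform C.\<close>

lemma flow_lipschitz_time_le:
  assumes x: "x \<in> \<Omega>" and st: "s \<in> {0..1}" "t \<in> {0..1}" "s \<le> t"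
  shows "norm (\<phi> t x - \<phi> s x) \<le> C * (t - s)"
proof -
  obtain L where L: "L-lipschitz_on {0..1} (\<lambda>t. \<phi> t x)"
    using flow x by (auto simp: flow_of_def)
  show ?thesis
  proof (rule lipschitz_increment_le_ae[OF st(3), of L "\<lambda>t. \<phi> t x"])
    show "L-lipschitz_on {s..t} (\<lambda>t. \<phi> t x)"
      using st by (intro lipschitz_on_subset[OF L]) auto
    show "AE r in lborel. r \<in> {s..t} \<longrightarrow>
       (\<exists>v. ((\<lambda>t. \<phi> t x) has_vector_derivative v) (at r within {s..t}) \<and> norm v \<le> C)"
      using good_AE
    proof (rule eventually_mono, intro impI)
      fix r assume "r \<in> {0..1} \<longrightarrow> r \<in> good" "r \<in> {s..t}"
      then have r: "r \<in> good" using st by auto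
      show "\<exists>v. ((\<lambda>t. \<phi> t x) has_vector_derivative v) (at r within {s..t}) \<and> norm v \<le> C"
        using good_bound[OF r] has_vector_derivative_within_subset[OF good_derivative[OF r x], of "{s..t}"] st
        by auto
    qed
  qed
qed

lemma flow_lipschitz_time:
  assumes x: "x \<in> \<Omega>" and st: "s \<in> {0..1}" "t \<in> {0..1}"
  shows "norm (\<phi> t x - \<phi> s x) \<le> C * \<bar>t - s\<bar>"
  using flow_lipschitz_time_le[OF x, of s t] flow_lipschitz_time_le[OF x, of t s] st
  by (cases "s \<le> t") (auto simp: norm_minus_commute)

text \<open>The squared distance Z of two trajectories satisfies |Z'| \<le> 2 C Z at almost every
  time. Gronwall for Z gives the upper bound and for - Z the lower one; the latter makes each \<phi>
  t injective, on which the measurability of \<open>v\<close> rests.\<close>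

lemma flow_bilipschitz:
  assumes x: "x \<in> \<Omega>" and y: "y \<in> \<Omega>" and t: "t \<in> {0..1}"
  shows "norm (\<phi> t x - \<phi> t y) \<le> exp C * norm (x - y)"
    and "norm (x - y) \<le> exp C * norm (\<phi> t x - \<phi> t y)"
proof -
  define D where "D = (\<lambda>s. \<phi> s x - \<phi> s y)"
  define Z where "Z = (\<lambda>s. D s \<bullet> D s)"
  define B where "B = norm (x - y) + 2 * C"
  have D0: "D 0 = x - y" using x y by (simp add: D_def flow_0)
  have Dl: "norm (D s - D r) \<le> 2 * C * \<bar>s - r\<bar>" if "s \<in> {0..1}" "r \<in> {0..1}" for s r
  proof -
    have "D s - D r = (\<phi> s x - \<phi> r x) - (\<phi> s y - \<phi> r y)" by (simp add: D_def)
    then have "norm (D s - D r) \<le> norm (\<phi> s x - \<phi> r x) + norm (\<phi> s y - \<phi> r y)"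
      by (simp only: norm_triangle_ineq4)
    then show ?thesis
      using flow_lipschitz_time[OF x that(2,1)] flow_lipschitz_time[OF y that(2,1)] by simp
  qed
  have Db: "norm (D s) \<le> B" if "s \<in> {0..1}" for s
  proof -
    have "norm (D s) \<le> norm (D 0) + norm (D s - D 0)"
      using norm_triangle_ineq[of "D 0" "D s - D 0"] by simp
    moreover have "norm (D s - D 0) \<le> 2 * C * 1"
      using Dl[OF that, of 0] that C_nonneg by (intro order_trans[OF _ mult_left_mono[of "\<bar>s - 0\<bar>" 1]]) auto
    ultimately show ?thesis by (simp add: B_def D0)
  qed
  have B: "B \<ge> 0" using C_nonneg by (simp add: B_def)
  have lipZ: "(4 * C * B)-lipschitz_on {0..1} Z"
  proof (rule lipschitz_onI)
    fix s r :: real assume sr: "s \<in> {0..1}" "r \<in> {0..1}"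
    have "Z s - Z r = (D s - D r) \<bullet> (D s + D r)"
      by (simp add: Z_def inner_diff_left inner_diff_right inner_add_right inner_commute)
    then have "\<bar>Z s - Z r\<bar> \<le> norm (D s - D r) * norm (D s + D r)"
      by (simp add: Cauchy_Schwarz_ineq2)
    also have "\<dots> \<le> (2 * C * \<bar>s - r\<bar>) * (B + B)"
      using Dl[OF sr] Db[OF sr(1)] Db[OF sr(2)] B C_nonneg
      by (intro mult_mono order_trans[OF norm_triangle_ineq add_mono]) auto
    finally show "dist (Z s) (Z r) \<le> 4 * C * B * dist s r"
      by (simp add: dist_real_def algebra_simps)
  qed (use C_nonneg B in auto)
  have dZ: "\<exists>z. (Z has_real_derivative z) (at s within {0..t}) \<and> \<bar>z\<bar> \<le> 2 * C * Z s"
    if s: "s \<in> good" "s \<in> {0..t}" for s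
  proof -
    have "(D has_vector_derivative (w s (\<phi> s x) - w s (\<phi> s y))) (at s within {0..1})"
      unfolding D_def using good_derivative[OF s(1) x] good_derivative[OF s(1) y]
      by (rule has_vector_derivative_diff)
    then have d: "(D has_vector_derivative (w s (\<phi> s x) - w s (\<phi> s y))) (at s within {0..t})"
      by (rule has_vector_derivative_within_subset) (use t in auto)
    have "(Z has_real_derivative (D s \<bullet> (w s (\<phi> s x) - w s (\<phi> s y)) + (w s (\<phi> s x) - w s (\<phi> s y)) \<bullet> D s)) (at s within {0..t})"
      unfolding Z_def has_real_derivative_iff_has_vector_derivative
      by (rule bounded_bilinear.has_vector_derivative[OF bounded_bilinear_inner d d])
    moreover have "\<bar>D s \<bullet> (w s (\<phi> s x) - w s (\<phi> s y)) + (w s (\<phi> s x) - w s (\<phi> s y)) \<bullet> D s\<bar> \<le> 2 * C * Z s"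
    proof -
      have "\<bar>D s \<bullet> (w s (\<phi> s x) - w s (\<phi> s y))\<bar> \<le> norm (D s) * norm (w s (\<phi> s x) - w s (\<phi> s y))"
        by (rule Cauchy_Schwarz_ineq2)
      also have "\<dots> \<le> norm (D s) * (C * norm (D s))"
        using good_lipschitz[OF s(1), of "\<phi> s x" "\<phi> s y"] by (intro mult_left_mono) (auto simp: D_def)
      also have "\<dots> = C * Z s" by (simp add: Z_def dot_square_norm power2_eq_square)
      finally show ?thesis by (simp add: inner_commute)
    qed
    ultimately show ?thesis by blast
  qed
  have "AE s in lborel. s \<in> {0..t} \<longrightarrow> s \<in> good"
    using good_AE t by (auto elim!: eventually_mono)
  then have ae: "AE s in lborel. s \<in> {0..t} \<longrightarrow> (\<exists>z. (Z has_real_derivative z) (at s within {0..t}) \<and> \<bar>z\<bar> \<le> 2 * C * Z s)"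
    by eventually_elim (use dZ in blast)
  have l: "(4 * C * B)-lipschitz_on {0..t} Z" "(4 * C * B)-lipschitz_on {0..t} (\<lambda>s. - Z s)"
    using lipschitz_on_subset[OF lipZ, of "{0..t}"] t by auto
  have e: "exp (2 * C * (t - 0)) \<le> (exp C)\<^sup>2"
    using t C_nonneg by (simp add: power2_eq_square exp_add[symmetric] mult_left_le)
  have Z0: "Z 0 = (norm (x - y))\<^sup>2" and Zt: "Z t = (norm (\<phi> t x - \<phi> t y))\<^sup>2"
    by (simp_all add: Z_def D0 dot_square_norm) (simp add: D_def)
  have "Z t \<le> exp (2 * C * (t - 0)) * Z 0"
  proof (rule gronwall_ae[OF _ l(1)])
    show "AE s in lborel. s \<in> {0..t} \<longrightarrow> (\<exists>z. (Z has_real_derivative z) (at s within {0..t}) \<and> z \<le> 2 * C * Z s)"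
      using ae by eventually_elim (meson abs_le_D1)
  qed (use t in auto)
  also have "\<dots> \<le> (exp C)\<^sup>2 * Z 0"
    using e by (intro mult_right_mono) (auto simp: Z0)
  finally have "(norm (\<phi> t x - \<phi> t y))\<^sup>2 \<le> (exp C * norm (x - y))\<^sup>2"
    by (simp add: Z0 Zt power_mult_distrib)
  then show "norm (\<phi> t x - \<phi> t y) \<le> exp C * norm (x - y)"
    by (rule power2_le_imp_le) auto
  \<comment> \<open>The bound Z' \<ge> - 2 C Z reads as a Gronwall hypothesis for - Z with the
    negative rate - 2 C.\<close>
  have "- Z t \<le> exp (- (2 * C) * (t - 0)) * - Z 0"
  proof (rule gronwall_ae[OF _ l(2)])
    show "AE s in lborel. s \<in> {0..t} \<longrightarrow> (\<exists>z. ((\<lambda>s. - Z s) has_real_derivative z) (at s within {0..t}) \<and> z \<le> - (2 * C) * - Z s)"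
      using ae
    proof (rule eventually_mono, intro impI)
      fix s assume "s \<in> {0..t} \<longrightarrow> (\<exists>z. (Z has_real_derivative z) (at s within {0..t}) \<and> \<bar>z\<bar> \<le> 2 * C * Z s)" "s \<in> {0..t}"
      then obtain z where z: "(Z has_real_derivative z) (at s within {0..t})" "\<bar>z\<bar> \<le> 2 * C * Z s" by blast
      then show "\<exists>z. ((\<lambda>s. - Z s) has_real_derivative z) (at s within {0..t}) \<and> z \<le> - (2 * C) * - Z s"
        by (intro exI[of _ "- z"]) (auto intro: DERIV_minus)
    qed
  qed (use t in auto)
  then have "exp (2 * C * t) * (exp (- (2 * C * t)) * Z 0) \<le> exp (2 * C * t) * Z t"
    by (intro mult_left_mono) auto
  then have "Z 0 \<le> exp (2 * C * t) * Z t"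
    by (simp add: mult.assoc[symmetric] exp_add[symmetric])
  also have "\<dots> \<le> (exp C)\<^sup>2 * Z t"
    using e by (intro mult_right_mono) (auto simp: Zt)
  finally have "(norm (x - y))\<^sup>2 \<le> (exp C * norm (\<phi> t x - \<phi> t y))\<^sup>2"
    by (simp add: Z0 Zt power_mult_distrib)
  then show "norm (x - y) \<le> exp C * norm (\<phi> t x - \<phi> t y)"
    by (rule power2_le_imp_le) auto
qed

lemma flow_continuous: "continuous_on ({0..1} \<times> \<Omega>) (\<lambda>z. \<phi> (fst z) (snd z))"
proof -
  have "(C + exp C)-lipschitz_on ({0..1} \<times> \<Omega>) (\<lambda>z. \<phi> (fst z) (snd z))"
  proof (rule lipschitz_onI)
    fix z z' :: "real \<times> 'x" assume z: "z \<in> {0..1} \<times> \<Omega>" and z': "z' \<in> {0..1} \<times> \<Omega>"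
    obtain t x s y where zz: "z = (t, x)" "z' = (s, y)" by (cases z, cases z')
    have "norm (\<phi> t x - \<phi> s y) \<le> norm (\<phi> t x - \<phi> s x) + norm (\<phi> s x - \<phi> s y)"
      using norm_triangle_ineq[of "\<phi> t x - \<phi> s x" "\<phi> s x - \<phi> s y"] by simp
    also have "\<dots> \<le> C * \<bar>t - s\<bar> + exp C * norm (x - y)"
      using z z' zz by (intro add_mono flow_lipschitz_time flow_bilipschitz(1)) auto
    also have "\<dots> \<le> C * dist z z' + exp C * dist z z'"
      using dist_fst_le[of z z'] dist_snd_le[of z z'] C_nonneg
      by (intro add_mono mult_left_mono) (auto simp: zz dist_norm dist_real_def)
    finally show "dist (\<phi> (fst z) (snd z)) (\<phi> (fst z') (snd z')) \<le> (C + exp C) * dist z z'"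
      by (simp add: zz dist_norm algebra_simps)
  qed (use C_nonneg in auto)
  then show ?thesis by (rule lipschitz_on_continuous_on)
qed

lemma flow_continuous_space: "t \<in> {0..1} \<Longrightarrow> continuous_on \<Omega> (\<phi> t)"
  by (rule continuous_on_compose2[OF flow_continuous, of \<Omega> "Pair t", simplified])
    (auto intro!: continuous_intros)

section \<open>Trajectories that remain in \<Omega>, and the measures as push-forwards under a
  globally Borel map\<close>

definition staying :: "'x set" where
  "staying = {x\<in>\<Omega>. \<forall>t\<in>{0..1}. \<phi> t x \<in> \<Omega>}"

lemma staying_subset: "staying \<subseteq> \<Omega>" and staying_flow: "x \<in> staying \<Longrightarrow> t \<in> {0..1} \<Longrightarrow> \<phi> t x \<in> \<Omega>"
  by (auto simp: staying_def)

lemma closed_staying: "closed staying"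
proof -
  have "staying = \<Omega> \<inter> (\<Inter>t\<in>{0..1}. \<Omega> \<inter> \<phi> t -` \<Omega>)"
    by (auto simp: staying_def)
  moreover have "closed (\<Omega> \<inter> \<phi> t -` \<Omega>)" if "t \<in> {0..1}" for t
    using compact_imp_closed[OF compact_\<Omega>] flow_continuous_space[OF that]
    by (intro continuous_closed_preimage)
  then have "closed (\<Inter>t\<in>{0..1}. \<Omega> \<inter> \<phi> t -` \<Omega>)"
    by (intro closed_INT) blast
  ultimately show ?thesis
    using compact_imp_closed[OF compact_\<Omega>] by (simp only: closed_Int)
qed

lemma \<Omega>_sets[measurable]: "\<Omega> \<in> sets borel" and staying_sets[measurable]: "staying \<in> sets borel"
  using compact_\<Omega> closed_staying by (auto intro: borel_compact borel_closed)

lemma \<rho>_sets[measurable_cong]: "t \<in> {0..1} \<Longrightarrow> sets (\<rho> t) = sets borel"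
  and \<rho>_space: "t \<in> {0..1} \<Longrightarrow> space (\<rho> t) = UNIV"
  and \<rho>_prob: "t \<in> {0..1} \<Longrightarrow> prob_space (\<rho> t)"
  using prob_measures_onD prob by blast+

lemma \<rho>0_sets[measurable_cong]: "sets (\<rho> 0) = sets borel"
  by (simp add: \<rho>_sets)

lemma flow_measurable_restrict:
  assumes "t \<in> {0..1}"
  shows "\<phi> t \<in> restrict_space (\<rho> 0) \<Omega> \<rightarrow>\<^sub>M borel"
  using borel_measurable_continuous_on_restrict[OF flow_continuous_space[OF assms]]
    measurable_cong_sets[OF sets_restrict_space_cong[OF \<rho>0_sets] refl] by blast

text \<open>Test functions live on \<Omega> only, so almost every trajectory must be kept there at
  all times simultaneously. Each \<rho> q is concentrated on \<Omega>; this is used for the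
  countably many rational q, and continuity in time with closedness of \<Omega> yields the remaining
  times.\<close>

lemma AE_staying: "AE x in \<rho> 0. x \<in> staying"
proof -
  let ?Q = "{q \<in> \<rat>. q \<in> {0..1::real}}"
  have "AE x in \<rho> 0. x \<in> \<Omega> \<longrightarrow> \<phi> q x \<in> \<Omega>" if q: "q \<in> ?Q" for q
  proof -
    have q': "q \<in> {0..1}" using q by auto
    have "AE y in distr (restrict_space (\<rho> 0) \<Omega>) borel (\<phi> q). y \<in> \<Omega>"
      using prob_measures_on_AE[OF prob[OF q'] \<Omega>_sets] by (simp only: push[OF q', symmetric])
    then have "AE x in restrict_space (\<rho> 0) \<Omega>. \<phi> q x \<in> \<Omega>"
      by (rule AE_distrD[OF flow_measurable_restrict[OF q']])
    then show ?thesis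
      by (subst (asm) AE_restrict_space_iff) (auto simp: \<rho>0_sets \<rho>_space)
  qed
  moreover have "countable ?Q"
    by (rule countable_subset[OF _ countable_rat]) auto
  ultimately have "AE x in \<rho> 0. \<forall>q\<in>?Q. x \<in> \<Omega> \<longrightarrow> \<phi> q x \<in> \<Omega>"
    by (subst AE_ball_countable) auto
  moreover have "AE x in \<rho> 0. x \<in> \<Omega>"
    by (rule prob_measures_on_AE[OF prob]) auto
  ultimately show ?thesis
  proof (rule eventually_elim2)
    fix x assume *: "\<forall>q\<in>?Q. x \<in> \<Omega> \<longrightarrow> \<phi> q x \<in> \<Omega>" and x: "x \<in> \<Omega>"
    have "\<phi> t x \<in> \<Omega>" if t: "t \<in> {0..1}" for t
    proof (rule ccontr)
      assume "\<phi> t x \<notin> \<Omega>"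
      then obtain e where e: "e > 0" "ball (\<phi> t x) e \<subseteq> - \<Omega>"
        using compact_imp_closed[OF compact_\<Omega>] by (meson ComplI openE open_Compl)
      \<comment> \<open>Within time d a trajectory moves by less than e, so a rational time this
        close to t would also lie outside \<Omega>.\<close>
      define d where "d = e / (C + 1)"
      have d: "d > 0" using e C_nonneg by (simp add: d_def)
      have "max 0 (t - d) < min 1 (t + d)" using t d by auto
      then obtain q where q: "q \<in> \<rat>" "max 0 (t - d) < q" "q < min 1 (t + d)"
        using Rats_dense_in_real by blast
      then have "norm (\<phi> t x - \<phi> q x) \<le> C * \<bar>t - q\<bar>"
        using t by (intro flow_lipschitz_time x) auto
      also have "\<dots> \<le> C * d" using q C_nonneg by (intro mult_left_mono) auto
      also have "\<dots> < e" using e(1) C_nonneg by (simp add: d_def field_simps)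
      finally have "\<phi> q x \<in> ball (\<phi> t x) e" by (simp add: dist_norm)
      moreover have "\<phi> q x \<in> \<Omega>" using * x q by auto
      ultimately show False using e(2) by auto
    qed
    then show "x \<in> staying" using x by (simp add: staying_def)
  qed
qed

text \<open>Cutting the flow off to 0 outside a closed set of times and starting points makes it
  jointly Borel on the whole space, so that Fubini and \<open>distr\<close> apply without restricted
  measures.\<close>

definition X :: "real \<Rightarrow> 'x \<Rightarrow> 'x" where
  "X t x = indicator ({0..1} \<times> staying) (t, x) *\<^sub>R \<phi> t x"

lemma X_eq: "t \<in> {0..1} \<Longrightarrow> x \<in> staying \<Longrightarrow> X t x = \<phi> t x"
  by (simp add: X_def)

lemma X_borel: "(\<lambda>z. X (fst z) (snd z)) \<in> borel_measurable borel"
proof -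
  have "(\<lambda>z. indicator ({0..1} \<times> staying) z *\<^sub>R \<phi> (fst z) (snd z)) \<in> borel_measurable borel"
    using closed_staying staying_subset
    by (intro borel_measurable_continuous_on_indicator continuous_on_subset[OF flow_continuous])
      (auto intro!: borel_closed closed_Times)
  then show ?thesis by (simp add: X_def)
qed

lemmas X_measurable[measurable] = measurable_compose_pair[OF X_borel]

lemma \<rho>_eq_distr:
  assumes t: "t \<in> {0..1}"
  shows "\<rho> t = distr (\<rho> 0) borel (X t)"
proof (rule measure_eqI)
  fix A assume "A \<in> sets (\<rho> t)"
  then have A[measurable]: "A \<in> sets borel" using \<rho>_sets[OF t] by simp
  have m: "\<phi> t -` A \<inter> \<Omega> \<in> sets (\<rho> 0)"
    using measurable_sets[OF flow_measurable_restrict[OF t] A]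
    by (auto simp: space_restrict_space \<rho>_space sets_restrict_space_iff \<rho>0_sets)
  have "emeasure (\<rho> t) A = emeasure (distr (restrict_space (\<rho> 0) \<Omega>) borel (\<phi> t)) A"
    using push[OF t] by simp
  also have "\<dots> = emeasure (restrict_space (\<rho> 0) \<Omega>) (\<phi> t -` A \<inter> \<Omega>)"
    using flow_measurable_restrict[OF t] A by (subst emeasure_distr) (auto simp: space_restrict_space \<rho>_space)
  also have "\<dots> = emeasure (\<rho> 0) (\<phi> t -` A \<inter> \<Omega>)"
    by (rule emeasure_restrict_space) (auto simp: \<rho>0_sets \<rho>_space)
  also have "\<dots> = emeasure (\<rho> 0) (X t -` A \<inter> space (\<rho> 0))"
  proof (rule emeasure_eq_AE)
    show "AE x in \<rho> 0. (x \<in> \<phi> t -` A \<inter> \<Omega>) = (x \<in> X t -` A \<inter> space (\<rho> 0))"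
      using AE_staying by eventually_elim (use t staying_subset in \<open>auto simp: X_eq \<rho>_space\<close>)
    show "X t -` A \<inter> space (\<rho> 0) \<in> sets (\<rho> 0)" by measurable
  qed (rule m)
  also have "\<dots> = emeasure (distr (\<rho> 0) borel (X t)) A"
    by (subst emeasure_distr) auto
  finally show "emeasure (\<rho> t) A = emeasure (distr (\<rho> 0) borel (X t)) A" .
qed (use \<rho>_sets[OF t] in simp)

lemma nn_integral_\<rho>:
  assumes "t \<in> {0..1}" "f \<in> borel_measurable borel"
  shows "(\<integral>\<^sup>+x. f x \<partial>\<rho> t) = (\<integral>\<^sup>+x. f (X t x) \<partial>\<rho> 0)"
  by (subst \<rho>_eq_distr[OF assms(1)], rule nn_integral_distr) (use assms(2) in auto)

lemma integral_\<rho>: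
  fixes f :: "'x \<Rightarrow> real"
  assumes "t \<in> {0..1}" "f \<in> borel_measurable borel"
  shows "(LINT x|\<rho> t. f x) = (LINT x|\<rho> 0. f (X t x))"
  by (subst \<rho>_eq_distr[OF assms(1)], rule integral_distr) (use assms(2) in auto)

text \<open>The flow may leave \<open>\<Omega>\<close> on a null set, and nothing is assumed about how \<open>w\<close> depends on time
  off its trajectories; setting it to zero there makes it jointly measurable.\<close>

definition v :: "real \<Rightarrow> 'x \<Rightarrow> 'x" where
  "v t y = (if t \<in> good \<and> y \<in> \<phi> t ` \<Omega> then w t y else 0)"

lemma v_bound: "norm (v t y) \<le> C"
  using good_bound C_nonneg by (simp add: v_def)

lemma v_flow: "t \<in> good \<Longrightarrow> x \<in> \<Omega> \<Longrightarrow> v t (\<phi> t x) = w t (\<phi> t x)"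
  by (auto simp: v_def)

text \<open>The space-time map sending (t, x) to (t, \<phi> t x) is continuous and injective on a
  compact set, so its inverse \<open>g\<close> is continuous on the compact image K. Hence the
  starting point depends continuously on the current one, and \<open>v\<close> is a pointwise limit
  of forward difference quotients along trajectories, which are Borel.\<close>

lemma v_borel: "(\<lambda>z. v (fst z) (snd z)) \<in> borel_measurable borel"
proof -
  define \<Phi> where "\<Phi> = (\<lambda>z::real \<times> 'x. (fst z, \<phi> (fst z) (snd z)))"
  define K where "K = \<Phi> ` ({0..1} \<times> \<Omega>)"
  have c\<Phi>: "continuous_on ({0..1} \<times> \<Omega>) \<Phi>"
    unfolding \<Phi>_def by (intro continuous_on_Pair continuous_on_fst continuous_on_id flow_continuous)
  have cpt: "compact ({0..1::real} \<times> \<Omega>)" using compact_\<Omega> by (intro compact_Times) auto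
  have inj: "inj_on \<Phi> ({0..1} \<times> \<Omega>)"
  proof (rule inj_onI)
    fix z z' assume z: "z \<in> {0..1} \<times> \<Omega>" "z' \<in> {0..1} \<times> \<Omega>" "\<Phi> z = \<Phi> z'"
    then have "fst z = fst z'" "\<phi> (fst z) (snd z) = \<phi> (fst z) (snd z')" by (auto simp: \<Phi>_def)
    moreover have "norm (snd z - snd z') \<le> exp C * norm (\<phi> (fst z) (snd z) - \<phi> (fst z) (snd z'))"
      using z by (intro flow_bilipschitz(2)) auto
    ultimately show "z = z'" by (simp add: prod_eq_iff)
  qed
  obtain g where g: "homeomorphism ({0..1} \<times> \<Omega>) K \<Phi> g"
    using homeomorphism_compact[OF cpt c\<Phi> _ inj, of K] by (auto simp: K_def)
  have cK: "K \<in> sets borel"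
    unfolding K_def by (intro borel_compact compact_continuous_image c\<Phi> cpt)
  have cg: "continuous_on K g" and g\<Phi>: "\<And>z. z \<in> {0..1} \<times> \<Omega> \<Longrightarrow> g (\<Phi> z) = z" and gK: "g ` K = {0..1} \<times> \<Omega>"
    using g by (auto simp: homeomorphism_def)
  \<comment> \<open>The minimum keeps the shifted time in [0,1], where the flow is controlled; at a
    good time, which is below 1, it eventually has no effect.\<close>
  define s where "s = (\<lambda>n::nat. \<lambda>t::real. min 1 (t + 1 / real (Suc n)))"
  define f where "f = (\<lambda>n::nat. \<lambda>z. indicator good (fst z) *\<^sub>R (indicator K z *\<^sub>R
     (real (Suc n) *\<^sub>R (\<phi> (s n (fst z)) (snd (g z)) - snd z))))"
  have fm: "f n \<in> borel_measurable borel" for n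
  proof -
    have "continuous_on K (\<lambda>z. \<phi> (s n (fst z)) (snd (g z)))"
    proof (rule continuous_on_compose2[OF flow_continuous, of K "\<lambda>z. (s n (fst z), snd (g z))", simplified])
      show "continuous_on K (\<lambda>z. (s n (fst z), snd (g z)))"
        unfolding s_def by (intro continuous_intros cg)
      show "(\<lambda>z. (s n (fst z), snd (g z))) ` K \<subseteq> {0..1} \<times> \<Omega>"
      proof
        fix p assume "p \<in> (\<lambda>z. (s n (fst z), snd (g z))) ` K"
        then obtain z where z: "z \<in> K" "p = (s n (fst z), snd (g z))" by blast
        moreover have "g z \<in> {0..1} \<times> \<Omega>" using z(1) gK by blast
        moreover have "fst z \<in> {0..1}" using z(1) by (auto simp: K_def \<Phi>_def)
        ultimately show "p \<in> {0..1} \<times> \<Omega>" by (auto simp: s_def)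
      qed
    qed
    then have "(\<lambda>z. indicator K z *\<^sub>R (real (Suc n) *\<^sub>R (\<phi> (s n (fst z)) (snd (g z)) - snd z))) \<in> borel_measurable borel"
      by (intro borel_measurable_continuous_on_indicator cK continuous_intros)
    moreover have "(\<lambda>z::real \<times> 'x. indicator good (fst z) :: real) \<in> borel_measurable borel"
      unfolding borel_prod[symmetric] by measurable
    ultimately show ?thesis unfolding f_def by (rule borel_measurable_scaleR[rotated])
  qed
  show ?thesis
  proof (rule borel_measurable_LIMSEQ_metric[OF fm])
    fix z :: "real \<times> 'x"
    obtain t y where z: "z = (t, y)" by (cases z)
    show "(\<lambda>n. f n z) \<longlonglongrightarrow> v (fst z) (snd z)"
    proof (cases "t \<in> good \<and> z \<in> K")
      case True
      then obtain x where x: "x \<in> \<Omega>" "z = \<Phi> (t, x)" and t: "t \<in> good" "t \<in> {0..1}" "t < 1"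
        using z good_subset by (auto simp: K_def \<Phi>_def)
      have y: "y = \<phi> t x" using x z by (simp add: \<Phi>_def)
      have gz: "g z = (t, x)" using g\<Phi>[of "(t, x)"] x t by simp
      have h0: "(\<lambda>n. 1 / real (Suc n)) \<longlonglongrightarrow> 0"
        using LIMSEQ_inverse_real_of_nat by (simp add: inverse_eq_divide)
      have "(\<lambda>n. s n t) \<longlonglongrightarrow> min 1 (t + 0)"
        unfolding s_def by (intro tendsto_min tendsto_add tendsto_const h0)
      then have "(\<lambda>n. s n t) \<longlonglongrightarrow> t" using t by simp
      moreover have "s n t \<in> {0..1} \<and> s n t \<noteq> t" for n
        using t by (auto simp: s_def min_def)
      ultimately have fl: "filterlim (\<lambda>n. s n t) (at t within {0..1}) sequentially"
        by (auto simp: filterlim_at)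
      have "((\<lambda>r. (1 / (r - t)) *\<^sub>R (\<phi> r x - \<phi> t x)) \<longlongrightarrow> w t (\<phi> t x)) (at t within {0..1})"
        using good_derivative[OF t(1) x(1)]
        by (rule has_vector_derivative_tendsto)
      from filterlim_compose[OF this fl]
      have "(\<lambda>n. (1 / (s n t - t)) *\<^sub>R (\<phi> (s n t) x - \<phi> t x)) \<longlonglongrightarrow> w t (\<phi> t x)" .
      moreover have "\<forall>\<^sub>F n in sequentially. (1 / (s n t - t)) *\<^sub>R (\<phi> (s n t) x - \<phi> t x) = f n z"
      proof -
        have "\<forall>\<^sub>F n in sequentially. 1 / real (Suc n) < 1 - t"
          using h0 t by (intro order_tendstoD) auto
        then show ?thesis
        proof eventually_elim
          case (elim n)
          then have "s n t = t + 1 / real (Suc n)" by (simp add: s_def)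
          then have "1 / (s n t - t) = real (Suc n)" by simp
          then show ?case using True z gz y by (simp add: f_def)
        qed
      qed
      ultimately have "(\<lambda>n. f n z) \<longlonglongrightarrow> w t (\<phi> t x)"
        by (rule Lim_transform_eventually)
      then show ?thesis using v_flow[OF t(1) x(1)] z y by simp
    next
      case False
      then have "f n z = 0" for n by (auto simp: f_def z indicator_def)
      moreover have "v t y = 0"
        using False good_subset by (auto simp: v_def z K_def \<Phi>_def image_iff)
      ultimately show ?thesis by (simp add: z)
    qed
  qed
qed

lemmas v_measurable[measurable] = measurable_compose_pair[OF v_borel]

lemma L2_v: "t \<in> {0..1} \<Longrightarrow> L2_enorm (\<rho> t) (v t) < \<infinity>"
proof -
  assume t: "t \<in> {0..1}"
  interpret prob_space "\<rho> t" by (rule \<rho>_prob[OF t])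
  have "(L2_enorm (\<rho> t) (v t))\<^sup>2 \<le> (\<integral>\<^sup>+x. ennreal (C\<^sup>2) \<partial>\<rho> t)"
    unfolding L2_enorm_power2 by (intro nn_integral_mono ennreal_leI power_mono v_bound) auto
  also have "\<dots> < \<infinity>" by (simp add: emeasure_space_1)
  finally show ?thesis by (auto simp: less_top power_less_top_ennreal)
qed

text \<open>\<rho> t is concentrated on the image of \<Omega> under \<phi> t, where
  \<open>v t\<close> and \<open>w t\<close> coincide.\<close>

lemma L2_w_eq:
  assumes "t \<in> good"
  shows "L2_enorm (\<rho> t) (w t) = L2_enorm (\<rho> t) (v t)"
proof -
  have t: "t \<in> {0..1}" using good_interval[OF assms] .
  have "AE y in restrict_space (\<rho> 0) \<Omega>. w t (\<phi> t y) = v t (\<phi> t y)"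
    using v_flow[OF assms] by (intro AE_I2) (auto simp: space_restrict_space)
  have "continuous_on UNIV (w t)"
  proof (rule lipschitz_on_continuous_on[of C])
    show "C-lipschitz_on UNIV (w t)"
      using good_lipschitz[OF assms] C_nonneg by (intro lipschitz_onI) (auto simp: dist_norm)
  qed
  then have [measurable]: "w t \<in> borel_measurable borel" by (rule borel_measurable_continuous_onI)
  have "(\<integral>\<^sup>+x. ennreal ((norm (w t x))\<^sup>2) \<partial>\<rho> t) = (\<integral>\<^sup>+x. ennreal ((norm (w t (X t x)))\<^sup>2) \<partial>\<rho> 0)"
    by (rule nn_integral_\<rho>[OF t]) measurable
  also have "\<dots> = (\<integral>\<^sup>+x. ennreal ((norm (v t (X t x)))\<^sup>2) \<partial>\<rho> 0)"
    by (rule nn_integral_cong_AE, use AE_staying in eventually_elim)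
      (use t staying_subset v_flow[OF assms] in \<open>auto simp: X_eq\<close>)
  also have "\<dots> = (\<integral>\<^sup>+x. ennreal ((norm (v t x))\<^sup>2) \<partial>\<rho> t)"
    by (rule nn_integral_\<rho>[OF t, symmetric]) measurable
  finally show ?thesis by (simp add: L2_enorm_def)
qed

text \<open>The bound on the derivative becomes a Lipschitz bound because [0,1] times \<Omega> is
  convex. For starting points in \<open>staying\<close> the curve (t, \<phi> t x) remains in that
  set, where the derivative of the test function is taken.\<close>

lemma C1_test_along_flow:
  assumes test: "C1_test \<Omega> \<psi> \<psi>t \<psi>x" and x: "x \<in> staying"
  shows "\<exists>L. L-lipschitz_on {0..1} (\<lambda>t. \<psi> (t, \<phi> t x))"
    and "t \<in> good \<Longrightarrow> ((\<lambda>t. \<psi> (t, \<phi> t x)) has_real_derivative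
        (\<psi>t (t, \<phi> t x) + \<psi>x (t, \<phi> t x) \<bullet> w t (\<phi> t x))) (at t within {0..1})"
proof -
  let ?S = "{0..1::real} \<times> \<Omega>"
  have x\<Omega>: "x \<in> \<Omega>" using x staying_subset by auto
  have ct: "continuous_on ?S \<psi>t" "continuous_on ?S \<psi>x"
    and der: "\<And>z. z \<in> ?S \<Longrightarrow> (\<psi> has_derivative (\<lambda>(s, h). s * \<psi>t z + \<psi>x z \<bullet> h)) (at z within ?S)"
    using test by (auto simp: C1_test_def)
  have cpt: "compact ?S" using compact_\<Omega> by (intro compact_Times) auto
  obtain A where A: "A > 0" "\<And>z. z \<in> ?S \<Longrightarrow> norm (\<psi>t z) \<le> A"
    using compact_imp_bounded[OF compact_continuous_image[OF ct(1) cpt]] unfolding bounded_pos by blast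
  obtain B where B: "B > 0" "\<And>z. z \<in> ?S \<Longrightarrow> norm (\<psi>x z) \<le> B"
    using compact_imp_bounded[OF compact_continuous_image[OF ct(2) cpt]] unfolding bounded_pos by blast
  have on: "onorm (\<lambda>(s, h). s * \<psi>t z + \<psi>x z \<bullet> h) \<le> A + B" if z: "z \<in> ?S" for z
  proof (rule onorm_le)
    fix p :: "real \<times> 'x"
    obtain s h where p: "p = (s, h)" by (cases p)
    have "norm (s * \<psi>t z + \<psi>x z \<bullet> h) \<le> \<bar>s\<bar> * \<bar>\<psi>t z\<bar> + norm (\<psi>x z) * norm h"
      using Cauchy_Schwarz_ineq2[of "\<psi>x z" h] by (simp add: abs_mult[symmetric])
    also have "\<dots> \<le> norm p * A + B * norm p"
      using A(2)[OF z] B z norm_fst_le[of s h] norm_snd_le[of h s] A(1)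
      by (intro add_mono mult_mono) (auto simp: p)
    finally show "norm (case p of (s, h) \<Rightarrow> s * \<psi>t z + \<psi>x z \<bullet> h) \<le> (A + B) * norm p"
      by (simp add: p algebra_simps)
  qed
  have lip: "norm (\<psi> z - \<psi> z') \<le> (A + B) * norm (z - z')" if "z \<in> ?S" "z' \<in> ?S" for z z'
    by (rule differentiable_bound[OF _ der on that]) (auto intro: convex_Times convex_\<Omega>)
  show "\<exists>L. L-lipschitz_on {0..1} (\<lambda>t. \<psi> (t, \<phi> t x))"
  proof (intro exI lipschitz_onI)
    fix s t :: real assume st: "s \<in> {0..1}" "t \<in> {0..1}"
    have "norm ((s, \<phi> s x) - (t, \<phi> t x)) \<le> norm (s - t) + norm (\<phi> s x - \<phi> t x)"
      using norm_Pair_le[of "s - t" "\<phi> s x - \<phi> t x"] by simp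
    also have "\<dots> \<le> (1 + C) * dist s t"
      using flow_lipschitz_time[OF x\<Omega> st(2,1)] by (simp add: dist_real_def algebra_simps)
    finally have "(A + B) * norm ((s, \<phi> s x) - (t, \<phi> t x)) \<le> (A + B) * ((1 + C) * dist s t)"
      using A(1) B(1) by (intro mult_left_mono) auto
    then show "dist (\<psi> (s, \<phi> s x)) (\<psi> (t, \<phi> t x)) \<le> ((A + B) * (1 + C)) * dist s t"
      using lip[of "(s, \<phi> s x)" "(t, \<phi> t x)"] st staying_flow[OF x]
      by (auto simp: dist_norm mult.assoc)
  qed (use A(1) B(1) C_nonneg in auto)
  show "((\<lambda>t. \<psi> (t, \<phi> t x)) has_real_derivative
        (\<psi>t (t, \<phi> t x) + \<psi>x (t, \<phi> t x) \<bullet> w t (\<phi> t x))) (at t within {0..1})" if t: "t \<in> good"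
  proof -
    have t01: "t \<in> {0..1}" using good_interval[OF t] .
    have c: "((\<lambda>s. (s, \<phi> s x)) has_vector_derivative (1, w t (\<phi> t x))) (at t within {0..1})"
      using has_derivative_Pair[OF has_vector_derivative_id[unfolded has_vector_derivative_def]
          good_derivative[OF t x\<Omega>, unfolded has_vector_derivative_def]]
      by (simp add: has_vector_derivative_def scaleR_prod_def)
    have "(\<psi> has_derivative (\<lambda>(s, h). s * \<psi>t (t, \<phi> t x) + \<psi>x (t, \<phi> t x) \<bullet> h)) (at (t, \<phi> t x) within (\<lambda>s. (s, \<phi> s x)) ` {0..1})"
      by (rule has_derivative_subset[OF der]) (use t01 staying_flow[OF x] in auto)
    from vector_derivative_diff_chain_within[OF c this]
    show ?thesis
      by (simp add: has_real_derivative_iff_has_vector_derivative comp_def)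
  qed
qed

section \<open>The continuity equation, by Fubini on times and starting points\<close>

lemma emeasure_strip: "emeasure (lborel \<Otimes>\<^sub>M \<rho> 0) ({0..1::real} \<times> UNIV) = 1"
proof -
  interpret R: prob_space "\<rho> 0" by (rule \<rho>_prob) simp
  have "emeasure (lborel \<Otimes>\<^sub>M \<rho> 0) ({0..1::real} \<times> UNIV) = emeasure lborel {0..1::real} * emeasure (\<rho> 0) UNIV"
    by (rule R.emeasure_pair_measure_Times) (auto simp: \<rho>0_sets)
  then show ?thesis using R.emeasure_space_1 by (simp add: \<rho>_space)
qed

lemma integrable_strip:
  fixes f :: "real \<times> 'x \<Rightarrow> real"
  assumes [measurable]: "f \<in> borel_measurable (lborel \<Otimes>\<^sub>M \<rho> 0)"
    and "\<And>t x. t \<in> {0..1} \<Longrightarrow> \<bar>f (t, x)\<bar> \<le> B" "\<And>t x. t \<notin> {0..1} \<Longrightarrow> f (t, x) = 0"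
  shows "integrable (lborel \<Otimes>\<^sub>M \<rho> 0) f"
proof (rule integrableI_bounded_set[where A = "{0..1} \<times> UNIV" and B = B])
  show "{0..1::real} \<times> UNIV \<in> sets (lborel \<Otimes>\<^sub>M \<rho> 0)"
    by (intro pair_measureI) (auto simp: \<rho>0_sets)
  show "AE z in lborel \<Otimes>\<^sub>M \<rho> 0. z \<notin> {0..1} \<times> UNIV \<longrightarrow> f z = 0"
  proof (rule AE_I2, rule impI)
    fix z :: "real \<times> 'x" assume "z \<notin> {0..1} \<times> UNIV"
    then show "f z = 0" using assms(3)[of "fst z" "snd z"] by (cases z) auto
  qed
qed (use assms emeasure_strip in auto)

text \<open>Pulled back to the starting points, both time integrals become double integrals over
  [0,1] and \<rho> 0. After exchanging the order, the inner integral in time is the increment of the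
  test function along one trajectory, by \<open>lipschitz_FTC\<close>.\<close>

lemma continuity_equation_v:
  assumes test: "C1_test \<Omega> \<psi> \<psi>t \<psi>x"
  shows "set_integrable lborel {0..1} (\<lambda>t. LINT x:\<Omega>|\<rho> t. \<psi>x (t, x) \<bullet> v t x)"
    and "(LINT t:{0..1}|lborel. (LINT x:\<Omega>|\<rho> t. \<psi>t (t, x)))
              + (LINT t:{0..1}|lborel. (LINT x:\<Omega>|\<rho> t. \<psi>x (t, x) \<bullet> v t x))
            = (LINT x:\<Omega>|\<rho> 1. \<psi> (1, x)) - (LINT x:\<Omega>|\<rho> 0. \<psi> (0, x))"
proof -
  let ?S = "{0..1::real} \<times> \<Omega>"
  interpret R: prob_space "\<rho> 0" by (rule \<rho>_prob) simp
  interpret P: pair_sigma_finite lborel "\<rho> 0" ..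
  have ct: "continuous_on ?S \<psi>t" "continuous_on ?S \<psi>x"
    and der: "\<And>z. z \<in> ?S \<Longrightarrow> (\<psi> has_derivative (\<lambda>(s, h). s * \<psi>t z + \<psi>x z \<bullet> h)) (at z within ?S)"
    using test by (auto simp: C1_test_def)
  have c\<psi>: "continuous_on ?S \<psi>"
    using der by (meson continuous_on_eq_continuous_within has_derivative_continuous)
  have cpt: "compact ?S" using compact_\<Omega> by (intro compact_Times) auto
  have Sb: "?S \<in> sets borel" using cpt by (rule borel_compact)
  obtain a where a: "a > 0" "\<And>z. z \<in> ?S \<Longrightarrow> norm (\<psi>t z) \<le> a"
    using compact_imp_bounded[OF compact_continuous_image[OF ct(1) cpt]] unfolding bounded_pos by blast
  obtain b where b: "b > 0" "\<And>z. z \<in> ?S \<Longrightarrow> norm (\<psi>x z) \<le> b"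
    using compact_imp_bounded[OF compact_continuous_image[OF ct(2) cpt]] unfolding bounded_pos by blast
  obtain c where c: "c > 0" "\<And>z. z \<in> ?S \<Longrightarrow> norm (\<psi> z) \<le> c"
    using compact_imp_bounded[OF compact_continuous_image[OF c\<psi> cpt]] unfolding bounded_pos by blast
  \<comment> \<open>Extension by zero: the test function and its derivatives are continuous only on
    [0,1] times \<Omega>, and Borel functions on the whole space are required.\<close>
  define G where "G = (\<lambda>t y. indicator ?S (t, y) *\<^sub>R \<psi>t (t, y))"
  define H where "H = (\<lambda>t y. indicator ?S (t, y) *\<^sub>R \<psi>x (t, y))"
  define F where "F = (\<lambda>t y. indicator ?S (t, y) *\<^sub>R \<psi> (t, y))"
  have "(\<lambda>z. G (fst z) (snd z)) \<in> borel_measurable borel"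
    using borel_measurable_continuous_on_indicator[OF Sb ct(1)] by (simp add: G_def)
  note Gm[measurable] = measurable_compose_pair[OF this]
  have "(\<lambda>z. H (fst z) (snd z)) \<in> borel_measurable borel"
    using borel_measurable_continuous_on_indicator[OF Sb ct(2)] by (simp add: H_def)
  note Hm[measurable] = measurable_compose_pair[OF this]
  have "(\<lambda>z. F (fst z) (snd z)) \<in> borel_measurable borel"
    using borel_measurable_continuous_on_indicator[OF Sb c\<psi>] by (simp add: F_def)
  note Fm[measurable] = measurable_compose_pair[OF this]
  have Gb: "\<bar>G t y\<bar> \<le> a" and Fb: "\<bar>F t y\<bar> \<le> c" for t y
    using a(2)[of "(t, y)"] a(1) c(2)[of "(t, y)"] c(1) by (auto simp: G_def F_def indicator_def)
  have Hb: "\<bar>H t y \<bullet> v t y\<bar> \<le> b * C" for t y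
  proof -
    have "norm (H t y) \<le> b" using b(2)[of "(t, y)"] b(1) by (auto simp: H_def indicator_def)
    then have "norm (H t y) * norm (v t y) \<le> b * C"
      using v_bound b(1) by (intro mult_mono) auto
    then show ?thesis using Cauchy_Schwarz_ineq2 order_trans by blast
  qed
  define k where "k = (\<lambda>t x. indicator {0..1} t * G t (X t x))"
  define l where "l = (\<lambda>t x. indicator {0..1} t * (H t (X t x) \<bullet> v t (X t x)))"
  have ik: "integrable (lborel \<Otimes>\<^sub>M \<rho> 0) (\<lambda>z. k (fst z) (snd z))"
    unfolding k_def by (rule integrable_strip[where B = a]) (use Gb in auto)
  have il: "integrable (lborel \<Otimes>\<^sub>M \<rho> 0) (\<lambda>z. l (fst z) (snd z))"
    unfolding l_def by (rule integrable_strip[where B = "b * C"]) (use Hb in auto)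
  have Lk: "indicator {0..1} t *\<^sub>R (LINT x:\<Omega>|\<rho> t. \<psi>t (t, x)) = (LINT x|\<rho> 0. k t x)" for t
  proof (cases "t \<in> {0..1}")
    case True
    have "(LINT x:\<Omega>|\<rho> t. \<psi>t (t, x)) = (LINT x|\<rho> t. G t x)"
      unfolding set_lebesgue_integral_def using True by (intro Bochner_Integration.integral_cong) (auto simp: G_def indicator_def)
    also have "\<dots> = (LINT x|\<rho> 0. G t (X t x))"
      by (rule integral_\<rho>[OF True]) measurable
    finally show ?thesis using True by (simp add: k_def)
  qed (simp add: k_def)
  have Ll: "indicator {0..1} t *\<^sub>R (LINT x:\<Omega>|\<rho> t. \<psi>x (t, x) \<bullet> v t x) = (LINT x|\<rho> 0. l t x)" for t
  proof (cases "t \<in> {0..1}")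
    case True
    have "(LINT x:\<Omega>|\<rho> t. \<psi>x (t, x) \<bullet> v t x) = (LINT x|\<rho> t. H t x \<bullet> v t x)"
      unfolding set_lebesgue_integral_def using True by (intro Bochner_Integration.integral_cong) (auto simp: H_def indicator_def)
    also have "\<dots> = (LINT x|\<rho> 0. H t (X t x) \<bullet> v t (X t x))"
      by (rule integral_\<rho>[OF True]) measurable
    finally show ?thesis using True by (simp add: l_def)
  qed (simp add: l_def)
  have LF: "(LINT x:\<Omega>|\<rho> t. \<psi> (t, x)) = (LINT x|\<rho> 0. F t (X t x))" if t: "t \<in> {0..1}" for t
  proof -
    have "(LINT x:\<Omega>|\<rho> t. \<psi> (t, x)) = (LINT x|\<rho> t. F t x)"
      unfolding set_lebesgue_integral_def using t by (intro Bochner_Integration.integral_cong) (auto simp: F_def indicator_def)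
    also have "\<dots> = (LINT x|\<rho> 0. F t (X t x))"
      by (rule integral_\<rho>[OF t]) measurable
    finally show ?thesis .
  qed
  have ik': "integrable lborel (\<lambda>t. LINT x|\<rho> 0. k t x)" and il': "integrable lborel (\<lambda>t. LINT x|\<rho> 0. l t x)"
    using P.integrable_fst'[OF ik] P.integrable_fst'[OF il] by simp_all
  show "set_integrable lborel {0..1} (\<lambda>t. LINT x:\<Omega>|\<rho> t. \<psi>x (t, x) \<bullet> v t x)"
    unfolding set_integrable_def using il' by (simp only: Ll)
  have ikl: "integrable (lborel \<Otimes>\<^sub>M \<rho> 0) (\<lambda>(t, x). k t x + l t x)"
    using Bochner_Integration.integrable_add[OF ik il] by (simp add: case_prod_unfold)
  have "(LINT t:{0..1}|lborel. (LINT x:\<Omega>|\<rho> t. \<psi>t (t, x)))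
              + (LINT t:{0..1}|lborel. (LINT x:\<Omega>|\<rho> t. \<psi>x (t, x) \<bullet> v t x))
     = (LINT t|lborel. (LINT x|\<rho> 0. k t x)) + (LINT t|lborel. (LINT x|\<rho> 0. l t x))"
    unfolding set_lebesgue_integral_def[of lborel "{0..1::real}"] Lk Ll ..
  also have "\<dots> = (LINT z|(lborel \<Otimes>\<^sub>M \<rho> 0). k (fst z) (snd z)) + (LINT z|(lborel \<Otimes>\<^sub>M \<rho> 0). l (fst z) (snd z))"
    using P.integral_fst'[OF ik] P.integral_fst'[OF il] by simp
  also have "\<dots> = (LINT z|(lborel \<Otimes>\<^sub>M \<rho> 0). (case z of (t, x) \<Rightarrow> k t x + l t x))"
    using Bochner_Integration.integral_add[OF ik il] by (simp add: case_prod_unfold)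
  also have "\<dots> = (LINT x|\<rho> 0. (LINT t|lborel. k t x + l t x))"
    using P.integral_snd[OF ikl] by simp
  also have "\<dots> = (LINT x|\<rho> 0. F 1 (X 1 x) - F 0 (X 0 x))"
  proof (rule integral_cong_AE)
    show "(\<lambda>x. LINT t|lborel. k t x + l t x) \<in> borel_measurable (\<rho> 0)"
      unfolding k_def l_def by measurable
    show "AE x in \<rho> 0. (LINT t|lborel. k t x + l t x) = F 1 (X 1 x) - F 0 (X 0 x)"
      using AE_staying
    proof eventually_elim
      case (elim x)
      obtain L where L: "L-lipschitz_on {0..1} (\<lambda>t. \<psi> (t, \<phi> t x))"
        using C1_test_along_flow(1)[OF test elim] by blast
      have "(LINT t|lborel. k t x + l t x) = (LINT t:{0..1}|lborel. G t (X t x) + H t (X t x) \<bullet> v t (X t x))"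
        unfolding set_lebesgue_integral_def by (intro Bochner_Integration.integral_cong) (auto simp: k_def l_def algebra_simps)
      also have "\<dots> = \<psi> (1, \<phi> 1 x) - \<psi> (0, \<phi> 0 x)"
      proof (rule lipschitz_FTC(2)[OF _ L])
        show "(\<lambda>t. G t (X t x) + H t (X t x) \<bullet> v t (X t x)) \<in> borel_measurable borel"
          by measurable
        show "AE t in lborel. t \<in> {0..1} \<longrightarrow> ((\<lambda>t. \<psi> (t, \<phi> t x)) has_real_derivative
           G t (X t x) + H t (X t x) \<bullet> v t (X t x)) (at t within {0..1})"
          using good_AE
        proof (rule eventually_mono, intro impI)
          fix t :: real assume "t \<in> {0..1} \<longrightarrow> t \<in> good" and t: "t \<in> {0..1}"
          then have tg: "t \<in> good" by blast
          have "v t (\<phi> t x) = w t (\<phi> t x)"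
            using v_flow[OF tg] elim staying_subset by auto
          then have "G t (X t x) + H t (X t x) \<bullet> v t (X t x) = \<psi>t (t, \<phi> t x) + \<psi>x (t, \<phi> t x) \<bullet> w t (\<phi> t x)"
            using t X_eq[OF t elim] staying_flow[OF elim t] by (simp add: G_def H_def)
          then show "((\<lambda>t. \<psi> (t, \<phi> t x)) has_real_derivative
             G t (X t x) + H t (X t x) \<bullet> v t (X t x)) (at t within {0..1})"
            using C1_test_along_flow(2)[OF test elim tg] by simp
        qed
      qed simp
      also have "\<dots> = F 1 (X 1 x) - F 0 (X 0 x)"
        using X_eq[of 1 x] X_eq[of 0 x] elim staying_flow[OF elim, of 0] staying_flow[OF elim, of 1]
        by (simp add: F_def)
      finally show ?case .
    qed
  qed measurable
  also have "\<dots> = (LINT x|\<rho> 0. F 1 (X 1 x)) - (LINT x|\<rho> 0. F 0 (X 0 x))"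
    by (intro Bochner_Integration.integral_diff R.integrable_const_bound[where B = c]) (use Fb in auto)
  also have "\<dots> = (LINT x:\<Omega>|\<rho> 1. \<psi> (1, x)) - (LINT x:\<Omega>|\<rho> 0. \<psi> (0, x))"
    by (simp add: LF)
  finally show "(LINT t:{0..1}|lborel. (LINT x:\<Omega>|\<rho> t. \<psi>t (t, x)))
              + (LINT t:{0..1}|lborel. (LINT x:\<Omega>|\<rho> t. \<psi>x (t, x) \<bullet> v t x))
            = (LINT x:\<Omega>|\<rho> 1. \<psi> (1, x)) - (LINT x:\<Omega>|\<rho> 0. \<psi> (0, x))" .
qed

lemma v_in_CE: "v \<in> CE \<Omega> \<rho>"
proof -
  have "(\<lambda>(t, x). v t x) \<in> borel_measurable (restrict_space borel ({0..1} \<times> \<Omega>))"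
    using measurable_restrict_space1[OF v_borel] by (simp add: case_prod_unfold)
  then show ?thesis
    unfolding CE_def using L2_v continuity_equation_v by blast
qed

section \<open>Energy and displacement along the flow\<close>

lemma energy_measurable:
  "(\<lambda>t. \<integral>\<^sup>+x. ennreal ((norm (v t (X t x)))\<^sup>2) \<partial>\<rho> 0) \<in> borel_measurable borel"
proof -
  interpret R: prob_space "\<rho> 0" by (rule \<rho>_prob) simp
  show ?thesis by measurable
qed

lemma L2_w_eq_X:
  assumes t: "t \<in> good"
  shows "(L2_enorm (\<rho> t) (w t))\<^sup>2 = (\<integral>\<^sup>+x. ennreal ((norm (v t (X t x)))\<^sup>2) \<partial>\<rho> 0)"
  unfolding L2_w_eq[OF t] L2_enorm_power2
  by (rule nn_integral_\<rho>[OF good_interval[OF t]]) measurable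

text \<open>The integrand on the right is Borel in time, which is not known of the one on the
  left.\<close>

lemma energy_w_eq:
  "(\<integral>\<^sup>+t\<in>{0..1}. (L2_enorm (\<rho> t) (w t))\<^sup>2 \<partial>lborel) =
   (\<integral>\<^sup>+t\<in>{0..1}. (\<integral>\<^sup>+x. ennreal ((norm (v t (X t x)))\<^sup>2) \<partial>\<rho> 0) \<partial>lborel)"
  by (rule nn_integral_cong_AE, use good_AE in eventually_elim) (auto simp: L2_w_eq_X indicator_def)

lemma energy_le:
  "energy \<Omega> \<rho> \<le> (\<integral>\<^sup>+t\<in>{0..1}. (L2_enorm (\<rho> t) (w t))\<^sup>2 \<partial>lborel)"
proof -
  have "energy \<Omega> \<rho> \<le> (\<integral>\<^sup>+t\<in>{0..1}. (L2_enorm (\<rho> t) (v t))\<^sup>2 \<partial>lborel)"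
    unfolding energy_def by (rule INF_lower[OF v_in_CE])
  also have "\<dots> = (\<integral>\<^sup>+t\<in>{0..1}. (L2_enorm (\<rho> t) (w t))\<^sup>2 \<partial>lborel)"
    by (rule nn_integral_cong_AE, use good_AE in eventually_elim) (auto simp: L2_w_eq indicator_def)
  finally show ?thesis .
qed

lemma energy_w_le: "(\<integral>\<^sup>+t\<in>{0..1}. (L2_enorm (\<rho> t) (w t))\<^sup>2 \<partial>lborel) \<le> ennreal (C\<^sup>2)"
proof -
  interpret R: prob_space "\<rho> 0" by (rule \<rho>_prob) simp
  have "(\<integral>\<^sup>+x. ennreal ((norm (v t (X t x)))\<^sup>2) \<partial>\<rho> 0) \<le> ennreal (C\<^sup>2)" for t
  proof -
    have "(\<integral>\<^sup>+x. ennreal ((norm (v t (X t x)))\<^sup>2) \<partial>\<rho> 0) \<le> (\<integral>\<^sup>+x. ennreal (C\<^sup>2) \<partial>\<rho> 0)"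
      by (intro nn_integral_mono ennreal_leI power_mono v_bound) auto
    then show ?thesis by (simp add: R.emeasure_space_1)
  qed
  note E = this
  have "(\<integral>\<^sup>+t\<in>{0..1}. (L2_enorm (\<rho> t) (w t))\<^sup>2 \<partial>lborel) \<le> (\<integral>\<^sup>+t\<in>{0..1::real}. ennreal (C\<^sup>2) \<partial>lborel)"
    unfolding energy_w_eq by (intro nn_integral_mono) (auto simp: indicator_def E)
  also have "\<dots> = ennreal (C\<^sup>2)" by (simp add: nn_integral_cmult_indicator)
  finally show ?thesis .
qed

text \<open>Cauchy-Schwarz in time, in a form without roots: with u the displacement, |u|^2 is the
  integral of v \<bullet> u, which is at most half the integral of |v|^2 + |u|^2, and half of |u|^2
  is absorbed on the left.\<close>

lemma displacement_le:
  assumes x: "x \<in> staying"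
  shows "ennreal ((norm (X 0 x - X 1 x))\<^sup>2) \<le> (\<integral>\<^sup>+t\<in>{0..1}. ennreal ((norm (v t (X t x)))\<^sup>2) \<partial>lborel)"
proof -
  define u where "u = \<phi> 1 x - \<phi> 0 x"
  have x\<Omega>: "x \<in> \<Omega>" using x staying_subset by auto
  have L: "(C * norm u)-lipschitz_on {0..1} (\<lambda>t. \<phi> t x \<bullet> u)"
  proof (rule lipschitz_onI)
    fix s t :: real assume st: "s \<in> {0..1}" "t \<in> {0..1}"
    have "\<bar>(\<phi> s x - \<phi> t x) \<bullet> u\<bar> \<le> norm (\<phi> s x - \<phi> t x) * norm u" by (rule Cauchy_Schwarz_ineq2)
    also have "\<dots> \<le> (C * \<bar>s - t\<bar>) * norm u"
      using flow_lipschitz_time[OF x\<Omega> st(2,1)] by (intro mult_right_mono) auto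
    finally show "dist (\<phi> s x \<bullet> u) (\<phi> t x \<bullet> u) \<le> C * norm u * dist s t"
      by (simp add: dist_real_def inner_diff_left algebra_simps)
  qed (use C_nonneg in auto)
  have m: "(\<lambda>t. v t (X t x)) \<in> borel_measurable borel" by measurable
  note m[measurable]
  have ae: "AE t in lborel. t \<in> {0..1} \<longrightarrow> ((\<lambda>t. \<phi> t x \<bullet> u) has_real_derivative v t (X t x) \<bullet> u) (at t within {0..1})"
    using good_AE
  proof (rule eventually_mono, intro impI)
    fix t :: real assume "t \<in> {0..1} \<longrightarrow> t \<in> good" and t: "t \<in> {0..1}"
    then have tg: "t \<in> good" by blast
    have "v t (X t x) = w t (\<phi> t x)"
      using v_flow[OF tg x\<Omega>] X_eq[OF t x] by simp
    then show "((\<lambda>t. \<phi> t x \<bullet> u) has_real_derivative v t (X t x) \<bullet> u) (at t within {0..1})"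
      unfolding has_real_derivative_iff_has_vector_derivative
      using bounded_linear.has_vector_derivative[OF bounded_linear_inner_left good_derivative[OF tg x\<Omega>]] by simp
  qed
  have i1: "set_integrable lborel {0..1} (\<lambda>t. v t (X t x) \<bullet> u)"
    and e1: "(LINT t:{0..1}|lborel. v t (X t x) \<bullet> u) = \<phi> 1 x \<bullet> u - \<phi> 0 x \<bullet> u"
    by (rule lipschitz_FTC[OF _ L _ ae], simp, measurable)+
  have i2: "set_integrable lborel {0..1} (\<lambda>t. (norm (v t (X t x)))\<^sup>2)"
    unfolding set_integrable_def
    by (rule integrableI_bounded_set[where A = "{0..1}" and B = "C\<^sup>2"]) (auto intro!: power_mono v_bound)
  have i3: "set_integrable lborel {0..1::real} (\<lambda>t. (norm u)\<^sup>2)"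
    unfolding set_integrable_def by (rule integrableI_bounded_set[where A = "{0..1}" and B = "(norm u)\<^sup>2"]) auto
  have i4: "(LINT t:{0..1::real}|lborel. (norm u)\<^sup>2) = (norm u)\<^sup>2"
    by (simp add: set_lebesgue_integral_def)
  have "(norm u)\<^sup>2 = (LINT t:{0..1}|lborel. v t (X t x) \<bullet> u)"
    unfolding e1 by (simp add: u_def power2_norm_eq_inner inner_diff_left)
  also have "\<dots> \<le> (LINT t:{0..1}|lborel. ((norm (v t (X t x)))\<^sup>2 + (norm u)\<^sup>2) / 2)"
  proof (rule set_integral_mono[OF i1])
    show "set_integrable lborel {0..1} (\<lambda>t. ((norm (v t (X t x)))\<^sup>2 + (norm u)\<^sup>2) / 2)"
      using i2 i3 by (intro set_integrable_divide set_integral_add) auto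
    fix t :: real
    have "v t (X t x) \<bullet> u \<le> norm (v t (X t x)) * norm u" by (rule norm_cauchy_schwarz)
    also have "\<dots> \<le> ((norm (v t (X t x)))\<^sup>2 + (norm u)\<^sup>2) / 2"
      using sum_squares_bound[of "norm (v t (X t x))" "norm u"] by simp
    finally show "v t (X t x) \<bullet> u \<le> ((norm (v t (X t x)))\<^sup>2 + (norm u)\<^sup>2) / 2" .
  qed
  also have "\<dots> = ((LINT t:{0..1}|lborel. (norm (v t (X t x)))\<^sup>2) + (norm u)\<^sup>2) / 2"
    using i2 i3 by (simp add: set_integral_add(2) i4)
  finally have le: "(norm u)\<^sup>2 \<le> (LINT t:{0..1}|lborel. (norm (v t (X t x)))\<^sup>2)" by simp
  have "ennreal ((norm (X 0 x - X 1 x))\<^sup>2) = ennreal ((norm u)\<^sup>2)"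
    using X_eq[OF _ x, of 0] X_eq[OF _ x, of 1] by (simp add: u_def norm_minus_commute)
  also have "\<dots> \<le> ennreal (LINT t|lborel. indicator {0..1} t *\<^sub>R (norm (v t (X t x)))\<^sup>2)"
    using le by (intro ennreal_leI) (simp add: set_lebesgue_integral_def)
  also have "\<dots> = (\<integral>\<^sup>+t. ennreal (indicator {0..1} t *\<^sub>R (norm (v t (X t x)))\<^sup>2) \<partial>lborel)"
    using i2 unfolding set_integrable_def by (intro nn_integral_eq_integral[symmetric]) auto
  also have "\<dots> = (\<integral>\<^sup>+t\<in>{0..1}. ennreal ((norm (v t (X t x)))\<^sup>2) \<partial>lborel)"
    by (intro nn_integral_cong) (auto simp: indicator_def)
  finally show ?thesis .
qed

lemma wasserstein2_le_energy:
  "ennreal ((wasserstein2 (\<rho> 0) (\<rho> 1))\<^sup>2) \<le> (\<integral>\<^sup>+t\<in>{0..1}. (L2_enorm (\<rho> t) (w t))\<^sup>2 \<partial>lborel)"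
proof -
  interpret R: prob_space "\<rho> 0" by (rule \<rho>_prob) simp
  interpret P: pair_sigma_finite lborel "\<rho> 0" ..
  define \<pi> where "\<pi> = distr (\<rho> 0) borel (\<lambda>x. (X 0 x, X 1 x))"
  have m[measurable]: "(\<lambda>x. (X 0 x, X 1 x)) \<in> \<rho> 0 \<rightarrow>\<^sub>M borel"
    unfolding borel_prod[symmetric] by measurable
  have [measurable]: "fst \<in> (borel :: ('x \<times> 'x) measure) \<rightarrow>\<^sub>M borel" "snd \<in> (borel :: ('x \<times> 'x) measure) \<rightarrow>\<^sub>M borel"
    unfolding borel_prod[symmetric] by measurable
  have "distr \<pi> borel fst = distr (\<rho> 0) borel (X 0)" "distr \<pi> borel snd = distr (\<rho> 0) borel (X 1)"
    unfolding \<pi>_def by (simp_all add: distr_distr comp_def)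
  then have "distr \<pi> borel fst = \<rho> 0" "distr \<pi> borel snd = \<rho> 1"
    using \<rho>_eq_distr[of 0] \<rho>_eq_distr[of 1] by simp_all
  then have cpl: "\<pi> \<in> couplings (\<rho> 0) (\<rho> 1)" by (simp add: couplings_def \<pi>_def)
  have "ennreal ((wasserstein2 (\<rho> 0) (\<rho> 1))\<^sup>2) \<le> transport_cost \<pi>"
  proof -
    have "ennreal (enn2real y) \<le> y" for y by (cases y) auto
    then have "ennreal ((wasserstein2 (\<rho> 0) (\<rho> 1))\<^sup>2) \<le> (INF \<pi>\<in>couplings (\<rho> 0) (\<rho> 1). transport_cost \<pi>)"
      by (simp add: wasserstein2_alt)
    also have "\<dots> \<le> transport_cost \<pi>" by (rule INF_lower[OF cpl])
    finally show ?thesis .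
  qed
  also have "transport_cost \<pi> = (\<integral>\<^sup>+x. ennreal ((norm (X 0 x - X 1 x))\<^sup>2) \<partial>\<rho> 0)"
    unfolding transport_cost_def \<pi>_def by (subst nn_integral_distr) auto
  also have "\<dots> \<le> (\<integral>\<^sup>+x. (\<integral>\<^sup>+t. ennreal ((norm (v t (X t x)))\<^sup>2) * indicator {0..1} t \<partial>lborel) \<partial>\<rho> 0)"
    by (rule nn_integral_mono_AE, use AE_staying in eventually_elim) (rule displacement_le)
  also have "\<dots> = (\<integral>\<^sup>+t. (\<integral>\<^sup>+x. ennreal ((norm (v t (X t x)))\<^sup>2) * indicator {0..1} t \<partial>\<rho> 0) \<partial>lborel)"
    using P.Fubini[of "\<lambda>(t, x). ennreal ((norm (v t (X t x)))\<^sup>2) * indicator {0..1} t"] by simp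
  also have "\<dots> = (\<integral>\<^sup>+t\<in>{0..1}. (\<integral>\<^sup>+x. ennreal ((norm (v t (X t x)))\<^sup>2) \<partial>\<rho> 0) \<partial>lborel)"
    by (intro nn_integral_cong) (simp add: nn_integral_multc)
  finally show ?thesis unfolding energy_w_eq .
qed

end

subsection \<open>Gradient fields minimise the energy\<close>

text \<open>Half-lines are closed under intersection and generate the Borel sets. So the vanishing
  of the integral passes to every Borel set, which determines the integrand almost
  everywhere.\<close>

lemma ae_zero_if_initial_integrals_zero:
  fixes F :: "real \<Rightarrow> real"
  assumes F: "set_integrable lborel {0..1} F"
    and zero: "\<And>s. 0 < s \<Longrightarrow> s \<le> 1 \<Longrightarrow> (LINT t:{0..s}|lborel. F t) = 0"
  shows "AE t in lborel. t \<in> {0..1} \<longrightarrow> F t = 0"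
proof -
  define f where "f = (\<lambda>t. indicator {0..1} t *\<^sub>R F t)"
  have f: "integrable lborel f" using F by (simp add: f_def set_integrable_def)
  have half: "(LINT t:{..a}|lborel. f t) = 0" for a
  proof (cases "a \<le> 0")
    case True
    have "(LINT t:{..a}|lborel. f t) = (LINT t::real|lborel. (0::real))"
      unfolding set_lebesgue_integral_def
    proof (rule integral_cong_AE)
      show "AE t in lborel. indicator {..a} t *\<^sub>R f t = 0"
        using AE_lborel_singleton[of 0] by eventually_elim (use True in \<open>auto simp: f_def indicator_def\<close>)
    qed (use f in auto)
    then show ?thesis by simp
  next
    case False
    have "(LINT t:{..a}|lborel. f t) = (LINT t:{0..min a 1}|lborel. F t)"
      unfolding set_lebesgue_integral_def
      by (intro Bochner_Integration.integral_cong) (auto simp: f_def indicator_def)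
    also have "\<dots> = 0" using False by (intro zero) auto
    finally show ?thesis .
  qed
  have total: "(LINT t|lborel. f t) = 0"
  proof -
    have "(LINT t:{..1}|lborel. f t) = (LINT t|lborel. f t)"
      unfolding set_lebesgue_integral_def
      by (intro Bochner_Integration.integral_cong) (auto simp: f_def indicator_def)
    then show ?thesis using half[of 1] by simp
  qed
  have si: "set_integrable lborel A f" if "A \<in> sets borel" for A
    unfolding set_integrable_def using integrable_mult_indicator[OF _ f, of A] that by simp
  have "(LINT t:A|lborel. f t) = 0" if A: "A \<in> sets lborel" for A
  proof -
    have stable: "Int_stable (range (\<lambda>a. {..a::real}))"
    proof (rule Int_stableI_image)
      fix a b :: real
      show "\<exists>c\<in>UNIV. {..a} \<inter> {..b} = {..c}" by (intro bexI[of _ "min a b"]) auto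
    qed
    have sub: "range (\<lambda>a. {..a::real}) \<subseteq> Pow UNIV" by auto
    have "A \<in> sigma_sets UNIV (range (\<lambda>a. {..a::real}))"
      using A by (simp add: borel_eq_atMost)
    then show ?thesis
    proof (induction A rule: sigma_sets_induct_disjoint[OF stable sub, consumes 1, case_names basic empty compl union])
      case (basic A)
      then show ?case using half by auto
    next
      case empty
      show ?case by (simp add: set_lebesgue_integral_def)
    next
      case (compl A)
      then have Ab: "A \<in> sets borel" by (simp add: borel_eq_atMost)
      have "(LINT t:(UNIV - A)|lborel. f t) = (LINT t|lborel. f t - indicator A t *\<^sub>R f t)"
        unfolding set_lebesgue_integral_def
        by (intro Bochner_Integration.integral_cong) (auto simp: indicator_def)
      also have "\<dots> = (LINT t|lborel. f t) - (LINT t:A|lborel. f t)"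
        unfolding set_lebesgue_integral_def using si[OF Ab]
        by (intro Bochner_Integration.integral_diff f) (simp add: set_integrable_def)
      finally show ?case using compl total by simp
    next
      case (union A)
      then have Ab: "A i \<in> sets borel" for i by (auto simp: borel_eq_atMost)
      have "(LINT t:(\<Union>i. A i)|lborel. f t) = (\<Sum>i. LINT t:A i|lborel. f t)"
        using union(1) Ab by (intro lebesgue_integral_countable_add si) (auto simp: disjoint_family_on_def)
      then show ?case using union by simp
    qed
  qed
  then have "AE t in lborel. f t = (\<lambda>t. 0) t"
    by (intro density_unique_real[OF f integrable_zero]) (simp add: set_lebesgue_integral_def)
  then show ?thesis by eventually_elim (auto simp: f_def)
qed

text \<open>The smooth weights exp (- (t/s)^(2n)) lie between 0 and 1 and tend to 1 for 0 \<le> t <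
  s and to 0 for t > s, so they approximate the indicator of [0,s] boundedly almost everywhere on
  [0,1].\<close>

lemma ae_zero_if_C1_weighted_integrals_zero:
  fixes F :: "real \<Rightarrow> real"
  assumes F: "set_integrable lborel {0..1} F"
    and zero: "\<And>a a'. (\<And>t. (a has_real_derivative a' t) (at t)) \<Longrightarrow> continuous_on UNIV a' \<Longrightarrow>
      (LINT t:{0..1}|lborel. a t * F t) = 0"
  shows "AE t in lborel. t \<in> {0..1} \<longrightarrow> F t = 0"
proof (rule ae_zero_if_initial_integrals_zero[OF F])
  fix s :: real assume s: "0 < s" "s \<le> 1"
  define a where "a = (\<lambda>n::nat. \<lambda>t::real. exp (- ((t / s) ^ (2 * n))))"
  define f where "f = (\<lambda>t. indicator {0..1} t *\<^sub>R F t)"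
  have f: "integrable lborel f" using F by (simp add: f_def set_integrable_def)
  have [measurable]: "f \<in> borel_measurable lborel" using f by auto
  have az: "(LINT t|lborel. a n t * f t) = 0" for n
  proof -
    have "(LINT t:{0..1}|lborel. a n t * F t) = 0"
    proof (rule zero)
      show "(a n has_real_derivative (exp (- ((t / s) ^ (2 * n))) * - (real (2 * n) * (t / s) ^ (2 * n - 1) * (1 / s)))) (at t)" for t
        unfolding a_def
        using DERIV_fun_exp[OF DERIV_minus[OF DERIV_power[OF DERIV_cdivide[OF DERIV_ident, of s], where n = "2 * n"]]]
        by (simp add: ac_simps)
      show "continuous_on UNIV (\<lambda>t. exp (- ((t / s) ^ (2 * n))) * - (real (2 * n) * (t / s) ^ (2 * n - 1) * (1 / s)))"
        using s by (intro continuous_intros) auto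
    qed
    moreover have "(LINT t:{0..1}|lborel. a n t * F t) = (LINT t|lborel. a n t * f t)"
      unfolding set_lebesgue_integral_def by (intro Bochner_Integration.integral_cong) (auto simp: f_def indicator_def)
    ultimately show ?thesis by simp
  qed
  have "(\<lambda>n. LINT t|lborel. a n t * f t) \<longlonglongrightarrow> (LINT t|lborel. indicator {0..s} t *\<^sub>R f t)"
  proof (rule integral_dominated_convergence[where w = "\<lambda>t. \<bar>f t\<bar>"])
    show "AE t in lborel. (\<lambda>n. a n t * f t) \<longlonglongrightarrow> indicator {0..s} t *\<^sub>R f t"
      using AE_lborel_singleton[of s]
    proof eventually_elim
      case (elim t)
      consider "t < 0" | "0 \<le> t" "t < s" | "s < t" using elim by linarith
      then show ?case
      proof cases
        case 1
        then show ?thesis by (simp add: f_def)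
      next
        case 2
        then have "0 \<le> t / s" "t / s < 1" using s by auto
        then have "(t / s)\<^sup>2 < 1\<^sup>2" by (intro power_strict_mono) auto
        then have "norm ((t / s)\<^sup>2) < 1" by simp
        then have "(\<lambda>n. ((t / s)\<^sup>2) ^ n) \<longlonglongrightarrow> 0"
          by (rule LIMSEQ_power_zero)
        then have "(\<lambda>n. exp (- (((t / s)\<^sup>2) ^ n)) * f t) \<longlonglongrightarrow> exp (- 0) * f t"
          by (intro tendsto_mult tendsto_exp tendsto_minus tendsto_const)
        then show ?thesis using 2 by (simp add: a_def power_mult)
      next
        case 3
        then have "1 < (t / s)\<^sup>2" using s by (simp add: one_less_power)
        then have i0: "(\<lambda>n. inverse (((t / s)\<^sup>2) ^ n)) \<longlonglongrightarrow> 0"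
          by (rule LIMSEQ_inverse_realpow_zero)
        have le: "exp (- (((t / s)\<^sup>2) ^ n)) \<le> inverse (((t / s)\<^sup>2) ^ n)" for n
        proof -
          have "0 < (t / s)\<^sup>2" using \<open>1 < (t / s)\<^sup>2\<close> by linarith
          then have "0 < ((t / s)\<^sup>2) ^ n" by (rule zero_less_power)
          moreover have "((t / s)\<^sup>2) ^ n \<le> exp (((t / s)\<^sup>2) ^ n)"
            using exp_ge_add_one_self[of "((t / s)\<^sup>2) ^ n"] by linarith
          ultimately show ?thesis
            unfolding exp_minus by (intro le_imp_inverse_le)
        qed
        have "(\<lambda>n. exp (- (((t / s)\<^sup>2) ^ n))) \<longlonglongrightarrow> 0"
        proof (rule tendsto_sandwich[OF _ _ tendsto_const i0])
          show "\<forall>\<^sub>F n in sequentially. 0 \<le> exp (- (((t / s)\<^sup>2) ^ n))" by simp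
          show "\<forall>\<^sub>F n in sequentially. exp (- (((t / s)\<^sup>2) ^ n)) \<le> inverse (((t / s)\<^sup>2) ^ n)"
            using le by (rule eventuallyI)
        qed
        then have "(\<lambda>n. exp (- (((t / s)\<^sup>2) ^ n)) * f t) \<longlonglongrightarrow> 0 * f t"
          by (intro tendsto_mult tendsto_const)
        then show ?thesis using 3 by (simp add: a_def power_mult)
      qed
    qed
    show "AE t in lborel. norm (a n t * f t) \<le> \<bar>f t\<bar>" for n
      by (rule AE_I2) (auto simp: a_def abs_mult power_mult intro!: mult_left_le_one_le)
    show "(\<lambda>t. a n t * f t) \<in> borel_measurable lborel" for n
      unfolding a_def by measurable
    show "(\<lambda>t. indicator {0..s} t *\<^sub>R f t) \<in> borel_measurable lborel" by measurable
  qed (use f in auto)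
  then have "(LINT t|lborel. indicator {0..s} t *\<^sub>R f t) = 0"
    unfolding az by (simp add: LIMSEQ_const_iff)
  moreover have "(LINT t|lborel. indicator {0..s} t *\<^sub>R f t) = (LINT t:{0..s}|lborel. F t)"
    unfolding set_lebesgue_integral_def using s by (intro Bochner_Integration.integral_cong) (auto simp: f_def indicator_def)
  ultimately show "(LINT t:{0..s}|lborel. F t) = 0" by simp
qed

text \<open>Reduces the orthogonality to \<open>w t\<close> for almost all \<open>t\<close>, where the test field depends on \<open>t\<close>, to
  countably many fixed test fields.\<close>

lemma countable_pointwise_dense_lipschitz:
  fixes w :: "'i \<Rightarrow> 'x::euclidean_space \<Rightarrow> 'x"
  assumes C: "C \<ge> 0" and lip: "\<And>t x y. t \<in> T \<Longrightarrow> norm (w t x - w t y) \<le> C * norm (x - y)"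
  obtains T' where "countable T'" "T' \<subseteq> T"
    "\<And>t. t \<in> T \<Longrightarrow> \<exists>s. (\<forall>k::nat. s k \<in> T') \<and> (\<forall>x. (\<lambda>k. w (s k) x) \<longlonglongrightarrow> w t x)"
proof -
  obtain D :: "'x set" where D: "countable D" "\<And>X. open X \<Longrightarrow> X \<noteq> {} \<Longrightarrow> \<exists>d\<in>D. d \<in> X"
    using countable_dense_exists by blast
  define q where "q = from_nat_into D"
  have q: "\<exists>n. dist x (q n) < e" if e: "e > 0" for x e
  proof -
    obtain d where "d \<in> D" "d \<in> ball x e" using D(2)[of "ball x e"] e by auto
    then show ?thesis using from_nat_into_surj[OF D(1)] unfolding q_def by (metis mem_ball)
  qed
  define e where "e = (\<lambda>t. \<lambda>n::nat. w t (q n))"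
  obtain R where R: "countable R" "R \<subseteq> e ` T" "e ` T \<subseteq> closure R"
    using separable by blast
  then obtain T' where T': "countable T'" "T' \<subseteq> T" "R = e ` T'"
    using countable_subset_image[of R e T] by blast
  show thesis
  proof (rule that[OF T'(1,2)])
    fix t assume t: "t \<in> T"
    then obtain r where r: "\<And>k. r k \<in> R" "r \<longlonglongrightarrow> e t"
      using R(3) closure_sequential by blast
    then have "\<forall>k. \<exists>s\<in>T'. r k = e s" using T'(3) by blast
    then obtain s where s: "\<And>k. s k \<in> T'" "\<And>k. r k = e (s k)" by metis
    have coord: "(\<lambda>k. w (s k) (q n)) \<longlonglongrightarrow> w t (q n)" for n
    proof -
      have "isCont (\<lambda>f :: nat \<Rightarrow> 'x. f n) (e t)"
        using continuous_on_product_coordinates[of n] by (metis continuous_on_eq_continuous_at open_UNIV UNIV_I)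
      from isCont_tendsto_compose[OF this r(2)] show ?thesis by (simp add: s(2) e_def)
    qed
    have "(\<lambda>k. w (s k) x) \<longlonglongrightarrow> w t x" for x
    proof (rule metric_LIMSEQ_I)
      fix \<epsilon> :: real assume \<epsilon>: "\<epsilon> > 0"
      obtain n where n: "dist x (q n) < \<epsilon> / (3 * (C + 1))"
        using q[of "\<epsilon> / (3 * (C + 1))" x] \<epsilon> C by auto
      have nC: "C * norm (x - q n) < \<epsilon> / 3"
      proof -
        have "C * norm (x - q n) \<le> (C + 1) * dist x (q n)"
          using C by (simp add: dist_norm mult_right_mono)
        also have "\<dots> < (C + 1) * (\<epsilon> / (3 * (C + 1)))"
          using n C by (intro mult_strict_left_mono) auto
        also have "\<dots> = \<epsilon> / 3" using C by (simp add: field_simps)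
        finally show ?thesis .
      qed
      obtain N where N: "\<And>k. k \<ge> N \<Longrightarrow> dist (w (s k) (q n)) (w t (q n)) < \<epsilon> / 3"
        using metric_LIMSEQ_D[OF coord, of "\<epsilon>/3" n] \<epsilon> by auto
      show "\<exists>N. \<forall>k\<ge>N. dist (w (s k) x) (w t x) < \<epsilon>"
      proof (intro exI[of _ N] allI impI)
        fix k assume k: "N \<le> k"
        have sk: "s k \<in> T" using s(1) T'(2) by blast
        have "dist (w (s k) x) (w (s k) (q n)) < \<epsilon> / 3" "dist (w t (q n)) (w t x) < \<epsilon> / 3"
          using lip[OF sk, of x "q n"] lip[OF t, of x "q n"] nC
          by (auto simp: dist_norm norm_minus_commute)
        then show "dist (w (s k) x) (w t x) < \<epsilon>"
          using N[OF k] dist_triangle[of "w (s k) x" "w t x" "w (s k) (q n)"]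
            dist_triangle[of "w (s k) (q n)" "w t x" "w t (q n)"] by simp
      qed
    qed
    then show "\<exists>s. (\<forall>k. s k \<in> T') \<and> (\<forall>x. (\<lambda>k. w (s k) x) \<longlonglongrightarrow> w t x)"
      using s(1) by blast
  qed
qed

text \<open>Separated test functions: the free factor in time isolates the time slices, and the
  gradient of the factor in space is the field f to be tested.\<close>

lemma C1_test_product:
  fixes \<psi> :: "'a::euclidean_space \<Rightarrow> real"
  assumes \<psi>: "\<And>x. (\<psi> has_derivative (\<lambda>h. f x \<bullet> h)) (at x)" and f: "continuous_on UNIV f"
    and a: "\<And>t. (a has_real_derivative a' t) (at t)" and a': "continuous_on UNIV a'"
  shows "C1_test \<Omega> (\<lambda>(t, x). a t * \<psi> x) (\<lambda>(t, x). a' t * \<psi> x) (\<lambda>(t, x). a t *\<^sub>R f x)"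
proof -
  have c\<psi>: "continuous_on UNIV \<psi>"
    using \<psi> by (meson continuous_at_imp_continuous_on has_derivative_continuous)
  have ca: "continuous_on UNIV a"
    using a by (meson DERIV_isCont continuous_at_imp_continuous_on)
  have fst: "continuous_on S (\<lambda>z. g (fst z))" if "continuous_on UNIV g"
    for S :: "(real \<times> 'a) set" and g :: "real \<Rightarrow> real"
    by (rule continuous_on_compose2[OF that]) (auto intro!: continuous_intros)
  have snd: "continuous_on S (\<lambda>z. h (snd z))" if "continuous_on UNIV h"
    for S :: "(real \<times> 'a) set" and h :: "'a \<Rightarrow> 'd::topological_space"
    by (rule continuous_on_compose2[OF that]) (auto intro!: continuous_intros)
  have der: "((\<lambda>(t, x). a t * \<psi> x) has_derivative (\<lambda>(s, h). s * (a' t * \<psi> x) + (a t *\<^sub>R f x) \<bullet> h)) (at (t, x) within S)"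
    for t x S
  proof -
    have "(a has_derivative (\<lambda>s. s * a' t)) (at t)"
      using a[of t] by (simp add: has_field_derivative_def mult_commute_abs)
    then have 1: "((\<lambda>z. a (fst z)) has_derivative (\<lambda>z. fst z * a' t)) (at (t, x) within S)"
      by (intro has_derivative_compose[OF has_derivative_fst[OF has_derivative_ident], of a, simplified]) auto
    have 2: "((\<lambda>z. \<psi> (snd z)) has_derivative (\<lambda>z. f x \<bullet> snd z)) (at (t, x) within S)"
      using \<psi>[of x] by (intro has_derivative_compose[OF has_derivative_snd[OF has_derivative_ident], of \<psi>, simplified]) auto
    show ?thesis
      using has_derivative_mult[OF 1 2] by (simp add: case_prod_unfold algebra_simps)
  qed
  show ?thesis
    unfolding C1_test_def
  proof (intro conjI ballI)
    show "continuous_on ({0..1} \<times> \<Omega>) (\<lambda>(t, x). a' t * \<psi> x)"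
      unfolding case_prod_unfold by (intro continuous_on_mult fst[OF a'] snd[OF c\<psi>])
    show "continuous_on ({0..1} \<times> \<Omega>) (\<lambda>(t, x). a t *\<^sub>R f x)"
      unfolding case_prod_unfold by (intro continuous_on_scaleR fst[OF ca] snd[OF f])
    fix z :: "real \<times> 'a" assume "z \<in> {0..1} \<times> \<Omega>"
    show "((\<lambda>(t, x). a t * \<psi> x) has_derivative
       (\<lambda>(s, h). s * (case z of (t, x) \<Rightarrow> a' t * \<psi> x) + (case z of (t, x) \<Rightarrow> a t *\<^sub>R f x) \<bullet> h)) (at z within {0..1} \<times> \<Omega>)"
      using der[of "fst z" "snd z"] by (simp add: case_prod_unfold)
  qed
qed

text \<open>In the difference of the two continuity equations all terms without the velocities
  cancel. What remains vanishes for every C^1 weight in time, hence slice by slice almost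
  everywhere; the exceptional times depend on f.\<close>

lemma CE_difference_orthogonal:
  assumes u: "u \<in> CE \<Omega> \<rho>" and v: "v \<in> CE \<Omega> \<rho>"
    and \<psi>: "\<And>x. (\<psi> has_derivative (\<lambda>h. f x \<bullet> h)) (at x)" and f: "continuous_on UNIV f"
  shows "AE t in lborel. t \<in> {0..1} \<longrightarrow> (LINT x:\<Omega>|\<rho> t. f x \<bullet> u t x) = (LINT x:\<Omega>|\<rho> t. f x \<bullet> v t x)"
proof -
  define U where "U = (\<lambda>t. LINT x:\<Omega>|\<rho> t. f x \<bullet> u t x)"
  define V where "V = (\<lambda>t. LINT x:\<Omega>|\<rho> t. f x \<bullet> v t x)"
  have CEu: "set_integrable lborel {0..1} (\<lambda>t. a t * (LINT x:\<Omega>|\<rho> t. f x \<bullet> u t x)) \<and>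
      (LINT t:{0..1}|lborel. (LINT x:\<Omega>|\<rho> t. a' t * \<psi> x))
              + (LINT t:{0..1}|lborel. a t * (LINT x:\<Omega>|\<rho> t. f x \<bullet> u t x))
            = (LINT x:\<Omega>|\<rho> 1. a 1 * \<psi> x) - (LINT x:\<Omega>|\<rho> 0. a 0 * \<psi> x)"
    if "u \<in> CE \<Omega> \<rho>" and a: "\<And>t. (a has_real_derivative a' t) (at t)" and a': "continuous_on UNIV a'"
    for u a a'
  proof -
    have e: "(LINT x:\<Omega>|\<rho> t. (a t *\<^sub>R f x) \<bullet> u t x) = a t * (LINT x:\<Omega>|\<rho> t. f x \<bullet> u t x)" for t
      by (simp add: set_integral_mult_right)
    have "\<forall>\<phi> \<phi>t \<phi>x. C1_test \<Omega> \<phi> \<phi>t \<phi>x \<longrightarrow>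
            set_integrable lborel {0..1} (\<lambda>t. LINT x:\<Omega>|\<rho> t. \<phi>x (t, x) \<bullet> u t x) \<and>
            (LINT t:{0..1}|lborel. (LINT x:\<Omega>|\<rho> t. \<phi>t (t, x)))
              + (LINT t:{0..1}|lborel. (LINT x:\<Omega>|\<rho> t. \<phi>x (t, x) \<bullet> u t x))
            = (LINT x:\<Omega>|\<rho> 1. \<phi> (1, x)) - (LINT x:\<Omega>|\<rho> 0. \<phi> (0, x))"
      using that(1) unfolding CE_def by blast
    from this[rule_format, OF C1_test_product[OF \<psi> f a a']]
    show ?thesis unfolding prod.case e .
  qed
  \<comment> \<open>The constant weight a = 1 yields the integrability of the slice integrals
    themselves.\<close>
  have intU: "set_integrable lborel {0..1} U" and intV: "set_integrable lborel {0..1} V"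
    using CEu[OF u, of "\<lambda>_. 1" "\<lambda>_. 0"] CEu[OF v, of "\<lambda>_. 1" "\<lambda>_. 0"] by (simp_all add: U_def V_def)
  have "AE t in lborel. t \<in> {0..1} \<longrightarrow> U t - V t = 0"
  proof (rule ae_zero_if_C1_weighted_integrals_zero)
    show "set_integrable lborel {0..1} (\<lambda>t. U t - V t)"
      using intU intV by (rule set_integral_diff)
    fix a a' :: "real \<Rightarrow> real"
    assume a: "\<And>t. (a has_real_derivative a' t) (at t)" and a': "continuous_on UNIV a'"
    from CEu[OF u a a'] CEu[OF v a a']
    have "set_integrable lborel {0..1} (\<lambda>t. a t * U t)" "set_integrable lborel {0..1} (\<lambda>t. a t * V t)"
      "(LINT t:{0..1}|lborel. a t * U t) = (LINT t:{0..1}|lborel. a t * V t)"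
      by (simp_all add: U_def V_def)
    then show "(LINT t:{0..1}|lborel. a t * (U t - V t)) = 0"
      by (simp add: right_diff_distrib set_integral_diff)
  qed
  then show ?thesis by eventually_elim (simp add: U_def V_def)
qed

section \<open>Comparison of the transported field with any competitor\<close>

context transported_family
begin

lemma CE_slice_borel:
  assumes u: "u \<in> CE \<Omega> \<rho>" and t: "t \<in> {0..1}"
  shows "(\<lambda>x. indicator \<Omega> x *\<^sub>R u t x) \<in> borel_measurable borel"
proof -
  have um: "(\<lambda>(t, x). u t x) \<in> borel_measurable (restrict_space borel ({0..1} \<times> \<Omega>))"
    using u by (simp add: CE_def)
  have "(\<lambda>x. (t, x)) \<in> restrict_space borel \<Omega> \<rightarrow>\<^sub>M restrict_space borel ({0..1} \<times> \<Omega>)"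
  proof (rule measurable_restrict_space2)
    show "(\<lambda>x. (t, x)) \<in> space (restrict_space borel \<Omega>) \<rightarrow> {0..1} \<times> \<Omega>"
      using t by (auto simp: space_restrict_space)
    show "(\<lambda>x. (t, x)) \<in> restrict_space borel \<Omega> \<rightarrow>\<^sub>M borel"
      by (rule measurable_restrict_space1) (intro borel_measurable_Pair, auto)
  qed
  from measurable_compose[OF this um] have "u t \<in> borel_measurable (restrict_space borel \<Omega>)" by simp
  then show ?thesis by (subst (asm) borel_measurable_restrict_space_iff) auto
qed

text \<open>Orthogonality makes the inner product of \<open>w t\<close> with \<open>u t\<close>
  equal to the squared norm of \<open>w t\<close>. The pointwise inequality between a product and
  the mean of the squares then bounds this by half the sum of the two squared norms.\<close>

lemma energy_density_le:
  assumes t: "t \<in> good" and u: "u \<in> CE \<Omega> \<rho>"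
    and orth: "(LINT x:\<Omega>|\<rho> t. w t x \<bullet> u t x) = (LINT x:\<Omega>|\<rho> t. w t x \<bullet> v t x)"
  shows "(L2_enorm (\<rho> t) (w t))\<^sup>2 \<le> (L2_enorm (\<rho> t) (u t))\<^sup>2"
proof -
  have t01: "t \<in> {0..1}" using good_interval[OF t] .
  interpret R: prob_space "\<rho> t" by (rule \<rho>_prob[OF t01])
  have [measurable_cong]: "sets (\<rho> t) = sets borel" by (rule \<rho>_sets[OF t01])
  \<comment> \<open>Members of \<open>CE\<close> are measurable on \<Omega> only; extension by zero
    changes no integral against \<rho> t.\<close>
  define \<upsilon> where "\<upsilon> = (\<lambda>x. indicator \<Omega> x *\<^sub>R u t x)"
  have [measurable]: "\<upsilon> \<in> borel_measurable borel" unfolding \<upsilon>_def by (rule CE_slice_borel[OF u t01])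
  have [measurable]: "w t \<in> borel_measurable borel"
  proof (intro borel_measurable_continuous_onI lipschitz_on_continuous_on[of C])
    show "C-lipschitz_on UNIV (w t)"
      using good_lipschitz[OF t] C_nonneg by (intro lipschitz_onI) (auto simp: dist_norm)
  qed
  have ae\<Omega>: "AE x in \<rho> t. x \<in> \<Omega>" by (rule prob_measures_on_AE[OF prob[OF t01]]) auto
  have aev: "AE x in \<rho> t. v t x = w t x"
    unfolding \<rho>_eq_distr[OF t01]
  proof (subst AE_distr_iff)
    show "AE x in \<rho> 0. v t (X t x) = w t (X t x)"
      using AE_staying by eventually_elim (use t01 v_flow[OF t] staying_subset in \<open>auto simp: X_eq\<close>)
  qed measurable
  have eu: "(L2_enorm (\<rho> t) (u t))\<^sup>2 = (\<integral>\<^sup>+x. ennreal ((norm (\<upsilon> x))\<^sup>2) \<partial>\<rho> t)"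
    unfolding L2_enorm_power2 by (rule nn_integral_cong_AE, use ae\<Omega> in eventually_elim) (simp add: \<upsilon>_def)
  have "L2_enorm (\<rho> t) (u t) < \<infinity>" using u t01 by (simp add: CE_def)
  then have "(L2_enorm (\<rho> t) (u t))\<^sup>2 < \<infinity>"
    by (simp add: power_less_top_ennreal)
  then have iu: "integrable (\<rho> t) (\<lambda>x. (norm (\<upsilon> x))\<^sup>2)"
    unfolding eu by (intro integrableI_bounded) auto
  have iw: "integrable (\<rho> t) (\<lambda>x. (norm (w t x))\<^sup>2)"
    by (rule R.integrable_const_bound[where B = "C\<^sup>2"]) (auto intro!: power_mono good_bound[OF t])
  have pt: "\<bar>w t x \<bullet> \<upsilon> x\<bar> \<le> ((norm (w t x))\<^sup>2 + (norm (\<upsilon> x))\<^sup>2) / 2" for x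
  proof -
    have "\<bar>w t x \<bullet> \<upsilon> x\<bar> \<le> norm (w t x) * norm (\<upsilon> x)" by (rule Cauchy_Schwarz_ineq2)
    then show ?thesis using sum_squares_bound[of "norm (w t x)" "norm (\<upsilon> x)"] by simp
  qed
  have iwu: "integrable (\<rho> t) (\<lambda>x. w t x \<bullet> \<upsilon> x)"
    by (rule Bochner_Integration.integrable_bound[of _ "\<lambda>x. ((norm (w t x))\<^sup>2 + (norm (\<upsilon> x))\<^sup>2) / 2"])
      (use iu iw pt in \<open>auto intro!: AE_I2\<close>)
  define J where "J = (LINT x|\<rho> t. (norm (w t x))\<^sup>2)"
  have "J = (LINT x:\<Omega>|\<rho> t. w t x \<bullet> v t x)"
    unfolding J_def set_lebesgue_integral_def
    by (rule integral_cong_AE, measurable, use ae\<Omega> aev in eventually_elim)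
      (simp add: power2_norm_eq_inner)
  also have "\<dots> = (LINT x:\<Omega>|\<rho> t. w t x \<bullet> u t x)" using orth by simp
  also have "\<dots> = (LINT x|\<rho> t. w t x \<bullet> \<upsilon> x)"
    unfolding set_lebesgue_integral_def by (intro Bochner_Integration.integral_cong) (auto simp: \<upsilon>_def)
  also have "\<dots> \<le> (LINT x|\<rho> t. ((norm (w t x))\<^sup>2 + (norm (\<upsilon> x))\<^sup>2) / 2)"
  proof (rule integral_mono[OF iwu])
    show "integrable (\<rho> t) (\<lambda>x. ((norm (w t x))\<^sup>2 + (norm (\<upsilon> x))\<^sup>2) / 2)" using iu iw by auto
    show "w t x \<bullet> \<upsilon> x \<le> ((norm (w t x))\<^sup>2 + (norm (\<upsilon> x))\<^sup>2) / 2" for x using pt[of x] by linarith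
  qed
  also have "\<dots> = (J + (LINT x|\<rho> t. (norm (\<upsilon> x))\<^sup>2)) / 2"
    using iu iw by (simp add: J_def)
  finally have "J \<le> (LINT x|\<rho> t. (norm (\<upsilon> x))\<^sup>2)" by simp
  then have "ennreal J \<le> ennreal (LINT x|\<rho> t. (norm (\<upsilon> x))\<^sup>2)" by (rule ennreal_leI)
  then show ?thesis
    unfolding eu unfolding L2_enorm_power2 J_def
    using nn_integral_eq_integral[OF iu] nn_integral_eq_integral[OF iw] by simp
qed

text \<open>\<open>CE_difference_orthogonal\<close> has exceptional times that depend on the field,
  so \<open>w t\<close> cannot be tested directly at time t. Countably many fields
  \<open>w s\<close> share one null set of times, and at a time outside it \<open>w t\<close> is a
  pointwise limit of such fields; dominated convergence carries the identity over.\<close>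

lemma energy_ge:
  assumes grad: "AE t in lborel. t \<in> {0..1} \<longrightarrow> gradient_field (w t)" and u: "u \<in> CE \<Omega> \<rho>"
  shows "(\<integral>\<^sup>+t\<in>{0..1}. (L2_enorm (\<rho> t) (w t))\<^sup>2 \<partial>lborel) \<le> (\<integral>\<^sup>+t\<in>{0..1}. (L2_enorm (\<rho> t) (u t))\<^sup>2 \<partial>lborel)"
proof -
  define T where "T = {t\<in>good. gradient_field (w t)}"
  have aeT: "AE t in lborel. t \<in> {0..1} \<longrightarrow> t \<in> T"
    using grad good_AE by eventually_elim (auto simp: T_def)
  have cw: "continuous_on UNIV (w t)" if "t \<in> T" for t
  proof (rule lipschitz_on_continuous_on[of C])
    show "C-lipschitz_on UNIV (w t)"
      using good_lipschitz[of t] that C_nonneg by (intro lipschitz_onI) (auto simp: dist_norm T_def)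
  qed
  obtain T' where T': "countable T'" "T' \<subseteq> T"
    "\<And>t. t \<in> T \<Longrightarrow> \<exists>s. (\<forall>k::nat. s k \<in> T') \<and> (\<forall>x. (\<lambda>k. w (s k) x) \<longlonglongrightarrow> w t x)"
    using countable_pointwise_dense_lipschitz[OF C_nonneg, of T w] good_lipschitz
    by (auto simp: T_def)
  have "AE t in lborel. t \<in> {0..1} \<longrightarrow> (LINT x:\<Omega>|\<rho> t. w s x \<bullet> u t x) = (LINT x:\<Omega>|\<rho> t. w s x \<bullet> v t x)"
    if "s \<in> T'" for s
  proof -
    have sT: "s \<in> T" using that T' by blast
    then obtain \<psi> where "\<And>x. (\<psi> has_derivative (\<lambda>h. w s x \<bullet> h)) (at x)"
      by (auto simp: T_def gradient_field_def)
    then show ?thesis by (rule CE_difference_orthogonal[OF u v_in_CE _ cw[OF sT]])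
  qed
  then have "AE t in lborel. \<forall>s\<in>T'. t \<in> {0..1} \<longrightarrow> (LINT x:\<Omega>|\<rho> t. w s x \<bullet> u t x) = (LINT x:\<Omega>|\<rho> t. w s x \<bullet> v t x)"
    unfolding AE_ball_countable[OF T'(1)] by blast
  with aeT have "AE t in lborel. t \<in> {0..1} \<longrightarrow> (L2_enorm (\<rho> t) (w t))\<^sup>2 \<le> (L2_enorm (\<rho> t) (u t))\<^sup>2"
  proof (rule eventually_elim2, intro impI)
    fix t :: real
    assume 1: "t \<in> {0..1} \<longrightarrow> t \<in> T"
      and 2: "\<forall>s\<in>T'. t \<in> {0..1} \<longrightarrow> (LINT x:\<Omega>|\<rho> t. w s x \<bullet> u t x) = (LINT x:\<Omega>|\<rho> t. w s x \<bullet> v t x)"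
      and t01: "t \<in> {0..1}"
    have t: "t \<in> T" "t \<in> good" using 1 t01 by (auto simp: T_def)
    interpret R: prob_space "\<rho> t" by (rule \<rho>_prob[OF t01])
    have [measurable_cong]: "sets (\<rho> t) = sets borel" by (rule \<rho>_sets[OF t01])
    obtain s where s: "\<And>k::nat. s k \<in> T'" "\<And>x. (\<lambda>k. w (s k) x) \<longlonglongrightarrow> w t x"
      using T'(3)[OF t(1)] by blast
    have wm: "w r \<in> borel_measurable borel" if "r \<in> T" for r
      using cw[OF that] by (rule borel_measurable_continuous_onI)
    have lim: "(\<lambda>k. LINT x:\<Omega>|\<rho> t. w (s k) x \<bullet> u' t x) \<longlonglongrightarrow> (LINT x:\<Omega>|\<rho> t. w t x \<bullet> u' t x)"
      if u': "u' \<in> CE \<Omega> \<rho>" for u'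
    proof -
      define \<upsilon> where "\<upsilon> = (\<lambda>x. indicator \<Omega> x *\<^sub>R u' t x)"
      have \<upsilon>[measurable]: "\<upsilon> \<in> borel_measurable borel" unfolding \<upsilon>_def by (rule CE_slice_borel[OF u' t01])
      have e: "(LINT x:\<Omega>|\<rho> t. w r x \<bullet> u' t x) = (LINT x|\<rho> t. w r x \<bullet> \<upsilon> x)" for r
        unfolding set_lebesgue_integral_def by (intro Bochner_Integration.integral_cong) (auto simp: \<upsilon>_def)
      have "L2_enorm (\<rho> t) (u' t) < \<infinity>" using u' t01 by (simp add: CE_def)
      then have "(L2_enorm (\<rho> t) (u' t))\<^sup>2 < \<infinity>" by (simp add: power_less_top_ennreal)
      moreover have "(\<integral>\<^sup>+x. ennreal ((norm (\<upsilon> x))\<^sup>2) \<partial>\<rho> t) \<le> (L2_enorm (\<rho> t) (u' t))\<^sup>2"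
        unfolding L2_enorm_power2 by (intro nn_integral_mono) (auto simp: \<upsilon>_def indicator_def)
      ultimately have "(\<integral>\<^sup>+x. ennreal ((norm (\<upsilon> x))\<^sup>2) \<partial>\<rho> t) < \<infinity>" by (rule le_less_trans[rotated])
      then have i2: "integrable (\<rho> t) (\<lambda>x. (norm (\<upsilon> x))\<^sup>2)" by (intro integrableI_bounded) auto
      have i1: "integrable (\<rho> t) (\<lambda>x. C * (1 + (norm (\<upsilon> x))\<^sup>2))" using i2 by auto
      \<comment> \<open>\<upsilon> is known to be square integrable, so its norm is majorised by 1
        plus its square, integrable since \<rho> t is finite.\<close>
      have bd: "\<bar>w (s k) x \<bullet> \<upsilon> x\<bar> \<le> C * (1 + (norm (\<upsilon> x))\<^sup>2)" for k x
      proof -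
        have "s k \<in> good" using s(1) T'(2) by (auto simp: T_def)
        then have "norm (w (s k) x) \<le> C" by (rule good_bound)
        moreover have "norm (\<upsilon> x) \<le> 1 + (norm (\<upsilon> x))\<^sup>2"
        proof -
          have "2 * norm (\<upsilon> x) \<le> 1 + (norm (\<upsilon> x))\<^sup>2"
            using sum_squares_bound[of 1 "norm (\<upsilon> x)"] by simp
          then show ?thesis using norm_ge_zero[of "\<upsilon> x"] by linarith
        qed
        ultimately have "norm (w (s k) x) * norm (\<upsilon> x) \<le> C * (1 + (norm (\<upsilon> x))\<^sup>2)"
          using C_nonneg by (intro mult_mono) auto
        then show ?thesis using Cauchy_Schwarz_ineq2 order_trans by blast
      qed
      show ?thesis
        unfolding e
      proof (rule integral_dominated_convergence[OF _ _ i1])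
        show "(\<lambda>x. w t x \<bullet> \<upsilon> x) \<in> borel_measurable (\<rho> t)"
          using wm[OF t(1)] by measurable
        show "(\<lambda>x. w (s k) x \<bullet> \<upsilon> x) \<in> borel_measurable (\<rho> t)" for k
        proof -
          have "s k \<in> T" using s(1) T'(2) by blast
          note wm[OF this, measurable]
          show ?thesis by measurable
        qed
        show "AE x in \<rho> t. (\<lambda>k. w (s k) x \<bullet> \<upsilon> x) \<longlonglongrightarrow> w t x \<bullet> \<upsilon> x"
          by (intro AE_I2 tendsto_inner s(2) tendsto_const)
        show "AE x in \<rho> t. norm (w (s k) x \<bullet> \<upsilon> x) \<le> C * (1 + (norm (\<upsilon> x))\<^sup>2)" for k
          using bd by (intro AE_I2) simp
      qed
    qed
    have "(LINT x:\<Omega>|\<rho> t. w (s k) x \<bullet> u t x) = (LINT x:\<Omega>|\<rho> t. w (s k) x \<bullet> v t x)" for k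
      using 2 s(1) t01 by blast
    with lim[OF u] have "(\<lambda>k. LINT x:\<Omega>|\<rho> t. w (s k) x \<bullet> v t x) \<longlonglongrightarrow> (LINT x:\<Omega>|\<rho> t. w t x \<bullet> u t x)" by simp
    then have "(LINT x:\<Omega>|\<rho> t. w t x \<bullet> u t x) = (LINT x:\<Omega>|\<rho> t. w t x \<bullet> v t x)"
      using lim[OF v_in_CE] by (rule LIMSEQ_unique)
    then show "(L2_enorm (\<rho> t) (w t))\<^sup>2 \<le> (L2_enorm (\<rho> t) (u t))\<^sup>2"
      by (rule energy_density_le[OF t(2) u])
  qed
  then have "AE t in lborel. (L2_enorm (\<rho> t) (w t))\<^sup>2 * indicator {0..1} t \<le> (L2_enorm (\<rho> t) (u t))\<^sup>2 * indicator {0..1} t"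
    by eventually_elim (auto simp: indicator_def)
  then show ?thesis by (rule nn_integral_mono_AE)
qed

lemma energy_eq:
  assumes "AE t in lborel. t \<in> {0..1} \<longrightarrow> gradient_field (w t)"
  shows "energy \<Omega> \<rho> = (\<integral>\<^sup>+t\<in>{0..1}. (L2_enorm (\<rho> t) (w t))\<^sup>2 \<partial>lborel)"
proof (rule antisym[OF energy_le])
  show "(\<integral>\<^sup>+t\<in>{0..1}. (L2_enorm (\<rho> t) (w t))\<^sup>2 \<partial>lborel) \<le> energy \<Omega> \<rho>"
    unfolding energy_def by (rule INF_greatest) (rule energy_ge[OF assms])
qed

end

subsection \<open>Uniqueness of geodesics\<close>

lemma gronwall:
  fixes Z :: "real \<Rightarrow> real"
  assumes ab: "a < b" and cont: "continuous_on {a..b} Z"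
    and der: "\<And>t. t \<in> {a<..<b} \<Longrightarrow> \<exists>z. (Z has_real_derivative z) (at t) \<and> z \<le> C * Z t"
  shows "Z b \<le> exp (C * (b - a)) * Z a"
proof -
  define h where "h = (\<lambda>t. exp (- C * (t - a)) * Z t)"
  have "h a \<ge> h b"
  proof (rule DERIV_nonpos_imp_decreasing_open[OF less_imp_le[OF ab]])
    fix t assume "a < t" "t < b"
    then obtain z where z: "(Z has_real_derivative z) (at t)" "z \<le> C * Z t" using der[of t] by auto
    have "(h has_real_derivative (exp (- C * (t - a)) * (z - C * Z t))) (at t)"
      unfolding h_def by (rule derivative_eq_intros z(1) refl)+ (simp add: algebra_simps)
    moreover have "exp (- C * (t - a)) * (z - C * Z t) \<le> 0"
      using z(2) by (intro mult_nonneg_nonpos) auto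
    ultimately show "\<exists>y. (h has_real_derivative y) (at t) \<and> y \<le> 0" by blast
  next
    show "continuous_on {a..b} h"
      unfolding h_def by (intro continuous_intros cont)
  qed
  then have "exp (- C * (b - a)) * Z b \<le> Z a" by (simp add: h_def)
  then have "exp (C * (b - a)) * (exp (- C * (b - a)) * Z b) \<le> exp (C * (b - a)) * Z a"
    by (intro mult_left_mono) auto
  then show ?thesis by (simp add: mult.assoc[symmetric] exp_add[symmetric])
qed

lemma linear_functional_bound:
  fixes f :: "'e::euclidean_space \<Rightarrow> real" and M :: real
  assumes f: "linear f" and M: "\<And>b. b \<in> Basis \<Longrightarrow> \<bar>f b\<bar> \<le> M"
  shows "\<bar>f u\<bar> \<le> DIM('e) * M * norm u"
proof -
  have "f u = f (\<Sum>b\<in>Basis. (u \<bullet> b) *\<^sub>R b)" by (simp add: euclidean_representation)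
  also have "\<dots> = (\<Sum>b\<in>Basis. (u \<bullet> b) * f b)"
    by (simp add: linear_sum[OF f] linear_cmul[OF f])
  finally have "\<bar>f u\<bar> \<le> (\<Sum>b\<in>Basis. \<bar>(u \<bullet> b) * f b\<bar>)" by (simp only: sum_abs)
  also have "\<dots> \<le> (\<Sum>b\<in>(Basis::'e set). norm u * M)"
    using M by (intro sum_mono) (auto simp: abs_mult intro!: mult_mono Basis_le_norm)
  finally show ?thesis by (simp add: algebra_simps)
qed

lemma Ck_on_1_cball_bound:
  fixes f :: "'e::euclidean_space \<Rightarrow> real"
  assumes f: "Ck_on (Suc 0) U f" and U: "open U" "cball x\<^sub>0 r \<subseteq> U"
  shows "\<exists>M\<ge>0. (\<forall>x\<in>cball x\<^sub>0 r. \<bar>f x\<bar> \<le> M) \<and> (\<forall>x\<in>cball x\<^sub>0 r. \<forall>y\<in>cball x\<^sub>0 r. \<bar>f x - f y\<bar> \<le> M * norm (x - y))"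
proof -
  have d: "(f has_derivative frechet_derivative f (at x)) (at x)" if "x \<in> U" for x
    using f that U(1) by (simp add: differentiable_on_eq_differentiable_at frechet_derivative_works)
  have c: "continuous_on U (\<lambda>x. frechet_derivative f (at x) h)" for h
    using f by simp
  have "\<exists>M. \<forall>x\<in>cball x\<^sub>0 r. \<bar>frechet_derivative f (at x) b\<bar> \<le> M" for b
  proof -
    have "compact ((\<lambda>x. frechet_derivative f (at x) b) ` cball x\<^sub>0 r)"
      by (intro compact_continuous_image continuous_on_subset[OF c U(2)] compact_cball)
    from compact_imp_bounded[OF this] show ?thesis by (auto simp: bounded_iff)
  qed
  then obtain N where N: "\<And>b x. x \<in> cball x\<^sub>0 r \<Longrightarrow> \<bar>frechet_derivative f (at x) b\<bar> \<le> N b" by metis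
  define N' where "N' = (\<Sum>b\<in>Basis. \<bar>N b\<bar>)"
  have N': "\<bar>frechet_derivative f (at x) b\<bar> \<le> N'" if "x \<in> cball x\<^sub>0 r" "b \<in> Basis" for x b
  proof -
    have "\<bar>frechet_derivative f (at x) b\<bar> \<le> \<bar>N b\<bar>" using N[OF that(1), of b] by linarith
    also have "\<dots> \<le> N'" unfolding N'_def by (rule member_le_sum[OF that(2)]) auto
    finally show ?thesis .
  qed
  have N0: "N' \<ge> 0" by (simp add: N'_def sum_nonneg)
  have "compact (f ` cball x\<^sub>0 r)"
    using d U(2) by (intro compact_continuous_image compact_cball continuous_at_imp_continuous_on)
      (meson has_derivative_continuous subsetD)
  then obtain B where B: "\<And>x. x \<in> cball x\<^sub>0 r \<Longrightarrow> \<bar>f x\<bar> \<le> B"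
    using compact_imp_bounded[of "f ` cball x\<^sub>0 r"] by (auto simp: bounded_iff simp del: mem_cball)
  have lip: "\<bar>f x - f y\<bar> \<le> DIM('e) * N' * norm (x - y)" if "x \<in> cball x\<^sub>0 r" "y \<in> cball x\<^sub>0 r" for x y
  proof -
    have "norm (f x - f y) \<le> (DIM('e) * N') * norm (x - y)"
    proof (rule differentiable_bound[of "cball x\<^sub>0 r"])
      fix z assume z: "z \<in> cball x\<^sub>0 r"
      show "(f has_derivative frechet_derivative f (at z)) (at z within cball x\<^sub>0 r)"
        using d z U(2) by (blast intro: has_derivative_at_withinI)
      have "linear (frechet_derivative f (at z))"
        using d z U(2) has_derivative_linear by blast
      then show "onorm (frechet_derivative f (at z)) \<le> DIM('e) * N'"
        using linear_functional_bound N'[OF z] by (intro onorm_le) (auto simp: )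
    qed (use that in auto)
    then show ?thesis by simp
  qed
  show ?thesis
  proof (intro exI[of _ "max \<bar>B\<bar> (DIM('e) * N')"] conjI ballI)
    fix x y assume xy: "x \<in> cball x\<^sub>0 r" "y \<in> cball x\<^sub>0 r"
    show "\<bar>f x - f y\<bar> \<le> max \<bar>B\<bar> (DIM('e) * N') * norm (x - y)"
      using lip[OF xy] by (rule order_trans) (intro mult_right_mono, auto)
  next
    fix x assume "x \<in> cball x\<^sub>0 r"
    then show "\<bar>f x\<bar> \<le> max \<bar>B\<bar> (DIM('e) * N')" using B[of x] by linarith
  qed auto
qed

lemma smooth_on_Ck: "smooth_on U f \<Longrightarrow> Ck_on k U f"
  by (simp add: smooth_on_def)

lemma smooth_on_derivative: "smooth_on U f \<Longrightarrow> Ck_on k U (\<lambda>x. frechet_derivative f (at x) h)"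
  using smooth_on_Ck[of U f "Suc k"] by simp

lemma smooth_on_has_derivative:
  assumes "smooth_on U f" "open U" "x \<in> U"
  shows "(f has_derivative frechet_derivative f (at x)) (at x)"
  using smooth_on_Ck[OF assms(1), of "Suc 0"] assms(2,3)
  by (simp add: differentiable_on_eq_differentiable_at frechet_derivative_works)

section \<open>A smooth metric on an open set of coordinates, and quantitative bounds for its
  Christoffel vectors\<close>

locale chart_metric =
  fixes U :: "'e::euclidean_space set" and G :: "'e \<Rightarrow> 'e \<Rightarrow> 'e \<Rightarrow> real"
  assumes U_open: "open U"
    and G_linear: "\<And>x w. x \<in> U \<Longrightarrow> linear (\<lambda>u. G x u w)"
    and G_sym: "\<And>x u w. x \<in> U \<Longrightarrow> G x u w = G x w u"
    and G_pos: "\<And>x u. x \<in> U \<Longrightarrow> u \<noteq> 0 \<Longrightarrow> G x u u > 0"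
    and G_smooth: "\<And>u w. smooth_on U (\<lambda>x. G x u w)"
begin

definition DG :: "'e \<Rightarrow> 'e \<Rightarrow> 'e \<Rightarrow> 'e \<Rightarrow> real" where
  "DG x h u w = frechet_derivative (\<lambda>y. G y u w) (at x) h"

definition koszul :: "'e \<Rightarrow> 'e \<Rightarrow> 'e \<Rightarrow> 'e \<Rightarrow> real" where
  "koszul x u v w = DG x u v w + DG x v u w - DG x w u v"

text \<open>The same vector as \<open>christoffel\<close>, formed for an abstract metric so that it
  can be studied apart from manifolds; \<open>christoffel_eq\<close> links the two.\<close>

definition \<Gamma> :: "'e \<Rightarrow> 'e \<Rightarrow> 'e \<Rightarrow> 'e" where
  "\<Gamma> x u v = (THE z. \<forall>w. 2 * G x z w = koszul x u v w)"

lemma G_linear2: "x \<in> U \<Longrightarrow> linear (\<lambda>w. G x u w)"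
  using G_linear[of x u] G_sym[of x u] by simp

lemma DG_has_derivative: "x \<in> U \<Longrightarrow> ((\<lambda>y. G y u w) has_derivative (\<lambda>h. DG x h u w)) (at x)"
  using smooth_on_has_derivative[OF G_smooth U_open, of x u w] by (simp add: DG_def[abs_def])

lemma DG_eqI: "x \<in> U \<Longrightarrow> ((\<lambda>y. G y u w) has_derivative f) (at x) \<Longrightarrow> DG x h u w = f h"
  using has_derivative_unique[OF DG_has_derivative] by metis

lemma DG_sym: "x \<in> U \<Longrightarrow> DG x h u w = DG x h w u"
proof (rule DG_eqI)
  assume x: "x \<in> U"
  show "((\<lambda>y. G y u w) has_derivative (\<lambda>h. DG x h w u)) (at x)"
    by (rule has_derivative_transform_within_open[OF DG_has_derivative[OF x] U_open x]) (rule G_sym)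
qed

lemma DG_linear1: "x \<in> U \<Longrightarrow> linear (\<lambda>h. DG x h u w)"
  using DG_has_derivative has_derivative_linear by blast

lemma DG_linear2:
  assumes x: "x \<in> U"
  shows "linear (\<lambda>u. DG x h u w)"
proof (rule linearI)
  fix u v
  have "((\<lambda>y. G y u w + G y v w) has_derivative (\<lambda>h. DG x h u w + DG x h v w)) (at x)"
    by (intro has_derivative_add DG_has_derivative x)
  then have "((\<lambda>y. G y (u + v) w) has_derivative (\<lambda>h. DG x h u w + DG x h v w)) (at x)"
    by (rule has_derivative_transform_within_open[OF _ U_open x]) (simp add: linear_add[OF G_linear])
  then show "DG x h (u + v) w = DG x h u w + DG x h v w" by (rule DG_eqI[OF x])
next
  fix r u
  have "((\<lambda>y. r * G y u w) has_derivative (\<lambda>h. r * DG x h u w)) (at x)"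
    by (intro has_derivative_mult_right DG_has_derivative x)
  then have "((\<lambda>y. G y (r *\<^sub>R u) w) has_derivative (\<lambda>h. r * DG x h u w)) (at x)"
    by (rule has_derivative_transform_within_open[OF _ U_open x]) (simp add: linear_cmul[OF G_linear])
  then show "DG x h (r *\<^sub>R u) w = r *\<^sub>R DG x h u w" using DG_eqI[OF x] by simp
qed

lemma DG_linear3: "x \<in> U \<Longrightarrow> linear (\<lambda>w. DG x h u w)"
  using DG_linear2[of x h u] DG_sym[of x h u] by simp

lemma koszul_linear3: "x \<in> U \<Longrightarrow> linear (\<lambda>w. koszul x u v w)"
  unfolding koszul_def by (intro linear_compose_sub linear_compose_add DG_linear3 DG_linear1)

lemma G_nondegenerate: "x \<in> U \<Longrightarrow> (\<And>w. G x z w = 0) \<Longrightarrow> z = 0"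
  using G_pos[of x z] by fastforce

text \<open>The linear map taking z to the coordinates of the functional G x z is injective by
  positivity, hence surjective in finite dimension.\<close>

lemma riesz:
  assumes x: "x \<in> U" and f: "linear f"
  shows "\<exists>z. \<forall>w. G x z w = f w"
proof -
  define T where "T = (\<lambda>z. \<Sum>b\<in>Basis. G x z b *\<^sub>R b)"
  have T: "linear T"
    unfolding T_def
    by (rule linearI) (simp_all add: linear_add[OF G_linear[OF x]] linear_cmul[OF G_linear[OF x]]
        scaleR_add_left sum.distrib scaleR_sum_right)
  have Tb: "T z \<bullet> b = G x z b" if "b \<in> Basis" for z b
    using that by (simp add: T_def inner_sum_left inner_Basis if_distrib cong: if_cong)
  have expand: "G x z w = (\<Sum>b\<in>Basis. (w \<bullet> b) * G x z b)" for z w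
  proof -
    have "G x z w = G x z (\<Sum>b\<in>Basis. (w \<bullet> b) *\<^sub>R b)" by (simp add: euclidean_representation)
    then show ?thesis by (simp add: linear_sum[OF G_linear2[OF x]] linear_cmul[OF G_linear2[OF x]])
  qed
  have "inj T"
  proof (subst linear_injective_0[OF T], intro allI impI)
    fix z assume "T z = 0"
    then have "G x z b = 0" if "b \<in> Basis" for b using Tb[OF that, of z] by simp
    then have "G x z w = 0" for w by (subst expand) simp
    then show "z = 0" by (rule G_nondegenerate[OF x])
  qed
  then have "surj T" using T linear_injective_imp_surjective by blast
  then obtain z where z: "T z = (\<Sum>b\<in>Basis. f b *\<^sub>R b)" by (metis surjD)
  have "G x z b = f b" if b: "b \<in> Basis" for b
    using Tb[OF b, of z] b by (simp add: z inner_sum_left inner_Basis if_distrib cong: if_cong)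
  then have "G x z w = f w" for w
    unfolding expand[of z w] using linear_sum[OF f, of "\<lambda>b. (w \<bullet> b) *\<^sub>R b" Basis]
    by (simp add: euclidean_representation linear_cmul[OF f])
  then show ?thesis by blast
qed

lemma \<Gamma>_eqI:
  assumes x: "x \<in> U" and "\<And>w. 2 * G x z w = koszul x u v w"
  shows "\<Gamma> x u v = z"
  unfolding \<Gamma>_def
proof (rule the_equality)
  show "\<forall>w. 2 * G x z w = koszul x u v w" using assms by blast
  fix y assume "\<forall>w. 2 * G x y w = koszul x u v w"
  then have "G x y w = G x z w" for w using assms(2)[of w] by (metis mult_left_cancel zero_neq_numeral)
  then have "G x (y - z) w = 0" for w by (simp add: linear_diff[OF G_linear[OF x]])
  then have "y - z = 0" by (rule G_nondegenerate[OF x])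
  then show "y = z" by simp
qed

lemma \<Gamma>_koszul:
  assumes x: "x \<in> U"
  shows "2 * G x (\<Gamma> x u v) w = koszul x u v w"
proof -
  obtain z where z: "\<And>w. G x z w = koszul x u v w / 2"
    using riesz[OF x, of "\<lambda>w. koszul x u v w / 2"] linear_compose_scale_right[OF koszul_linear3[OF x], of "1/2" u v]
    by auto
  then have "\<Gamma> x u v = z" by (intro \<Gamma>_eqI[OF x]) (simp add: z)
  then show ?thesis using z[of w] by (simp only:)
qed

lemma \<Gamma>_scale: "x \<in> U \<Longrightarrow> \<Gamma> x (s *\<^sub>R u) (s *\<^sub>R u) = s\<^sup>2 *\<^sub>R \<Gamma> x u u"
proof (rule \<Gamma>_eqI)
  fix w assume x: "x \<in> U"
  have "2 * G x (s\<^sup>2 *\<^sub>R \<Gamma> x u u) w = s\<^sup>2 * koszul x u u w"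
    using \<Gamma>_koszul[OF x, of u u w] by (simp add: linear_cmul[OF G_linear[OF x]])
  also have "\<dots> = koszul x (s *\<^sub>R u) (s *\<^sub>R u) w"
    by (simp add: koszul_def linear_cmul[OF DG_linear1[OF x]] linear_cmul[OF DG_linear2[OF x]]
        linear_cmul[OF DG_linear3[OF x]] power2_eq_square algebra_simps)
  finally show "2 * G x (s\<^sup>2 *\<^sub>R \<Gamma> x u u) w = koszul x (s *\<^sub>R u) (s *\<^sub>R u) w" .
qed

text \<open>Compactness bounds the finitely many coefficients on basis vectors and their increments;
  multilinearity extends the bounds to all vectors at the cost of powers of the dimension.\<close>

lemma coefficient_bounds:
  assumes r: "cball x\<^sub>0 r \<subseteq> U"
  obtains M where "M \<ge> 0"
    "\<And>x u w. x \<in> cball x\<^sub>0 r \<Longrightarrow> \<bar>G x u w\<bar> \<le> M * norm u * norm w"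
    "\<And>x h u w. x \<in> cball x\<^sub>0 r \<Longrightarrow> \<bar>DG x h u w\<bar> \<le> M * norm h * norm u * norm w"
    "\<And>x y u w. x \<in> cball x\<^sub>0 r \<Longrightarrow> y \<in> cball x\<^sub>0 r \<Longrightarrow>
       \<bar>G x u w - G y u w\<bar> \<le> M * norm (x - y) * norm u * norm w"
    "\<And>x y h u w. x \<in> cball x\<^sub>0 r \<Longrightarrow> y \<in> cball x\<^sub>0 r \<Longrightarrow>
       \<bar>DG x h u w - DG y h u w\<bar> \<le> M * norm (x - y) * norm h * norm u * norm w"
proof -
  let ?B = "cball x\<^sub>0 r"
  have "\<exists>M\<ge>0. (\<forall>x\<in>?B. \<bar>G x i j\<bar> \<le> M) \<and> (\<forall>x\<in>?B. \<forall>y\<in>?B. \<bar>G x i j - G y i j\<bar> \<le> M * norm (x - y))" for i j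
    by (rule Ck_on_1_cball_bound[OF smooth_on_Ck[OF G_smooth] U_open r])
  then obtain M1 where M1: "\<And>i j. M1 i j \<ge> 0" "\<And>i j x. x \<in> ?B \<Longrightarrow> \<bar>G x i j\<bar> \<le> M1 i j"
    "\<And>i j x y. x \<in> ?B \<Longrightarrow> y \<in> ?B \<Longrightarrow> \<bar>G x i j - G y i j\<bar> \<le> M1 i j * norm (x - y)" by metis
  have "\<exists>M\<ge>0. (\<forall>x\<in>?B. \<bar>DG x h i j\<bar> \<le> M) \<and> (\<forall>x\<in>?B. \<forall>y\<in>?B. \<bar>DG x h i j - DG y h i j\<bar> \<le> M * norm (x - y))" for h i j
    unfolding DG_def by (rule Ck_on_1_cball_bound[OF smooth_on_derivative[OF G_smooth] U_open r])
  then obtain M2 where M2: "\<And>h i j. M2 h i j \<ge> 0" "\<And>h i j x. x \<in> ?B \<Longrightarrow> \<bar>DG x h i j\<bar> \<le> M2 h i j"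
    "\<And>h i j x y. x \<in> ?B \<Longrightarrow> y \<in> ?B \<Longrightarrow> \<bar>DG x h i j - DG y h i j\<bar> \<le> M2 h i j * norm (x - y)" by metis
  define N where "N = (\<Sum>i\<in>Basis. \<Sum>j\<in>Basis. M1 i j) + (\<Sum>h\<in>Basis. \<Sum>i\<in>Basis. \<Sum>j\<in>Basis. M2 h i j)"
  have s1: "(\<Sum>i\<in>Basis. \<Sum>j\<in>Basis. M1 i j) \<ge> 0" and s2: "(\<Sum>h\<in>Basis. \<Sum>i\<in>Basis. \<Sum>j\<in>Basis. M2 h i j) \<ge> 0"
    using M1(1) M2(1) by (simp_all add: sum_nonneg)
  have N0: "N \<ge> 0" using s1 s2 by (simp add: N_def)
  have N1: "M1 i j \<le> N" if "i \<in> Basis" "j \<in> Basis" for i j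
  proof -
    have "M1 i j \<le> (\<Sum>j\<in>Basis. M1 i j)" by (rule member_le_sum[OF that(2)]) (auto simp: M1(1))
    also have "\<dots> \<le> (\<Sum>i\<in>Basis. \<Sum>j\<in>Basis. M1 i j)"
      by (rule member_le_sum[OF that(1), of "\<lambda>i. \<Sum>j\<in>Basis. M1 i j"]) (auto simp: M1(1) sum_nonneg)
    finally show ?thesis using s2 by (simp add: N_def)
  qed
  have N2: "M2 h i j \<le> N" if "h \<in> Basis" "i \<in> Basis" "j \<in> Basis" for h i j
  proof -
    have "M2 h i j \<le> (\<Sum>j\<in>Basis. M2 h i j)" by (rule member_le_sum[OF that(3)]) (auto simp: M2(1))
    also have "\<dots> \<le> (\<Sum>i\<in>Basis. \<Sum>j\<in>Basis. M2 h i j)"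
      by (rule member_le_sum[OF that(2), of "\<lambda>i. \<Sum>j\<in>Basis. M2 h i j"]) (auto simp: M2(1) sum_nonneg)
    also have "\<dots> \<le> (\<Sum>h\<in>Basis. \<Sum>i\<in>Basis. \<Sum>j\<in>Basis. M2 h i j)"
      by (rule member_le_sum[OF that(1), of "\<lambda>h. \<Sum>i\<in>Basis. \<Sum>j\<in>Basis. M2 h i j"]) (auto simp: M2(1) sum_nonneg)
    finally show ?thesis using s1 by (simp add: N_def)
  qed
  define n where "n = real DIM('e)"
  have n1: "n \<ge> 1" by (simp add: n_def Suc_leI)
  have bilin: "\<bar>T u w\<bar> \<le> n * n * c * norm u * norm w"
    if lin: "\<And>w. linear (\<lambda>u. T u w)" "\<And>u. linear (T u)" "\<And>i j. i \<in> Basis \<Longrightarrow> j \<in> Basis \<Longrightarrow> \<bar>T i j\<bar> \<le> c"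
    for T :: "'e \<Rightarrow> 'e \<Rightarrow> real" and c u w
  proof -
    have "\<bar>T i w\<bar> \<le> n * c * norm w" if i: "i \<in> Basis" for i
      using linear_functional_bound[of "T i" c w] lin(2) lin(3)[OF i] by (simp add: n_def)
    from linear_functional_bound[OF lin(1) this, of u] show ?thesis
      by (simp add: n_def algebra_simps)
  qed
  have trilin: "\<bar>T h u w\<bar> \<le> n * n * n * c * norm h * norm u * norm w"
    if lin: "\<And>u w. linear (\<lambda>h. T h u w)" "\<And>h w. linear (\<lambda>u. T h u w)" "\<And>h u. linear (T h u)"
      "\<And>h i j. h \<in> Basis \<Longrightarrow> i \<in> Basis \<Longrightarrow> j \<in> Basis \<Longrightarrow> \<bar>T h i j\<bar> \<le> c"
    for T :: "'e \<Rightarrow> 'e \<Rightarrow> 'e \<Rightarrow> real" and c h u w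
  proof -
    have "\<bar>T i u w\<bar> \<le> n * n * c * norm u * norm w" if i: "i \<in> Basis" for i
      by (rule bilin[OF lin(2) lin(3) lin(4)[OF i]])
    from linear_functional_bound[OF lin(1) this, of h] show ?thesis
      by (simp add: n_def algebra_simps)
  qed
  \<comment> \<open>The trilinear forms need the factor n^3 and the bilinear ones only n^2; as n is
    at least 1, one constant serves both.\<close>
  define M where "M = n * n * n * N"
  have NM: "n * n * N \<le> M"
    using n1 N0 mult_left_mono[of 1 n "n * n * N"] by (simp add: M_def algebra_simps)
  show thesis
  proof (rule that[of M])
    show "M \<ge> 0" using n1 N0 by (simp add: M_def)
    fix x assume xB: "x \<in> ?B"
    then have x: "x \<in> U" using r by auto
    show "\<bar>G x u w\<bar> \<le> M * norm u * norm w" for u w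
    proof -
      have "\<bar>G x u w\<bar> \<le> n * n * N * norm u * norm w"
        by (rule bilin[OF G_linear[OF x] G_linear2[OF x]]) (rule order_trans[OF M1(2)[OF xB] N1])
      also have "\<dots> \<le> M * norm u * norm w" using NM by (intro mult_right_mono) auto
      finally show ?thesis .
    qed
    show "\<bar>DG x h u w\<bar> \<le> M * norm h * norm u * norm w" for h u w
      unfolding M_def
      by (rule trilin[OF DG_linear1[OF x] DG_linear2[OF x] DG_linear3[OF x]]) (rule order_trans[OF M2(2)[OF xB] N2])
    fix y assume yB: "y \<in> ?B"
    then have y: "y \<in> U" using r by auto
    show "\<bar>G x u w - G y u w\<bar> \<le> M * norm (x - y) * norm u * norm w" for u w
    proof -
      have "\<bar>G x u w - G y u w\<bar> \<le> n * n * (N * norm (x - y)) * norm u * norm w"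
        by (rule bilin[of "\<lambda>u w. G x u w - G y u w"])
          (auto intro!: linear_compose_sub G_linear G_linear2 x y order_trans[OF M1(3)[OF xB yB]] mult_right_mono N1)
      also have "\<dots> = (n * n * N) * (norm (x - y) * norm u * norm w)" by (simp add: algebra_simps)
      also have "\<dots> \<le> M * (norm (x - y) * norm u * norm w)" using NM by (intro mult_right_mono) auto
      finally show ?thesis by (simp add: algebra_simps)
    qed
    show "\<bar>DG x h u w - DG y h u w\<bar> \<le> M * norm (x - y) * norm h * norm u * norm w" for h u w
    proof -
      have "\<bar>DG x h u w - DG y h u w\<bar> \<le> n * n * n * (N * norm (x - y)) * norm h * norm u * norm w"
        by (rule trilin[of "\<lambda>h u w. DG x h u w - DG y h u w"])
          (auto intro!: linear_compose_sub DG_linear1 DG_linear2 DG_linear3 x y order_trans[OF M2(3)[OF xB yB]] mult_right_mono N2)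
      then show ?thesis by (simp add: M_def algebra_simps)
    qed
  qed
qed

text \<open>Positivity on the unit sphere at \<open>x\<^sub>0\<close> gives a coercivity constant,
  half of which survives on a small ball. Testing the Koszul equation with \<Gamma> itself then
  bounds \<Gamma>, and testing the difference of two such equations with the difference of their
  solutions gives the Lipschitz estimate.\<close>

lemma local_bounds:
  assumes x\<^sub>0: "x\<^sub>0 \<in> U"
  obtains r m K where "r > 0" "m > 0" "K \<ge> 0" "cball x\<^sub>0 r \<subseteq> U"
    "\<And>x u. x \<in> cball x\<^sub>0 r \<Longrightarrow> m * (norm u)\<^sup>2 \<le> G x u u"
    "\<And>x u. x \<in> cball x\<^sub>0 r \<Longrightarrow> norm (\<Gamma> x u u) \<le> K * (norm u)\<^sup>2"
    "\<And>R. \<exists>L\<ge>0. \<forall>x\<in>cball x\<^sub>0 r. \<forall>y\<in>cball x\<^sub>0 r. \<forall>u v. norm u \<le> R \<and> norm v \<le> R \<longrightarrow>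
        norm (\<Gamma> x u u - \<Gamma> y v v) \<le> L * (norm (x - y) + norm (u - v))"
proof -
  obtain r1 where r1: "r1 > 0" "cball x\<^sub>0 r1 \<subseteq> U"
    using U_open x\<^sub>0 open_contains_cball by blast
  obtain M where M: "M \<ge> 0"
    and MG: "\<And>x u w. x \<in> cball x\<^sub>0 r1 \<Longrightarrow> \<bar>G x u w\<bar> \<le> M * norm u * norm w"
    and MD: "\<And>x h u w. x \<in> cball x\<^sub>0 r1 \<Longrightarrow> \<bar>DG x h u w\<bar> \<le> M * norm h * norm u * norm w"
    and LG: "\<And>x y u w. x \<in> cball x\<^sub>0 r1 \<Longrightarrow> y \<in> cball x\<^sub>0 r1 \<Longrightarrow> \<bar>G x u w - G y u w\<bar> \<le> M * norm (x - y) * norm u * norm w"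
    and LD: "\<And>x y h u w. x \<in> cball x\<^sub>0 r1 \<Longrightarrow> y \<in> cball x\<^sub>0 r1 \<Longrightarrow> \<bar>DG x h u w - DG y h u w\<bar> \<le> M * norm (x - y) * norm h * norm u * norm w"
    by (rule coefficient_bounds[OF r1(2)]) (rule that)
  obtain m0 where m0: "m0 > 0" "\<And>u. m0 * (norm u)\<^sup>2 \<le> G x\<^sub>0 u u"
  proof -
    have "bilinear (G x\<^sub>0)"
      using G_linear[OF x\<^sub>0] G_linear2[OF x\<^sub>0] by (simp add: bilinear_def)
    then have "bounded_bilinear (G x\<^sub>0)" by (simp add: bilinear_conv_bounded_bilinear)
    then have "continuous_on (sphere 0 1) (\<lambda>u. G x\<^sub>0 u u)"
      by (rule bounded_bilinear.continuous_on) (auto intro: continuous_intros)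
    moreover have "sphere (0::'e) 1 \<noteq> {}" by simp
    ultimately obtain e where e: "e \<in> sphere 0 1" "\<And>u. u \<in> sphere 0 1 \<Longrightarrow> G x\<^sub>0 e e \<le> G x\<^sub>0 u u"
      using continuous_attains_inf[of "sphere 0 1" "\<lambda>u. G x\<^sub>0 u u"] by auto
    have "e \<noteq> 0" using e(1) by auto
    show thesis
    proof (rule that[of "G x\<^sub>0 e e"])
      show "G x\<^sub>0 e e > 0" by (rule G_pos[OF x\<^sub>0 \<open>e \<noteq> 0\<close>])
      fix u :: 'e
      show "G x\<^sub>0 e e * (norm u)\<^sup>2 \<le> G x\<^sub>0 u u"
      proof (cases "u = 0")
        case True
        then show ?thesis using linear_0[OF G_linear[OF x\<^sub>0]] by simp
      next
        case False
        define s where "s = (1 / norm u) *\<^sub>R u"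
        have "s \<in> sphere 0 1" using False by (simp add: s_def)
        moreover have "u = norm u *\<^sub>R s" using False by (simp add: s_def)
        then have "G x\<^sub>0 u u = norm u * (norm u * G x\<^sub>0 s s)"
          using linear_cmul[OF G_linear[OF x\<^sub>0]] linear_cmul[OF G_linear2[OF x\<^sub>0]] by (metis real_scaleR_def)
        ultimately show ?thesis using e(2)[of s]
          by (simp add: power2_eq_square mult.commute mult.left_commute mult_left_mono)
      qed
    qed
  qed
  \<comment> \<open>On this ball the quadratic form differs from the one at \<open>x\<^sub>0\<close>
    by at most half of its lower bound m0.\<close>
  define r where "r = min r1 (m0 / (2 * (M + 1)))"
  define m where "m = m0 / 2"
  have r: "r > 0" "r \<le> r1" using r1 m0(1) M by (auto simp: r_def)
  have m: "m > 0" using m0(1) by (simp add: m_def)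
  have sub: "cball x\<^sub>0 r \<subseteq> cball x\<^sub>0 r1" using r by auto
  have low: "m * (norm u)\<^sup>2 \<le> G x u u" if x: "x \<in> cball x\<^sub>0 r" for x u
  proof -
    have "\<bar>G x u u - G x\<^sub>0 u u\<bar> \<le> M * norm (x - x\<^sub>0) * norm u * norm u"
      using x sub r1(1) by (intro LG) auto
    also have "\<dots> = (M * norm (x - x\<^sub>0)) * (norm u)\<^sup>2" by (simp add: power2_eq_square)
    also have "\<dots> \<le> m * (norm u)\<^sup>2"
    proof (intro mult_right_mono)
      have "norm (x - x\<^sub>0) \<le> m0 / (2 * (M + 1))"
        using x by (simp add: r_def dist_norm norm_minus_commute)
      then have "M * norm (x - x\<^sub>0) \<le> M * (m0 / (2 * (M + 1)))" using M by (intro mult_left_mono)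
      also have "\<dots> \<le> m" using M m0(1) by (simp add: m_def field_simps)
      finally show "M * norm (x - x\<^sub>0) \<le> m" .
    qed auto
    finally have "\<bar>G x u u - G x\<^sub>0 u u\<bar> \<le> m * (norm u)\<^sup>2" .
    moreover have "m0 * (norm u)\<^sup>2 = 2 * (m * (norm u)\<^sup>2)" by (simp add: m_def)
    ultimately show ?thesis using m0(2)[of u] by linarith
  qed
  define K where "K = 3 * M / (2 * m)"
  have K: "K \<ge> 0" using M m by (simp add: K_def)
  \<comment> \<open>A quadratic lower bound meets a linear upper bound; one factor norm d
    cancels.\<close>
  have from_sq: "norm d \<le> c / (2 * m)" if x: "x \<in> cball x\<^sub>0 r" and "2 * G x d d \<le> c * norm d" and "c \<ge> 0" for x d c
  proof (cases "d = 0")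
    case False
    have "2 * m * norm d * norm d \<le> c * norm d"
      using low[OF x, of d] that(2) by (simp add: power2_eq_square)
    then have "2 * m * norm d \<le> c" using False by (simp add: mult_le_cancel_right)
    then show ?thesis using m by (simp add: field_simps)
  qed (use that m in simp)
  have \<Gamma>b: "norm (\<Gamma> x u u) \<le> K * (norm u)\<^sup>2" if x: "x \<in> cball x\<^sub>0 r" for x u
  proof -
    have x1: "x \<in> cball x\<^sub>0 r1" using x sub by blast
    then have xU: "x \<in> U" using r1(2) by blast
    define z where "z = \<Gamma> x u u"
    have "2 * G x z z = koszul x u u z" unfolding z_def by (rule \<Gamma>_koszul[OF xU])
    also have "\<dots> \<le> \<bar>DG x u u z\<bar> + \<bar>DG x u u z\<bar> + \<bar>DG x z u u\<bar>" unfolding koszul_def by linarith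
    also have "\<dots> \<le> (3 * M * (norm u)\<^sup>2) * norm z"
      using MD[OF x1, of u u z] MD[OF x1, of z u u] by (simp add: power2_eq_square algebra_simps)
    finally have "norm z \<le> 3 * M * (norm u)\<^sup>2 / (2 * m)"
      using M by (intro from_sq[OF x]) auto
    then show ?thesis by (simp add: z_def K_def)
  qed
  have \<Gamma>L: "\<exists>L\<ge>0. \<forall>x\<in>cball x\<^sub>0 r. \<forall>y\<in>cball x\<^sub>0 r. \<forall>u v. norm u \<le> R \<and> norm v \<le> R \<longrightarrow>
        norm (\<Gamma> x u u - \<Gamma> y v v) \<le> L * (norm (x - y) + norm (u - v))" for R
  proof -
    \<comment> \<open>\<open>a\<close> collects the dependence on the base point, three derivatives
      of G and then G itself applied to \<open>z2\<close>; \<open>b\<close> collects the dependence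
      on the velocity.\<close>
    define a where "a = 3 * M * R\<^sup>2 + 2 * M * (K * R\<^sup>2)"
    define b where "b = 6 * M * \<bar>R\<bar>"
    define L where "L = (a + b) / (2 * m)"
    have a: "a \<ge> 0" and b: "b \<ge> 0" using M K by (auto simp: a_def b_def)
    show ?thesis
    proof (intro exI[of _ L] conjI ballI allI impI)
      show "L \<ge> 0" using a b m by (simp add: L_def)
      fix x y u v :: 'e assume x: "x \<in> cball x\<^sub>0 r" and y: "y \<in> cball x\<^sub>0 r" and uv: "norm u \<le> R \<and> norm v \<le> R"
      have R: "R \<ge> 0" using uv norm_ge_zero order_trans by blast
      have x1: "x \<in> cball x\<^sub>0 r1" "y \<in> cball x\<^sub>0 r1" using x y sub by blast+
      then have xU: "x \<in> U" "y \<in> U" using r1(2) by blast+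
      define z1 z2 d where "z1 = \<Gamma> x u u" and "z2 = \<Gamma> y v v" and "d = z1 - z2"
      have u2: "(norm u)\<^sup>2 \<le> R\<^sup>2" "(norm v)\<^sup>2 \<le> R\<^sup>2" using uv by (auto intro!: power_mono)
      have z2: "norm z2 \<le> K * R\<^sup>2"
        unfolding z2_def by (rule order_trans[OF \<Gamma>b[OF y] mult_left_mono[OF u2(2) K]])
      have "2 * G x d d = 2 * G x z1 d - 2 * G x z2 d"
        unfolding d_def by (simp add: linear_diff[OF G_linear[OF xU(1)]])
      \<comment> \<open>\<open>z2\<close> solves the Koszul equation at y and not at x; the last
        term is the error of exchanging the metric.\<close>
      also have "\<dots> = koszul x u u d - koszul y v v d + 2 * (G y z2 d - G x z2 d)"
        using \<Gamma>_koszul[OF xU(1), of u u d] \<Gamma>_koszul[OF xU(2), of v v d] by (simp add: z1_def z2_def)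
      also have "\<dots> \<le> (a * norm (x - y) + b * norm (u - v)) * norm d"
      proof -
        have k1: "koszul x u u d - koszul y u u d \<le> 3 * M * R\<^sup>2 * norm (x - y) * norm d"
        proof -
          have "koszul x u u d - koszul y u u d = 2 * (DG x u u d - DG y u u d) + - (DG x d u u - DG y d u u)"
            by (simp add: koszul_def)
          also have "\<dots> \<le> 2 * \<bar>DG x u u d - DG y u u d\<bar> + \<bar>DG x d u u - DG y d u u\<bar>"
            by (intro add_mono mult_left_mono abs_ge_self abs_ge_minus_self) simp
          also have "\<dots> \<le> 3 * (M * norm (x - y) * norm d) * (norm u)\<^sup>2"
            using LD[OF x1, of u u d] LD[OF x1, of d u u] by (simp add: power2_eq_square algebra_simps)
          also have "\<dots> \<le> 3 * (M * norm (x - y) * norm d) * R\<^sup>2"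
            using u2(1) M by (intro mult_left_mono) auto
          finally show ?thesis by (simp add: algebra_simps)
        qed
        have k2: "koszul y u u d - koszul y v v d \<le> b * norm (u - v) * norm d"
        proof -
          have "koszul y u u d - koszul y v v d = 2 * (DG y (u - v) u d + DG y v (u - v) d) - (DG y d (u - v) u + DG y d v (u - v))"
            unfolding koszul_def
            by (simp add: linear_diff[OF DG_linear1[OF xU(2)]] linear_diff[OF DG_linear2[OF xU(2)]] linear_diff[OF DG_linear3[OF xU(2)]])
          also have "\<dots> = 2 * DG y (u - v) u d + 2 * DG y v (u - v) d + - DG y d (u - v) u + - DG y d v (u - v)"
            by simp
          also have "\<dots> \<le> 2 * \<bar>DG y (u - v) u d\<bar> + 2 * \<bar>DG y v (u - v) d\<bar> + \<bar>DG y d (u - v) u\<bar> + \<bar>DG y d v (u - v)\<bar>"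
            by (intro add_mono mult_left_mono abs_ge_self abs_ge_minus_self) simp_all
          also have "\<dots> \<le> 3 * (M * norm (u - v) * norm d) * (norm u + norm v)"
            using MD[OF x1(2), of "u - v" u d] MD[OF x1(2), of v "u - v" d] MD[OF x1(2), of d "u - v" u] MD[OF x1(2), of d v "u - v"]
            by (simp add: algebra_simps)
          also have "\<dots> \<le> 3 * (M * norm (u - v) * norm d) * (R + R)"
            using uv M by (intro mult_left_mono add_mono) auto
          finally show ?thesis using R by (simp add: b_def algebra_simps)
        qed
        have k3: "2 * (G y z2 d - G x z2 d) \<le> 2 * M * (K * R\<^sup>2) * norm (x - y) * norm d"
        proof -
          have "G y z2 d - G x z2 d \<le> M * norm (x - y) * norm z2 * norm d"
            using LG[OF x1(2,1), of z2 d] by (simp add: norm_minus_commute)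
          also have "\<dots> \<le> M * norm (x - y) * (K * R\<^sup>2) * norm d"
            using z2 M by (intro mult_right_mono mult_left_mono) auto
          finally show ?thesis by (simp add: algebra_simps)
        qed
        have "koszul x u u d - koszul y v v d + 2 * (G y z2 d - G x z2 d) \<le>
           3 * M * R\<^sup>2 * norm (x - y) * norm d + b * norm (u - v) * norm d + 2 * M * (K * R\<^sup>2) * norm (x - y) * norm d"
          using k1 k2 k3 by linarith
        then show ?thesis by (simp add: a_def algebra_simps)
      qed
      finally have "norm d \<le> (a * norm (x - y) + b * norm (u - v)) / (2 * m)"
        using a b by (intro from_sq[OF x]) auto
      also have "\<dots> \<le> ((a + b) * (norm (x - y) + norm (u - v))) / (2 * m)"
        using a b m by (intro divide_right_mono) (auto simp: algebra_simps)
      finally show "norm (\<Gamma> x u u - \<Gamma> y v v) \<le> L * (norm (x - y) + norm (u - v))"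
        by (simp add: L_def d_def z1_def z2_def)
    qed
  qed
  show thesis
    by (rule that[OF r(1) m K _ low \<Gamma>b \<Gamma>L]) (use sub r1(2) in auto)
qed

end

lemma has_vector_derivative_within_unique:
  fixes f :: "real \<Rightarrow> 'a::euclidean_space"
  assumes "a < b" "t \<in> {a..b}" "(f has_vector_derivative u) (at t within {a..b})" "(f has_vector_derivative v) (at t within {a..b})"
  shows "u = v"
  using vector_derivative_within_cbox[of a b t f u] vector_derivative_within_cbox[of a b t f v] assms
  by simp

lemma vector_derivative_unit_interval:
  fixes f :: "real \<Rightarrow> 'a::euclidean_space"
  shows "t \<in> {0..1} \<Longrightarrow> (f has_vector_derivative u) (at t within {0..1}) \<Longrightarrow>
    vector_derivative f (at t within {0..1}) = u"
  using vector_derivative_within_cbox[of 0 1 t f u] by simp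

section \<open>Charts, tangent vectors and velocities on the manifold\<close>

context riemannian_manifold
begin

abbreviation chart_image :: "('m, 'e) chart \<Rightarrow> 'e set" where
  "chart_image c \<equiv> snd c ` fst c"

lemma chart_open: "c \<in> A \<Longrightarrow> open (fst c)" and chart_image_open: "c \<in> A \<Longrightarrow> open (chart_image c)"
  using smooth_atlas by (auto simp: smooth_atlas_def)

text \<open>The atlas provides some continuous inverse of a chart, while \<open>transition\<close>
  and \<open>metric_coords\<close> are written with \<open>inv_into\<close>; the two agree on the
  image.\<close>

lemma chart_homeomorphism:
  assumes "c \<in> A"
  shows "homeomorphism (fst c) (chart_image c) (snd c) (inv_into (fst c) (snd c))"
proof -
  obtain \<psi> where \<psi>: "homeomorphism (fst c) (chart_image c) (snd c) \<psi>"
    using smooth_atlas assms by (auto simp: smooth_atlas_def)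
  then have \<psi>_inv: "\<psi> (snd c p) = p" if "p \<in> fst c" for p
    using that by (simp add: homeomorphism_def)
  have "inj_on (snd c) (fst c)"
    using \<psi>_inv by (rule inj_on_inverseI)
  then have inv: "inv_into (fst c) (snd c) (snd c p) = p" if "p \<in> fst c" for p
    using that by simp
  have "continuous_on (chart_image c) \<psi>" "continuous_on (fst c) (snd c)"
    using \<psi> by (simp_all add: homeomorphism_def)
  moreover from this(1) have "continuous_on (chart_image c) (inv_into (fst c) (snd c))"
    by (rule continuous_on_eq) (use inv \<psi>_inv in auto)
  moreover have "inv_into (fst c) (snd c) ` chart_image c = fst c"
    unfolding image_image using inv by simp
  ultimately show ?thesis
    unfolding homeomorphism_def using inv by auto
qed

lemma chart_inj: "c \<in> A \<Longrightarrow> inj_on (snd c) (fst c)"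
  using chart_homeomorphism[of c] by (intro inj_on_inverseI[of _ "inv_into (fst c) (snd c)"]) (simp add: homeomorphism_def)

lemma chart_inv: "c \<in> A \<Longrightarrow> p \<in> fst c \<Longrightarrow> inv_into (fst c) (snd c) (snd c p) = p"
  by (simp add: chart_inj)

lemma chart_continuous: "c \<in> A \<Longrightarrow> continuous_on (fst c) (snd c)"
  and chart_inv_continuous: "c \<in> A \<Longrightarrow> continuous_on (chart_image c) (inv_into (fst c) (snd c))"
  using chart_homeomorphism[of c] by (simp_all add: homeomorphism_def)

lemma chart_image_open_subset:
  assumes "c \<in> A" "open V" "V \<subseteq> fst c"
  shows "open (snd c ` V)"
proof -
  have "openin (top_of_set (chart_image c)) (snd c ` V)"
    using assms by (intro homeomorphism_imp_open_map[OF chart_homeomorphism]) (auto intro: open_subset)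
  then show ?thesis using openin_open_eq[OF chart_image_open[OF assms(1)]] by simp
qed

lemma chart_preimage_open:
  assumes "c \<in> A" "open V"
  shows "open {p \<in> fst c. snd c p \<in> V}"
proof -
  have "open (fst c \<inter> snd c -` V)"
    using chart_continuous[OF assms(1)] chart_open[OF assms(1)] assms(2)
    by (rule continuous_open_preimage)
  then show ?thesis by (simp add: Int_def)
qed

lemma chart_preimage_compact:
  assumes "c \<in> A" "compact C" "C \<subseteq> chart_image c"
  shows "compact {p \<in> fst c. snd c p \<in> C}"
proof -
  have "{p \<in> fst c. snd c p \<in> C} = inv_into (fst c) (snd c) ` C"
  proof
    show "{p \<in> fst c. snd c p \<in> C} \<subseteq> inv_into (fst c) (snd c) ` C"
      using chart_inv[OF assms(1)] by (force intro: image_eqI[of _ _ "snd c _"])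
    show "inv_into (fst c) (snd c) ` C \<subseteq> {p \<in> fst c. snd c p \<in> C}"
      using assms(3) by (auto simp: f_inv_into_f subset_iff intro!: inv_into_into)
  qed
  then show ?thesis
    using compact_continuous_image[OF continuous_on_subset[OF chart_inv_continuous[OF assms(1)] assms(3)] assms(2)] by simp
qed

lemma transition_apply: "c \<in> A \<Longrightarrow> p \<in> fst c \<Longrightarrow> transition c c' (snd c p) = snd c' p"
  by (simp add: transition_def chart_inv)

definition jac :: "('m, 'e) chart \<Rightarrow> ('m, 'e) chart \<Rightarrow> 'm \<Rightarrow> 'e \<Rightarrow> 'e" where
  "jac c c' p = frechet_derivative (transition c c') (at (snd c p))"

lemma overlap_open:
  assumes "c \<in> A" "c' \<in> A"
  shows "open (snd c ` (fst c \<inter> fst c'))"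
  using assms by (intro chart_image_open_subset) (auto simp: chart_open)

lemma jac_has_derivative:
  assumes "c \<in> A" "c' \<in> A" "p \<in> fst c" "p \<in> fst c'"
  shows "(transition c c' has_derivative jac c c' p) (at (snd c p))"
proof -
  have "smooth_on (snd c ` (fst c \<inter> fst c')) (transition c c')"
    using smooth_atlas assms by (auto simp: smooth_atlas_def)
  then have "Ck_on (Suc 0) (snd c ` (fst c \<inter> fst c')) (transition c c')"
    unfolding smooth_on_def by blast
  then have "transition c c' differentiable (at (snd c p))"
    using overlap_open[OF assms(1,2)] assms(3,4) by (auto simp: differentiable_on_eq_differentiable_at)
  then show ?thesis by (simp add: jac_def frechet_derivative_works)
qed

lemma jac_eqI:
  assumes "c \<in> A" "c' \<in> A" "p \<in> fst c" "p \<in> fst c'" "(transition c c' has_derivative f) (at (snd c p))"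
  shows "jac c c' p = f"
  using has_derivative_unique[OF jac_has_derivative[OF assms(1-4)] assms(5)] .

lemma jac_linear: "c \<in> A \<Longrightarrow> c' \<in> A \<Longrightarrow> p \<in> fst c \<Longrightarrow> p \<in> fst c' \<Longrightarrow> linear (jac c c' p)"
  using jac_has_derivative has_derivative_linear by blast

lemma jac_self:
  assumes c: "c \<in> A" "p \<in> fst c"
  shows "jac c c p = (\<lambda>u. u)"
proof (rule jac_eqI[OF c(1) c(1) c(2) c(2)])
  show "(transition c c has_derivative (\<lambda>u. u)) (at (snd c p))"
    by (rule has_derivative_transform_within_open[OF has_derivative_ident chart_image_open[OF c(1)]])
      (use c in \<open>auto simp: transition_apply\<close>)
qed

lemma jac_chain:
  assumes "c \<in> A" "c' \<in> A" "c'' \<in> A" "p \<in> fst c" "p \<in> fst c'" "p \<in> fst c''"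
  shows "jac c c'' p u = jac c' c'' p (jac c c' p u)"
proof -
  let ?W = "snd c ` (fst c \<inter> fst c' \<inter> fst c'')"
  have "(transition c' c'' has_derivative jac c' c'' p) (at (transition c c' (snd c p)))"
    using jac_has_derivative[OF assms(2,3,5,6)] transition_apply[OF assms(1,4)] by simp
  from has_derivative_compose[OF jac_has_derivative[OF assms(1,2,4,5)] this]
  have d: "((\<lambda>x. transition c' c'' (transition c c' x)) has_derivative (\<lambda>u. jac c' c'' p (jac c c' p u))) (at (snd c p))" .
  have "open ?W"
    using chart_open[OF assms(1)] chart_open[OF assms(2)] chart_open[OF assms(3)]
    by (intro chart_image_open_subset assms(1) open_Int) auto
  moreover have "snd c p \<in> ?W" using assms by auto
  moreover have "transition c' c'' (transition c c' x) = transition c c'' x" if x: "x \<in> ?W" for x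
  proof -
    obtain q where q: "q \<in> fst c" "q \<in> fst c'" "x = snd c q" using x by blast
    then show ?thesis
      using transition_apply[OF assms(1) q(1), of c'] transition_apply[OF assms(1) q(1), of c'']
        transition_apply[OF assms(2) q(2), of c''] by (simp only:)
  qed
  ultimately have "(transition c c'' has_derivative (\<lambda>u. jac c' c'' p (jac c c' p u))) (at (snd c p))"
    by (rule has_derivative_transform_within_open[OF d])
  from jac_eqI[OF assms(1,3,4,6) this] show ?thesis by simp
qed

lemma coord_vector_apply:
  "coord_vector A c p u c' = (if c' \<in> A \<and> p \<in> fst c' then jac c c' p u else 0)"
  by (simp add: coord_vector_def jac_def)

lemma coord_vector_self: "c \<in> A \<Longrightarrow> p \<in> fst c \<Longrightarrow> coord_vector A c p u c = u"
  by (simp add: coord_vector_apply jac_self)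

lemma coord_vector_tangent:
  assumes c: "c \<in> A" "p \<in> fst c"
  shows "coord_vector A c p u \<in> tangent_space A p"
  unfolding tangent_space_def
proof (intro CollectI conjI allI ballI impI)
  fix c' assume "c' \<notin> A \<or> p \<notin> fst c'"
  then show "coord_vector A c p u c' = 0" by (auto simp: coord_vector_apply)
next
  fix c' assume c': "c' \<in> A" "p \<in> fst c'"
  show "coord_vector A c p u = coord_vector A c' p (coord_vector A c p u c')"
  proof
    fix c''
    show "coord_vector A c p u c'' = coord_vector A c' p (coord_vector A c p u c') c''"
      using jac_chain[of c c' c'' p u] c c' by (simp add: coord_vector_apply)
  qed
qed

lemma tangent_coord: "v \<in> tangent_space A p \<Longrightarrow> c \<in> A \<Longrightarrow> p \<in> fst c \<Longrightarrow> coord_vector A c p (v c) = v"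
  by (simp add: tangent_space_def)

lemma coord_vector_combine:
  assumes c: "c \<in> A" "p \<in> fst c"
  shows "coord_vector A c p (a *\<^sub>R u + b *\<^sub>R w) = (\<lambda>c'. a *\<^sub>R coord_vector A c p u c' + b *\<^sub>R coord_vector A c p w c')"
  using jac_linear[of c _ p] c by (auto simp: coord_vector_apply linear_add linear_cmul fun_eq_iff)

lemma coord_vector_scale:
  assumes c: "c \<in> A" "p \<in> fst c"
  shows "coord_vector A c p (a *\<^sub>R u) = (\<lambda>c'. a *\<^sub>R coord_vector A c p u c')"
  using coord_vector_combine[OF c, of a u 0 0] by simp

lemma tangent_scale:
  assumes "p \<in> carrier A" "v \<in> tangent_space A p"
  shows "(\<lambda>c. a *\<^sub>R v c) \<in> tangent_space A p"
proof -
  obtain c where c: "c \<in> A" "p \<in> fst c" using assms(1) by (auto simp: carrier_def)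
  have "(\<lambda>c. a *\<^sub>R v c) = coord_vector A c p (a *\<^sub>R v c)"
    using coord_vector_scale[OF c] tangent_coord[OF assms(2) c] by simp
  then show ?thesis using coord_vector_tangent[OF c] by metis
qed

lemma carrier_chart: "c \<in> A \<Longrightarrow> p \<in> fst c \<Longrightarrow> p \<in> carrier A"
  by (auto simp: carrier_def)

lemma metric_coords_apply:
  "c \<in> A \<Longrightarrow> p \<in> fst c \<Longrightarrow> metric_coords A g c (snd c p) u w = g p (coord_vector A c p u) (coord_vector A c p w)"
  by (simp add: metric_coords_def chart_inv)

lemma chart_metric:
  assumes c: "c \<in> A"
  shows "chart_metric (chart_image c) (metric_coords A g c)"
proof (rule chart_metric.intro)
  show "open (chart_image c)" by (rule chart_image_open[OF c])
  show "smooth_on (chart_image c) (\<lambda>x. metric_coords A g c x u w)" for u w by (rule metric_smooth[OF c])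
  fix x assume "x \<in> chart_image c"
  then obtain p where p: "p \<in> fst c" and x: "x = snd c p" by auto
  note pc = carrier_chart[OF c p] and T = coord_vector_tangent[OF c p]
  show "metric_coords A g c x u w = metric_coords A g c x w u" for u w
    unfolding x metric_coords_apply[OF c p] by (rule metric_sym[OF pc T T])
  show "metric_coords A g c x u u > 0" if "u \<noteq> 0" for u
  proof -
    have "coord_vector A c p u \<noteq> (\<lambda>c. 0)"
      using coord_vector_self[OF c p, of u] that by metis
    then show ?thesis unfolding x metric_coords_apply[OF c p] by (rule metric_pos[OF pc T])
  qed
  show "linear (\<lambda>u. metric_coords A g c x u w)" for w
    unfolding x metric_coords_apply[OF c p]
  proof (rule linearI)
    show "g p (coord_vector A c p (u + v)) (coord_vector A c p w) =
      g p (coord_vector A c p u) (coord_vector A c p w) + g p (coord_vector A c p v) (coord_vector A c p w)" for u v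
      using metric_linear[OF pc T T T, of 1 u 1 v w] coord_vector_combine[OF c p, of 1 u 1 v] by simp
    show "g p (coord_vector A c p (r *\<^sub>R u)) (coord_vector A c p w) =
      r *\<^sub>R g p (coord_vector A c p u) (coord_vector A c p w)" for r u
      using metric_linear[OF pc T T T, of r u 0 0 w] coord_vector_combine[OF c p, of r u 0 0] by simp
  qed
qed

lemma tangent_norm_coord:
  assumes "c \<in> A" "p \<in> fst c" "v \<in> tangent_space A p"
  shows "(tangent_norm g p v)\<^sup>2 = metric_coords A g c (snd c p) (v c) (v c)"
proof -
  interpret C: chart_metric "chart_image c" "metric_coords A g c" by (rule chart_metric[OF assms(1)])
  have "metric_coords A g c (snd c p) (v c) (v c) \<ge> 0"
  proof (cases "v c = 0")
    case True
    then show ?thesis using linear_0[OF C.G_linear[of "snd c p"]] assms(2) by simp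
  next
    case False
    then show ?thesis using C.G_pos[of "snd c p" "v c"] assms(2) by simp
  qed
  moreover have "metric_coords A g c (snd c p) (v c) (v c) = g p v v"
    unfolding metric_coords_apply[OF assms(1,2)] tangent_coord[OF assms(3,1,2)] ..
  ultimately show ?thesis by (simp add: tangent_norm_def)
qed

lemma tangent_norm_scale:
  assumes "p \<in> carrier A" "v \<in> tangent_space A p"
  shows "tangent_norm g p (\<lambda>c. a *\<^sub>R v c) = \<bar>a\<bar> * tangent_norm g p v"
proof -
  have t: "(\<lambda>c. a *\<^sub>R v c) \<in> tangent_space A p" by (rule tangent_scale[OF assms])
  have "g p (\<lambda>c. a *\<^sub>R v c) (\<lambda>c. a *\<^sub>R v c) = a * g p v (\<lambda>c. a *\<^sub>R v c)"
    using metric_linear[OF assms(1,2,2) t, of a 0] by simp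
  also have "g p v (\<lambda>c. a *\<^sub>R v c) = a * g p v v"
    using metric_linear[OF assms(1,2,2,2), of a 0] metric_sym[OF assms(1,2) t] by simp
  finally show ?thesis by (simp add: tangent_norm_def real_sqrt_mult)
qed

text \<open>Junk values of \<open>velocity\<close> are avoided by exhibiting a derivative in a single chart.\<close>

lemma velocity_eq:
  assumes t: "t \<in> {0..1}" and cont: "continuous (at t within {0..1}) \<gamma>"
    and c: "c \<in> A" "\<gamma> t \<in> fst c"
    and d: "((snd c \<circ> \<gamma>) has_vector_derivative u) (at t within {0..1})"
  shows "velocity A \<gamma> t = coord_vector A c (\<gamma> t) u"
proof
  fix c'
  show "velocity A \<gamma> t c' = coord_vector A c (\<gamma> t) u c'"
  proof (cases "c' \<in> A \<and> \<gamma> t \<in> fst c'")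
    case True
    then have c': "c' \<in> A" "\<gamma> t \<in> fst c'" by auto
    have "open (fst c \<inter> fst c')" using chart_open[OF c(1)] chart_open[OF c'(1)] by (rule open_Int)
    then have ev: "\<forall>\<^sub>F s in at t within {0..1}. \<gamma> s \<in> fst c \<inter> fst c'"
      using cont c c' unfolding continuous_within by (auto dest!: topological_tendstoD)
    have "(transition c c' has_derivative jac c c' (\<gamma> t)) (at ((snd c \<circ> \<gamma>) t))"
      using jac_has_derivative[OF c(1) c'(1) c(2) c'(2)] by simp
    then have "((transition c c' \<circ> (snd c \<circ> \<gamma>)) has_vector_derivative jac c c' (\<gamma> t) u) (at t within {0..1})"
      by (rule vector_derivative_diff_chain_within[OF d has_derivative_at_withinI])
    then have "((snd c' \<circ> \<gamma>) has_vector_derivative jac c c' (\<gamma> t) u) (at t within {0..1})"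
      unfolding has_vector_derivative_def
    proof (rule has_derivative_transform_eventually)
      show "\<forall>\<^sub>F s in at t within {0..1}. (transition c c' \<circ> (snd c \<circ> \<gamma>)) s = (snd c' \<circ> \<gamma>) s"
        using ev by eventually_elim (use c transition_apply[OF c(1), of _ c'] in simp)
    qed (use c t transition_apply[OF c(1), of _ c'] in simp_all)
    then have "vector_derivative (snd c' \<circ> \<gamma>) (at t within {0..1}) = jac c c' (\<gamma> t) u"
      by (rule vector_derivative_unit_interval[OF t])
    then show ?thesis using c' by (simp add: velocity_def coord_vector_apply)
  qed (auto simp: velocity_def coord_vector_apply)
qed

section \<open>Uniqueness and rescaling of geodesics\<close>

lemma geodesicD:
  assumes "geodesic A g \<gamma>"
  shows "continuous_on {0..1} \<gamma>" "\<gamma> ` {0..1} \<subseteq> carrier A"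
    and "\<And>c. c \<in> A \<Longrightarrow> \<exists>x'. \<forall>t\<in>{0..1}. \<gamma> t \<in> fst c \<longrightarrow>
        ((snd c \<circ> \<gamma>) has_vector_derivative x' t) (at t within {0..1}) \<and>
        (x' has_vector_derivative - christoffel A g c (snd c (\<gamma> t)) (x' t) (x' t)) (at t within {0..1})"
  using assms unfolding geodesic_def by blast+

lemma christoffel_eq:
  assumes "c \<in> A"
  shows "christoffel A g c = chart_metric.\<Gamma> (metric_coords A g c)"
proof -
  interpret C: chart_metric "chart_image c" "metric_coords A g c" by (rule chart_metric[OF assms])
  show ?thesis
    by (intro ext) (simp add: christoffel_def C.\<Gamma>_def C.koszul_def C.DG_def)
qed

lemma continuous_near:
  assumes "continuous_on {0..1::real} \<gamma>" "\<tau> \<in> {0..1}" "open V" "\<gamma> \<tau> \<in> (V :: 'n::topological_space set)"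
  obtains d where "d > 0" "\<And>t. t \<in> {0..1} \<Longrightarrow> \<bar>t - \<tau>\<bar> < d \<Longrightarrow> \<gamma> t \<in> V"
proof -
  have "continuous (at \<tau> within {0..1}) \<gamma>"
    using assms(1,2) by (simp add: continuous_on_eq_continuous_within)
  then have "\<forall>\<^sub>F t in at \<tau> within {0..1}. \<gamma> t \<in> V"
    using assms(3,4) unfolding continuous_within by (rule topological_tendstoD)
  then obtain d where d: "d > 0" "\<And>t. t \<in> {0..1} \<Longrightarrow> t \<noteq> \<tau> \<Longrightarrow> dist t \<tau> < d \<Longrightarrow> \<gamma> t \<in> V"
    unfolding eventually_at by blast
  show thesis
    by (rule that[OF d(1)]) (use d(2) assms(4) in \<open>auto simp: dist_real_def\<close>)
qed

text \<open>In a chart the position and velocity solve a first-order system whose right-hand side is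
  Lipschitz for bounded velocities. The squared distance Z of the two solutions vanishes at \<tau>
  and satisfies Z' \<le> k Z, so Gronwall keeps it at zero.\<close>

lemma geodesic_unique_step:
  assumes g1: "geodesic A g \<gamma>\<^sub>1" and g2: "geodesic A g \<gamma>\<^sub>2" and \<tau>: "0 \<le> \<tau>" "\<tau> < 1"
    and c: "c \<in> A" "\<gamma>\<^sub>1 \<tau> \<in> fst c" and eq: "\<gamma>\<^sub>1 \<tau> = \<gamma>\<^sub>2 \<tau>"
    and x1: "\<And>t. t \<in> {0..1} \<Longrightarrow> \<gamma>\<^sub>1 t \<in> fst c \<Longrightarrow>
        ((snd c \<circ> \<gamma>\<^sub>1) has_vector_derivative x1 t) (at t within {0..1}) \<and>
        (x1 has_vector_derivative - christoffel A g c (snd c (\<gamma>\<^sub>1 t)) (x1 t) (x1 t)) (at t within {0..1})"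
    and x2: "\<And>t. t \<in> {0..1} \<Longrightarrow> \<gamma>\<^sub>2 t \<in> fst c \<Longrightarrow>
        ((snd c \<circ> \<gamma>\<^sub>2) has_vector_derivative x2 t) (at t within {0..1}) \<and>
        (x2 has_vector_derivative - christoffel A g c (snd c (\<gamma>\<^sub>2 t)) (x2 t) (x2 t)) (at t within {0..1})"
    and veq: "x1 \<tau> = x2 \<tau>"
  shows "\<exists>d>0. \<tau> + d \<le> 1 \<and> (\<forall>t\<in>{\<tau>..\<tau> + d}. \<gamma>\<^sub>1 t = \<gamma>\<^sub>2 t)"
proof -
  interpret C: chart_metric "chart_image c" "metric_coords A g c" by (rule chart_metric[OF c(1)])
  have \<tau>01: "\<tau> \<in> {0..1}" using \<tau> by auto
  define x0 where "x0 = snd c (\<gamma>\<^sub>1 \<tau>)"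
  have x0: "x0 \<in> chart_image c" using c by (auto simp: x0_def)
  obtain r m K where r: "r > 0" "cball x0 r \<subseteq> chart_image c"
    and LL: "\<And>R. \<exists>L\<ge>0. \<forall>x\<in>cball x0 r. \<forall>y\<in>cball x0 r. \<forall>u v. norm u \<le> R \<and> norm v \<le> R \<longrightarrow>
        norm (C.\<Gamma> x u u - C.\<Gamma> y v v) \<le> L * (norm (x - y) + norm (u - v))"
    using C.local_bounds[OF x0] by metis
  \<comment> \<open>\<Gamma> is Lipschitz only for bounded velocities; by continuity both velocities
    keep this bound for a short time.\<close>
  define R where "R = norm (x1 \<tau>) + 1"
  obtain L where L: "L \<ge> 0" "\<And>x y u v. x \<in> cball x0 r \<Longrightarrow> y \<in> cball x0 r \<Longrightarrow> norm u \<le> R \<Longrightarrow> norm v \<le> R \<Longrightarrow>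
        norm (C.\<Gamma> x u u - C.\<Gamma> y v v) \<le> L * (norm (x - y) + norm (u - v))"
    using LL[of R] by blast
  let ?V = "{p \<in> fst c. snd c p \<in> ball x0 r}"
  have V: "open ?V" by (rule chart_preimage_open[OF c(1)]) simp
  have "\<gamma>\<^sub>1 \<tau> \<in> ?V" using c r(1) by (simp add: x0_def)
  then have V12: "\<gamma>\<^sub>1 \<tau> \<in> ?V" "\<gamma>\<^sub>2 \<tau> \<in> ?V" using eq by auto
  obtain d1 where d1: "d1 > 0" "\<And>t. t \<in> {0..1} \<Longrightarrow> \<bar>t - \<tau>\<bar> < d1 \<Longrightarrow> \<gamma>\<^sub>1 t \<in> ?V"
    using continuous_near[OF geodesicD(1)[OF g1] \<tau>01 V V12(1)] by blast
  obtain d2 where d2: "d2 > 0" "\<And>t. t \<in> {0..1} \<Longrightarrow> \<bar>t - \<tau>\<bar> < d2 \<Longrightarrow> \<gamma>\<^sub>2 t \<in> ?V"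
    using continuous_near[OF geodesicD(1)[OF g2] \<tau>01 V V12(2)] by blast
  have near: "\<exists>d>0. \<forall>t\<in>{0..1}. \<bar>t - \<tau>\<bar> < d \<longrightarrow> norm (x t) \<le> R"
    if "(x has_vector_derivative z) (at \<tau> within {0..1})" "x \<tau> = x1 \<tau>" for x :: "real \<Rightarrow> 'e" and z
  proof -
    have "continuous (at \<tau> within {0..1}) x" by (rule has_vector_derivative_continuous[OF that(1)])
    then obtain d where d: "d > 0" "\<And>t. t \<in> {0..1} \<Longrightarrow> dist t \<tau> < d \<Longrightarrow> dist (x t) (x \<tau>) < 1"
      unfolding continuous_within_eps_delta using zero_less_one by blast
    show ?thesis
    proof (intro exI conjI ballI impI, rule d(1))
      fix t assume "t \<in> {0..1}" "\<bar>t - \<tau>\<bar> < d"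
      then have "dist (x t) (x \<tau>) < 1" by (intro d(2)) (auto simp: dist_real_def)
      then show "norm (x t) \<le> R"
        using norm_triangle_ineq2[of "x t" "x \<tau>"] that(2) by (simp add: R_def dist_norm)
    qed
  qed
  obtain d3 where d3: "d3 > 0" "\<And>t. t \<in> {0..1} \<Longrightarrow> \<bar>t - \<tau>\<bar> < d3 \<Longrightarrow> norm (x1 t) \<le> R"
    using near[OF conjunct2[OF x1[OF \<tau>01 c(2)]] refl] by blast
  obtain d4 where d4: "d4 > 0" "\<And>t. t \<in> {0..1} \<Longrightarrow> \<bar>t - \<tau>\<bar> < d4 \<Longrightarrow> norm (x2 t) \<le> R"
  proof -
    have "\<gamma>\<^sub>2 \<tau> \<in> fst c" using c(2) eq by simp
    from near[OF conjunct2[OF x2[OF \<tau>01 this]] veq[symmetric]] that show thesis by blast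
  qed
  define d where "d = Min {d1, d2, d3, d4, 1 - \<tau>} / 2"
  have "Min {d1, d2, d3, d4, 1 - \<tau>} > 0" using d1(1) d2(1) d3(1) d4(1) \<tau> by simp
  then have d: "d > 0" "d < d1" "d < d2" "d < d3" "d < d4" "d < 1 - \<tau>"
    unfolding d_def by auto
  define y1 where "y1 = snd c \<circ> \<gamma>\<^sub>1"
  define y2 where "y2 = snd c \<circ> \<gamma>\<^sub>2"
  have in_nbhd: "t \<in> {0..1} \<and> \<gamma>\<^sub>1 t \<in> ?V \<and> \<gamma>\<^sub>2 t \<in> ?V \<and> norm (x1 t) \<le> R \<and> norm (x2 t) \<le> R" if "t \<in> {\<tau>..\<tau> + d}" for t
  proof -
    have "t \<in> {0..1}" using that d \<tau> by auto
    moreover have "\<bar>t - \<tau>\<bar> < d1" "\<bar>t - \<tau>\<bar> < d2" "\<bar>t - \<tau>\<bar> < d3" "\<bar>t - \<tau>\<bar> < d4" using that d by auto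
    ultimately show ?thesis using d1 d2 d3 d4 by blast
  qed
  define Z where "Z = (\<lambda>t. (y1 t - y2 t) \<bullet> (y1 t - y2 t) + (x1 t - x2 t) \<bullet> (x1 t - x2 t))"
  define G where "G = (\<lambda>t. C.\<Gamma> (y1 t) (x1 t) (x1 t) - C.\<Gamma> (y2 t) (x2 t) (x2 t))"
  have der: "(y1 has_vector_derivative x1 t) (at t within {0..1})" "(y2 has_vector_derivative x2 t) (at t within {0..1})"
      "(x1 has_vector_derivative - C.\<Gamma> (y1 t) (x1 t) (x1 t)) (at t within {0..1})"
      "(x2 has_vector_derivative - C.\<Gamma> (y2 t) (x2 t) (x2 t)) (at t within {0..1})" if "t \<in> {\<tau>..\<tau> + d}" for t
    using in_nbhd[OF that] x1[of t] x2[of t] by (auto simp: y1_def y2_def christoffel_eq[OF c(1)])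
  have dZ: "(Z has_vector_derivative (2 * ((y1 t - y2 t) \<bullet> (x1 t - x2 t)) - 2 * ((x1 t - x2 t) \<bullet> G t))) (at t within {0..1})"
    if t: "t \<in> {\<tau>..\<tau> + d}" for t
  proof -
    have a: "((\<lambda>t. y1 t - y2 t) has_vector_derivative (x1 t - x2 t)) (at t within {0..1})"
      by (intro has_vector_derivative_diff der t)
    have "((\<lambda>t. x1 t - x2 t) has_vector_derivative (- C.\<Gamma> (y1 t) (x1 t) (x1 t) - - C.\<Gamma> (y2 t) (x2 t) (x2 t))) (at t within {0..1})"
      by (intro has_vector_derivative_diff der t)
    then have b: "((\<lambda>t. x1 t - x2 t) has_vector_derivative (- G t)) (at t within {0..1})"
      by (simp add: G_def)
    show ?thesis
      unfolding Z_def
      using has_vector_derivative_add[OF bounded_bilinear.has_vector_derivative[OF bounded_bilinear_inner a a]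
          bounded_bilinear.has_vector_derivative[OF bounded_bilinear_inner b b]]
      by (simp add: inner_commute)
  qed
  \<comment> \<open>Bounding 2 a b and b^2 by a^2 + b^2, the terms contribute 1, L and 2 L.\<close>
  define k where "k = 1 + 3 * L"
  have Zk: "2 * ((y1 t - y2 t) \<bullet> (x1 t - x2 t)) - 2 * ((x1 t - x2 t) \<bullet> G t) \<le> k * Z t" if t: "t \<in> {\<tau>..\<tau> + d}" for t
  proof -
    define a where "a = norm (y1 t - y2 t)"
    define b where "b = norm (x1 t - x2 t)"
    have Zt: "Z t = a\<^sup>2 + b\<^sup>2" by (simp add: Z_def a_def b_def dot_square_norm)
    have "y1 t \<in> cball x0 r" "y2 t \<in> cball x0 r"
      using in_nbhd[OF t] by (auto simp: y1_def y2_def)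
    then have Gb: "norm (G t) \<le> L * (a + b)"
      unfolding G_def a_def b_def using in_nbhd[OF t] by (intro L(2)) auto
    have "(y1 t - y2 t) \<bullet> (x1 t - x2 t) \<le> a * b" unfolding a_def b_def by (rule norm_cauchy_schwarz)
    moreover have "- ((x1 t - x2 t) \<bullet> G t) \<le> b * (L * (a + b))"
    proof -
      have "- ((x1 t - x2 t) \<bullet> G t) \<le> norm (x1 t - x2 t) * norm (G t)"
        using Cauchy_Schwarz_ineq2[of "x1 t - x2 t" "G t"] by linarith
      also have "\<dots> \<le> b * (L * (a + b))" unfolding b_def[symmetric] using Gb by (intro mult_left_mono) (auto simp: b_def)
      finally show ?thesis .
    qed
    ultimately have "2 * ((y1 t - y2 t) \<bullet> (x1 t - x2 t)) - 2 * ((x1 t - x2 t) \<bullet> G t) \<le> 2 * (a * b) + 2 * (b * (L * (a + b)))"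
      by linarith
    also have "\<dots> = (2 * a * b) + L * (2 * a * b) + 2 * L * b\<^sup>2" by (simp add: power2_eq_square algebra_simps)
    also have "\<dots> \<le> (a\<^sup>2 + b\<^sup>2) + L * (a\<^sup>2 + b\<^sup>2) + 2 * L * (a\<^sup>2 + b\<^sup>2)"
      using sum_squares_bound[of a b] L(1) by (intro add_mono mult_left_mono) auto
    also have "\<dots> = k * Z t" by (simp add: k_def Zt algebra_simps)
    finally show ?thesis .
  qed
  have Z0: "Z t \<le> 0" if t: "t \<in> {\<tau><..\<tau> + d}" for t
  proof -
    have "Z t \<le> exp (k * (t - \<tau>)) * Z \<tau>"
    proof (rule gronwall)
      show "\<tau> < t" using t by auto
      show "continuous_on {\<tau>..t} Z"
        unfolding continuous_on_eq_continuous_within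
      proof
        fix s assume s: "s \<in> {\<tau>..t}"
        then have "s \<in> {\<tau>..\<tau> + d}" using t by auto
        from has_vector_derivative_continuous[OF dZ[OF this]]
        show "continuous (at s within {\<tau>..t}) Z"
          by (rule continuous_within_subset) (use \<tau> d t in auto)
      qed
      fix s assume s: "s \<in> {\<tau><..<t}"
      then have s': "s \<in> {\<tau>..\<tau> + d}" using t by auto
      have "at s within {0..1} = at s" using s \<tau> d t by (intro at_within_interior) auto
      then show "\<exists>z. (Z has_real_derivative z) (at s) \<and> z \<le> k * Z s"
        using dZ[OF s'] Zk[OF s'] by (auto simp: has_real_derivative_iff_has_vector_derivative)
    qed
    moreover have "Z \<tau> = 0" using veq eq by (simp add: Z_def y1_def y2_def)
    ultimately show ?thesis by simp
  qed
  have "\<gamma>\<^sub>1 t = \<gamma>\<^sub>2 t" if t: "t \<in> {\<tau>..\<tau> + d}" for t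
  proof (cases "t = \<tau>")
    case False
    then have "Z t \<le> 0" using Z0 t by auto
    moreover have "0 \<le> (y1 t - y2 t) \<bullet> (y1 t - y2 t)" "0 \<le> (x1 t - x2 t) \<bullet> (x1 t - x2 t)" by auto
    ultimately have "(y1 t - y2 t) \<bullet> (y1 t - y2 t) = 0" unfolding Z_def by linarith
    then have "snd c (\<gamma>\<^sub>1 t) = snd c (\<gamma>\<^sub>2 t)" by (simp add: y1_def y2_def)
    then show ?thesis
      using chart_inj[OF c(1)] in_nbhd[OF t] by (auto dest: inj_onD)
  qed (use eq in simp)
  then show ?thesis using d by (intro exI[of _ d]) auto
qed

text \<open>The supremum \<tau> of the times up to which the curves agree is itself such a time. If
  it were less than 1, position and velocity would agree there and the local step would carry
  agreement beyond it.\<close>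

lemma geodesic_unique:
  assumes g1: "geodesic A g \<gamma>\<^sub>1" and g2: "geodesic A g \<gamma>\<^sub>2" and eq0: "\<gamma>\<^sub>1 0 = \<gamma>\<^sub>2 0"
    and v0: "velocity A \<gamma>\<^sub>1 0 = velocity A \<gamma>\<^sub>2 0" and t: "t \<in> {0..1}"
  shows "\<gamma>\<^sub>1 t = \<gamma>\<^sub>2 t"
proof -
  define E where "E = {t\<in>{0..1}. \<forall>s\<in>{0..t}. \<gamma>\<^sub>1 s = \<gamma>\<^sub>2 s}"
  define \<tau> where "\<tau> = Sup E"
  have E0: "0 \<in> E" using eq0 by (auto simp: E_def)
  have bdd: "bdd_above E" by (rule bdd_aboveI[of _ 1]) (auto simp: E_def)
  have \<tau>0: "0 \<le> \<tau>" unfolding \<tau>_def using E0 bdd by (rule cSup_upper)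
  have "E \<noteq> {}" using E0 by blast
  then have \<tau>1: "\<tau> \<le> 1" unfolding \<tau>_def by (rule cSup_least) (simp add: E_def)
  have before: "\<gamma>\<^sub>1 s = \<gamma>\<^sub>2 s" if s: "0 \<le> s" "s < \<tau>" for s
  proof -
    obtain t where "t \<in> E" "s < t" using less_cSupD[OF _ s(2)[unfolded \<tau>_def]] E0 by blast
    then show ?thesis using s(1) by (auto simp: E_def)
  qed
  \<comment> \<open>Agreement before \<tau> passes to \<tau> because the space is Hausdorff.\<close>
  have at: "\<gamma>\<^sub>1 \<tau> = \<gamma>\<^sub>2 \<tau>"
  proof (rule ccontr)
    assume "\<gamma>\<^sub>1 \<tau> \<noteq> \<gamma>\<^sub>2 \<tau>"
    from hausdorff[OF this]
    obtain V W where VW: "open V" "open W" "\<gamma>\<^sub>1 \<tau> \<in> V" "\<gamma>\<^sub>2 \<tau> \<in> W" "V \<inter> W = {}"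
      by blast
    have \<tau>01: "\<tau> \<in> {0..1}" using \<tau>0 \<tau>1 by auto
    have "\<tau> \<noteq> 0" using eq0 \<open>\<gamma>\<^sub>1 \<tau> \<noteq> \<gamma>\<^sub>2 \<tau>\<close> by auto
    obtain d1 where d1: "d1 > 0" "\<And>t. t \<in> {0..1} \<Longrightarrow> \<bar>t - \<tau>\<bar> < d1 \<Longrightarrow> \<gamma>\<^sub>1 t \<in> V"
      using continuous_near[OF geodesicD(1)[OF g1] \<tau>01 VW(1,3)] by blast
    obtain d2 where d2: "d2 > 0" "\<And>t. t \<in> {0..1} \<Longrightarrow> \<bar>t - \<tau>\<bar> < d2 \<Longrightarrow> \<gamma>\<^sub>2 t \<in> W"
      using continuous_near[OF geodesicD(1)[OF g2] \<tau>01 VW(2,4)] by blast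
    define s where "s = max 0 (\<tau> - min d1 d2 / 2)"
    have s: "0 \<le> s" "s < \<tau>" "\<bar>s - \<tau>\<bar> < d1" "\<bar>s - \<tau>\<bar> < d2"
      using \<tau>0 \<open>\<tau> \<noteq> 0\<close> d1(1) d2(1) by (auto simp: s_def)
    then have "\<gamma>\<^sub>1 s \<in> V" "\<gamma>\<^sub>2 s \<in> W" using d1(2)[of s] d2(2)[of s] \<tau>1 by auto
    then show False using before[OF s(1,2)] VW(5) by auto
  qed
  have upto: "\<gamma>\<^sub>1 s = \<gamma>\<^sub>2 s" if "s \<in> {0..\<tau>}" for s
    using before[of s] at that by (cases "s = \<tau>") auto
  have "\<tau> = 1"
  proof (rule ccontr)
    assume "\<tau> \<noteq> 1"
    then have lt: "\<tau> < 1" using \<tau>1 by simp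
    have \<tau>01: "\<tau> \<in> {0..1}" using \<tau>0 \<tau>1 by auto
    obtain c where c: "c \<in> A" "\<gamma>\<^sub>1 \<tau> \<in> fst c"
    proof -
      have "\<gamma>\<^sub>1 \<tau> \<in> carrier A" using geodesicD(2)[OF g1] \<tau>01 by blast
      then show thesis using that unfolding carrier_def by blast
    qed
    then have c2: "\<gamma>\<^sub>2 \<tau> \<in> fst c" using at by simp
    obtain x1 where x1: "\<And>t. t \<in> {0..1} \<Longrightarrow> \<gamma>\<^sub>1 t \<in> fst c \<Longrightarrow>
        ((snd c \<circ> \<gamma>\<^sub>1) has_vector_derivative x1 t) (at t within {0..1}) \<and>
        (x1 has_vector_derivative - christoffel A g c (snd c (\<gamma>\<^sub>1 t)) (x1 t) (x1 t)) (at t within {0..1})"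
      using geodesicD(3)[OF g1 c(1)] by blast
    obtain x2 where x2: "\<And>t. t \<in> {0..1} \<Longrightarrow> \<gamma>\<^sub>2 t \<in> fst c \<Longrightarrow>
        ((snd c \<circ> \<gamma>\<^sub>2) has_vector_derivative x2 t) (at t within {0..1}) \<and>
        (x2 has_vector_derivative - christoffel A g c (snd c (\<gamma>\<^sub>2 t)) (x2 t) (x2 t)) (at t within {0..1})"
      using geodesicD(3)[OF g2 c(1)] by blast
    \<comment> \<open>For \<tau> > 0 both velocities are derivatives from the left of the same
      curve; for \<tau> = 0 they agree by hypothesis.\<close>
    have veq: "x1 \<tau> = x2 \<tau>"
    proof (cases "\<tau> = 0")
      case True
      have "velocity A \<gamma>\<^sub>1 0 c = x1 0" "velocity A \<gamma>\<^sub>2 0 c = x2 0"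
        using x1[OF \<tau>01 c(2)] x2[OF \<tau>01 c2] c c2 True
        by (auto simp: velocity_def intro!: vector_derivative_unit_interval)
      then show ?thesis using v0 True by simp
    next
      case False
      then have pos: "0 < \<tau>" using \<tau>0 by simp
      have a: "((snd c \<circ> \<gamma>\<^sub>1) has_vector_derivative x1 \<tau>) (at \<tau> within {0..\<tau>})"
        by (rule has_vector_derivative_within_subset[of _ _ _ "{0..1}"]) (use x1[OF \<tau>01 c(2)] \<tau>1 in auto)
      have "((snd c \<circ> \<gamma>\<^sub>2) has_vector_derivative x2 \<tau>) (at \<tau> within {0..\<tau>})"
        by (rule has_vector_derivative_within_subset[of _ _ _ "{0..1}"]) (use x2[OF \<tau>01 c2] \<tau>1 in auto)
      then have "((snd c \<circ> \<gamma>\<^sub>1) has_vector_derivative x2 \<tau>) (at \<tau> within {0..\<tau>})"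
        by (rule has_vector_derivative_transform[rotated -1]) (use upto \<tau>0 in auto)
      from has_vector_derivative_within_unique[OF pos _ a this] show ?thesis using \<tau>0 by simp
    qed
    obtain d where d: "d > 0" "\<tau> + d \<le> 1" "\<forall>t\<in>{\<tau>..\<tau> + d}. \<gamma>\<^sub>1 t = \<gamma>\<^sub>2 t"
      using geodesic_unique_step[OF g1 g2 \<tau>0 lt c at x1 x2 veq] by blast
    have "\<tau> + d \<in> E"
      unfolding E_def
    proof (intro CollectI conjI ballI)
      show "\<tau> + d \<in> {0..1}" using d \<tau>0 by auto
      fix s assume "s \<in> {0..\<tau> + d}"
      then show "\<gamma>\<^sub>1 s = \<gamma>\<^sub>2 s" using upto[of s] d(3) by (cases "s \<le> \<tau>") auto
    qed
    then have "\<tau> + d \<le> \<tau>" unfolding \<tau>_def using bdd by (rule cSup_upper)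
    then show False using d(1) by simp
  qed
  then show ?thesis using upto[of t] t by simp
qed

text \<open>The geodesic equation is homogeneous because \<Gamma> is quadratic in the velocity. This
  identifies \<open>exp_curve\<close>, defined by the exponentials of all shortened vectors, with a
  single geodesic run from time 0.\<close>

lemma geodesic_scale:
  assumes g: "geodesic A g \<gamma>" and s: "s \<in> {0..1}"
  shows "geodesic A g (\<lambda>r. \<gamma> (s * r))"
    and "velocity A (\<lambda>r. \<gamma> (s * r)) 0 = (\<lambda>c. s *\<^sub>R velocity A \<gamma> 0 c)"
proof -
  have sr: "s * r \<in> {0..1}" if "r \<in> {0..1}" for r
    using that s by (auto simp: mult_le_one)
  have img: "(\<lambda>r. s * r) ` {0..1} \<subseteq> {0..1}" using sr by auto
  have d: "((\<lambda>r. f (s * r)) has_vector_derivative s *\<^sub>R z) (at r within {0..1})"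
    if "(f has_vector_derivative z) (at (s * r) within {0..1})" for f :: "real \<Rightarrow> 'e" and z r
  proof -
    have "((\<lambda>r. s * r) has_vector_derivative s) (at r within {0..1})"
      by (auto intro!: derivative_eq_intros simp: has_real_derivative_iff_has_vector_derivative[symmetric])
    from vector_diff_chain_within[OF this has_vector_derivative_within_subset[OF that img]]
    show ?thesis by (simp add: comp_def)
  qed
  show "geodesic A g (\<lambda>r. \<gamma> (s * r))"
    unfolding geodesic_def
  proof (intro conjI ballI)
    show "continuous_on {0..1} (\<lambda>r. \<gamma> (s * r))"
      by (rule continuous_on_compose2[OF geodesicD(1)[OF g] _ img]) (intro continuous_intros)
    show "(\<lambda>r. \<gamma> (s * r)) ` {0..1} \<subseteq> carrier A"
      using geodesicD(2)[OF g] sr by auto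
    fix c assume c: "c \<in> A"
    interpret C: chart_metric "chart_image c" "metric_coords A g c" by (rule chart_metric[OF c])
    obtain x where x: "\<And>t. t \<in> {0..1} \<Longrightarrow> \<gamma> t \<in> fst c \<Longrightarrow>
        ((snd c \<circ> \<gamma>) has_vector_derivative x t) (at t within {0..1}) \<and>
        (x has_vector_derivative - christoffel A g c (snd c (\<gamma> t)) (x t) (x t)) (at t within {0..1})"
      using geodesicD(3)[OF g c] by blast
    show "\<exists>x'. \<forall>t\<in>{0..1}. \<gamma> (s * t) \<in> fst c \<longrightarrow>
        ((snd c \<circ> (\<lambda>r. \<gamma> (s * r))) has_vector_derivative x' t) (at t within {0..1}) \<and>
        (x' has_vector_derivative - christoffel A g c (snd c (\<gamma> (s * t))) (x' t) (x' t)) (at t within {0..1})"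
    proof (intro exI[of _ "\<lambda>r. s *\<^sub>R x (s * r)"] ballI impI conjI)
      fix t assume t: "t \<in> {0..1::real}" "\<gamma> (s * t) \<in> fst c"
      note X = x[OF sr[OF t(1)] t(2)]
      show "((snd c \<circ> (\<lambda>r. \<gamma> (s * r))) has_vector_derivative s *\<^sub>R x (s * t)) (at t within {0..1})"
        using d[of "snd c \<circ> \<gamma>" _ t] X by (simp add: comp_def)
      have "((\<lambda>r. s *\<^sub>R x (s * r)) has_vector_derivative s *\<^sub>R (s *\<^sub>R - christoffel A g c (snd c (\<gamma> (s * t))) (x (s * t)) (x (s * t)))) (at t within {0..1})"
        by (rule bounded_linear.has_vector_derivative[OF bounded_linear_scaleR_right d[OF conjunct2[OF X]]])
      moreover have "christoffel A g c (snd c (\<gamma> (s * t))) (s *\<^sub>R x (s * t)) (s *\<^sub>R x (s * t)) =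
          s *\<^sub>R s *\<^sub>R christoffel A g c (snd c (\<gamma> (s * t))) (x (s * t)) (x (s * t))"
        unfolding christoffel_eq[OF c] using C.\<Gamma>_scale[of "snd c (\<gamma> (s * t))"] t(2) by (simp add: power2_eq_square)
      ultimately show "((\<lambda>r. s *\<^sub>R x (s * r)) has_vector_derivative
          - christoffel A g c (snd c (\<gamma> (s * t))) (s *\<^sub>R x (s * t)) (s *\<^sub>R x (s * t))) (at t within {0..1})"
        by simp
    qed
  qed
  show "velocity A (\<lambda>r. \<gamma> (s * r)) 0 = (\<lambda>c. s *\<^sub>R velocity A \<gamma> 0 c)"
  proof
    fix c
    show "velocity A (\<lambda>r. \<gamma> (s * r)) 0 c = s *\<^sub>R velocity A \<gamma> 0 c"
    proof (cases "c \<in> A \<and> \<gamma> 0 \<in> fst c")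
      case True
      then obtain z where z: "((snd c \<circ> \<gamma>) has_vector_derivative z) (at 0 within {0..1})"
        using geodesicD(3)[OF g, of c] by force
      then have "((snd c \<circ> (\<lambda>r. \<gamma> (s * r))) has_vector_derivative s *\<^sub>R z) (at 0 within {0..1})"
        using d[of "snd c \<circ> \<gamma>" z 0] by (simp add: comp_def)
      then have "vector_derivative (snd c \<circ> (\<lambda>r. \<gamma> (s * r))) (at 0 within {0..1}) = s *\<^sub>R z"
        by (intro vector_derivative_unit_interval) auto
      moreover have "vector_derivative (snd c \<circ> \<gamma>) (at 0 within {0..1}) = z"
        using z by (intro vector_derivative_unit_interval) auto
      ultimately show ?thesis using True by (simp add: velocity_def)
    qed (auto simp: velocity_def)
  qed
qed

lemma riem_exp_eq:
  assumes "geodesic A g \<gamma>" "\<gamma> 0 = p" "velocity A \<gamma> 0 = v"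
  shows "riem_exp A g p v = \<gamma> 1"
  unfolding riem_exp_def
proof (rule the_equality)
  show "\<exists>\<gamma>'. geodesic A g \<gamma>' \<and> \<gamma>' 0 = p \<and> velocity A \<gamma>' 0 = v \<and> \<gamma>' 1 = \<gamma> 1" using assms by blast
  fix q assume "\<exists>\<gamma>'. geodesic A g \<gamma>' \<and> \<gamma>' 0 = p \<and> velocity A \<gamma>' 0 = v \<and> \<gamma>' 1 = q"
  then obtain \<gamma>' where "geodesic A g \<gamma>'" "\<gamma>' 0 = p" "velocity A \<gamma>' 0 = v" "\<gamma>' 1 = q" by blast
  then show "q = \<gamma> 1" using geodesic_unique[of \<gamma>' \<gamma> 1] assms by simp
qed

lemma exp_curve_eq:
  assumes "geodesic A g \<gamma>" "\<gamma> 0 = p" "velocity A \<gamma> 0 = v" "t \<in> {0..1}"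
  shows "exp_curve A g p v t = \<gamma> t"
  using riem_exp_eq[OF geodesic_scale(1)[OF assms(1,4)], of p "\<lambda>c. t *\<^sub>R v c"] geodesic_scale(2)[OF assms(1,4)] assms(2,3)
  by (simp add: exp_curve_def)

lemma velocity_cong:
  assumes "\<And>s. s \<in> {0..1} \<Longrightarrow> \<gamma> s = \<gamma>' s" "t \<in> {0..1}"
  shows "velocity A \<gamma> t = velocity A \<gamma>' t"
proof -
  have "((snd c \<circ> \<gamma>) has_vector_derivative z) (at t within {0..1}) \<longleftrightarrow> ((snd c \<circ> \<gamma>') has_vector_derivative z) (at t within {0..1})"
    for c :: "('m, 'e) chart" and z
    using has_vector_derivative_transform[of t "{0..1}" "snd c \<circ> \<gamma>" "snd c \<circ> \<gamma>'" z]
      has_vector_derivative_transform[of t "{0..1}" "snd c \<circ> \<gamma>'" "snd c \<circ> \<gamma>" z] assms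
    by auto
  then have "vector_derivative (snd c \<circ> \<gamma>) (at t within {0..1}) = vector_derivative (snd c \<circ> \<gamma>') (at t within {0..1})"
    for c :: "('m, 'e) chart"
    unfolding vector_derivative_def by simp
  note eq = this
  show ?thesis
  proof
    fix c
    show "velocity A \<gamma> t c = velocity A \<gamma>' t c"
      using assms(1)[OF assms(2)] eq[of c] unfolding velocity_def by (simp only:)
  qed
qed

end

subsection \<open>The distance on the parameter space\<close>

lemma vector_mvt_bound:
  fixes f :: "real \<Rightarrow> 'a::euclidean_space"
  assumes ab: "a \<le> b" and f: "\<And>t. t \<in> {a..b} \<Longrightarrow> (f has_vector_derivative f' t) (at t within {a..b})"
    and B: "\<And>t. t \<in> {a..b} \<Longrightarrow> norm (f' t) \<le> B"
  shows "norm (f b - f a) \<le> B * (b - a)"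
proof -
  have "norm (f b - f a) \<le> B * norm (b - a)"
  proof (rule differentiable_bound[of "{a..b}"])
    fix t assume t: "t \<in> {a..b}"
    show "(f has_derivative (\<lambda>h. h *\<^sub>R f' t)) (at t within {a..b})"
      using f[OF t] by (simp add: has_vector_derivative_def)
    show "onorm (\<lambda>h. h *\<^sub>R f' t) \<le> B"
    proof (rule onorm_le)
      show "norm (h *\<^sub>R f' t) \<le> B * norm h" for h :: real
        using mult_left_mono[OF B[OF t], of "\<bar>h\<bar>"] by (simp add: mult.commute)
    qed
  qed (use ab in auto)
  then show ?thesis using ab by simp
qed

lemma has_vector_derivative_affine:
  fixes f :: "real \<Rightarrow> 'a::real_normed_vector"
  assumes "(f has_vector_derivative z) (at (u * r + w) within T)" "\<And>s. s \<in> S \<Longrightarrow> u * s + w \<in> T"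
  shows "((\<lambda>r. f (u * r + w)) has_vector_derivative u *\<^sub>R z) (at r within S)"
proof -
  have "((\<lambda>r. u * r + w) has_vector_derivative u) (at r within S)"
    by (auto intro!: derivative_eq_intros simp: has_real_derivative_iff_has_vector_derivative[symmetric])
  from vector_diff_chain_within[OF this has_vector_derivative_within_subset[OF assms(1)]]
  show ?thesis using assms(2) by (auto simp: comp_def)
qed

lemma at_within_interval_subset:
  assumes "{a..b} \<subseteq> {0..1::real}" "r \<in> {a<..<b}"
  shows "at r within {a..b} = at r" "at r within {0..1} = at r"
proof -
  show 1: "at r within {a..b} = at r" using assms(2) by (intro at_within_interior) auto
  have "r \<in> interior {a..b}" using assms(2) by auto
  then have "r \<in> interior {0..1}" using interior_mono[OF assms(1)] by blast
  then show "at r within {0..1} = at r" by (rule at_within_interior)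
qed

context riemannian_manifold
begin

text \<open>Only interior times are treated: there the derivatives within the small interval, within
  [0,1] and on the line are the same. The end points are negligible in all integrals.\<close>

lemma velocity_affine:
  assumes ab: "{a..b} \<subseteq> {0..1}" and r: "r \<in> {a<..<b}"
    and map: "\<And>s. s \<in> {a..b} \<Longrightarrow> u * s + w \<in> {0..1}" "\<And>s. s \<in> {a..b} \<Longrightarrow> \<gamma>' s = \<gamma> (u * s + w)"
    and cont: "continuous_on {0..1} \<gamma>"
    and c: "c \<in> A" "\<gamma> (u * r + w) \<in> fst c"
    and d: "((snd c \<circ> \<gamma>) has_vector_derivative z) (at (u * r + w) within {0..1})"
  shows "velocity A \<gamma>' r = (\<lambda>c. u *\<^sub>R velocity A \<gamma> (u * r + w) c)"
    and "velocity A \<gamma> (u * r + w) \<in> tangent_space A (\<gamma> (u * r + w))"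
proof -
  have r': "r \<in> {a..b}" "r \<in> {0..1}" using r ab by auto
  have cg: "continuous (at s within {0..1}) \<gamma>" if "s \<in> {0..1}" for s
    using cont that by (simp add: continuous_on_eq_continuous_within)
  have v: "velocity A \<gamma> (u * r + w) = coord_vector A c (\<gamma> (u * r + w)) z"
    by (rule velocity_eq[OF map(1)[OF r'(1)] cg[OF map(1)[OF r'(1)]] c d])
  show "velocity A \<gamma> (u * r + w) \<in> tangent_space A (\<gamma> (u * r + w))"
    unfolding v by (rule coord_vector_tangent[OF c])
  have "continuous_on {a..b} (\<lambda>s. \<gamma> (u * s + w))"
    by (rule continuous_on_compose2[OF cont]) (use map(1) in \<open>auto intro!: continuous_intros\<close>)
  then have "continuous_on {a..b} \<gamma>'"
    by (rule continuous_on_eq) (simp add: map(2))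
  then have "continuous (at r within {a..b}) \<gamma>'"
    using r'(1) by (simp add: continuous_on_eq_continuous_within)
  then have c': "continuous (at r within {0..1}) \<gamma>'"
    by (simp only: at_within_interval_subset[OF ab r])
  have "((\<lambda>s. (snd c \<circ> \<gamma>) (u * s + w)) has_vector_derivative u *\<^sub>R z) (at r within {a..b})"
    by (rule has_vector_derivative_affine[OF d map(1)])
  then have "((snd c \<circ> \<gamma>') has_vector_derivative u *\<^sub>R z) (at r within {a..b})"
    by (rule has_vector_derivative_transform[OF r'(1), rotated]) (simp add: map(2))
  then have "((snd c \<circ> \<gamma>') has_vector_derivative u *\<^sub>R z) (at r within {0..1})"
    by (simp only: at_within_interval_subset[OF ab r])
  from velocity_eq[OF r'(2) c' c(1) _ this] c(2) map(2)[OF r'(1)]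
  show "velocity A \<gamma>' r = (\<lambda>c. u *\<^sub>R velocity A \<gamma> (u * r + w) c)"
    by (simp add: v coord_vector_scale[OF c])
qed

end

section \<open>\<open>dist_S\<close> as a metric, with minimising geodesics from
  \<open>D\<close>\<close>

context parameter_space
begin

abbreviation dist_S :: "'m \<Rightarrow> 'm \<Rightarrow> real" where
  "dist_S \<equiv> riem_dist A g S"

lemma dist_S_nonneg: "0 \<le> dist_S p q"
  by (simp add: riem_dist_def)

lemma D_S: "(\<theta>, \<eta>) \<in> D \<Longrightarrow> \<theta> \<in> S" and D_in_tangent: "(\<theta>, \<eta>) \<in> D \<Longrightarrow> \<eta> \<in> tangent_space A \<theta>"
  using D_tangent by blast+

lemma D_norm: "(\<theta>, \<eta>) \<in> D \<Longrightarrow> tangent_norm g \<theta> \<eta> = dist_S \<theta> (riem_exp A g \<theta> \<eta>)"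
  using D_speed[of \<theta> \<eta> 0] by simp

lemma exp_curve_1: "exp_curve A g \<theta> \<eta> 1 = riem_exp A g \<theta> \<eta>"
  by (simp add: exp_curve_def)

lemma D_curve:
  assumes "(\<theta>, \<eta>) \<in> D"
  shows "geodesic A g (exp_curve A g \<theta> \<eta>)" "t \<in> {0..1} \<Longrightarrow> exp_curve A g \<theta> \<eta> t \<in> S" "exp_curve A g \<theta> \<eta> 0 = \<theta>"
  using D_geodesic[OF assms] by auto

text \<open>\<open>exp_curve\<close> is assembled from end points of different geodesics; it has
  initial velocity \<eta> because by uniqueness it is the one geodesic that
  \<open>exp_defined\<close> provides.\<close>

lemma D_velocity_0:
  assumes "(\<theta>, \<eta>) \<in> D"
  shows "velocity A (exp_curve A g \<theta> \<eta>) 0 = \<eta>"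
proof -
  obtain \<gamma> where \<gamma>: "geodesic A g \<gamma>" "\<gamma> 0 = \<theta>" "velocity A \<gamma> 0 = \<eta>"
    using D_exp_defined[OF assms] by (auto simp: exp_defined_def)
  have "velocity A (exp_curve A g \<theta> \<eta>) 0 = velocity A \<gamma> 0"
    by (rule velocity_cong) (use exp_curve_eq[OF \<gamma>] in auto)
  then show ?thesis using \<gamma>(3) by simp
qed

lemma D_curve_affine:
  assumes D: "(\<theta>, \<eta>) \<in> D" and ab: "a < b" "{a..b} \<subseteq> {0..1}"
    and map: "\<And>s. s \<in> {a..b} \<Longrightarrow> u * s + w \<in> {0..1}" "\<And>s. s \<in> {a..b} \<Longrightarrow> \<gamma> s = exp_curve A g \<theta> \<eta> (u * s + w)"
  shows "C1_curve_on A a b \<gamma>"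
    and "\<And>r. r \<in> {a<..<b} \<Longrightarrow> tangent_norm g (\<gamma> r) (velocity A \<gamma> r) = \<bar>u\<bar> * tangent_norm g \<theta> \<eta>"
proof -
  define \<alpha> where "\<alpha> = exp_curve A g \<theta> \<eta>"
  note G = D_curve(1)[OF D, folded \<alpha>_def]
  have m2: "\<gamma> s = \<alpha> (u * s + w)" if "s \<in> {a..b}" for s using map(2)[OF that] by (simp add: \<alpha>_def)
  have cont: "continuous_on {0..1} \<alpha>" by (rule geodesicD(1)[OF G])
  show "C1_curve_on A a b \<gamma>"
    unfolding C1_curve_on_def
  proof (intro conjI ballI)
    have "continuous_on {a..b} (\<lambda>s. \<alpha> (u * s + w))"
      by (rule continuous_on_compose2[OF cont]) (use map(1) in \<open>auto intro!: continuous_intros\<close>)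
    then show "continuous_on {a..b} \<gamma>" by (rule continuous_on_eq) (simp add: m2)
    show "\<gamma> ` {a..b} \<subseteq> carrier A"
      using geodesicD(2)[OF G] map(1) m2 by auto
    fix c assume c: "c \<in> A"
    obtain x where x: "\<And>t. t \<in> {0..1} \<Longrightarrow> \<alpha> t \<in> fst c \<Longrightarrow>
        ((snd c \<circ> \<alpha>) has_vector_derivative x t) (at t within {0..1}) \<and>
        (x has_vector_derivative - christoffel A g c (snd c (\<alpha> t)) (x t) (x t)) (at t within {0..1})"
      using geodesicD(3)[OF G c] by blast
    show "\<exists>x'. continuous_on {t \<in> {a..b}. \<gamma> t \<in> fst c} x' \<and>
        (\<forall>t\<in>{a..b}. \<gamma> t \<in> fst c \<longrightarrow> ((snd c \<circ> \<gamma>) has_vector_derivative x' t) (at t within {a..b}))"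
    proof (intro exI[of _ "\<lambda>s. u *\<^sub>R x (u * s + w)"] conjI ballI impI)
      show "continuous_on {t \<in> {a..b}. \<gamma> t \<in> fst c} (\<lambda>s. u *\<^sub>R x (u * s + w))"
        unfolding continuous_on_eq_continuous_within
      proof
        fix s assume s: "s \<in> {t \<in> {a..b}. \<gamma> t \<in> fst c}"
        then have s': "s \<in> {a..b}" "\<alpha> (u * s + w) \<in> fst c" using m2 by auto
        have "((\<lambda>s. x (u * s + w)) has_vector_derivative
            u *\<^sub>R - christoffel A g c (snd c (\<alpha> (u * s + w))) (x (u * s + w)) (x (u * s + w))) (at s within {a..b})"
          using x[OF map(1)[OF s'(1)] s'(2)] map(1) by (intro has_vector_derivative_affine) auto
        from has_vector_derivative_continuous[OF this]
        have "continuous (at s within {t \<in> {a..b}. \<gamma> t \<in> fst c}) (\<lambda>s. x (u * s + w))"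
          by (rule continuous_within_subset) auto
        then show "continuous (at s within {t \<in> {a..b}. \<gamma> t \<in> fst c}) (\<lambda>s. u *\<^sub>R x (u * s + w))"
          by (intro continuous_scaleR continuous_const)
      qed
      fix s assume s: "s \<in> {a..b}" "\<gamma> s \<in> fst c"
      have "((\<lambda>s. (snd c \<circ> \<alpha>) (u * s + w)) has_vector_derivative u *\<^sub>R x (u * s + w)) (at s within {a..b})"
      proof (rule has_vector_derivative_affine)
        have "\<alpha> (u * s + w) \<in> fst c" using s m2 by simp
        then show "((snd c \<circ> \<alpha>) has_vector_derivative x (u * s + w)) (at (u * s + w) within {0..1})"
          using x[OF map(1)[OF s(1)]] by blast
      qed (rule map(1))
      then show "((snd c \<circ> \<gamma>) has_vector_derivative u *\<^sub>R x (u * s + w)) (at s within {a..b})"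
        by (rule has_vector_derivative_transform[OF s(1), rotated]) (simp add: m2)
    qed
  qed
  fix r assume r: "r \<in> {a<..<b}"
  then have r': "r \<in> {a..b}" by auto
  have "\<alpha> (u * r + w) \<in> carrier A" using geodesicD(2)[OF G] map(1)[OF r'] by blast
  then obtain c where c: "c \<in> A" "\<alpha> (u * r + w) \<in> fst c" unfolding carrier_def by blast
  then obtain z where z: "((snd c \<circ> \<alpha>) has_vector_derivative z) (at (u * r + w) within {0..1})"
    using geodesicD(3)[OF G c(1)] map(1)[OF r'] by blast
  have V: "velocity A \<gamma> r = (\<lambda>c. u *\<^sub>R velocity A \<alpha> (u * r + w) c)"
      "velocity A \<alpha> (u * r + w) \<in> tangent_space A (\<alpha> (u * r + w))"
    using velocity_affine[OF ab(2) r, of u w \<gamma> \<alpha>, OF map(1) m2 cont c z] by simp_all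
  have "tangent_norm g (\<gamma> r) (velocity A \<gamma> r) = \<bar>u\<bar> * tangent_norm g (\<alpha> (u * r + w)) (velocity A \<alpha> (u * r + w))"
    unfolding V(1) m2[OF r'] by (rule tangent_norm_scale[OF carrier_chart[OF c] V(2)])
  then show "tangent_norm g (\<gamma> r) (velocity A \<gamma> r) = \<bar>u\<bar> * tangent_norm g \<theta> \<eta>"
    using D_speed[OF D map(1)[OF r']] by (simp add: \<alpha>_def)
qed

lemma dist_S_le:
  assumes "piecewise_C1_curve A \<gamma>" "\<gamma> ` {0..1} \<subseteq> S" "\<gamma> 0 = p" "\<gamma> 1 = q"
    and "curve_length A g \<gamma> \<le> ennreal l" "0 \<le> l"
  shows "dist_S p q \<le> l"
  unfolding riem_dist_def
  by (rule enn2real_leI[OF assms(6)], rule INF_lower2[of \<gamma>]) (use assms in auto)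

text \<open>The piece of the geodesic between the two times, run affinely over [0,1]. The times may
  come in either order, from which the symmetry of \<open>dist_S\<close> follows.\<close>

lemma dist_S_exp_curve:
  assumes D: "(\<theta>, \<eta>) \<in> D" and s: "s \<in> {0..1}" and t: "t \<in> {0..1}"
  shows "dist_S (exp_curve A g \<theta> \<eta> s) (exp_curve A g \<theta> \<eta> t) \<le> \<bar>t - s\<bar> * tangent_norm g \<theta> \<eta>"
proof -
  define \<gamma> where "\<gamma> = (\<lambda>r. exp_curve A g \<theta> \<eta> ((t - s) * r + s))"
  have map: "(t - s) * r + s \<in> {0..1}" if "r \<in> {0..1}" for r
  proof -
    have "(t - s) * r + s = (1 - r) * s + r * t" by (simp add: algebra_simps)
    moreover have "(1 - r) * s + r * t \<le> (1 - r) * 1 + r * 1" using that s t by (intro add_mono mult_left_mono) auto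
    moreover have "0 \<le> (1 - r) * s + r * t" using that s t by simp
    ultimately show ?thesis by simp
  qed
  have C1: "C1_curve_on A 0 1 \<gamma>" and sp: "\<And>r. r \<in> {0<..<1} \<Longrightarrow> tangent_norm g (\<gamma> r) (velocity A \<gamma> r) = \<bar>t - s\<bar> * tangent_norm g \<theta> \<eta>"
    using D_curve_affine[OF D zero_less_one subset_refl map, where \<gamma> = \<gamma>] by (auto simp: \<gamma>_def)
  show ?thesis
  proof (rule dist_S_le)
    show "piecewise_C1_curve A \<gamma>"
      unfolding piecewise_C1_curve_def using C1 by (intro exI[of _ "{0, 1}"]) auto
    show "\<gamma> ` {0..1} \<subseteq> S" using D_curve(2)[OF D] map by (auto simp: \<gamma>_def)
    show "\<gamma> 0 = exp_curve A g \<theta> \<eta> s" "\<gamma> 1 = exp_curve A g \<theta> \<eta> t" by (simp_all add: \<gamma>_def)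
    show "0 \<le> \<bar>t - s\<bar> * tangent_norm g \<theta> \<eta>" using D_norm[OF D] dist_S_nonneg by simp
    have "AE r in lborel. r \<noteq> 0 \<and> r \<noteq> (1::real)"
      using AE_lborel_singleton[of 0] AE_lborel_singleton[of 1] by (rule eventually_conj)
    then have "AE r in lborel. ennreal (tangent_norm g (\<gamma> r) (velocity A \<gamma> r)) * indicator {0..1} r
        = ennreal (\<bar>t - s\<bar> * tangent_norm g \<theta> \<eta>) * indicator {0..1} r"
      by eventually_elim (use sp in \<open>auto simp: indicator_def\<close>)
    then have "curve_length A g \<gamma> = (\<integral>\<^sup>+r\<in>{0..1::real}. ennreal (\<bar>t - s\<bar> * tangent_norm g \<theta> \<eta>) \<partial>lborel)"
      unfolding curve_length_def by (rule nn_integral_cong_AE)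
    then show "curve_length A g \<gamma> \<le> ennreal (\<bar>t - s\<bar> * tangent_norm g \<theta> \<eta>)"
      by (simp add: nn_integral_cmult_indicator)
  qed
qed

lemma D_reachesE:
  assumes "p \<in> S" "q \<in> S"
  obtains \<eta> where "(p, \<eta>) \<in> D" "q = riem_exp A g p \<eta>" "tangent_norm g p \<eta> = dist_S p q"
  using D_reaches[OF assms] D_norm by blast

text \<open>\<open>D\<close> supplies curves that attain the two distances, so concatenating them at
  double speed needs no approximation.\<close>

lemma dist_S_triangle:
  assumes p: "p \<in> S" and q: "q \<in> S" and r: "r \<in> S"
  shows "dist_S p r \<le> dist_S p q + dist_S q r"
proof -
  obtain \<eta> where \<eta>: "(p, \<eta>) \<in> D" "q = riem_exp A g p \<eta>" "tangent_norm g p \<eta> = dist_S p q"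
    using D_reachesE[OF p q] .
  obtain \<zeta> where \<zeta>: "(q, \<zeta>) \<in> D" "r = riem_exp A g q \<zeta>" "tangent_norm g q \<zeta> = dist_S q r"
    using D_reachesE[OF q r] .
  define \<alpha> where "\<alpha> = exp_curve A g p \<eta>"
  define \<beta> where "\<beta> = exp_curve A g q \<zeta>"
  define \<gamma> where "\<gamma> = (\<lambda>t::real. if t \<le> 1/2 then \<alpha> (2 * t) else \<beta> (2 * t - 1))"
  have mid: "\<alpha> 1 = \<beta> 0" using \<eta>(2) D_curve(3)[OF \<zeta>(1)] by (simp add: \<alpha>_def \<beta>_def exp_curve_1)
  have sub: "{0..1/2} \<subseteq> {0..1::real}" "{1/2..1} \<subseteq> {0..1::real}" by auto
  have m1: "2 * s + 0 \<in> {0..1}" "\<gamma> s = \<alpha> (2 * s + 0)" if "s \<in> {0..1/2}" for s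
    using that by (auto simp: \<gamma>_def)
  have m2: "2 * s + (-1) \<in> {0..1}" if "s \<in> {1/2..1}" for s :: real
    using that by simp
  have m2': "\<gamma> s = \<beta> (2 * s + (-1))" if s: "s \<in> {1/2..1}" for s
  proof (cases "s = 1/2")
    case True
    then have e: "2 * s = 1" by simp
    show ?thesis unfolding \<gamma>_def e using True mid by simp
  next
    case False
    then show ?thesis using s by (simp add: \<gamma>_def)
  qed
  have C1: "C1_curve_on A 0 (1/2) \<gamma>" and s1: "\<And>s. s \<in> {0<..<1/2} \<Longrightarrow> tangent_norm g (\<gamma> s) (velocity A \<gamma> s) = 2 * dist_S p q"
    using D_curve_affine[OF \<eta>(1) _ sub(1) m1[unfolded \<alpha>_def]] \<eta>(3) by auto
  have C2: "C1_curve_on A (1/2) 1 \<gamma>" and s2: "\<And>s. s \<in> {1/2<..<1} \<Longrightarrow> tangent_norm g (\<gamma> s) (velocity A \<gamma> s) = 2 * dist_S q r"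
    using D_curve_affine[OF \<zeta>(1) _ sub(2) m2 m2'[unfolded \<beta>_def]] \<zeta>(3) by auto
  show ?thesis
  proof (rule dist_S_le)
    show "piecewise_C1_curve A \<gamma>"
      unfolding piecewise_C1_curve_def
    proof (intro exI[of _ "{0, 1/2, 1}"] conjI ballI impI)
      fix a b :: real assume "a \<in> {0, 1/2, 1}" "b \<in> {0, 1/2, 1}" "a < b \<and> {a<..<b} \<inter> {0, 1/2, 1} = {}"
      then have "(a = 0 \<and> b = 1/2) \<or> (a = 1/2 \<and> b = 1)" by auto
      then show "C1_curve_on A a b \<gamma>" using C1 C2 by (elim disjE conjE) (simp_all only:)
    qed auto
    show "\<gamma> ` {0..1} \<subseteq> S"
      using D_curve(2)[OF \<eta>(1)] D_curve(2)[OF \<zeta>(1)] by (auto simp: \<gamma>_def \<alpha>_def \<beta>_def)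
    show "\<gamma> 0 = p" using D_curve(3)[OF \<eta>(1)] by (simp add: \<gamma>_def \<alpha>_def)
    show "\<gamma> 1 = r" using \<zeta>(2) by (simp add: \<gamma>_def \<beta>_def exp_curve_1)
    show "0 \<le> dist_S p q + dist_S q r" using dist_S_nonneg by simp
    have "AE t in lborel. (t \<noteq> 0 \<and> t \<noteq> (1::real)) \<and> t \<noteq> 1/2"
      using AE_lborel_singleton[of 0] AE_lborel_singleton[of 1] AE_lborel_singleton[of "1/2"]
      by (intro eventually_conj)
    then have "AE t in lborel. ennreal (tangent_norm g (\<gamma> t) (velocity A \<gamma> t)) * indicator {0..1} t
        \<le> ennreal (2 * dist_S p q) * indicator {0..1/2} t + ennreal (2 * dist_S q r) * indicator {1/2..1} t"
    proof eventually_elim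
      case (elim t)
      consider "t \<notin> {0..1}" | "t \<in> {0<..<1/2}" | "t \<in> {1/2<..<1}" using elim by force
      then show ?case
      proof cases
        case 2
        then show ?thesis using s1[OF 2] by simp
      next
        case 3
        then show ?thesis using s2[OF 3] by simp
      qed simp
    qed
    then have "curve_length A g \<gamma> \<le> (\<integral>\<^sup>+t. ennreal (2 * dist_S p q) * indicator {0..1/2} t + ennreal (2 * dist_S q r) * indicator {1/2..1::real} t \<partial>lborel)"
      unfolding curve_length_def by (rule nn_integral_mono_AE)
    also have "\<dots> = ennreal (2 * dist_S p q) * ennreal (1/2) + ennreal (2 * dist_S q r) * ennreal (1/2)"
      by (subst nn_integral_add) (auto simp: nn_integral_cmult_indicator)
    also have "\<dots> = ennreal (dist_S p q + dist_S q r)"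
    proof -
      have "ennreal (2 * x) * ennreal (1/2) = ennreal x" if "x \<ge> 0" for x
        by (subst ennreal_mult[symmetric]) (use that in simp_all)
      from this[OF dist_S_nonneg] show ?thesis
        by (simp only: ennreal_plus[OF dist_S_nonneg dist_S_nonneg])
    qed
    finally show "curve_length A g \<gamma> \<le> ennreal (dist_S p q + dist_S q r)" .
  qed
qed

lemma dist_S_commute: "dist_S p q = dist_S q p"
proof -
  have le: "dist_S q p \<le> dist_S p q" if pq: "p \<in> S" "q \<in> S" for p q
  proof -
    obtain \<eta> where \<eta>: "(p, \<eta>) \<in> D" "q = riem_exp A g p \<eta>" "tangent_norm g p \<eta> = dist_S p q"
      using D_reachesE[OF pq] .
    show ?thesis
      using dist_S_exp_curve[OF \<eta>(1), of 1 0] \<eta>(2,3) D_curve(3)[OF \<eta>(1)] by (simp add: exp_curve_1)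
  qed
  \<comment> \<open>\<open>Metric_space\<close> demands symmetry for all arguments. Off S no curve
    is admissible, the infimum is infinite and \<open>enn2real\<close> makes it 0.\<close>
  have out: "dist_S p q = 0" if "p \<notin> S \<or> q \<notin> S" for p q
  proof -
    have empty: "{\<gamma>. piecewise_C1_curve A \<gamma> \<and> \<gamma> ` {0..1} \<subseteq> S \<and> \<gamma> 0 = p \<and> \<gamma> 1 = q} = {}"
      using that by force
    show ?thesis unfolding riem_dist_def empty by simp
  qed
  show ?thesis
  proof (cases "p \<in> S \<and> q \<in> S")
    case True
    then show ?thesis using le[of p q] le[of q p] by simp
  qed (use out[of p q] out[of q p] in auto)
qed

lemma dist_S_refl: "p \<in> S \<Longrightarrow> dist_S p p = 0"
proof -
  assume p: "p \<in> S"
  obtain \<eta> where \<eta>: "(p, \<eta>) \<in> D" using D_reachesE[OF p p] .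
  show ?thesis
    using dist_S_exp_curve[OF \<eta>, of 0 0] D_curve(3)[OF \<eta>] dist_S_nonneg[of p p] by simp
qed

lemma dist_S_eq_0:
  assumes pq: "p \<in> S" "q \<in> S" and 0: "dist_S p q = 0"
  shows "p = q"
proof -
  obtain \<eta> where \<eta>: "(p, \<eta>) \<in> D" "q = riem_exp A g p \<eta>" "tangent_norm g p \<eta> = dist_S p q"
    using D_reachesE[OF pq] .
  have "g p \<eta> \<eta> = 0" using \<eta>(3) 0 by (simp add: tangent_norm_def)
  then have "\<eta> = (\<lambda>c. 0)"
    using metric_pos[OF _ D_in_tangent[OF \<eta>(1)]] S_subset pq(1) by fastforce
  \<comment> \<open>For the zero vector both times give the exponential of the same vector.\<close>
  then have "exp_curve A g p \<eta> 1 = exp_curve A g p \<eta> 0" by (simp add: exp_curve_def)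
  then show ?thesis using \<eta>(2) D_curve(3)[OF \<eta>(1)] by (simp add: exp_curve_1)
qed

lemma Metric_space_S: "Metric_space S dist_S"
  by unfold_locales
    (use dist_S_nonneg dist_S_commute dist_S_triangle dist_S_refl dist_S_eq_0 in auto)

text \<open>In a chart, the geodesic issued from \<open>q\<close> with velocity \<open>\<eta>\<close> deviates from the straight line by
  \<open>O(\<parallel>\<eta>\<parallel>\<^sup>2)\<close>, uniformly for \<open>q\<close> near \<open>p\<close>.\<close>

lemma exp_chart_estimate:
  assumes p: "p \<in> S" and c: "c \<in> A" "p \<in> fst c"
  obtains \<epsilon> K where "\<epsilon> > 0" "K \<ge> 0"
    "\<And>q \<eta>. q \<in> fst c \<Longrightarrow> norm (snd c q - snd c p) < \<epsilon> \<Longrightarrow> (q, \<eta>) \<in> D \<Longrightarrow> tangent_norm g q \<eta> < \<epsilon> \<Longrightarrow>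
       riem_exp A g q \<eta> \<in> fst c \<and> norm (snd c (riem_exp A g q \<eta>) - snd c q) \<le> K * tangent_norm g q \<eta> \<and>
       norm (snd c (riem_exp A g q \<eta>) - snd c q - \<eta> c) \<le> K * (tangent_norm g q \<eta>)\<^sup>2"
proof -
  interpret C: chart_metric "chart_image c" "metric_coords A g c" by (rule chart_metric[OF c(1)])
  define x0 where "x0 = snd c p"
  have x0: "x0 \<in> chart_image c" using c by (auto simp: x0_def)
  obtain r m K0 where r: "r > 0" "cball x0 r \<subseteq> chart_image c" and m: "m > 0" and K0: "K0 \<ge> 0"
    and low: "\<And>x u. x \<in> cball x0 r \<Longrightarrow> m * (norm u)\<^sup>2 \<le> metric_coords A g c x u u"
    and \<Gamma>b: "\<And>x u. x \<in> cball x0 r \<Longrightarrow> norm (C.\<Gamma> x u u) \<le> K0 * (norm u)\<^sup>2"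
    using C.local_bounds[OF x0] by metis
  define \<mu> where "\<mu> = sqrt m"
  have \<mu>: "\<mu> > 0" "\<mu>\<^sup>2 = m" using m by (auto simp: \<mu>_def)
  \<comment> \<open>A curve that starts within r/4 of x0 and has coordinate length at most
    \<sigma>/\<mu> < r/4 remains in the ball of radius r/2.\<close>
  define \<epsilon> where "\<epsilon> = min (r/4) (\<mu> * r/4)"
  define K where "K = max (1/\<mu>) (K0 / m)"
  show thesis
  proof (rule that[of \<epsilon> K])
    show "\<epsilon> > 0" using r(1) \<mu>(1) by (simp add: \<epsilon>_def)
    show "K \<ge> 0" using \<mu>(1) by (simp add: K_def le_max_iff_disj)
    fix q \<eta> assume q: "q \<in> fst c" "norm (snd c q - snd c p) < \<epsilon>" and D: "(q, \<eta>) \<in> D" and small: "tangent_norm g q \<eta> < \<epsilon>"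
    define \<sigma> where "\<sigma> = tangent_norm g q \<eta>"
    have \<sigma>0: "\<sigma> \<ge> 0" using D_norm[OF D] dist_S_nonneg by (simp add: \<sigma>_def)
    define \<alpha> where "\<alpha> = exp_curve A g q \<eta>"
    define y where "y = snd c \<circ> \<alpha>"
    note G = D_curve(1)[OF D, folded \<alpha>_def]
    note cont = geodesicD(1)[OF G]
    have \<alpha>0: "\<alpha> 0 = q" using D_curve(3)[OF D] by (simp add: \<alpha>_def)
    obtain x where x: "\<And>t. t \<in> {0..1} \<Longrightarrow> \<alpha> t \<in> fst c \<Longrightarrow>
        (y has_vector_derivative x t) (at t within {0..1}) \<and>
        (x has_vector_derivative - christoffel A g c (snd c (\<alpha> t)) (x t) (x t)) (at t within {0..1})"
      using geodesicD(3)[OF G c(1)] unfolding y_def by blast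
    have vel: "velocity A \<alpha> t = coord_vector A c (\<alpha> t) (x t)" if "t \<in> {0..1}" "\<alpha> t \<in> fst c" for t
      using cont that x[OF that] c(1)
      by (intro velocity_eq) (auto simp: continuous_on_eq_continuous_within y_def)
    let ?V = "{z \<in> fst c. snd c z \<in> ball x0 r}"
    let ?C = "{z \<in> fst c. snd c z \<in> cball x0 (r/2)}"
    have Vo: "open ?V" by (rule chart_preimage_open[OF c(1)]) simp
    have "cball x0 (r/2) \<subseteq> chart_image c" using r by (intro order_trans[OF _ r(2)]) auto
    then have "compact ?C" by (intro chart_preimage_compact[OF c(1)]) auto
    then have Cc: "open (- ?C)" by (simp add: compact_imp_closed open_Compl)
    have CV: "?C \<subseteq> ?V" using r(1) by auto
    have near: "norm (x0 - y 0) < r/4" using q(2) by (simp add: y_def \<alpha>0 x0_def \<epsilon>_def norm_minus_commute)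
    \<comment> \<open>Coercivity converts the constant Riemannian speed \<sigma> into a bound on the
      coordinate speed, as long as the curve stays in the chart ball.\<close>
    have speed: "norm (x t) \<le> \<sigma> / \<mu>" if t: "t \<in> {0..1}" "\<alpha> t \<in> ?V" for t
    proof -
      have tc: "\<alpha> t \<in> fst c" using t by auto
      have "(tangent_norm g (\<alpha> t) (velocity A \<alpha> t))\<^sup>2 = metric_coords A g c (snd c (\<alpha> t)) (x t) (x t)"
        using tangent_norm_coord[OF c(1) tc coord_vector_tangent[OF c(1) tc, of "x t"]]
        by (simp add: vel[OF t(1) tc] coord_vector_self[OF c(1) tc])
      moreover have "tangent_norm g (\<alpha> t) (velocity A \<alpha> t) = \<sigma>"
        using D_speed[OF D t(1)] by (simp add: \<alpha>_def \<sigma>_def)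
      moreover have "m * (norm (x t))\<^sup>2 \<le> metric_coords A g c (snd c (\<alpha> t)) (x t) (x t)"
        using t by (intro low) auto
      ultimately have "(\<mu> * norm (x t))\<^sup>2 \<le> \<sigma>\<^sup>2" by (simp add: power_mult_distrib \<mu>(2))
      then have "\<mu> * norm (x t) \<le> \<sigma>" using \<sigma>0 by (rule power2_le_imp_le)
      then show ?thesis using \<mu>(1) by (simp add: field_simps)
    qed
    have \<sigma>\<mu>: "\<sigma> / \<mu> < r/4"
      using small \<mu>(1) by (simp add: \<sigma>_def \<epsilon>_def field_simps)
    have path: "norm (y t - y 0) \<le> \<sigma> / \<mu> * t" if t: "t \<in> {0..1}" and V: "\<And>s. s \<in> {0..t} \<Longrightarrow> \<alpha> s \<in> ?V" for t
    proof -
      have "norm (y t - y 0) \<le> \<sigma> / \<mu> * (t - 0)"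
      proof (rule vector_mvt_bound)
        fix s assume s: "s \<in> {0..t}"
        then have s1: "s \<in> {0..1}" using t by auto
        show "norm (x s) \<le> \<sigma> / \<mu>" by (rule speed[OF s1 V[OF s]])
        show "(y has_vector_derivative x s) (at s within {0..t})"
          by (rule has_vector_derivative_within_subset[of _ _ _ "{0..1}"]) (use x[OF s1] V[OF s] t in auto)
      qed (use t in auto)
      then show ?thesis by simp
    qed
    have inC: "\<alpha> t \<in> ?C" if t: "t \<in> {0..1}" and V: "\<And>s. s \<in> {0..t} \<Longrightarrow> \<alpha> s \<in> ?V" for t
    proof -
      have "norm (y t - y 0) \<le> \<sigma> / \<mu> * 1"
        by (rule order_trans[OF path[OF t V] mult_left_mono]) (use t \<sigma>0 \<mu>(1) in auto)
      moreover have "norm (x0 - y t) \<le> norm (x0 - y 0) + norm (y t - y 0)"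
        using norm_triangle_ineq[of "x0 - y 0" "y 0 - y t"] by (simp add: norm_minus_commute)
      ultimately have "norm (x0 - y t) \<le> r/2"
        using near \<sigma>\<mu> by linarith
      then show ?thesis using V[of t] t by (auto simp: y_def dist_norm)
    qed
    \<comment> \<open>At a first exit time \<tau> from the open set \<open>?V\<close>, all earlier
      points lie in the smaller set \<open>?C\<close> by \<open>inC\<close>. That set is compact,
      hence closed, so the exit point lies in it too, and it is contained in
      \<open>?V\<close>.\<close>
    have stay: "\<alpha> t \<in> ?V" if t: "t \<in> {0..1}" for t
    proof (rule ccontr)
      assume bad: "\<alpha> t \<notin> ?V"
      define T where "T = {0..1} \<inter> \<alpha> -` (- ?V)"
      have "closed T" unfolding T_def using cont Vo by (intro continuous_closed_preimage) auto
      moreover have "bounded T" by (rule bounded_subset[of "{0..1}"]) (auto simp: T_def)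
      ultimately have "compact T" by (simp add: compact_eq_bounded_closed)
      moreover have "t \<in> T" using t bad by (auto simp: T_def)
      ultimately obtain \<tau> where \<tau>: "\<tau> \<in> T" "\<And>s. s \<in> T \<Longrightarrow> \<tau> \<le> s"
        using compact_attains_inf[of T] by blast
      have \<tau>01: "\<tau> \<in> {0..1}" and \<tau>V: "\<alpha> \<tau> \<notin> ?V" using \<tau>(1) by (auto simp: T_def)
      have before: "\<alpha> s \<in> ?V" if "0 \<le> s" "s < \<tau>" for s
        using \<tau>(2)[of s] that \<tau>01 by (auto simp: T_def)
      have "\<alpha> 0 \<in> ?V" using q(1) near r(1) by (auto simp: y_def \<alpha>0 dist_norm)
      then have pos: "0 < \<tau>" using \<tau>V \<tau>01 by (cases "\<tau> = 0") auto
      have "\<alpha> \<tau> \<in> ?C"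
      proof (rule ccontr)
        assume "\<alpha> \<tau> \<notin> ?C"
        then have "\<alpha> \<tau> \<in> - ?C" by blast
        from continuous_near[OF cont \<tau>01 Cc this] obtain d where
          d: "d > 0" "\<And>t. t \<in> {0..1} \<Longrightarrow> \<bar>t - \<tau>\<bar> < d \<Longrightarrow> \<alpha> t \<in> - ?C" by blast
        define s where "s = max 0 (\<tau> - d/2)"
        have s: "0 \<le> s" "s < \<tau>" "\<bar>s - \<tau>\<bar> < d" using pos d(1) by (auto simp: s_def)
        have s1: "s \<in> {0..1}" using s \<tau>01 by auto
        have "\<alpha> s \<in> ?C" by (rule inC[OF s1]) (rule before, use s in auto)
        then show False using d(2)[OF s1 s(3)] by blast
      qed
      then show False using CV \<tau>V by blast
    qed
    have one: "(1::real) \<in> {0..1}" and zero: "(0::real) \<in> {0..1}" by auto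
    have e1: "\<alpha> 1 = riem_exp A g q \<eta>" by (simp add: \<alpha>_def exp_curve_1)
    have y1: "snd c (riem_exp A g q \<eta>) = y 1" "snd c q = y 0" using e1 \<alpha>0 by (simp_all add: y_def)
    have "norm (y 1 - y 0) \<le> \<sigma> / \<mu> * 1" by (rule path[OF one]) (rule stay, auto)
    also have "\<dots> \<le> K * \<sigma>"
      using mult_right_mono[of "1 / \<mu>" K \<sigma>] \<sigma>0 by (simp add: K_def)
    finally have b1: "norm (y 1 - y 0) \<le> K * \<sigma>" .
    have x\<eta>: "x 0 = \<eta> c"
      using vel[OF zero] stay[OF zero] D_velocity_0[OF D] coord_vector_self[OF c(1), of "\<alpha> 0" "x 0"]
      by (simp add: \<alpha>_def)
    have dx: "norm (x t - x 0) \<le> K0 / m * \<sigma>\<^sup>2" if t: "t \<in> {0..1}" for t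
    proof -
      have "norm (x t - x 0) \<le> (K0 / m * \<sigma>\<^sup>2) * (t - 0)"
      proof (rule vector_mvt_bound)
        fix s assume s: "s \<in> {0..t}"
        then have s1: "s \<in> {0..1}" using t by auto
        have sV: "\<alpha> s \<in> ?V" by (rule stay[OF s1])
        show "(x has_vector_derivative - christoffel A g c (snd c (\<alpha> s)) (x s) (x s)) (at s within {0..t})"
          by (rule has_vector_derivative_within_subset[of _ _ _ "{0..1}"]) (use x[OF s1] sV t in auto)
        have "norm (C.\<Gamma> (snd c (\<alpha> s)) (x s) (x s)) \<le> K0 * (norm (x s))\<^sup>2"
          using sV by (intro \<Gamma>b) auto
        also have "\<dots> \<le> K0 * (\<sigma> / \<mu>)\<^sup>2"
          using speed[OF s1 sV] K0 by (intro mult_left_mono power_mono) auto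
        also have "\<dots> = K0 / m * \<sigma>\<^sup>2" using \<mu> by (simp add: power_divide)
        finally show "norm (- christoffel A g c (snd c (\<alpha> s)) (x s) (x s)) \<le> K0 / m * \<sigma>\<^sup>2"
          by (simp add: christoffel_eq[OF c(1)])
      qed (use t in auto)
      also have "\<dots> \<le> (K0 / m * \<sigma>\<^sup>2) * 1" using t K0 m by (intro mult_left_mono) auto
      finally show ?thesis by simp
    qed
    \<comment> \<open>The velocity stays within O(\<sigma>^2) of \<eta> by the geodesic equation;
      integrating once more bounds the deviation from the straight line.\<close>
    have "norm ((y 1 - 1 *\<^sub>R \<eta> c) - (y 0 - 0 *\<^sub>R \<eta> c)) \<le> (K0 / m * \<sigma>\<^sup>2) * (1 - 0)"
    proof (rule vector_mvt_bound)
      fix t :: real assume t: "t \<in> {0..1}"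
      show "((\<lambda>t. y t - t *\<^sub>R \<eta> c) has_vector_derivative (x t - \<eta> c)) (at t within {0..1})"
        using x[OF t] stay[OF t]
        by (auto intro!: has_vector_derivative_diff derivative_eq_intros)
      show "norm (x t - \<eta> c) \<le> K0 / m * \<sigma>\<^sup>2" using dx[OF t] by (simp add: x\<eta>)
    qed auto
    also have "\<dots> \<le> K * \<sigma>\<^sup>2"
      using mult_right_mono[of "K0 / m" K "\<sigma>\<^sup>2"] by (simp add: K_def)
    finally have b2: "norm (y 1 - y 0 - \<eta> c) \<le> K * \<sigma>\<^sup>2" by (simp add: algebra_simps)
    show "riem_exp A g q \<eta> \<in> fst c \<and> norm (snd c (riem_exp A g q \<eta>) - snd c q) \<le> K * tangent_norm g q \<eta> \<and>
       norm (snd c (riem_exp A g q \<eta>) - snd c q - \<eta> c) \<le> K * (tangent_norm g q \<eta>)\<^sup>2"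
      using b1 b2 stay[OF one] unfolding y1 by (simp add: e1 \<sigma>_def)
  qed
qed

lemma lip_curveD:
  assumes "lip_curve dist_S S \<gamma>"
  obtains L where "L \<ge> 0" "\<And>t. t \<in> {0..1} \<Longrightarrow> \<gamma> t \<in> S"
    "\<And>s t. s \<in> {0..1} \<Longrightarrow> t \<in> {0..1} \<Longrightarrow> dist_S (\<gamma> s) (\<gamma> t) \<le> L * \<bar>s - t\<bar>"
proof -
  obtain L where L: "\<gamma> ` {0..1} \<subseteq> S" "\<And>s t. s \<in> {0..1} \<Longrightarrow> t \<in> {0..1} \<Longrightarrow> dist_S (\<gamma> s) (\<gamma> t) \<le> L * \<bar>s - t\<bar>"
    using assms unfolding lip_curve_def by blast
  show thesis
  proof (rule that[of "max L 0"])
    fix s t :: real assume "s \<in> {0..1}" "t \<in> {0..1}"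
    then show "dist_S (\<gamma> s) (\<gamma> t) \<le> max L 0 * \<bar>s - t\<bar>"
      using L(2) mult_right_mono[of L "max L 0" "\<bar>s - t\<bar>"] by (meson abs_ge_zero max.cobounded1 order_trans)
  qed (use L(1) in auto)
qed

section \<open>Lipschitz curves in the parameter space, seen through charts\<close>

context
  fixes \<gamma> :: "real \<Rightarrow> 'm" and L :: real
  assumes L: "L \<ge> 0" and \<gamma>_S: "\<And>t. t \<in> {0..1} \<Longrightarrow> \<gamma> t \<in> S"
    and \<gamma>_lip: "\<And>s t. s \<in> {0..1} \<Longrightarrow> t \<in> {0..1} \<Longrightarrow> dist_S (\<gamma> s) (\<gamma> t) \<le> L * \<bar>s - t\<bar>"
begin

text \<open>Two nearby points of the curve are joined by a minimising geodesic of \<open>D\<close>,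
  and \<open>exp_chart_estimate\<close> bounds its coordinate displacement by a multiple of their
  distance.\<close>

lemma lip_curve_chart:
  assumes \<tau>: "\<tau> \<in> {0..1}" and c: "c \<in> A" "\<gamma> \<tau> \<in> fst c"
  obtains \<delta> M where "\<delta> > 0" "M \<ge> 0" "\<And>t. t \<in> {0..1} \<Longrightarrow> \<bar>t - \<tau>\<bar> < \<delta> \<Longrightarrow> \<gamma> t \<in> fst c"
    "\<And>s t. s \<in> {0..1} \<Longrightarrow> t \<in> {0..1} \<Longrightarrow> \<bar>s - \<tau>\<bar> < \<delta> \<Longrightarrow> \<bar>t - \<tau>\<bar> < \<delta> \<Longrightarrow>
       norm (snd c (\<gamma> t) - snd c (\<gamma> s)) \<le> M * \<bar>t - s\<bar>"
proof -
  obtain \<epsilon> K where \<epsilon>: "\<epsilon> > 0" and K: "K \<ge> 0"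
    and est: "\<And>q \<eta>. q \<in> fst c \<Longrightarrow> norm (snd c q - snd c (\<gamma> \<tau>)) < \<epsilon> \<Longrightarrow> (q, \<eta>) \<in> D \<Longrightarrow> tangent_norm g q \<eta> < \<epsilon> \<Longrightarrow>
       riem_exp A g q \<eta> \<in> fst c \<and> norm (snd c (riem_exp A g q \<eta>) - snd c q) \<le> K * tangent_norm g q \<eta> \<and>
       norm (snd c (riem_exp A g q \<eta>) - snd c q - \<eta> c) \<le> K * (tangent_norm g q \<eta>)\<^sup>2"
    using exp_chart_estimate[OF \<gamma>_S[OF \<tau>] c] by metis
  have step: "\<gamma> t \<in> fst c \<and> norm (snd c (\<gamma> t) - snd c (\<gamma> s)) \<le> K * L * \<bar>t - s\<bar>"
    if s: "s \<in> {0..1}" "\<gamma> s \<in> fst c" "norm (snd c (\<gamma> s) - snd c (\<gamma> \<tau>)) < \<epsilon>" and t: "t \<in> {0..1}" "L * \<bar>t - s\<bar> < \<epsilon>" for s t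
  proof -
    obtain \<eta> where \<eta>: "(\<gamma> s, \<eta>) \<in> D" "\<gamma> t = riem_exp A g (\<gamma> s) \<eta>" "tangent_norm g (\<gamma> s) \<eta> = dist_S (\<gamma> s) (\<gamma> t)"
      using D_reachesE[OF \<gamma>_S[OF s(1)] \<gamma>_S[OF t(1)]] .
    have le: "tangent_norm g (\<gamma> s) \<eta> \<le> L * \<bar>t - s\<bar>"
      using \<gamma>_lip[OF s(1) t(1)] by (simp add: \<eta>(3) abs_minus_commute)
    then have "tangent_norm g (\<gamma> s) \<eta> < \<epsilon>" using t(2) by simp
    from est[OF s(2,3) \<eta>(1) this] have "\<gamma> t \<in> fst c" "norm (snd c (\<gamma> t) - snd c (\<gamma> s)) \<le> K * tangent_norm g (\<gamma> s) \<eta>"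
      by (simp_all add: \<eta>(2)[symmetric])
    moreover have "K * tangent_norm g (\<gamma> s) \<eta> \<le> K * (L * \<bar>t - s\<bar>)" using le K by (rule mult_left_mono)
    ultimately show ?thesis by (simp add: mult.assoc)
  qed
  \<comment> \<open>Makes both 2 L \<delta> and K L \<delta> smaller than \<epsilon>: the first for
    the vector joining two points, the second for their distance from the centre in the
    chart.\<close>
  define \<delta> where "\<delta> = \<epsilon> / (2 * (L + K * L + 1))"
  have den: "L + K * L + 1 > 0" using L K by (intro add_nonneg_pos add_nonneg_nonneg mult_nonneg_nonneg) auto
  have \<delta>: "\<delta> > 0" using \<epsilon> den by (simp add: \<delta>_def)
  have "2 * (L + K * L + 1) * \<delta> = \<epsilon>" using den by (simp add: \<delta>_def)
  then have sum: "2 * (L * \<delta>) + 2 * (K * L * \<delta>) + 2 * \<delta> = \<epsilon>" by (simp add: algebra_simps)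
  have L\<delta>: "0 \<le> L * \<delta>" "0 \<le> K * L * \<delta>" using L K \<delta> by auto
  have near: "\<gamma> t \<in> fst c \<and> norm (snd c (\<gamma> t) - snd c (\<gamma> \<tau>)) < \<epsilon>" if t: "t \<in> {0..1}" "\<bar>t - \<tau>\<bar> < \<delta>" for t
  proof -
    have "L * \<bar>t - \<tau>\<bar> \<le> L * \<delta>" "K * L * \<bar>t - \<tau>\<bar> \<le> K * L * \<delta>"
      using t(2) L K by (auto intro!: mult_left_mono)
    then have a: "L * \<bar>t - \<tau>\<bar> < \<epsilon>" "K * L * \<bar>t - \<tau>\<bar> < \<epsilon>" using sum L\<delta> \<delta> by linarith+
    from step[OF \<tau> c(2) _ t(1) a(1)] \<epsilon> have "\<gamma> t \<in> fst c" "norm (snd c (\<gamma> t) - snd c (\<gamma> \<tau>)) \<le> K * L * \<bar>t - \<tau>\<bar>"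
      by auto
    then show ?thesis using a(2) by simp
  qed
  show thesis
  proof (rule that[of \<delta> "K * L"])
    fix s t :: real assume st: "s \<in> {0..1}" "t \<in> {0..1}" "\<bar>s - \<tau>\<bar> < \<delta>" "\<bar>t - \<tau>\<bar> < \<delta>"
    have "\<bar>t - s\<bar> \<le> 2 * \<delta>" using st by linarith
    then have "L * \<bar>t - s\<bar> \<le> L * (2 * \<delta>)" using L by (rule mult_left_mono)
    then have "L * \<bar>t - s\<bar> < \<epsilon>" using sum L\<delta> \<delta> by linarith
    then show "norm (snd c (\<gamma> t) - snd c (\<gamma> s)) \<le> K * L * \<bar>t - s\<bar>"
      using step[OF st(1) _ _ st(2)] near[OF st(1,3)] by blast
  qed (use \<delta> L K near in auto)
qed

text \<open>The topology of the manifold is not given as the one induced by \<open>dist_S\<close>;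
  continuity is obtained in the chart and transported back through its open images.\<close>

lemma lip_curve_continuous: "continuous_on {0..1} \<gamma>"
  unfolding continuous_on_eq_continuous_within continuous_within
proof (intro ballI topological_tendstoI)
  fix \<tau> :: real and V assume \<tau>: "\<tau> \<in> {0..1}" and V: "open V" "\<gamma> \<tau> \<in> V"
  have "\<gamma> \<tau> \<in> carrier A" using \<gamma>_S[OF \<tau>] S_subset by blast
  then obtain c where c: "c \<in> A" "\<gamma> \<tau> \<in> fst c" unfolding carrier_def by blast
  obtain \<delta> M where \<delta>: "\<delta> > 0" and M: "M \<ge> 0" and inc: "\<And>t. t \<in> {0..1} \<Longrightarrow> \<bar>t - \<tau>\<bar> < \<delta> \<Longrightarrow> \<gamma> t \<in> fst c"
    and lip: "\<And>s t. s \<in> {0..1} \<Longrightarrow> t \<in> {0..1} \<Longrightarrow> \<bar>s - \<tau>\<bar> < \<delta> \<Longrightarrow> \<bar>t - \<tau>\<bar> < \<delta> \<Longrightarrow>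
       norm (snd c (\<gamma> t) - snd c (\<gamma> s)) \<le> M * \<bar>t - s\<bar>"
    using lip_curve_chart[OF \<tau> c] by metis
  have "open (snd c ` (fst c \<inter> V))"
    using V(1) chart_open[OF c(1)] by (intro chart_image_open_subset c(1)) auto
  moreover have "snd c (\<gamma> \<tau>) \<in> snd c ` (fst c \<inter> V)" using V(2) c(2) by blast
  ultimately obtain e where e: "e > 0" "ball (snd c (\<gamma> \<tau>)) e \<subseteq> snd c ` (fst c \<inter> V)"
    by (meson openE)
  define d where "d = min \<delta> (e / (M + 1))"
  have d: "d > 0" using \<delta> e M by (simp add: d_def)
  have "\<gamma> t \<in> V" if t: "t \<in> {0..1}" "dist t \<tau> < d" for t
  proof -
    have t\<delta>: "\<bar>t - \<tau>\<bar> < \<delta>" using t(2) by (simp add: d_def dist_real_def)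
    have "norm (snd c (\<gamma> t) - snd c (\<gamma> \<tau>)) \<le> M * \<bar>t - \<tau>\<bar>" using lip[OF \<tau> t(1) _ t\<delta>] \<delta> by simp
    also have "\<dots> \<le> M * (e / (M + 1))" using t(2) M by (intro mult_left_mono) (auto simp: d_def dist_real_def)
    also have "\<dots> < e" using M e(1) by (simp add: field_simps)
    finally have "snd c (\<gamma> t) \<in> ball (snd c (\<gamma> \<tau>)) e" by (simp add: dist_norm norm_minus_commute)
    then obtain z where "z \<in> fst c" "z \<in> V" "snd c (\<gamma> t) = snd c z" using e(2) by blast
    then show ?thesis using inj_onD[OF chart_inj[OF c(1)]] inc[OF t(1) t\<delta>] by metis
  qed
  then show "\<forall>\<^sub>F t in at \<tau> within {0..1}. \<gamma> t \<in> V"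
    unfolding eventually_at using d by blast
qed

text \<open>By compactness finitely many time intervals, each mapped into one chart, cover [0,1]. On
  each of them the curve is Lipschitz in coordinates and hence differentiable almost
  everywhere.\<close>

lemma lip_curve_ae_differentiable:
  "AE t in lborel. t \<in> {0..1} \<longrightarrow> t \<in> {0<..<1} \<and>
     (\<exists>c\<in>A. \<gamma> t \<in> fst c \<and> (\<exists>u. ((snd c \<circ> \<gamma>) has_vector_derivative u) (at t within {0..1})))"
proof -
  define P where "P = (\<lambda>\<tau> c \<delta> M. c \<in> A \<and> \<delta> > 0 \<and> M \<ge> 0 \<and> (\<forall>t\<in>{0..1}. \<bar>t - \<tau>\<bar> < \<delta> \<longrightarrow> \<gamma> t \<in> fst c) \<and>
     (\<forall>s\<in>{0..1}. \<forall>t\<in>{0..1}. \<bar>s - \<tau>\<bar> < \<delta> \<longrightarrow> \<bar>t - \<tau>\<bar> < \<delta> \<longrightarrow> norm (snd c (\<gamma> t) - snd c (\<gamma> s)) \<le> M * \<bar>t - s\<bar>))"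
  have "\<exists>c \<delta> M. P \<tau> c \<delta> M"
    if \<tau>: "\<tau> \<in> {0..1}" for \<tau>
  proof -
    have "\<gamma> \<tau> \<in> carrier A" using \<gamma>_S[OF \<tau>] S_subset by blast
    then obtain c where c: "c \<in> A" "\<gamma> \<tau> \<in> fst c" unfolding carrier_def by blast
    show ?thesis
    proof (rule lip_curve_chart[OF \<tau> c])
      fix \<delta> M assume "\<delta> > 0" "M \<ge> 0" "\<And>t. t \<in> {0..1} \<Longrightarrow> \<bar>t - \<tau>\<bar> < \<delta> \<Longrightarrow> \<gamma> t \<in> fst c"
        "\<And>s t. s \<in> {0..1} \<Longrightarrow> t \<in> {0..1} \<Longrightarrow> \<bar>s - \<tau>\<bar> < \<delta> \<Longrightarrow> \<bar>t - \<tau>\<bar> < \<delta> \<Longrightarrow>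
          norm (snd c (\<gamma> t) - snd c (\<gamma> s)) \<le> M * \<bar>t - s\<bar>"
      then show ?thesis using c(1) by (intro exI[of _ c] exI[of _ \<delta>] exI[of _ M]) (simp only: P_def, blast)
    qed
  qed
  then obtain c \<delta> M where P: "\<And>\<tau>. \<tau> \<in> {0..1} \<Longrightarrow> P \<tau> (c \<tau>) (\<delta> \<tau>) (M \<tau>)"
    by metis
  have cA: "\<And>\<tau>. \<tau> \<in> {0..1} \<Longrightarrow> c \<tau> \<in> A" and \<delta>: "\<And>\<tau>. \<tau> \<in> {0..1} \<Longrightarrow> \<delta> \<tau> > 0"
    and M: "\<And>\<tau>. \<tau> \<in> {0..1} \<Longrightarrow> M \<tau> \<ge> 0"
    and inc: "\<And>\<tau> t. \<tau> \<in> {0..1} \<Longrightarrow> t \<in> {0..1} \<Longrightarrow> \<bar>t - \<tau>\<bar> < \<delta> \<tau> \<Longrightarrow> \<gamma> t \<in> fst (c \<tau>)"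
    and lip: "\<And>\<tau> s t. \<tau> \<in> {0..1} \<Longrightarrow> s \<in> {0..1} \<Longrightarrow> t \<in> {0..1} \<Longrightarrow> \<bar>s - \<tau>\<bar> < \<delta> \<tau> \<Longrightarrow> \<bar>t - \<tau>\<bar> < \<delta> \<tau> \<Longrightarrow>
       norm (snd (c \<tau>) (\<gamma> t) - snd (c \<tau>) (\<gamma> s)) \<le> M \<tau> * \<bar>t - s\<bar>"
    using P unfolding P_def by blast+
  have cover: "{0..1} \<subseteq> (\<Union>\<tau>\<in>{0..1}. ball \<tau> (\<delta> \<tau> / 2))"
    using \<delta> by force
  obtain F where F: "F \<subseteq> {0..1}" "finite F" "{0..1} \<subseteq> (\<Union>\<tau>\<in>F. ball \<tau> (\<delta> \<tau> / 2))"
    by (rule compactE_image[OF compact_Icc[of 0 "1::real"] _ cover]) auto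
  define lo where "lo = (\<lambda>\<tau>. max 0 (\<tau> - \<delta> \<tau> / 2))"
  define hi where "hi = (\<lambda>\<tau>. min 1 (\<tau> + \<delta> \<tau> / 2))"
  have "AE t in lborel. t \<in> {lo \<tau><..<hi \<tau>} \<longrightarrow> (snd (c \<tau>) \<circ> \<gamma>) differentiable (at t)" if \<tau>: "\<tau> \<in> {0..1}" for \<tau>
  proof (rule lipschitz_ae_differentiable[of "M \<tau>"])
    show "(M \<tau>)-lipschitz_on {lo \<tau>..hi \<tau>} (snd (c \<tau>) \<circ> \<gamma>)"
    proof (rule lipschitz_onI)
      fix s t assume "s \<in> {lo \<tau>..hi \<tau>}" "t \<in> {lo \<tau>..hi \<tau>}"
      then have "s \<in> {0..1}" "t \<in> {0..1}" "\<bar>s - \<tau>\<bar> < \<delta> \<tau>" "\<bar>t - \<tau>\<bar> < \<delta> \<tau>"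
        using \<delta>[OF \<tau>] by (auto simp: lo_def hi_def abs_less_iff)
      then show "dist ((snd (c \<tau>) \<circ> \<gamma>) s) ((snd (c \<tau>) \<circ> \<gamma>) t) \<le> M \<tau> * dist s t"
        using lip[OF \<tau>, of t s] by (simp add: dist_norm)
    qed (rule M[OF \<tau>])
  qed
  then have "\<forall>\<tau>\<in>F. AE t in lborel. t \<in> {lo \<tau><..<hi \<tau>} \<longrightarrow> (snd (c \<tau>) \<circ> \<gamma>) differentiable (at t)"
    using F(1) by blast
  then have "AE t in lborel. \<forall>\<tau>\<in>F. t \<in> {lo \<tau><..<hi \<tau>} \<longrightarrow> (snd (c \<tau>) \<circ> \<gamma>) differentiable (at t)"
    unfolding AE_ball_countable[OF countable_finite[OF F(2)]] .
  moreover have "AE t in lborel. t \<noteq> 0 \<and> t \<noteq> (1::real)"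
    using AE_lborel_singleton[of 0] AE_lborel_singleton[of 1] by (rule eventually_conj)
  ultimately show ?thesis
  proof (rule eventually_elim2, intro impI)
    fix t :: real
    assume d: "\<forall>\<tau>\<in>F. t \<in> {lo \<tau><..<hi \<tau>} \<longrightarrow> (snd (c \<tau>) \<circ> \<gamma>) differentiable (at t)"
      and ne: "t \<noteq> 0 \<and> t \<noteq> 1" and t: "t \<in> {0..1}"
    obtain \<tau> where \<tau>: "\<tau> \<in> F" "t \<in> ball \<tau> (\<delta> \<tau> / 2)" using F(3) t by blast
    then have \<tau>01: "\<tau> \<in> {0..1}" using F(1) by blast
    have "\<bar>\<tau> - t\<bar> < \<delta> \<tau> / 2" using \<tau>(2) by (simp add: dist_real_def)
    then have "\<tau> - \<delta> \<tau> / 2 < t" "t < \<tau> + \<delta> \<tau> / 2" by linarith+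
    then have "t \<in> {lo \<tau><..<hi \<tau>}"
      using t ne by (auto simp: lo_def hi_def)
    then have "(snd (c \<tau>) \<circ> \<gamma>) differentiable (at t)" by (rule d[THEN bspec, THEN mp, OF \<tau>(1)])
    then have "((snd (c \<tau>) \<circ> \<gamma>) has_vector_derivative vector_derivative (snd (c \<tau>) \<circ> \<gamma>) (at t)) (at t within {0..1})"
      by (rule has_vector_derivative_at_within[OF vector_derivative_works[THEN iffD1]])
    moreover have "\<gamma> t \<in> fst (c \<tau>)"
    proof (rule inc[OF \<tau>01 t])
      show "\<bar>t - \<tau>\<bar> < \<delta> \<tau>"
        using \<open>\<bar>\<tau> - t\<bar> < \<delta> \<tau> / 2\<close> \<delta>[OF \<tau>01] by linarith
    qed
    ultimately show "t \<in> {0<..<1} \<and>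
      (\<exists>c\<in>A. \<gamma> t \<in> fst c \<and> (\<exists>u. ((snd c \<circ> \<gamma>) has_vector_derivative u) (at t within {0..1})))"
      using cA[OF \<tau>01] t ne by auto
  qed
qed

text \<open>The vectors \<open>\<eta> n\<close> are logarithms at \<gamma> t of the points \<gamma>
  (t + h n). In the chart they differ from the displacement by O(h^2), so dividing by h leaves the
  derivative of the curve.\<close>

lemma velocity_log_limit:
  assumes t: "t \<in> {0<..<1}" and c: "c \<in> A" "\<gamma> t \<in> fst c"
    and u: "((snd c \<circ> \<gamma>) has_vector_derivative u) (at t within {0..1})"
  shows "velocity A \<gamma> t = coord_vector A c (\<gamma> t) u"
    and "\<exists>h \<eta>. (\<forall>n::nat. h n > 0 \<and> (\<gamma> t, \<eta> n) \<in> D \<and> tangent_norm g (\<gamma> t) (\<eta> n) \<le> L * h n) \<and>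
      (\<lambda>n. (1 / h n) *\<^sub>R \<eta> n c) \<longlonglongrightarrow> u"
proof -
  have t01: "t \<in> {0..1}" using t by auto
  show "velocity A \<gamma> t = coord_vector A c (\<gamma> t) u"
    using lip_curve_continuous t01 c u by (intro velocity_eq) (auto simp: continuous_on_eq_continuous_within)
  obtain \<epsilon> K where \<epsilon>: "\<epsilon> > 0" and K: "K \<ge> 0"
    and est: "\<And>q \<eta>. q \<in> fst c \<Longrightarrow> norm (snd c q - snd c (\<gamma> t)) < \<epsilon> \<Longrightarrow> (q, \<eta>) \<in> D \<Longrightarrow> tangent_norm g q \<eta> < \<epsilon> \<Longrightarrow>
       riem_exp A g q \<eta> \<in> fst c \<and> norm (snd c (riem_exp A g q \<eta>) - snd c q) \<le> K * tangent_norm g q \<eta> \<and>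
       norm (snd c (riem_exp A g q \<eta>) - snd c q - \<eta> c) \<le> K * (tangent_norm g q \<eta>)\<^sup>2"
    using exp_chart_estimate[OF \<gamma>_S[OF t01] c] by metis
  \<comment> \<open>The factor 1 - t keeps t + h n inside [0,1] for every n.\<close>
  define h where "h = (\<lambda>n::nat. (1 - t) * (1 / real (Suc n)))"
  have h: "h n > 0" "t + h n \<in> {0..1}" for n
  proof -
    show "h n > 0" using t by (simp add: h_def)
    have "h n \<le> (1 - t) * 1" unfolding h_def using t by (intro mult_left_mono) auto
    then show "t + h n \<in> {0..1}" using t \<open>h n > 0\<close> by simp
  qed
  have h0: "h \<longlonglongrightarrow> 0"
  proof -
    have "(\<lambda>n. 1 / real (Suc n)) \<longlonglongrightarrow> 0"
      using LIMSEQ_inverse_real_of_nat by (simp add: inverse_eq_divide)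
    from tendsto_mult[OF tendsto_const this, of "1 - t"] show ?thesis by (simp add: h_def[abs_def])
  qed
  have "\<exists>\<eta>. (\<gamma> t, \<eta>) \<in> D \<and> \<gamma> (t + h n) = riem_exp A g (\<gamma> t) \<eta> \<and> tangent_norm g (\<gamma> t) \<eta> = dist_S (\<gamma> t) (\<gamma> (t + h n))" for n
    using D_reachesE[OF \<gamma>_S[OF t01] \<gamma>_S[OF h(2)[of n]]] by blast
  then obtain \<eta> where \<eta>: "\<And>n. (\<gamma> t, \<eta> n) \<in> D" "\<And>n. \<gamma> (t + h n) = riem_exp A g (\<gamma> t) (\<eta> n)"
    "\<And>n. tangent_norm g (\<gamma> t) (\<eta> n) = dist_S (\<gamma> t) (\<gamma> (t + h n))" by metis
  have le: "tangent_norm g (\<gamma> t) (\<eta> n) \<le> L * h n" for n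
    using \<gamma>_lip[OF t01 h(2)[of n]] h(1)[of n] by (simp add: \<eta>(3))
  have nn: "0 \<le> tangent_norm g (\<gamma> t) (\<eta> n)" for n by (simp add: \<eta>(3) dist_S_nonneg)
  define y where "y = (\<lambda>n. (1 / h n) *\<^sub>R (snd c (\<gamma> (t + h n)) - snd c (\<gamma> t)))"
  have ylim: "y \<longlonglongrightarrow> u"
  proof -
    have "(\<lambda>n. t + h n) \<longlonglongrightarrow> t + 0" by (intro tendsto_add tendsto_const h0)
    then have "filterlim (\<lambda>n. t + h n) (at t within {0..1}) sequentially"
      using h by (auto simp: filterlim_at less_imp_neq[symmetric])
    from filterlim_compose[OF has_vector_derivative_tendsto[OF u] this] show ?thesis
      by (simp add: y_def)
  qed
  have "\<forall>\<^sub>F n in sequentially. norm ((1 / h n) *\<^sub>R \<eta> n c - y n) \<le> K * L\<^sup>2 * h n"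
  proof -
    have "(\<lambda>n. L * h n) \<longlonglongrightarrow> L * 0" by (intro tendsto_mult tendsto_const h0)
    then have "\<forall>\<^sub>F n in sequentially. L * h n < \<epsilon>" using \<epsilon> by (intro order_tendstoD) auto
    then show ?thesis
    proof eventually_elim
      case (elim n)
      have "tangent_norm g (\<gamma> t) (\<eta> n) < \<epsilon>" using le[of n] elim by simp
      from est[OF c(2) _ \<eta>(1) this] \<epsilon>
      have "norm (snd c (\<gamma> (t + h n)) - snd c (\<gamma> t) - \<eta> n c) \<le> K * (tangent_norm g (\<gamma> t) (\<eta> n))\<^sup>2"
        by (simp add: \<eta>(2)[symmetric])
      also have "\<dots> \<le> K * (L * h n)\<^sup>2" using le nn K by (intro mult_left_mono power_mono) auto
      finally have b: "norm (snd c (\<gamma> (t + h n)) - snd c (\<gamma> t) - \<eta> n c) \<le> K * (L * h n)\<^sup>2" .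
      have "(1 / h n) *\<^sub>R \<eta> n c - y n = - (1 / h n) *\<^sub>R (snd c (\<gamma> (t + h n)) - snd c (\<gamma> t) - \<eta> n c)"
        by (simp add: y_def scaleR_diff_right)
      then have "norm ((1 / h n) *\<^sub>R \<eta> n c - y n) = (1 / h n) * norm (snd c (\<gamma> (t + h n)) - snd c (\<gamma> t) - \<eta> n c)"
        using h(1)[of n] by simp
      also have "\<dots> \<le> (1 / h n) * (K * (L * h n)\<^sup>2)" using b h(1)[of n] by (intro mult_left_mono) auto
      also have "\<dots> = K * L\<^sup>2 * h n" using h(1)[of n] by (simp add: power2_eq_square)
      finally show ?case .
    qed
  qed
  moreover have "(\<lambda>n. K * L\<^sup>2 * h n) \<longlonglongrightarrow> 0"
    using tendsto_mult[OF tendsto_const h0, of "K * L\<^sup>2"] by simp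
  ultimately have "(\<lambda>n. (1 / h n) *\<^sub>R \<eta> n c - y n) \<longlonglongrightarrow> 0"
    by (rule Lim_null_comparison)
  from tendsto_add[OF this ylim] have "(\<lambda>n. (1 / h n) *\<^sub>R \<eta> n c) \<longlonglongrightarrow> u" by simp
  then show "\<exists>h \<eta>. (\<forall>n::nat. h n > 0 \<and> (\<gamma> t, \<eta> n) \<in> D \<and> tangent_norm g (\<gamma> t) (\<eta> n) \<le> L * h n) \<and>
      (\<lambda>n. (1 / h n) *\<^sub>R \<eta> n c) \<longlonglongrightarrow> u"
    using h(1) \<eta>(1) le by blast
qed

end

end

subsection \<open>The restricted distance\<close>

lemma ennsqrt_mono: "x \<le> y \<Longrightarrow> ennsqrt x \<le> ennsqrt y"
  by (cases x; cases y) (auto simp: ennsqrt_def top_unique)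

lemma ennsqrt_ennreal_power2: "0 \<le> a \<Longrightarrow> ennsqrt (ennreal (a\<^sup>2)) = ennreal a"
  by (simp add: ennsqrt_def)

lemma ennsqrt_lessD:
  assumes "ennsqrt x < ennreal a"
  shows "x \<le> ennreal (a\<^sup>2)"
proof -
  have "x = (ennsqrt x)\<^sup>2" by (simp add: ennsqrt_power2)
  also have "\<dots> \<le> (ennreal a)\<^sup>2" using assms by (intro power_mono) auto
  also have "\<dots> = ennreal (a\<^sup>2)"
    using assms by (cases "0 \<le> a") (auto simp: ennreal_power ennreal_neg)
  finally show ?thesis .
qed

lemma ae_affine:
  fixes P :: "real \<Rightarrow> bool"
  assumes "AE x in lborel. P x" "u \<noteq> 0"
  shows "AE x in lborel. P (w + u * x)"
proof -
  obtain N where N: "N \<in> null_sets lborel" "\<And>x. x \<notin> N \<Longrightarrow> P x"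
    using ae_null_borel[OF assms(1)] by blast
  have "N \<in> sets borel" using N(1) by auto
  then have "AE x in lborel. w + u * x \<notin> N"
    by (intro AE_borel_affine[OF assms(2)] AE_not_in[OF N(1)]) simp
  then show ?thesis by eventually_elim (rule N(2))
qed

lemma L2_enorm_scale:
  assumes "f \<in> borel_measurable borel" "sets \<mu> = sets borel"
  shows "(L2_enorm \<mu> (\<lambda>x. u *\<^sub>R f x))\<^sup>2 = ennreal (u\<^sup>2) * (L2_enorm \<mu> f)\<^sup>2"
proof -
  have [measurable]: "f \<in> borel_measurable \<mu>"
    using assms(1) by (simp only: measurable_cong_sets[OF assms(2) refl])
  have "(\<integral>\<^sup>+x. ennreal ((norm (u *\<^sub>R f x))\<^sup>2) \<partial>\<mu>) = (\<integral>\<^sup>+x. ennreal (u\<^sup>2) * ennreal ((norm (f x))\<^sup>2) \<partial>\<mu>)"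
    by (intro nn_integral_cong) (simp add: power_mult_distrib ennreal_mult)
  also have "\<dots> = ennreal (u\<^sup>2) * (\<integral>\<^sup>+x. ennreal ((norm (f x))\<^sup>2) \<partial>\<mu>)"
    by (rule nn_integral_cmult) measurable
  finally show ?thesis by (simp only: L2_enorm_power2)
qed

lemma C1_enorm_bounds:
  fixes f :: "'x::euclidean_space \<Rightarrow> 'x"
  assumes f: "Ck_on 1 UNIV f" and b: "C1_enorm f \<le> ennreal K" and K: "0 \<le> K"
  shows "norm (f x) \<le> K" "norm (f x - f y) \<le> K * norm (x - y)"
proof -
  have "ennreal (norm (f x)) \<le> C1_enorm f"
    unfolding C1_enorm_def by (rule max.coboundedI1) (rule SUP_upper, simp)
  then have "ennreal (norm (f x)) \<le> ennreal K" using b by (rule order_trans)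
  then show "norm (f x) \<le> K" using K by simp
  show "norm (f x - f y) \<le> K * norm (x - y)"
  proof (rule differentiable_bound[where S = UNIV and f' = "\<lambda>x. frechet_derivative f (at x)"])
    fix z
    have "f differentiable (at z)" using f by (simp add: differentiable_on_def)
    then show "(f has_derivative frechet_derivative f (at z)) (at z within UNIV)"
      by (simp add: frechet_derivative_works)
    have "ennreal (onorm (frechet_derivative f (at z))) \<le> C1_enorm f"
      unfolding C1_enorm_def by (rule max.coboundedI2) (rule SUP_upper, simp)
    then have "ennreal (onorm (frechet_derivative f (at z))) \<le> ennreal K" using b by (rule order_trans)
    then show "onorm (frechet_derivative f (at z)) \<le> K" using K by simp
  qed auto
qed

lemma equivalent_metricsI:
  assumes M: "Metric_space X d" "Metric_space X d'" and "a > 0" "b > 0"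
    and le: "\<And>x y. x \<in> X \<Longrightarrow> y \<in> X \<Longrightarrow> d x y \<le> a * d' x y" "\<And>x y. x \<in> X \<Longrightarrow> y \<in> X \<Longrightarrow> d' x y \<le> b * d x y"
  shows "equivalent_metrics X d d'"
  unfolding equivalent_metrics_def
proof (intro conjI exI[of _ "max a b"] ballI M)
  show "max a b > 0" using \<open>a > 0\<close> by simp
  fix x y assume xy: "x \<in> X" "y \<in> X"
  have "d x y \<le> max a b * d' x y"
    using le(1)[OF xy] Metric_space.nonneg[OF M(2), of x y] by (meson max.cobounded1 mult_right_mono order_trans)
  then show "inverse (max a b) * d x y \<le> d' x y"
    using \<open>max a b > 0\<close> by (simp add: field_simps)
  show "d' x y \<le> max a b * d x y"
    using le(2)[OF xy] Metric_space.nonneg[OF M(1), of x y] by (meson max.cobounded2 mult_right_mono order_trans)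
qed

section \<open>Bounds and energies of the velocity fields of Lipschitz curves\<close>

context embedded_family
begin

abbreviation curve_field :: "(real \<Rightarrow> 'm) \<Rightarrow> real \<Rightarrow> 'x \<Rightarrow> 'x" where
  "curve_field \<gamma> t \<equiv> B (\<gamma> t) (velocity A \<gamma> t)"

lemma B_scale:
  assumes "\<theta> \<in> S" "\<eta> \<in> tangent_space A \<theta>"
  shows "B \<theta> (\<lambda>c. a *\<^sub>R \<eta> c) = (\<lambda>x. a *\<^sub>R B \<theta> \<eta> x)"
  using B_linear[OF assms assms(2), of a 0] by simp

lemma B_measurable:
  assumes "\<theta> \<in> S" "\<eta> \<in> tangent_space A \<theta>"
  shows "B \<theta> \<eta> \<in> borel_measurable borel"
proof -
  have "B \<theta> \<eta> differentiable_on UNIV" using B_C1[OF assms] by simp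
  then show ?thesis by (intro borel_measurable_continuous_onI differentiable_imp_continuous_on)
qed

lemma B_coord_linear:
  assumes "\<theta> \<in> S" "c \<in> A" "\<theta> \<in> fst c"
  shows "linear (\<lambda>z. B \<theta> (coord_vector A c \<theta> z) x)"
proof (rule linearI)
  fix u w :: 'e and r :: real
  note T = coord_vector_tangent[OF assms(2,3)]
  have "coord_vector A c \<theta> (1 *\<^sub>R u + 1 *\<^sub>R w) = (\<lambda>c'. 1 *\<^sub>R coord_vector A c \<theta> u c' + 1 *\<^sub>R coord_vector A c \<theta> w c')"
    by (rule coord_vector_combine[OF assms(2,3)])
  then have e: "coord_vector A c \<theta> (u + w) = (\<lambda>c'. 1 *\<^sub>R coord_vector A c \<theta> u c' + 1 *\<^sub>R coord_vector A c \<theta> w c')"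
    by simp
  show "B \<theta> (coord_vector A c \<theta> (u + w)) x = B \<theta> (coord_vector A c \<theta> u) x + B \<theta> (coord_vector A c \<theta> w) x"
    unfolding e B_linear[OF assms(1) T T] by simp
  show "B \<theta> (coord_vector A c \<theta> (r *\<^sub>R u)) x = r *\<^sub>R B \<theta> (coord_vector A c \<theta> u) x"
    unfolding coord_vector_scale[OF assms(2,3)] B_scale[OF assms(1) T] by simp
qed

text \<open>A fixed witness, so that the same constant links the estimates of different
  lemmas.\<close>

definition C0 :: real where
  "C0 = (SOME C. C > 0 \<and> (\<forall>\<theta> \<eta>. (\<theta>, \<eta>) \<in> D \<longrightarrow> C1_enorm (B \<theta> \<eta>) \<le> ennreal (C * tangent_norm g \<theta> \<eta>)))"

lemma C0_pos: "C0 > 0" and C0_bound: "(\<theta>, \<eta>) \<in> D \<Longrightarrow> C1_enorm (B \<theta> \<eta>) \<le> ennreal (C0 * tangent_norm g \<theta> \<eta>)"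
proof -
  have "\<exists>C. C > 0 \<and> (\<forall>\<theta> \<eta>. (\<theta>, \<eta>) \<in> D \<longrightarrow> C1_enorm (B \<theta> \<eta>) \<le> ennreal (C * tangent_norm g \<theta> \<eta>))"
    using B_bounds by fast
  from someI_ex[OF this, folded C0_def]
  show "C0 > 0" "(\<theta>, \<eta>) \<in> D \<Longrightarrow> C1_enorm (B \<theta> \<eta>) \<le> ennreal (C0 * tangent_norm g \<theta> \<eta>)" by blast+
qed

lemma B_D_bounds:
  assumes D: "(\<theta>, \<eta>) \<in> D"
  shows "norm (B \<theta> \<eta> x) \<le> C0 * tangent_norm g \<theta> \<eta>" "norm (B \<theta> \<eta> x - B \<theta> \<eta> y) \<le> (C0 * tangent_norm g \<theta> \<eta>) * norm (x - y)"
proof -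
  have "0 \<le> C0 * tangent_norm g \<theta> \<eta>" using C0_pos D_norm[OF D] dist_S_nonneg by simp
  from C1_enorm_bounds[OF B_C1[OF D_S[OF D] D_in_tangent[OF D]] C0_bound[OF D] this]
  show "norm (B \<theta> \<eta> x) \<le> C0 * tangent_norm g \<theta> \<eta>" "norm (B \<theta> \<eta> x - B \<theta> \<eta> y) \<le> (C0 * tangent_norm g \<theta> \<eta>) * norm (x - y)"
    by blast+
qed

text \<open>The bounds on \<open>B\<close> are only assumed on \<open>D\<close>; they pass to the velocity of a Lipschitz curve, which
  is the limit of difference quotients \<open>\<eta>\<^sub>n / h\<^sub>n\<close> with \<open>\<eta>\<^sub>n\<close> in \<open>D\<close>.\<close>

lemma curve_field_bounds:
  assumes L: "0 \<le> L" and \<gamma>S: "\<And>t. t \<in> {0..1} \<Longrightarrow> \<gamma> t \<in> S"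
    and \<gamma>lip: "\<And>s t. s \<in> {0..1} \<Longrightarrow> t \<in> {0..1} \<Longrightarrow> dist_S (\<gamma> s) (\<gamma> t) \<le> L * \<bar>s - t\<bar>"
  shows "AE t in lborel. t \<in> {0..1} \<longrightarrow> velocity A \<gamma> t \<in> tangent_space A (\<gamma> t) \<and>
     (\<forall>x. norm (curve_field \<gamma> t x) \<le> C0 * L) \<and>
     (\<forall>x y. norm (curve_field \<gamma> t x - curve_field \<gamma> t y) \<le> C0 * L * norm (x - y))"
proof -
  have diff: "AE t in lborel. t \<in> {0..1} \<longrightarrow> t \<in> {0<..<1} \<and>
     (\<exists>c\<in>A. \<gamma> t \<in> fst c \<and> (\<exists>u. ((snd c \<circ> \<gamma>) has_vector_derivative u) (at t within {0..1})))"
    by (rule lip_curve_ae_differentiable[OF L \<gamma>S \<gamma>lip])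
  show ?thesis
    using diff
  proof (rule eventually_mono, intro impI)
    fix t :: real
    assume "t \<in> {0..1} \<longrightarrow> t \<in> {0<..<1} \<and>
       (\<exists>c\<in>A. \<gamma> t \<in> fst c \<and> (\<exists>u. ((snd c \<circ> \<gamma>) has_vector_derivative u) (at t within {0..1})))" and t01: "t \<in> {0..1}"
    then obtain c u where t: "t \<in> {0<..<1}" and c: "c \<in> A" "\<gamma> t \<in> fst c"
      and u: "((snd c \<circ> \<gamma>) has_vector_derivative u) (at t within {0..1})" by blast
    have V1: "velocity A \<gamma> t = coord_vector A c (\<gamma> t) u"
      by (rule velocity_log_limit(1)[OF L \<gamma>S \<gamma>lip t c u])
    have V2: "\<exists>h \<eta>. (\<forall>n::nat. h n > 0 \<and> (\<gamma> t, \<eta> n) \<in> D \<and> tangent_norm g (\<gamma> t) (\<eta> n) \<le> L * h n) \<and>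
        (\<lambda>n. (1 / h n) *\<^sub>R \<eta> n c) \<longlonglongrightarrow> u"
      by (rule velocity_log_limit(2)[OF L \<gamma>S \<gamma>lip t c u])
    obtain h \<eta> where h: "\<And>n::nat. h n > 0" and D: "\<And>n. (\<gamma> t, \<eta> n) \<in> D"
      and le: "\<And>n. tangent_norm g (\<gamma> t) (\<eta> n) \<le> L * h n" and lim: "(\<lambda>n. (1 / h n) *\<^sub>R \<eta> n c) \<longlonglongrightarrow> u"
      using V2 by blast
    define f where "f = (\<lambda>n x. (1 / h n) *\<^sub>R B (\<gamma> t) (\<eta> n) x)"
    have f: "f n x = B (\<gamma> t) (coord_vector A c (\<gamma> t) ((1 / h n) *\<^sub>R \<eta> n c)) x" for n x
      using B_scale[OF \<gamma>S[OF t01] D_in_tangent[OF D]]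
      by (simp add: f_def coord_vector_scale[OF c] tangent_coord[OF D_in_tangent[OF D] c])
    have flim: "(\<lambda>n. f n x) \<longlonglongrightarrow> curve_field \<gamma> t x" for x
      unfolding V1 f
      by (rule bounded_linear.tendsto[OF linear_conv_bounded_linear[THEN iffD1, OF B_coord_linear[OF \<gamma>S[OF t01] c]] lim])
    have le': "C0 * tangent_norm g (\<gamma> t) (\<eta> n) \<le> C0 * L * h n" for n
      using le[of n] C0_pos by simp
    have fb: "norm (f n x) \<le> C0 * L" for n x
    proof -
      have "norm (B (\<gamma> t) (\<eta> n) x) \<le> C0 * L * h n" using B_D_bounds(1)[OF D] le' by (rule order_trans)
      then show ?thesis using h[of n] by (simp add: f_def field_simps)
    qed
    have fl: "norm (f n x - f n y) \<le> C0 * L * norm (x - y)" for n x y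
    proof -
      have le2: "norm (B (\<gamma> t) (\<eta> n) x - B (\<gamma> t) (\<eta> n) y) \<le> (C0 * L * h n) * norm (x - y)"
        using B_D_bounds(2)[OF D] mult_right_mono[OF le' norm_ge_zero] by (rule order_trans)
      have "norm (f n x - f n y) = (1 / h n) * norm (B (\<gamma> t) (\<eta> n) x - B (\<gamma> t) (\<eta> n) y)"
        using h[of n] by (simp add: f_def scaleR_diff_right[symmetric])
      also have "\<dots> \<le> (1 / h n) * ((C0 * L * h n) * norm (x - y))"
        using h[of n] by (intro mult_left_mono[OF le2]) simp
      also have "\<dots> = C0 * L * norm (x - y)" using h[of n] by simp
      finally show ?thesis .
    qed
    have "velocity A \<gamma> t \<in> tangent_space A (\<gamma> t)"
      unfolding V1 by (rule coord_vector_tangent[OF c])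
    moreover have "norm (curve_field \<gamma> t x) \<le> C0 * L" for x
      by (rule LIMSEQ_le_const2[OF tendsto_norm[OF flim]]) (use fb in blast)
    moreover have "norm (curve_field \<gamma> t x - curve_field \<gamma> t y) \<le> C0 * L * norm (x - y)" for x y
      by (rule LIMSEQ_le_const2[OF tendsto_norm[OF tendsto_diff[OF flim flim]]]) (use fl in blast)
    ultimately show "velocity A \<gamma> t \<in> tangent_space A (\<gamma> t) \<and> (\<forall>x. norm (curve_field \<gamma> t x) \<le> C0 * L) \<and>
       (\<forall>x y. norm (curve_field \<gamma> t x - curve_field \<gamma> t y) \<le> C0 * L * norm (x - y))" by blast
  qed
qed

text \<open>\<rho> is required to equal E \<circ> \<gamma> on [0,1] only, because the curves in
  \<open>geodesic_restriction\<close> are arbitrary elsewhere. The last part supplies a Borel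
  version of the energy density, whose own measurability in time is not known; the change of
  variables below depends on it.\<close>

lemma lip_curve_energy:
  assumes L: "0 \<le> L" and \<gamma>S: "\<And>t. t \<in> {0..1} \<Longrightarrow> \<gamma> t \<in> S"
    and \<gamma>lip: "\<And>s t. s \<in> {0..1} \<Longrightarrow> t \<in> {0..1} \<Longrightarrow> dist_S (\<gamma> s) (\<gamma> t) \<le> L * \<bar>s - t\<bar>"
    and \<rho>: "\<And>t. t \<in> {0..1} \<Longrightarrow> \<rho> t = E (\<gamma> t)"
  shows "energy \<Omega> \<rho> = curve_energy A E B \<gamma>"
    and "curve_energy A E B \<gamma> \<le> ennreal ((C0 * L)\<^sup>2)"
    and "ennreal ((wasserstein2 (E (\<gamma> 0)) (E (\<gamma> 1)))\<^sup>2) \<le> curve_energy A E B \<gamma>"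
    and "\<exists>F\<in>borel_measurable borel. AE t in lborel. t \<in> {0..1} \<longrightarrow> (L2_enorm (E (\<gamma> t)) (curve_field \<gamma> t))\<^sup>2 = F t"
proof -
  have bounds: "AE t in lborel. t \<in> {0..1} \<longrightarrow> velocity A \<gamma> t \<in> tangent_space A (\<gamma> t) \<and>
     (\<forall>x. norm (curve_field \<gamma> t x) \<le> C0 * L) \<and>
     (\<forall>x y. norm (curve_field \<gamma> t x - curve_field \<gamma> t y) \<le> C0 * L * norm (x - y))"
    by (rule curve_field_bounds[OF L \<gamma>S \<gamma>lip])
  have "lip_curve dist_S S \<gamma>" unfolding lip_curve_def using \<gamma>S \<gamma>lip by blast
  from B_flow[OF this] obtain \<phi> where \<phi>: "flow_of \<Omega> (curve_field \<gamma>) \<phi>"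
    "\<And>t. t \<in> {0..1} \<Longrightarrow> E (\<gamma> t) = distr (restrict_space (E (\<gamma> 0)) \<Omega>) borel (\<phi> t)" by blast
  interpret T: transported_family \<Omega> "curve_field \<gamma>" \<phi> "C0 * L" \<rho>
  proof
    show "AE t in lborel. t \<in> {0..1} \<longrightarrow> (\<forall>x. norm (curve_field \<gamma> t x) \<le> C0 * L) \<and>
       (\<forall>x y. norm (curve_field \<gamma> t x - curve_field \<gamma> t y) \<le> C0 * L * norm (x - y))"
      using bounds by (rule eventually_mono) blast
    show "0 \<le> C0 * L" using C0_pos L by simp
    show "\<rho> t = distr (restrict_space (\<rho> 0) \<Omega>) borel (\<phi> t)" if "t \<in> {0..1}" for t
      using \<phi>(2)[OF that] \<rho>[OF that] \<rho>[of 0] by simp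
    show "\<rho> t \<in> prob_measures_on \<Omega>" if "t \<in> {0..1}" for t
      using E_prob[OF \<gamma>S[OF that]] \<rho>[OF that] by simp
  qed (rule \<Omega>_compact \<Omega>_convex \<phi>(1))+
  have e: "(\<integral>\<^sup>+t\<in>{0..1}. (L2_enorm (\<rho> t) (curve_field \<gamma> t))\<^sup>2 \<partial>lborel) = curve_energy A E B \<gamma>"
    unfolding curve_energy_def by (intro nn_integral_cong) (auto simp: \<rho> indicator_def)
  have "AE t in lborel. t \<in> {0..1} \<longrightarrow> gradient_field (curve_field \<gamma> t)"
    using bounds by (rule eventually_mono) (use B_gradient \<gamma>S in blast)
  then show "energy \<Omega> \<rho> = curve_energy A E B \<gamma>" unfolding e[symmetric] by (rule T.energy_eq)
  show "curve_energy A E B \<gamma> \<le> ennreal ((C0 * L)\<^sup>2)" using T.energy_w_le unfolding e .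
  show "ennreal ((wasserstein2 (E (\<gamma> 0)) (E (\<gamma> 1)))\<^sup>2) \<le> curve_energy A E B \<gamma>"
    using T.wasserstein2_le_energy unfolding e using \<rho>[of 0] \<rho>[of 1] by simp
  show "\<exists>F\<in>borel_measurable borel. AE t in lborel. t \<in> {0..1} \<longrightarrow> (L2_enorm (E (\<gamma> t)) (curve_field \<gamma> t))\<^sup>2 = F t"
  proof (rule bexI[OF _ T.energy_measurable])
    show "AE t in lborel. t \<in> {0..1} \<longrightarrow>
      (L2_enorm (E (\<gamma> t)) (curve_field \<gamma> t))\<^sup>2 = (\<integral>\<^sup>+x. ennreal ((norm (T.v t (T.X t x)))\<^sup>2) \<partial>\<rho> 0)"
      using T.good_AE
    proof (rule eventually_mono, intro impI)
      fix t :: real assume "t \<in> {0..1} \<longrightarrow> t \<in> T.good" and t: "t \<in> {0..1}"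
      then have "t \<in> T.good" by blast
      from T.L2_w_eq_X[OF this]
      show "(L2_enorm (E (\<gamma> t)) (curve_field \<gamma> t))\<^sup>2 = (\<integral>\<^sup>+x. ennreal ((norm (T.v t (T.X t x)))\<^sup>2) \<partial>\<rho> 0)"
        by (simp only: \<rho>[OF t])
    qed
  qed
qed

text \<open>Velocities scale by u and densities by u^2, and the substitution contributes 1/|u|. The
  result is phrased with a Borel majorant so that the contributions of several pieces of a curve can
  be added under the integral.\<close>

lemma curve_energy_affine:
  assumes \<gamma>: "lip_curve dist_S S \<gamma>" and ab: "{a..b} \<subseteq> {0..1}" and u: "u \<noteq> 0"
    and map: "\<And>s. s \<in> {a..b} \<Longrightarrow> u * s + w \<in> {0..1}" "\<And>s. s \<in> {a..b} \<Longrightarrow> \<gamma>' s = \<gamma> (u * s + w)"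
  shows "\<exists>G\<in>borel_measurable borel.
    (AE s in lborel. s \<in> {a..b} \<longrightarrow> (L2_enorm (E (\<gamma>' s)) (curve_field \<gamma>' s))\<^sup>2 \<le> G s) \<and>
    (\<integral>\<^sup>+s. G s \<partial>lborel) \<le> ennreal \<bar>u\<bar> * curve_energy A E B \<gamma>"
proof -
  obtain L where L: "0 \<le> L" and \<gamma>S: "\<And>t. t \<in> {0..1} \<Longrightarrow> \<gamma> t \<in> S"
    and \<gamma>lip: "\<And>s t. s \<in> {0..1} \<Longrightarrow> t \<in> {0..1} \<Longrightarrow> dist_S (\<gamma> s) (\<gamma> t) \<le> L * \<bar>s - t\<bar>"
    using lip_curveD[OF \<gamma>] by blast
  define e where "e = (\<lambda>t. (L2_enorm (E (\<gamma> t)) (curve_field \<gamma> t))\<^sup>2)"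
  obtain F where F[measurable]: "F \<in> borel_measurable borel" and Fe: "AE t in lborel. t \<in> {0..1} \<longrightarrow> e t = F t"
    using lip_curve_energy(4)[OF L \<gamma>S \<gamma>lip refl] unfolding e_def by blast
  \<comment> \<open>The substitution runs over the whole line; the cut-off removes the times outside
    [0,1].\<close>
  define H where "H = (\<lambda>t. F t * indicator {0..1} t)"
  have H[measurable]: "H \<in> borel_measurable borel" unfolding H_def by measurable
  have H_int: "(\<integral>\<^sup>+t. H t \<partial>lborel) = curve_energy A E B \<gamma>"
    unfolding curve_energy_def
  proof (rule nn_integral_cong_AE)
    show "AE t in lborel. H t = (L2_enorm (E (\<gamma> t)) (curve_field \<gamma> t))\<^sup>2 * indicator {0..1} t"
      using Fe by eventually_elim (auto simp: H_def e_def indicator_def)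
  qed
  have cont: "continuous_on {0..1} \<gamma>" by (rule lip_curve_continuous[OF L \<gamma>S \<gamma>lip])
  have diff: "AE t in lborel. t \<in> {0..1} \<longrightarrow> t \<in> {0<..<1} \<and>
     (\<exists>c\<in>A. \<gamma> t \<in> fst c \<and> (\<exists>u. ((snd c \<circ> \<gamma>) has_vector_derivative u) (at t within {0..1})))"
    by (rule lip_curve_ae_differentiable[OF L \<gamma>S \<gamma>lip])
  have ne: "AE s in lborel. s \<noteq> a \<and> s \<noteq> b"
    using AE_lborel_singleton[of a] AE_lborel_singleton[of b] by (rule eventually_conj)
  show ?thesis
  proof (intro bexI[of _ "\<lambda>s. ennreal (u\<^sup>2) * H (w + u * s)"] conjI)
    show "AE s in lborel. s \<in> {a..b} \<longrightarrow> (L2_enorm (E (\<gamma>' s)) (curve_field \<gamma>' s))\<^sup>2 \<le> ennreal (u\<^sup>2) * H (w + u * s)"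
      using ne ae_affine[OF Fe u, of w] ae_affine[OF diff u, of w]
    proof (eventually_elim, intro impI)
      fix s
      assume s: "s \<in> {a..b}" and "s \<noteq> a \<and> s \<noteq> b" and "w + u * s \<in> {0..1} \<longrightarrow> e (w + u * s) = F (w + u * s)"
        and "w + u * s \<in> {0..1} \<longrightarrow> w + u * s \<in> {0<..<1} \<and> (\<exists>c\<in>A. \<gamma> (w + u * s) \<in> fst c \<and>
          (\<exists>z. ((snd c \<circ> \<gamma>) has_vector_derivative z) (at (w + u * s) within {0..1})))"
      moreover have t: "u * s + w \<in> {0..1}" by (rule map(1)[OF s])
      ultimately obtain c z where c: "c \<in> A" "\<gamma> (u * s + w) \<in> fst c"
        and z: "((snd c \<circ> \<gamma>) has_vector_derivative z) (at (u * s + w) within {0..1})"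
        and s': "s \<in> {a<..<b}" and eF: "e (u * s + w) = F (u * s + w)"
        unfolding add.commute[of w] by fastforce
      have V: "velocity A \<gamma>' s = (\<lambda>c. u *\<^sub>R velocity A \<gamma> (u * s + w) c)"
        "velocity A \<gamma> (u * s + w) \<in> tangent_space A (\<gamma> (u * s + w))"
        using velocity_affine[OF ab s', of u w \<gamma>' \<gamma>, OF map cont c z] by simp_all
      have "(L2_enorm (E (\<gamma>' s)) (curve_field \<gamma>' s))\<^sup>2 = ennreal (u\<^sup>2) * e (u * s + w)"
        unfolding V(1) map(2)[OF s] B_scale[OF \<gamma>S[OF t] V(2)] e_def
        by (rule L2_enorm_scale[OF B_measurable[OF \<gamma>S[OF t] V(2)]]) (rule prob_measures_onD(2)[OF E_prob[OF \<gamma>S[OF t]]])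
      also have "\<dots> = ennreal (u\<^sup>2) * H (w + u * s)" using eF t by (simp add: H_def add.commute)
      finally show "(L2_enorm (E (\<gamma>' s)) (curve_field \<gamma>' s))\<^sup>2 \<le> ennreal (u\<^sup>2) * H (w + u * s)" by simp
    qed
    have "(\<integral>\<^sup>+s. ennreal (u\<^sup>2) * H (w + u * s) \<partial>lborel) = ennreal (\<bar>u\<bar> * \<bar>u\<bar>) * (\<integral>\<^sup>+s. H (w + u * s) \<partial>lborel)"
      by (subst nn_integral_cmult) (auto simp: power2_eq_square)
    also have "\<dots> = ennreal \<bar>u\<bar> * (\<integral>\<^sup>+t. H t \<partial>lborel)"
      unfolding nn_integral_real_affine[OF H u, of w] by (simp only: ennreal_mult abs_ge_zero mult.assoc)
    finally show "(\<integral>\<^sup>+s. ennreal (u\<^sup>2) * H (w + u * s) \<partial>lborel) \<le> ennreal \<bar>u\<bar> * curve_energy A E B \<gamma>"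
      by (simp add: H_int)
  qed measurable
qed

section \<open>The infimum over curves in the parameter space is symmetric and satisfies the
  triangle inequality\<close>

abbreviation lip_curves :: "'m \<Rightarrow> 'm \<Rightarrow> (real \<Rightarrow> 'm) set" where
  "lip_curves p q \<equiv> {\<gamma>. lip_curve dist_S S \<gamma> \<and> \<gamma> 0 = p \<and> \<gamma> 1 = q}"

text \<open>The right-hand side of the formula to be proved, kept in \<open>ennreal\<close> until
  \<open>dL_le_dist\<close> shows it finite.\<close>

definition dL :: "'m \<Rightarrow> 'm \<Rightarrow> ennreal" where
  "dL p q = (INF \<gamma>\<in>lip_curves p q. ennsqrt (curve_energy A E B \<gamma>))"

lemma lip_curves_reverse:
  assumes "\<gamma> \<in> lip_curves p q"
  obtains \<gamma>' where "\<gamma>' \<in> lip_curves q p" "curve_energy A E B \<gamma>' \<le> curve_energy A E B \<gamma>"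
proof (rule that[of "\<lambda>t. \<gamma> (1 - t)"])
  have \<gamma>: "lip_curve dist_S S \<gamma>" "\<gamma> 0 = p" "\<gamma> 1 = q" using assms by auto
  obtain L where L: "0 \<le> L" and \<gamma>S: "\<And>t. t \<in> {0..1} \<Longrightarrow> \<gamma> t \<in> S"
    and \<gamma>lip: "\<And>s t. s \<in> {0..1} \<Longrightarrow> t \<in> {0..1} \<Longrightarrow> dist_S (\<gamma> s) (\<gamma> t) \<le> L * \<bar>s - t\<bar>"
    using lip_curveD[OF \<gamma>(1)] by blast
  have "dist_S (\<gamma> (1 - s)) (\<gamma> (1 - t)) \<le> L * \<bar>s - t\<bar>" if "s \<in> {0..1}" "t \<in> {0..1}" for s t
    using \<gamma>lip[of "1 - s" "1 - t"] that by (simp add: abs_minus_commute)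
  then have "lip_curve dist_S S (\<lambda>t. \<gamma> (1 - t))"
    unfolding lip_curve_def using \<gamma>S by (intro conjI exI[of _ L] ballI) auto
  then show "(\<lambda>t. \<gamma> (1 - t)) \<in> lip_curves q p" using \<gamma> by simp
  obtain G where G: "G \<in> borel_measurable borel"
    and le: "AE s in lborel. s \<in> {0..1} \<longrightarrow> (L2_enorm (E (\<gamma> (1 - s))) (curve_field (\<lambda>t. \<gamma> (1 - t)) s))\<^sup>2 \<le> G s"
    and int: "(\<integral>\<^sup>+s. G s \<partial>lborel) \<le> ennreal \<bar>-1\<bar> * curve_energy A E B \<gamma>"
    using curve_energy_affine[OF \<gamma>(1), of 0 1 "-1" 1 "\<lambda>t. \<gamma> (1 - t)"] by auto
  have "curve_energy A E B (\<lambda>t. \<gamma> (1 - t)) \<le> (\<integral>\<^sup>+s. G s \<partial>lborel)"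
    unfolding curve_energy_def
    by (rule nn_integral_mono_AE) (use le in eventually_elim, auto simp: indicator_def)
  then show "curve_energy A E B (\<lambda>t. \<gamma> (1 - t)) \<le> curve_energy A E B \<gamma>" using int by simp
qed

text \<open>Time is divided in the ratio of the prospective lengths a and b. Pieces with energies at
  most a^2 and b^2 then give a curve with energy at most (a + b)^2, which is the triangle inequality
  after taking roots.\<close>

lemma lip_curves_concat:
  assumes "\<gamma>1 \<in> lip_curves p q" "\<gamma>2 \<in> lip_curves q r" and a: "a > 0" and b: "b > 0"
  obtains \<gamma> where "\<gamma> \<in> lip_curves p r"
    "curve_energy A E B \<gamma> \<le> ennreal ((a + b) / a) * curve_energy A E B \<gamma>1 + ennreal ((a + b) / b) * curve_energy A E B \<gamma>2"
proof -
  have \<gamma>1: "lip_curve dist_S S \<gamma>1" "\<gamma>1 0 = p" "\<gamma>1 1 = q" and \<gamma>2: "lip_curve dist_S S \<gamma>2" "\<gamma>2 0 = q" "\<gamma>2 1 = r"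
    using assms by auto
  \<comment> \<open>The constants u, v, w are those of the affine maps carrying [0,s] and [s,1] onto
    [0,1].\<close>
  define s where "s = a / (a + b)"
  define u where "u = (a + b) / a"
  define v where "v = (a + b) / b"
  define w where "w = - a / b"
  have s: "0 < s" "s < 1" using a b by (auto simp: s_def)
  have uv: "u > 0" "v > 0" using a b by (auto simp: u_def v_def)
  have us: "u * s = 1" "v * s + w = 0" "v + w = 1"
  proof -
    have ab: "a + b \<noteq> 0" using a b by simp
    show "u * s = 1" using a ab by (simp add: u_def s_def)
    have "v * s = a / b" using b ab by (simp add: v_def s_def)
    then show "v * s + w = 0" by (simp add: w_def)
    show "v + w = 1" using b by (simp add: v_def w_def add_divide_distrib)
  qed
  define \<gamma> where "\<gamma> = (\<lambda>t. if t \<le> s then \<gamma>1 (u * t + 0) else \<gamma>2 (v * t + w))"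
  have m1: "u * t + 0 \<in> {0..1}" "\<gamma> t = \<gamma>1 (u * t + 0)" if t: "t \<in> {0..s}" for t
  proof -
    have "u * t \<le> u * s" using t uv by (intro mult_left_mono) auto
    then show "u * t + 0 \<in> {0..1}" using t uv us(1) by simp
    show "\<gamma> t = \<gamma>1 (u * t + 0)" using t by (simp add: \<gamma>_def)
  qed
  have m2: "v * t + w \<in> {0..1}" "\<gamma> t = \<gamma>2 (v * t + w)" if t: "t \<in> {s..1}" for t
  proof -
    have "v * s \<le> v * t" "v * t \<le> v * 1" using t uv by (auto intro!: mult_left_mono)
    then show "v * t + w \<in> {0..1}" using us by simp
    show "\<gamma> t = \<gamma>2 (v * t + w)"
    proof (cases "t = s")
      case True
      then show ?thesis using us \<gamma>1(3) \<gamma>2(2) by (simp add: \<gamma>_def)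
    qed (use t in \<open>simp add: \<gamma>_def\<close>)
  qed
  obtain L1 where L1: "0 \<le> L1" and S1: "\<And>t. t \<in> {0..1} \<Longrightarrow> \<gamma>1 t \<in> S"
    and lip1: "\<And>s t. s \<in> {0..1} \<Longrightarrow> t \<in> {0..1} \<Longrightarrow> dist_S (\<gamma>1 s) (\<gamma>1 t) \<le> L1 * \<bar>s - t\<bar>"
    using lip_curveD[OF \<gamma>1(1)] by blast
  obtain L2 where L2: "0 \<le> L2" and S2: "\<And>t. t \<in> {0..1} \<Longrightarrow> \<gamma>2 t \<in> S"
    and lip2: "\<And>s t. s \<in> {0..1} \<Longrightarrow> t \<in> {0..1} \<Longrightarrow> dist_S (\<gamma>2 s) (\<gamma>2 t) \<le> L2 * \<bar>s - t\<bar>"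
    using lip_curveD[OF \<gamma>2(1)] by blast
  define K where "K = L1 * u + L2 * v"
  have K: "L1 * u \<le> K" "L2 * v \<le> K" using L1 L2 uv by (auto simp: K_def)
  have h1: "dist_S (\<gamma> t) (\<gamma> t') \<le> K * \<bar>t - t'\<bar>" if "t \<in> {0..s}" "t' \<in> {0..s}" for t t'
  proof -
    have "u * t + 0 - (u * t' + 0) = u * (t - t')" by (simp add: algebra_simps)
    then have "\<bar>u * t + 0 - (u * t' + 0)\<bar> = u * \<bar>t - t'\<bar>" using uv by (simp only: abs_mult abs_of_pos)
    then have "dist_S (\<gamma> t) (\<gamma> t') \<le> (L1 * u) * \<bar>t - t'\<bar>"
      using lip1[OF m1(1)[OF that(1)] m1(1)[OF that(2)]] m1(2)[OF that(1)] m1(2)[OF that(2)] by (simp only: mult.assoc)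
    also have "\<dots> \<le> K * \<bar>t - t'\<bar>" using K(1) by (intro mult_right_mono) auto
    finally show ?thesis .
  qed
  have h2: "dist_S (\<gamma> t) (\<gamma> t') \<le> K * \<bar>t - t'\<bar>" if "t \<in> {s..1}" "t' \<in> {s..1}" for t t'
  proof -
    have "v * t + w - (v * t' + w) = v * (t - t')" by (simp add: algebra_simps)
    then have "\<bar>v * t + w - (v * t' + w)\<bar> = v * \<bar>t - t'\<bar>" using uv by (simp only: abs_mult abs_of_pos)
    then have "dist_S (\<gamma> t) (\<gamma> t') \<le> (L2 * v) * \<bar>t - t'\<bar>"
      using lip2[OF m2(1)[OF that(1)] m2(1)[OF that(2)]] m2(2)[OF that(1)] m2(2)[OF that(2)] by (simp only: mult.assoc)
    also have "\<dots> \<le> K * \<bar>t - t'\<bar>" using K(2) by (intro mult_right_mono) auto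
    finally show ?thesis .
  qed
  have \<gamma>S: "\<gamma> t \<in> S" if "t \<in> {0..1}" for t
  proof (cases "t \<le> s")
    case True
    then show ?thesis using S1[OF m1(1)] m1(2) that by simp
  next
    case False
    then show ?thesis using S2[OF m2(1)] m2(2) that by simp
  qed
  have h12: "dist_S (\<gamma> t) (\<gamma> t') \<le> K * \<bar>t - t'\<bar>" if "t \<in> {0..s}" "t' \<in> {s..1}" for t t'
  proof -
    have "dist_S (\<gamma> t) (\<gamma> t') \<le> dist_S (\<gamma> t) (\<gamma> s) + dist_S (\<gamma> s) (\<gamma> t')"
      by (rule dist_S_triangle) (use that s \<gamma>S in auto)
    also have "\<dots> \<le> K * \<bar>t - s\<bar> + K * \<bar>s - t'\<bar>"
      by (intro add_mono h1 h2) (use that s in auto)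
    also have "\<dots> = K * \<bar>t - t'\<bar>"
    proof -
      have "\<bar>t - s\<bar> = s - t" "\<bar>s - t'\<bar> = t' - s" "\<bar>t - t'\<bar> = t' - t" using that by auto
      then show ?thesis by (simp add: algebra_simps)
    qed
    finally show ?thesis .
  qed
  have "dist_S (\<gamma> t) (\<gamma> t') \<le> K * \<bar>t - t'\<bar>" if tt: "t \<in> {0..1}" "t' \<in> {0..1}" for t t'
  proof -
    consider "t \<in> {0..s}" "t' \<in> {0..s}" | "t \<in> {s..1}" "t' \<in> {s..1}" | "t \<in> {0..s}" "t' \<in> {s..1}" | "t' \<in> {0..s}" "t \<in> {s..1}"
      using tt by force
    then show ?thesis
    proof cases
      case 4
      then show ?thesis using h12[of t' t] by (simp only: dist_S_commute[of "\<gamma> t"] abs_minus_commute)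
    qed (use h1 h2 h12 in blast)+
  qed
  then have lip: "lip_curve dist_S S \<gamma>" unfolding lip_curve_def using \<gamma>S by blast
  have sub: "{0..s} \<subseteq> {0..1}" "{s..1} \<subseteq> {0..1}" using s by auto
  obtain G1 where G1[measurable]: "G1 \<in> borel_measurable borel"
    and le1: "AE t in lborel. t \<in> {0..s} \<longrightarrow> (L2_enorm (E (\<gamma> t)) (curve_field \<gamma> t))\<^sup>2 \<le> G1 t"
    and int1: "(\<integral>\<^sup>+t. G1 t \<partial>lborel) \<le> ennreal \<bar>u\<bar> * curve_energy A E B \<gamma>1"
    using curve_energy_affine[OF \<gamma>1(1) sub(1) _ m1] uv(1) by blast
  obtain G2 where G2[measurable]: "G2 \<in> borel_measurable borel"
    and le2: "AE t in lborel. t \<in> {s..1} \<longrightarrow> (L2_enorm (E (\<gamma> t)) (curve_field \<gamma> t))\<^sup>2 \<le> G2 t"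
    and int2: "(\<integral>\<^sup>+t. G2 t \<partial>lborel) \<le> ennreal \<bar>v\<bar> * curve_energy A E B \<gamma>2"
    using curve_energy_affine[OF \<gamma>2(1) sub(2) _ m2] uv(2) by blast
  have "curve_energy A E B \<gamma> \<le> (\<integral>\<^sup>+t. G1 t + G2 t \<partial>lborel)"
    unfolding curve_energy_def
  proof (rule nn_integral_mono_AE)
    show "AE t in lborel. (L2_enorm (E (\<gamma> t)) (curve_field \<gamma> t))\<^sup>2 * indicator {0..1} t \<le> G1 t + G2 t"
      using le1 le2
    proof eventually_elim
      case (elim t)
      consider "t \<notin> {0..1}" | "t \<in> {0..s}" | "t \<in> {s..1}" by force
      then show ?case
      proof cases
        case 2
        then have "(L2_enorm (E (\<gamma> t)) (curve_field \<gamma> t))\<^sup>2 \<le> G1 t + G2 t" using elim(1) by (simp add: add_increasing2)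
        then show ?thesis by (auto simp: indicator_def)
      next
        case 3
        then have "(L2_enorm (E (\<gamma> t)) (curve_field \<gamma> t))\<^sup>2 \<le> G1 t + G2 t" using elim(2) by (simp add: add_increasing)
        then show ?thesis by (auto simp: indicator_def)
      qed simp
    qed
  qed
  also have "\<dots> = (\<integral>\<^sup>+t. G1 t \<partial>lborel) + (\<integral>\<^sup>+t. G2 t \<partial>lborel)" by (rule nn_integral_add) measurable
  also have "\<dots> \<le> ennreal \<bar>u\<bar> * curve_energy A E B \<gamma>1 + ennreal \<bar>v\<bar> * curve_energy A E B \<gamma>2"
    by (rule add_mono[OF int1 int2])
  finally have "curve_energy A E B \<gamma> \<le> ennreal u * curve_energy A E B \<gamma>1 + ennreal v * curve_energy A E B \<gamma>2"
    using uv by simp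
  moreover have "\<gamma> 0 = p" "\<gamma> 1 = r" using m1(2)[of 0] m2(2)[of 1] s us \<gamma>1 \<gamma>2 by auto
  ultimately show thesis using lip by (intro that[of \<gamma>]) (auto simp: u_def v_def)
qed

lemma dL_le_dist:
  assumes "p \<in> S" "q \<in> S"
  shows "dL p q \<le> ennreal (C0 * dist_S p q)"
proof -
  obtain \<eta> where \<eta>: "(p, \<eta>) \<in> D" "q = riem_exp A g p \<eta>" "tangent_norm g p \<eta> = dist_S p q"
    using D_reachesE[OF assms] .
  define \<gamma> where "\<gamma> = exp_curve A g p \<eta>"
  have \<gamma>S: "\<And>t. t \<in> {0..1} \<Longrightarrow> \<gamma> t \<in> S" using D_curve(2)[OF \<eta>(1)] by (simp add: \<gamma>_def)
  have \<gamma>lip: "dist_S (\<gamma> s) (\<gamma> t) \<le> dist_S p q * \<bar>s - t\<bar>" if "s \<in> {0..1}" "t \<in> {0..1}" for s t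
    using dist_S_exp_curve[OF \<eta>(1) that] \<eta>(3) by (simp add: \<gamma>_def mult.commute abs_minus_commute)
  have "\<gamma> \<in> lip_curves p q"
    using \<gamma>S \<gamma>lip D_curve(3)[OF \<eta>(1)] \<eta>(2) unfolding lip_curve_def
    by (auto simp: \<gamma>_def exp_curve_1 intro!: exI[of _ "dist_S p q"])
  then have "dL p q \<le> ennsqrt (curve_energy A E B \<gamma>)" unfolding dL_def by (rule INF_lower)
  also have "\<dots> \<le> ennsqrt (ennreal ((C0 * dist_S p q)\<^sup>2))"
    by (rule ennsqrt_mono[OF lip_curve_energy(2)[OF dist_S_nonneg \<gamma>S \<gamma>lip refl]])
  also have "\<dots> = ennreal (C0 * dist_S p q)"
    using C0_pos dist_S_nonneg by (intro ennsqrt_ennreal_power2) simp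
  finally show ?thesis .
qed

lemma wasserstein2_le_dL: "ennreal (wasserstein2 (E p) (E q)) \<le> dL p q"
  unfolding dL_def
proof (rule INF_greatest)
  fix \<gamma> assume "\<gamma> \<in> lip_curves p q"
  then have \<gamma>: "lip_curve dist_S S \<gamma>" "\<gamma> 0 = p" "\<gamma> 1 = q" by auto
  obtain L where L: "0 \<le> L" and \<gamma>S: "\<And>t. t \<in> {0..1} \<Longrightarrow> \<gamma> t \<in> S"
    and \<gamma>lip: "\<And>s t. s \<in> {0..1} \<Longrightarrow> t \<in> {0..1} \<Longrightarrow> dist_S (\<gamma> s) (\<gamma> t) \<le> L * \<bar>s - t\<bar>"
    using lip_curveD[OF \<gamma>(1)] by blast
  have "ennsqrt (ennreal ((wasserstein2 (E p) (E q))\<^sup>2)) \<le> ennsqrt (curve_energy A E B \<gamma>)"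
    using lip_curve_energy(3)[OF L \<gamma>S \<gamma>lip refl] \<gamma>(2,3) by (intro ennsqrt_mono) simp
  then show "ennreal (wasserstein2 (E p) (E q)) \<le> ennsqrt (curve_energy A E B \<gamma>)"
    by (simp only: ennsqrt_ennreal_power2[OF wasserstein2_nonneg])
qed

lemma dL_commute: "dL p q = dL q p"
proof -
  have "dL q p \<le> dL p q" for p q
    unfolding dL_def[of p q]
  proof (rule INF_greatest)
    fix \<gamma> assume "\<gamma> \<in> lip_curves p q"
    then obtain \<gamma>' where \<gamma>': "\<gamma>' \<in> lip_curves q p" "curve_energy A E B \<gamma>' \<le> curve_energy A E B \<gamma>"
      by (rule lip_curves_reverse)
    have "dL q p \<le> ennsqrt (curve_energy A E B \<gamma>')" unfolding dL_def by (rule INF_lower[OF \<gamma>'(1)])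
    also have "\<dots> \<le> ennsqrt (curve_energy A E B \<gamma>)" by (rule ennsqrt_mono[OF \<gamma>'(2)])
    finally show "dL q p \<le> ennsqrt (curve_energy A E B \<gamma>)" .
  qed
  then show ?thesis by (intro antisym)
qed

lemma dL_triangle:
  assumes "p \<in> S" "q \<in> S" "r \<in> S"
  shows "dL p r \<le> dL p q + dL q r"
proof (rule ennreal_le_epsilon)
  fix e :: real assume e: "0 < e"
  \<comment> \<open>The infimum need not be attained, and the concatenation divides by a and b, so
    both are enlarged to positive numbers.\<close>
  have near: "\<exists>a>0. ennreal a = dL p q + ennreal (e/2) \<and> (\<exists>\<gamma>\<in>lip_curves p q. curve_energy A E B \<gamma> \<le> ennreal (a\<^sup>2))"
    if pq: "p \<in> S" "q \<in> S" for p q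
  proof -
    have "dL p q < \<top>" using dL_le_dist[OF pq] by (auto simp: order_le_less_trans)
    then obtain \<alpha> where \<alpha>: "\<alpha> \<ge> 0" "dL p q = ennreal \<alpha>" by (cases "dL p q") auto
    have "(INF \<gamma>\<in>lip_curves p q. ennsqrt (curve_energy A E B \<gamma>)) < ennreal (\<alpha> + e/2)"
      using \<alpha> e by (simp add: dL_def[symmetric] ennreal_less_iff)
    then obtain \<gamma> where \<gamma>: "\<gamma> \<in> lip_curves p q" "ennsqrt (curve_energy A E B \<gamma>) < ennreal (\<alpha> + e/2)"
      unfolding INF_less_iff by blast
    have "ennreal (\<alpha> + e/2) = dL p q + ennreal (e/2)" unfolding \<alpha>(2) by (rule ennreal_plus) (use \<alpha> e in auto)
    then show ?thesis using \<alpha>(1) e ennsqrt_lessD[OF \<gamma>(2)] \<gamma>(1) by (intro exI[of _ "\<alpha> + e/2"]) auto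
  qed
  obtain a \<gamma>1 where a: "a > 0" "ennreal a = dL p q + ennreal (e/2)" and \<gamma>1: "\<gamma>1 \<in> lip_curves p q" "curve_energy A E B \<gamma>1 \<le> ennreal (a\<^sup>2)"
    using near[OF assms(1,2)] by blast
  obtain b \<gamma>2 where b: "b > 0" "ennreal b = dL q r + ennreal (e/2)" and \<gamma>2: "\<gamma>2 \<in> lip_curves q r" "curve_energy A E B \<gamma>2 \<le> ennreal (b\<^sup>2)"
    using near[OF assms(2,3)] by blast
  obtain \<gamma> where \<gamma>: "\<gamma> \<in> lip_curves p r"
    "curve_energy A E B \<gamma> \<le> ennreal ((a + b) / a) * curve_energy A E B \<gamma>1 + ennreal ((a + b) / b) * curve_energy A E B \<gamma>2"
    by (rule lip_curves_concat[OF \<gamma>1(1) \<gamma>2(1) a(1) b(1)])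
  note \<gamma>(2)
  also have "ennreal ((a + b) / a) * curve_energy A E B \<gamma>1 + ennreal ((a + b) / b) * curve_energy A E B \<gamma>2
      \<le> ennreal ((a + b) / a) * ennreal (a\<^sup>2) + ennreal ((a + b) / b) * ennreal (b\<^sup>2)"
    by (intro add_mono mult_left_mono \<gamma>1(2) \<gamma>2(2)) auto
  also have "\<dots> = ennreal ((a + b) / a * a\<^sup>2 + (a + b) / b * b\<^sup>2)"
    using a(1) b(1) by (simp add: ennreal_mult[symmetric] ennreal_plus[symmetric] del: ennreal_plus)
  also have "(a + b) / a * a\<^sup>2 + (a + b) / b * b\<^sup>2 = (a + b)\<^sup>2"
    using a(1) b(1) by (simp add: power2_eq_square field_simps)
  finally have le: "curve_energy A E B \<gamma> \<le> ennreal ((a + b)\<^sup>2)" .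
  have "dL p r \<le> ennsqrt (curve_energy A E B \<gamma>)" unfolding dL_def by (rule INF_lower[OF \<gamma>(1)])
  also have "\<dots> \<le> ennsqrt (ennreal ((a + b)\<^sup>2))" by (rule ennsqrt_mono[OF le])
  also have "\<dots> = ennreal (a + b)" using a(1) b(1) by (intro ennsqrt_ennreal_power2) simp
  also have "\<dots> = ennreal a + ennreal b" using a(1) b(1) by (intro ennreal_plus) auto
  also have "\<dots> = dL p q + dL q r + (ennreal (e/2) + ennreal (e/2))" unfolding a(2) b(2) by (simp only: ac_simps)
  also have "ennreal (e/2) + ennreal (e/2) = ennreal e" using e by (subst ennreal_plus[symmetric]) auto
  finally show "dL p r \<le> dL p q + dL q r + ennreal e" .
qed

section \<open>Identification with the geodesic restriction, and equivalence of the metrics\<close>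

lemma geodesic_restriction_eq:
  assumes p: "p \<in> S" and q: "q \<in> S"
  shows "geodesic_restriction \<Omega> (E ` S) (E p) (E q) = dL p q"
proof -
  obtain \<kappa> where \<kappa>: "\<kappa> > 0" and bl: "\<And>p q. p \<in> S \<Longrightarrow> q \<in> S \<Longrightarrow> inverse \<kappa> * dist_S p q \<le> wasserstein2 (E p) (E q)"
    "\<And>p q. p \<in> S \<Longrightarrow> q \<in> S \<Longrightarrow> wasserstein2 (E p) (E q) \<le> \<kappa> * dist_S p q"
    using E_bilipschitz by blast
  show ?thesis
  proof (rule antisym)
    show "geodesic_restriction \<Omega> (E ` S) (E p) (E q) \<le> dL p q"
      unfolding dL_def
    proof (rule INF_greatest)
      fix \<gamma> assume "\<gamma> \<in> lip_curves p q"
      then have \<gamma>: "lip_curve dist_S S \<gamma>" "\<gamma> 0 = p" "\<gamma> 1 = q" by auto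
      obtain L where L: "0 \<le> L" and \<gamma>S: "\<And>t. t \<in> {0..1} \<Longrightarrow> \<gamma> t \<in> S"
        and \<gamma>lip: "\<And>s t. s \<in> {0..1} \<Longrightarrow> t \<in> {0..1} \<Longrightarrow> dist_S (\<gamma> s) (\<gamma> t) \<le> L * \<bar>s - t\<bar>"
        using lip_curveD[OF \<gamma>(1)] by blast
      have "wasserstein2 (E (\<gamma> s)) (E (\<gamma> t)) \<le> (\<kappa> * L) * \<bar>s - t\<bar>" if "s \<in> {0..1}" "t \<in> {0..1}" for s t
      proof -
        have "\<kappa> * dist_S (\<gamma> s) (\<gamma> t) \<le> \<kappa> * (L * \<bar>s - t\<bar>)" using \<gamma>lip[OF that] \<kappa> by (intro mult_left_mono) auto
        then show ?thesis using bl(2)[OF \<gamma>S[OF that(1)] \<gamma>S[OF that(2)]] by (simp only: mult.assoc)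
      qed
      then have "lip_curve wasserstein2 (E ` S) (\<lambda>t. E (\<gamma> t))"
        unfolding lip_curve_def using \<gamma>S by blast
      then have "geodesic_restriction \<Omega> (E ` S) (E p) (E q) \<le> ennsqrt (energy \<Omega> (\<lambda>t. E (\<gamma> t)))"
        unfolding geodesic_restriction_def using \<gamma>(2,3) by (intro INF_lower) simp
      also have "energy \<Omega> (\<lambda>t. E (\<gamma> t)) = curve_energy A E B \<gamma>"
        by (rule lip_curve_energy(1)[OF L \<gamma>S \<gamma>lip refl])
      finally show "geodesic_restriction \<Omega> (E ` S) (E p) (E q) \<le> ennsqrt (curve_energy A E B \<gamma>)" .
    qed
    show "dL p q \<le> geodesic_restriction \<Omega> (E ` S) (E p) (E q)"
      unfolding geodesic_restriction_def
    proof (rule INF_greatest)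
      fix \<rho> assume "\<rho> \<in> {\<rho>. lip_curve wasserstein2 (E ` S) \<rho> \<and> \<rho> 0 = E p \<and> \<rho> 1 = E q}"
      then have \<rho>: "lip_curve wasserstein2 (E ` S) \<rho>" "\<rho> 0 = E p" "\<rho> 1 = E q" by auto
      obtain L where L: "\<rho> ` {0..1} \<subseteq> E ` S"
        "\<And>s t. s \<in> {0..1} \<Longrightarrow> t \<in> {0..1} \<Longrightarrow> wasserstein2 (\<rho> s) (\<rho> t) \<le> L * \<bar>s - t\<bar>"
        using \<rho>(1) unfolding lip_curve_def by blast
      \<comment> \<open>Every admissible curve lifts, since only curves inside the image of E
        compete; the lower Lipschitz bound of E keeps the lift Lipschitz.\<close>
      define \<gamma> where "\<gamma> = (\<lambda>t. inv_into S E (\<rho> t))"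
      have in_img: "\<rho> t \<in> E ` S" if "t \<in> {0..1}" for t using L(1) that by blast
      have \<gamma>S: "\<gamma> t \<in> S" if "t \<in> {0..1}" for t unfolding \<gamma>_def by (rule inv_into_into[OF in_img[OF that]])
      have \<rho>E: "\<rho> t = E (\<gamma> t)" if "t \<in> {0..1}" for t unfolding \<gamma>_def by (rule f_inv_into_f[OF in_img[OF that], symmetric])
      have ends: "\<gamma> 0 = p" "\<gamma> 1 = q" using p q by (simp_all add: \<gamma>_def \<rho> inv_into_f_f[OF E_inj])
      have \<gamma>lip: "dist_S (\<gamma> s) (\<gamma> t) \<le> (\<kappa> * L) * \<bar>s - t\<bar>" if "s \<in> {0..1}" "t \<in> {0..1}" for s t
      proof -
        have "inverse \<kappa> * dist_S (\<gamma> s) (\<gamma> t) \<le> L * \<bar>s - t\<bar>"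
          using bl(1)[OF \<gamma>S[OF that(1)] \<gamma>S[OF that(2)]] L(2)[OF that] by (simp only: \<rho>E that)
        then show ?thesis using \<kappa> by (simp add: field_simps)
      qed
      have lip: "lip_curve dist_S S \<gamma>" unfolding lip_curve_def using \<gamma>S \<gamma>lip by blast
      obtain M where M: "0 \<le> M" "\<And>t. t \<in> {0..1} \<Longrightarrow> \<gamma> t \<in> S" "\<And>s t. s \<in> {0..1} \<Longrightarrow> t \<in> {0..1} \<Longrightarrow> dist_S (\<gamma> s) (\<gamma> t) \<le> M * \<bar>s - t\<bar>"
        using lip_curveD[OF lip] by blast
      have "dL p q \<le> ennsqrt (curve_energy A E B \<gamma>)"
        unfolding dL_def using lip ends by (intro INF_lower) simp
      then show "dL p q \<le> ennsqrt (energy \<Omega> \<rho>)"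
        by (simp only: lip_curve_energy(1)[OF M \<rho>E])
    qed
  qed
qed

abbreviation W_Lam :: "'x measure \<Rightarrow> 'x measure \<Rightarrow> real" where
  "W_Lam \<mu> \<nu> \<equiv> enn2real (geodesic_restriction \<Omega> (E ` S) \<mu> \<nu>)"

text \<open>Finiteness makes the passage from \<open>ennreal\<close> to reals faithful; the other
  two parts are the outer links of the chain behind both equivalences.\<close>

lemma W_Lam_eq:
  assumes "p \<in> S" "q \<in> S"
  shows "geodesic_restriction \<Omega> (E ` S) (E p) (E q) = ennreal (W_Lam (E p) (E q))"
    and "wasserstein2 (E p) (E q) \<le> W_Lam (E p) (E q)" and "W_Lam (E p) (E q) \<le> C0 * dist_S p q"
proof -
  have fin: "dL p q < \<top>" using dL_le_dist[OF assms] by (auto simp: order_le_less_trans)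
  note e = geodesic_restriction_eq[OF assms]
  show 1: "geodesic_restriction \<Omega> (E ` S) (E p) (E q) = ennreal (W_Lam (E p) (E q))"
    using fin by (simp add: e)
  show "wasserstein2 (E p) (E q) \<le> W_Lam (E p) (E q)"
  proof -
    have "ennreal (wasserstein2 (E p) (E q)) \<le> ennreal (W_Lam (E p) (E q))"
      using wasserstein2_le_dL[of p q] by (simp only: trans[OF 1[symmetric] e])
    then show ?thesis by (subst (asm) ennreal_le_iff) simp_all
  qed
  show "W_Lam (E p) (E q) \<le> C0 * dist_S p q"
    unfolding e using dL_le_dist[OF assms] C0_pos dist_S_nonneg by (intro enn2real_leI) auto
qed

lemma W_Lam_commute: "W_Lam \<mu> \<nu> = W_Lam \<nu> \<mu>"
proof (cases "\<mu> \<in> E ` S \<and> \<nu> \<in> E ` S")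
  case True
  then show ?thesis using geodesic_restriction_eq dL_commute by auto
next
  case False
  \<comment> \<open>As for \<open>dist_S\<close>, symmetry is demanded off the carrier too, where
    the infimum over no curves becomes 0.\<close>
  have "W_Lam \<mu> \<nu> = 0" if "\<mu> \<notin> E ` S \<or> \<nu> \<notin> E ` S" for \<mu> \<nu>
  proof -
    have empty: "{\<rho>. lip_curve wasserstein2 (E ` S) \<rho> \<and> \<rho> 0 = \<mu> \<and> \<rho> 1 = \<nu>} = {}"
      using that by (force simp: lip_curve_def image_subset_iff)
    show ?thesis unfolding geodesic_restriction_def empty by simp
  qed
  then show ?thesis using False by metis
qed

lemma W_Lam_triangle:
  assumes "p \<in> S" "q \<in> S" "r \<in> S"
  shows "W_Lam (E p) (E r) \<le> W_Lam (E p) (E q) + W_Lam (E q) (E r)"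
proof -
  have e: "ennreal (W_Lam (E p) (E q)) = dL p q" if "p \<in> S" "q \<in> S" for p q
    by (rule trans[OF W_Lam_eq(1)[OF that, symmetric] geodesic_restriction_eq[OF that]])
  have "ennreal (W_Lam (E p) (E r)) \<le> ennreal (W_Lam (E p) (E q)) + ennreal (W_Lam (E q) (E r))"
    using dL_triangle[OF assms] by (simp only: e assms)
  also have "\<dots> = ennreal (W_Lam (E p) (E q) + W_Lam (E q) (E r))"
    by (rule ennreal_plus[symmetric]) simp_all
  finally show ?thesis by (subst (asm) ennreal_le_iff) simp_all
qed

text \<open>Both equivalences come from one cycle: \<open>dist_S\<close> is at most \<kappa> times
  the Wasserstein distance, which is at most \<open>W_Lam\<close>, which is at most C0 times
  \<open>dist_S\<close>. The same inequalities show that each distance vanishes only on the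
  diagonal.\<close>

lemma equivalent_metrics_restriction:
  shows "equivalent_metrics S dist_S (\<lambda>p q. W_Lam (E p) (E q))"
    and "equivalent_metrics (E ` S) wasserstein2 W_Lam"
proof -
  obtain \<kappa> where \<kappa>: "\<kappa> > 0" and bl: "\<And>p q. p \<in> S \<Longrightarrow> q \<in> S \<Longrightarrow> inverse \<kappa> * dist_S p q \<le> wasserstein2 (E p) (E q)"
    "\<And>p q. p \<in> S \<Longrightarrow> q \<in> S \<Longrightarrow> wasserstein2 (E p) (E q) \<le> \<kappa> * dist_S p q"
    using E_bilipschitz by blast
  have dW: "dist_S p q \<le> \<kappa> * wasserstein2 (E p) (E q)" if "p \<in> S" "q \<in> S" for p q
    using bl(1)[OF that] \<kappa> by (simp add: field_simps)
  have dWL: "dist_S p q \<le> \<kappa> * W_Lam (E p) (E q)" if "p \<in> S" "q \<in> S" for p q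
    by (rule order_trans[OF dW[OF that] mult_left_mono[OF W_Lam_eq(2)[OF that]]]) (use \<kappa> in simp)
  have W0: "wasserstein2 (E p) (E q) = 0 \<longleftrightarrow> p = q" if "p \<in> S" "q \<in> S" for p q
    using dW[OF that] bl(2)[OF that] dist_S_eq_0[OF that] dist_S_refl[OF that(1)] dist_S_nonneg[of p q]
      wasserstein2_nonneg[of "E p" "E q"] by fastforce
  have WL0: "W_Lam (E p) (E q) = 0 \<longleftrightarrow> p = q" if "p \<in> S" "q \<in> S" for p q
    using dWL[OF that] W_Lam_eq(3)[OF that] dist_S_eq_0[OF that] dist_S_refl[OF that(1)] dist_S_nonneg[of p q]
      enn2real_nonneg[of "geodesic_restriction \<Omega> (E ` S) (E p) (E q)"] by fastforce
  have M1: "Metric_space S (\<lambda>p q. W_Lam (E p) (E q))"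
    by unfold_locales (auto intro: W_Lam_commute W_Lam_triangle simp: WL0)
  have M2: "Metric_space (E ` S) W_Lam"
  proof
    show "W_Lam \<mu> \<nu> = W_Lam \<nu> \<mu>" for \<mu> \<nu> by (rule W_Lam_commute)
    show "(W_Lam \<mu> \<nu> = 0) = (\<mu> = \<nu>)" if "\<mu> \<in> E ` S" "\<nu> \<in> E ` S" for \<mu> \<nu>
      using that WL0 inj_on_eq_iff[OF E_inj] by auto
    show "W_Lam \<mu> \<xi> \<le> W_Lam \<mu> \<nu> + W_Lam \<nu> \<xi>" if "\<mu> \<in> E ` S" "\<nu> \<in> E ` S" "\<xi> \<in> E ` S" for \<mu> \<nu> \<xi>
      using that W_Lam_triangle by auto
  qed simp
  have M3: "Metric_space (E ` S) wasserstein2"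
  proof
    show "wasserstein2 \<mu> \<nu> = wasserstein2 \<nu> \<mu>" for \<mu> \<nu> :: "'x measure" by (rule wasserstein2_commute)
    show "(wasserstein2 \<mu> \<nu> = 0) = (\<mu> = \<nu>)" if "\<mu> \<in> E ` S" "\<nu> \<in> E ` S" for \<mu> \<nu>
      using that W0 inj_on_eq_iff[OF E_inj] by auto
    show "wasserstein2 \<mu> \<xi> \<le> wasserstein2 \<mu> \<nu> + wasserstein2 \<nu> \<xi>" if "\<mu> \<in> E ` S" "\<nu> \<in> E ` S" "\<xi> \<in> E ` S" for \<mu> \<nu> \<xi>
      by (rule wasserstein2_triangle[of _ \<Omega>]) (use that E_prob \<Omega>_compact in auto)
  qed (rule wasserstein2_nonneg)
  show "equivalent_metrics S dist_S (\<lambda>p q. W_Lam (E p) (E q))"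
    by (rule equivalent_metricsI[OF Metric_space_S M1 \<kappa> C0_pos dWL W_Lam_eq(3)])
  show "equivalent_metrics (E ` S) wasserstein2 W_Lam"
  proof (rule equivalent_metricsI[OF M3 M2, of 1 "C0 * \<kappa>"])
    fix \<mu> \<nu> assume "\<mu> \<in> E ` S" "\<nu> \<in> E ` S"
    then obtain p q where p: "p \<in> S" "\<mu> = E p" and q: "q \<in> S" "\<nu> = E q" by blast
    show "wasserstein2 \<mu> \<nu> \<le> 1 * W_Lam \<mu> \<nu>" using W_Lam_eq(2)[OF p(1) q(1)] p q by simp
    have "W_Lam (E p) (E q) \<le> C0 * dist_S p q" by (rule W_Lam_eq(3)[OF p(1) q(1)])
    also have "\<dots> \<le> C0 * (\<kappa> * wasserstein2 (E p) (E q))" using dW[OF p(1) q(1)] C0_pos by (intro mult_left_mono) auto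
    finally show "W_Lam \<mu> \<nu> \<le> C0 * \<kappa> * wasserstein2 \<mu> \<nu>" using p q by (simp only: mult.assoc)
  qed (use C0_pos \<kappa> in auto)
qed

end

theorem proposition2p10:
  fixes A :: "('m::{t2_space, second_countable_topology}, 'e::euclidean_space) chart set"
    and g :: "'m \<Rightarrow> ('m, 'e) tangent \<Rightarrow> ('m, 'e) tangent \<Rightarrow> real"
    and S :: "'m set" and D :: "('m \<times> ('m, 'e) tangent) set"
    and \<Omega> :: "'x::euclidean_space set"
    and E :: "'m \<Rightarrow> 'x measure"
    and B :: "'m \<Rightarrow> ('m, 'e) tangent \<Rightarrow> 'x \<Rightarrow> 'x"
  assumes "embedded_family A g S D \<Omega> E B"
  shows "(\<forall>\<theta>\<^sub>0\<in>S. \<forall>\<theta>\<^sub>1\<in>S.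
            geodesic_restriction \<Omega> (E ` S) (E \<theta>\<^sub>0) (E \<theta>\<^sub>1) =
              (INF \<gamma>\<in>{\<gamma>. lip_curve (riem_dist A g S) S \<gamma> \<and> \<gamma> 0 = \<theta>\<^sub>0 \<and> \<gamma> 1 = \<theta>\<^sub>1}. ennsqrt (curve_energy A E B \<gamma>))) \<and>
         (\<forall>\<theta>\<^sub>0\<in>S. \<forall>\<theta>\<^sub>1\<in>S. geodesic_restriction \<Omega> (E ` S) (E \<theta>\<^sub>0) (E \<theta>\<^sub>1) < \<infinity>) \<and>
         equivalent_metrics S (riem_dist A g S)
           (\<lambda>\<theta>\<^sub>0 \<theta>\<^sub>1. enn2real (geodesic_restriction \<Omega> (E ` S) (E \<theta>\<^sub>0) (E \<theta>\<^sub>1))) \<and>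
         equivalent_metrics (E ` S) wasserstein2
           (\<lambda>\<mu> \<nu>. enn2real (geodesic_restriction \<Omega> (E ` S) \<mu> \<nu>))"
proof -
  interpret embedded_family A g S D \<Omega> E B by (rule assms)
  \<comment> \<open>Shown separately, since a value of \<open>enn2real\<close> alone does not
    exclude an infinite distance.\<close>
  have "geodesic_restriction \<Omega> (E ` S) (E p) (E q) < \<infinity>" if "p \<in> S" "q \<in> S" for p q
    by (subst W_Lam_eq(1)[OF that]) simp
  then show ?thesis
    using geodesic_restriction_eq equivalent_metrics_restriction unfolding dL_def by (intro conjI ballI) blast+
qed

end
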